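(* Assume that $|u(q^\dagger)|\ge c_0$ in $\Omega$ for some constant $c_0>0$, and that $q^\dagger-q^*\in H_0^\kappa(\Omega)$ with $\kappa>0$ and $\kappa\ne 1/2$. For an exponent $\alpha>0$ consider the statement $(R_\alpha)$: under the parameter choice $\beta=\delta^{2-\alpha}$, the minimizers $q^\delta_\beta$ satisfy $$\|u(q^\delta_\beta)-u(q^\dagger)\|_{0,\Omega}=O(\delta)\quad\text{and}\quad \|q^\delta_\beta-q^\dagger\|_{0,\Omega}=O(\delta^{\alpha/2})\qquad(\delta\to0).$$ Then: - if $\kappa>1$, $(R_\alpha)$ holds with $\alpha=\tfrac12$; - if $\kappa\in(0,\tfrac12)\cup(\tfrac12,1]$, $(R_\alpha)$ holds with some $\alpha<\frac{\kappa}{1+\kappa}$ which can be chosen arbitrarily close to $\frac{\kappa}{1+\kappa}$; that is, for every $\eta>0$ there is $\alpha>0$ with $\frac{\kappa}{1+\kappa}-\eta<\alpha<\frac{\kappa}{1+\kappa}$ for which $(R_\alpha)$ holds.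
   Context: $\Omega\subset\mathbb{R}^d$ ($d=2,3$) is an open bounded connected domain with $C^2$ boundary. Standing assumptions: $a\in W^{1,\infty}(\Omega)$ has a positive lower bound, $f\in L^2(\Omega)$, $g\in H^{3/2}(\partial\Omega)$. With constants $0<\underline q\le\bar q$, the admissible set is $K=\{q\in L^2(\Omega): \underline q\le q\le\bar q \text{ a.e. in }\Omega\}$. For $q\in K$, $u(q)\in H^2(\Omega)$ denotes the unique solution of $$-\nabla\cdot(a\nabla u)+q u=f\ \text{ in }\Omega,\qquad u=g\ \text{ on }\partial\Omega.$$ $q^\dagger\in K$ is the true radiativity and $q^*\in K$ is an a priori estimate of it. For noise level $\delta>0$ the data $z^\delta\in L^2(\Omega)$ satisfy $\|u(q^\dagger)-z^\delta\|_{0,\Omega}\le\delta$. For $\beta>0$, $q^\delta_\beta$ denotes a minimizer over $q\in K$ of $$J_{\delta,\beta}(q)=\tfrac12\|u(q)-z^\delta\|_{0,\Omega}^2+\tfrac\beta2\|q-q^*\|_{0,\Omega}^2.$$ $\|\cdot\|_{s,\Omega}$ is the norm of $H^s(\Omega)$ ($\|\cdot\|_{0,\Omega}$ the $L^2(\Omega)$ norm), and for $s>0$, $H^s_0(\Omega)$ is the completion of $C_c^\infty(\Omega)$ under $\|\cdot\|_{s,\Omega}$. *)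

theory Defs
  imports "HOL-Analysis.Analysis"
begin

text \<open>Functions on a subset of Euclidean space are total functions whose values outside that subset
  are never used, and elements of function spaces are represented by functions rather than by
  classes modulo null sets.\<close>

section \<open>Lebesgue spaces\<close>

definition L2 :: "'a measure \<Rightarrow> ('a \<Rightarrow> real) set" where
  "L2 M = {f \<in> borel_measurable M. integrable M (\<lambda>x. (f x)\<^sup>2)}"

definition l2norm :: "'a measure \<Rightarrow> ('a \<Rightarrow> real) \<Rightarrow> real" where
  "l2norm M f = sqrt (LINT x|M. (f x)\<^sup>2)"

definition Linf :: "'a measure \<Rightarrow> ('a \<Rightarrow> real) set" where
  "Linf M = {f \<in> borel_measurable M. \<exists>C. AE x in M. \<bar>f x\<bar> \<le> C}"

section \<open>Classical derivatives and test functions\<close>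

definition pd :: "'d::finite \<Rightarrow> (real^'d \<Rightarrow> real) \<Rightarrow> real^'d \<Rightarrow> real" where
  "pd i f x = frechet_derivative f (at x) (axis i 1)"

primrec Ck :: "nat \<Rightarrow> (real^'d::finite \<Rightarrow> real) \<Rightarrow> bool" where
  "Ck 0 f \<longleftrightarrow> continuous_on UNIV f"
| "Ck (Suc k) f \<longleftrightarrow> f differentiable_on UNIV \<and> (\<forall>i. Ck k (pd i f))"

definition Cc_inf :: "(real^'d::finite) set \<Rightarrow> (real^'d \<Rightarrow> real) set" where
  "Cc_inf \<Omega> = {\<phi>. (\<forall>k. Ck k \<phi>) \<and> compact (closure {x. \<phi> x \<noteq> 0}) \<and> closure {x. \<phi> x \<noteq> 0} \<subseteq> \<Omega>}"

section \<open>Weak derivatives and Sobolev spaces\<close>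

text \<open>A list \<open>[i\<^sub>1, \<dots>, i\<^sub>k]\<close> of coordinate indices stands for the derivative
  \<open>\<partial>\<^bsub>i\<^sub>1\<^esub> \<dots> \<partial>\<^bsub>i\<^sub>k\<^esub>\<close> of order \<open>k\<close>.\<close>

definition weak_deriv ::
    "(real^'d::finite) set \<Rightarrow> 'd list \<Rightarrow> (real^'d \<Rightarrow> real) \<Rightarrow> (real^'d \<Rightarrow> real) \<Rightarrow> bool" where
  "weak_deriv \<Omega> is u v \<longleftrightarrow>
     (\<forall>C. compact C \<and> C \<subseteq> \<Omega> \<longrightarrow> integrable (lebesgue_on C) u \<and> integrable (lebesgue_on C) v) \<and>
     (\<forall>\<phi>\<in>Cc_inf \<Omega>. (LINT x|lebesgue_on \<Omega>. u x * foldr pd is \<phi> x) =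
        (-1) ^ length is * (LINT x|lebesgue_on \<Omega>. v x * \<phi> x))"

text \<open>The weak derivative is determined up to a null set whenever it exists.\<close>

definition wderiv :: "(real^'d::finite) set \<Rightarrow> 'd list \<Rightarrow> (real^'d \<Rightarrow> real) \<Rightarrow> real^'d \<Rightarrow> real" where
  "wderiv \<Omega> is u = (SOME v. weak_deriv \<Omega> is u v)"

definition W1inf :: "(real^'d::finite) set \<Rightarrow> (real^'d \<Rightarrow> real) set" where
  "W1inf \<Omega> = {u \<in> Linf (lebesgue_on \<Omega>). \<forall>i. \<exists>v \<in> Linf (lebesgue_on \<Omega>). weak_deriv \<Omega> [i] u v}"

definition gagliardo_sq ::
    "(real^'d::finite) set \<Rightarrow> real \<Rightarrow> (real^'d \<Rightarrow> real) \<Rightarrow> ennreal" where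
  "gagliardo_sq \<Omega> \<sigma> v =
     (\<integral>\<^sup>+x. \<integral>\<^sup>+y. ennreal (\<bar>v x - v y\<bar>\<^sup>2 / norm (x - y) powr (real CARD('d) + 2 * \<sigma>))
        \<partial>lebesgue_on \<Omega> \<partial>lebesgue_on \<Omega>)"

text \<open>The Sobolev--Slobodeckij space \<open>H\<^sup>s(\<Omega>)\<close> for real \<open>s \<ge> 0\<close>, with integer part \<open>m = \<lfloor>s\<rfloor>\<close>.
  Summing over lists instead of multi-indices counts a mixed derivative once for each order of
  differentiation, that is, it uses the Frobenius norms of the tensors of \<open>j\<close>-th derivatives; the
  resulting norm is equivalent to the one with multi-indices.\<close>

definition sobolev :: "(real^'d::finite) set \<Rightarrow> real \<Rightarrow> (real^'d \<Rightarrow> real) set" where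
  "sobolev \<Omega> s = {u \<in> L2 (lebesgue_on \<Omega>).
     (\<forall>is. length is \<le> nat \<lfloor>s\<rfloor> \<longrightarrow> (\<exists>v \<in> L2 (lebesgue_on \<Omega>). weak_deriv \<Omega> is u v)) \<and>
     (frac s > 0 \<longrightarrow>
        (\<forall>is. length is = nat \<lfloor>s\<rfloor> \<longrightarrow> gagliardo_sq \<Omega> (frac s) (wderiv \<Omega> is u) < \<infinity>))}"

definition sobolev_norm :: "(real^'d::finite) set \<Rightarrow> real \<Rightarrow> (real^'d \<Rightarrow> real) \<Rightarrow> real" where
  "sobolev_norm \<Omega> s u = sqrt (
     (\<Sum>is | length is \<le> nat \<lfloor>s\<rfloor>. (l2norm (lebesgue_on \<Omega>) (wderiv \<Omega> is u))\<^sup>2) +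
     (if frac s > 0
      then \<Sum>is | length is = nat \<lfloor>s\<rfloor>. enn2real (gagliardo_sq \<Omega> (frac s) (wderiv \<Omega> is u))
      else 0))"

text \<open>The completion of \<open>C\<^sub>c\<^sup>\<infinity>(\<Omega>)\<close> under the norm of \<open>H\<^sup>s(\<Omega>)\<close>, realised inside \<open>L\<^sup>2(\<Omega>)\<close>: a Cauchy
  sequence of test functions is identified with its \<open>L\<^sup>2\<close>-limit. This identification is
  injective because \<open>H\<^sup>s(\<Omega>)\<close> is complete and continuously embedded in \<open>L\<^sup>2(\<Omega>)\<close>.\<close>

definition sobolev0 :: "(real^'d::finite) set \<Rightarrow> real \<Rightarrow> (real^'d \<Rightarrow> real) set" where
  "sobolev0 \<Omega> s = {u \<in> L2 (lebesgue_on \<Omega>). \<exists>\<phi>::nat \<Rightarrow> real^'d \<Rightarrow> real.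
     (\<forall>n. \<phi> n \<in> Cc_inf \<Omega>) \<and>
     (\<forall>e>0. \<exists>N. \<forall>m\<ge>N. \<forall>n\<ge>N. sobolev_norm \<Omega> s (\<lambda>x. \<phi> m x - \<phi> n x) < e) \<and>
     (\<lambda>n. l2norm (lebesgue_on \<Omega>) (\<lambda>x. \<phi> n x - u x)) \<longlonglongrightarrow> 0}"

section \<open>The boundary\<close>

text \<open>Near each boundary point, and in suitable Cartesian coordinates, \<open>\<Omega>\<close> is the region strictly
  above the graph of a \<open>C\<^sup>2\<close> function of the remaining \<open>d - 1\<close> coordinates. A function of these
  coordinates is represented by a function on the whole space evaluated at points whose
  \<open>k\<close>-th coordinate is replaced by 0.\<close>

definition C2_boundary :: "(real^'d::finite) set \<Rightarrow> bool" where
  "C2_boundary \<Omega> \<longleftrightarrow> (\<forall>x0 \<in> frontier \<Omega>. \<exists>r>0.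
     \<exists>(T :: real^'d \<Rightarrow> real^'d) k (\<gamma> :: real^'d \<Rightarrow> real). orthogonal_transformation T \<and> Ck 2 \<gamma> \<and>
     \<Omega> \<inter> ball x0 r = {x \<in> ball x0 r. T x $ k > \<gamma> (\<chi> i. if i = k then 0 else T x $ i)})"

text \<open>The Hausdorff outer measure of dimension \<open>k \<ge> 1\<close>, normalised so that it is the usual
  \<open>k\<close>-dimensional surface area on \<open>C\<^sup>1\<close> submanifolds. It is countably additive on Borel sets by
  Caratheodory's criterion for metric outer measures, so \<^const>\<open>measure_of\<close> below does not fall back
  to the zero measure.\<close>

definition hausdorff_outer :: "nat \<Rightarrow> 'a::metric_space set \<Rightarrow> ennreal" where
  "hausdorff_outer k A = (SUP \<delta>\<in>{0::real<..}.
     INF C \<in> {C::nat \<Rightarrow> 'a set. A \<subseteq> (\<Union>i. C i) \<and> (\<forall>i. bounded (C i) \<and> diameter (C i) \<le> \<delta>)}.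
       (\<Sum>i. ennreal (unit_ball_vol (real k) * (diameter (C i) / 2) ^ k)))"

definition surface_measure :: "(real^'d::finite) set \<Rightarrow> (real^'d) measure" where
  "surface_measure \<Omega> =
     completion (restrict_space (measure_of UNIV (sets borel) (hausdorff_outer (CARD('d) - 1)))
       (frontier \<Omega>))"

text \<open>The trace of \<open>u \<in> H\<^sup>1(\<Omega>)\<close> on the boundary is the continuous extension to \<open>H\<^sup>1(\<Omega>)\<close>, with values
  in \<open>L\<^sup>2(\<partial>\<Omega>)\<close>, of the restriction map on functions that are smooth up to the boundary.\<close>

definition has_trace :: "(real^'d::finite) set \<Rightarrow> (real^'d \<Rightarrow> real) \<Rightarrow> (real^'d \<Rightarrow> real) \<Rightarrow> bool" where
  "has_trace \<Omega> u g \<longleftrightarrow> u \<in> sobolev \<Omega> 1 \<and> g \<in> L2 (surface_measure \<Omega>) \<and>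
     (\<exists>\<phi>::nat \<Rightarrow> real^'d \<Rightarrow> real. (\<forall>n. \<phi> n \<in> Cc_inf UNIV) \<and>
        (\<lambda>n. sobolev_norm \<Omega> 1 (\<lambda>x. \<phi> n x - u x)) \<longlonglongrightarrow> 0 \<and>
        (\<lambda>n. l2norm (surface_measure \<Omega>) (\<lambda>x. \<phi> n x - g x)) \<longlonglongrightarrow> 0)"

text \<open>\<open>H\<^bsup>3/2\<^esup>(\<partial>\<Omega>)\<close> as the trace space of \<open>H\<^sup>2(\<Omega>)\<close>.\<close>

definition H32_boundary :: "(real^'d::finite) set \<Rightarrow> (real^'d \<Rightarrow> real) set" where
  "H32_boundary \<Omega> = {g. \<exists>G \<in> sobolev \<Omega> 2. has_trace \<Omega> G g}"

section \<open>The boundary value problem and the Tikhonov functional\<close>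

definition is_solution ::
    "(real^'d::finite) set \<Rightarrow> (real^'d \<Rightarrow> real) \<Rightarrow> (real^'d \<Rightarrow> real) \<Rightarrow> (real^'d \<Rightarrow> real) \<Rightarrow>
     (real^'d \<Rightarrow> real) \<Rightarrow> (real^'d \<Rightarrow> real) \<Rightarrow> bool" where
  "is_solution \<Omega> a f g q u \<longleftrightarrow> u \<in> sobolev \<Omega> 2 \<and>
     (AE x in lebesgue_on \<Omega>.
        - (\<Sum>i\<in>UNIV. wderiv \<Omega> [i] (\<lambda>y. a y * wderiv \<Omega> [i] u y) x) + q x * u x = f x) \<and>
     has_trace \<Omega> u g"

definition admissible :: "(real^'d::finite) set \<Rightarrow> real \<Rightarrow> real \<Rightarrow> (real^'d \<Rightarrow> real) set" where
  "admissible \<Omega> ql qu = {q \<in> L2 (lebesgue_on \<Omega>). AE x in lebesgue_on \<Omega>. ql \<le> q x \<and> q x \<le> qu}"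

definition tikhonov ::
    "(real^'d::finite) set \<Rightarrow> ((real^'d \<Rightarrow> real) \<Rightarrow> real^'d \<Rightarrow> real) \<Rightarrow> (real^'d \<Rightarrow> real) \<Rightarrow>
     (real^'d \<Rightarrow> real) \<Rightarrow> real \<Rightarrow> (real^'d \<Rightarrow> real) \<Rightarrow> real" where
  "tikhonov \<Omega> u z qs \<beta> q =
     1/2 * (l2norm (lebesgue_on \<Omega>) (\<lambda>x. u q x - z x))\<^sup>2 +
     \<beta>/2 * (l2norm (lebesgue_on \<Omega>) (\<lambda>x. q x - qs x))\<^sup>2"

definition is_minimizer :: "(real^'d::finite) set \<Rightarrow> ((real^'d \<Rightarrow> real) \<Rightarrow> real^'d \<Rightarrow> real) \<Rightarrow>
     real \<Rightarrow> real \<Rightarrow> (real^'d \<Rightarrow> real) \<Rightarrow> (real^'d \<Rightarrow> real) \<Rightarrow> real \<Rightarrow> (real^'d \<Rightarrow> real) \<Rightarrow> bool" where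
  "is_minimizer \<Omega> u ql qu z qs \<beta> q \<longleftrightarrow> q \<in> admissible \<Omega> ql qu \<and>
     (\<forall>p \<in> admissible \<Omega> ql qu. tikhonov \<Omega> u z qs \<beta> q \<le> tikhonov \<Omega> u z qs \<beta> p)"

text \<open>The convergence rates with exponent \<open>\<alpha>\<close>, where \<open>qd\<close> is the true radiativity and \<open>qs\<close> its
  a priori estimate. The constant in the Landau symbols depends neither on the noisy data nor on
  the choice of the minimizer.\<close>

definition rates :: "(real^'d::finite) set \<Rightarrow> ((real^'d \<Rightarrow> real) \<Rightarrow> real^'d \<Rightarrow> real) \<Rightarrow>
     real \<Rightarrow> real \<Rightarrow> (real^'d \<Rightarrow> real) \<Rightarrow> (real^'d \<Rightarrow> real) \<Rightarrow> real \<Rightarrow> bool" where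
  "rates \<Omega> u ql qu qd qs \<alpha> \<longleftrightarrow> (\<exists>C. \<forall>\<^sub>F \<delta> in at_right 0.
     \<forall>z \<in> L2 (lebesgue_on \<Omega>). l2norm (lebesgue_on \<Omega>) (\<lambda>x. u qd x - z x) \<le> \<delta> \<longrightarrow>
       (\<forall>q. is_minimizer \<Omega> u ql qu z qs (\<delta> powr (2 - \<alpha>)) q \<longrightarrow>
          l2norm (lebesgue_on \<Omega>) (\<lambda>x. u q x - u qd x) \<le> C * \<delta> \<and>
          l2norm (lebesgue_on \<Omega>) (\<lambda>x. q x - qd x) \<le> C * \<delta> powr (\<alpha> / 2)))"

end

theory Submission
  imports Defs
begin

text \<open>
  Write \<open>w = q\<^sup>\<dagger> - q\<^sup>*\<close>, \<open>k = min \<kappa> 1\<close> and \<open>h = u(q) - u(q\<^sup>\<dagger>)\<close>. For a test function \<open>\<psi>\<close> the equations for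
  \<open>u(q)\<close> and \<open>u(q\<^sup>\<dagger>)\<close> give \<open>\<integral>(q\<^sup>\<dagger> - q) u(q\<^sup>\<dagger>) \<psi> = \<integral>h (q \<psi> - \<nabla>\<cdot>(a\<nabla>\<psi>))\<close>, all derivatives having been moved to \<open>\<psi>\<close>.
  If \<open>\<psi>\<close> is the mollification at scale \<open>\<epsilon>\<close> of \<open>w/u(q\<^sup>\<dagger>)\<close> cut off at depth \<open>2\<epsilon>\<close> below the boundary, then
  \<open>w - u(q\<^sup>\<dagger>) \<psi>\<close> is \<open>O(\<epsilon>\<^sup>k)\<close> in \<open>L\<^sup>2\<close> and the derivatives of \<open>\<psi>\<close> up to order two are \<open>O(\<epsilon>\<^bsup>k-2\<^esup>)\<close>. Hence
  \<open>\<integral>w (q\<^sup>\<dagger> - q) \<le> C (\<epsilon>\<^sup>k \<parallel>q - q\<^sup>\<dagger>\<parallel> + \<epsilon>\<^bsup>k-2\<^esup> \<parallel>h\<parallel>)\<close>, an approximate source condition. Inserted with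
  \<open>\<epsilon> = \<delta>\<^bsup>\<alpha>/(2k)\<^esup>\<close> into the minimality of \<open>q\<close>, it gives the rates for every \<open>\<alpha> \<le> 2k/(2+k)\<close>, which
  exceeds \<open>\<kappa>/(1+\<kappa>)\<close> for \<open>\<kappa> \<le> 1\<close> and \<open>1/2\<close> for \<open>\<kappa> > 1\<close>.

  The bounds on \<open>\<psi>\<close> need only the mean oscillation of \<open>w\<close> and \<open>u(q\<^sup>\<dagger>)\<close> at scale \<open>\<epsilon>\<close> and the mass of \<open>w\<close>
  in the boundary layer of width \<open>3\<epsilon>\<close>. For \<open>k \<le> 1/2\<close> the latter is small because \<open>w\<close> is bounded and the
  layer has volume \<open>O(\<epsilon>)\<close>; for \<open>k > 1/2\<close> it is controlled by a dyadic form of Hardy's inequality.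
\<close>

section \<open>Smooth functions\<close>

text \<open>Minimality controls \<open>h\<close> in \<open>L^2\<close> only. This forces the very
  weak identity: both derivatives fall on \<open>\<psi>\<close>, which costs
  \<open>\<epsilon>^(-2)\<close>. The factor \<open>\<epsilon>^k\<close> is regained from the
  kernel: derivatives of a mollifier have mean zero, so convolution with them sees only differences
  of the mollified quotient, and these are measured by the mean oscillation. The quotient inherits
  its oscillation from \<open>w\<close> and the solution because \<open>w\<close> is bounded, being
  a difference of two elements of \<open>K\<close>, and the solution is bounded away from 0. The
  solution has oscillation of order one, which suffices as \<open>k \<le> 1\<close>. A test function
  vanishes near the boundary, so the mass of \<open>w\<close> there is lost; this is why layer
  estimates are needed. Regularity always enters through smooth approximants with a fixed energy
  bound, chosen afresh at each scale so that their \<open>L^2\<close> error has the order wanted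
  there. The scale is fixed by \<open>\<epsilon>^k = \<delta>^(\<alpha>/2)\<close>, which matches
  the target rate; the threshold \<open>2k/(2+k)\<close> is then exactly the condition
  \<open>\<beta> \<epsilon>^(k-2) \<le> \<delta>\<close> for small \<open>\<delta>\<close>.\<close>

definition smooth :: "(real^'d::finite \<Rightarrow> real) \<Rightarrow> bool" where
  "smooth f \<longleftrightarrow> (\<forall>k. Ck k f)"

lemma pd_eq: "(f has_derivative F) (at x) \<Longrightarrow> pd i f x = F (axis i 1)"
  unfolding pd_def by (metis frechet_derivative_at)

lemma has_derivative_pd:
  fixes f :: "real^'d::finite \<Rightarrow> real"
  assumes "f differentiable (at x)"
  shows "(f has_derivative (\<lambda>h. \<Sum>i\<in>UNIV. h $ i * pd i f x)) (at x)"
proof -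
  let ?F = "frechet_derivative f (at x)"
  have d: "(f has_derivative ?F) (at x)"
    using assms by (simp add: frechet_derivative_works)
  then interpret bounded_linear ?F by (rule has_derivative_bounded_linear)
  have "?F = (\<lambda>h. \<Sum>i\<in>UNIV. h $ i * pd i f x)"
  proof
    fix h :: "real^'d"
    have "?F h = ?F (\<Sum>i\<in>UNIV. h $ i *\<^sub>R axis i 1)"
      by (rule arg_cong[where f = ?F]) (simp add: vec_eq_iff axis_def if_distrib cong: if_cong)
    also have "\<dots> = (\<Sum>i\<in>UNIV. h $ i * pd i f x)"
      by (simp add: sum scaleR pd_def)
    finally show "?F h = (\<Sum>i\<in>UNIV. h $ i * pd i f x)" .
  qed
  with d show ?thesis by simp
qed

lemma Ck_continuous: "Ck k f \<Longrightarrow> continuous_on UNIV f"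
  by (cases k) (auto intro: differentiable_imp_continuous_on)

lemma Ck_SucD: "Ck (Suc k) f \<Longrightarrow> Ck k f"
proof (induction k arbitrary: f)
  case 0
  then show ?case using Ck_continuous[of "Suc 0"] by (metis Ck.simps(1))
next
  case (Suc k)
  then show ?case by (auto simp del: Ck.simps(2) simp: Ck.simps(2)[of "Suc k"] Ck.simps(2)[of k])
qed

lemma smooth_differentiable: "smooth f \<Longrightarrow> f differentiable (at x)"
  using Ck.simps(2)[of 0 f] unfolding smooth_def differentiable_on_def
  by (metis UNIV_I)

lemma smooth_pd: "smooth f \<Longrightarrow> smooth (pd i f)"
proof (unfold smooth_def, intro allI)
  fix k assume "\<forall>k. Ck k f"
  then have "Ck (Suc k) f" by blast
  then show "Ck k (pd i f)" by simp
qed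

lemma smooth_continuous_on: "smooth f \<Longrightarrow> continuous_on A f"
  unfolding smooth_def using Ck_continuous continuous_on_subset by blast

lemma smooth_borel [measurable_dest]: "smooth f \<Longrightarrow> f \<in> borel_measurable borel"
  by (simp add: borel_measurable_continuous_onI smooth_continuous_on)

lemma pd_const: "pd i (\<lambda>x. c) = (\<lambda>x. 0)"
  by (rule ext, subst pd_eq[OF has_derivative_const], simp)

lemma Ck_const: "Ck k (\<lambda>x. c)"
  by (induction k arbitrary: c) (auto simp: pd_const)

lemma pd_mult:
  assumes "f differentiable (at x)" "g differentiable (at x)"
  shows "pd i (\<lambda>x. f x * g x) x = f x * pd i g x + pd i f x * g x"
  using pd_eq[OF has_derivative_mult[OF assms[unfolded frechet_derivative_works]]]
  by (simp add: pd_def)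

lemma pd_add:
  assumes "f differentiable (at x)" "g differentiable (at x)"
  shows "pd i (\<lambda>x. f x + g x) x = pd i f x + pd i g x"
  using pd_eq[OF has_derivative_add[OF assms[unfolded frechet_derivative_works]]]
  by (simp add: pd_def)

lemma Ck_SucI: "(\<And>x. f differentiable (at x)) \<Longrightarrow> (\<And>i. Ck k (pd i f)) \<Longrightarrow> Ck (Suc k) f"
  by (simp add: differentiable_on_def)

lemma Ck_Suc_differentiable: "Ck (Suc k) f \<Longrightarrow> f differentiable (at x)"
  by (simp add: differentiable_on_def)

lemma Ck_Suc_pd: "Ck (Suc k) f \<Longrightarrow> Ck k (pd i f)"
  by simp

lemma Ck_add: "Ck k f \<Longrightarrow> Ck k g \<Longrightarrow> Ck k (\<lambda>x. f x + g x)"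
proof (induction k arbitrary: f g)
  case (Suc k)
  note d = Suc.prems[THEN Ck_Suc_differentiable]
  have "pd i (\<lambda>x. f x + g x) = (\<lambda>x. pd i f x + pd i g x)" for i
    using pd_add[OF d] by (intro ext)
  with Suc.IH[OF Suc.prems[THEN Ck_Suc_pd]] show ?case
    by (intro Ck_SucI differentiable_add d) simp
qed (simp add: continuous_on_add)

lemma Ck_mult: "Ck k f \<Longrightarrow> Ck k g \<Longrightarrow> Ck k (\<lambda>x. f x * g x)"
proof (induction k arbitrary: f g)
  case (Suc k)
  note d = Suc.prems[THEN Ck_Suc_differentiable]
  have p: "pd i (\<lambda>x. f x * g x) = (\<lambda>x. f x * pd i g x + pd i f x * g x)" for i
    using pd_mult[OF d] by (intro ext)
  have "Ck k (\<lambda>x. f x * pd i g x + pd i f x * g x)" for i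
    by (rule Ck_add; rule Suc.IH; rule Ck_SucD Ck_Suc_pd; rule Suc.prems)
  then show ?case
    by (intro Ck_SucI differentiable_mult d) (simp add: p)
qed (simp add: continuous_on_mult)

lemma Ck_sum: "(\<And>j. j \<in> J \<Longrightarrow> Ck k (f j)) \<Longrightarrow> Ck k (\<lambda>x. \<Sum>j\<in>J. f j x)"
  by (induction J rule: infinite_finite_induct) (simp_all add: Ck_add Ck_const)

lemma has_derivative_component: "((\<lambda>x::real^'d::finite. x $ j) has_derivative (\<lambda>h. h $ j)) (at x)"
  by (rule bounded_linear.has_derivative[OF bounded_linear_vec_nth has_derivative_ident])

lemma pd_component: "pd i (\<lambda>x. x $ j) = (\<lambda>x. if i = j then 1 else 0)"
  by (rule ext, subst pd_eq[OF has_derivative_component]) (simp add: axis_def)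

lemma Ck_component: "Ck k (\<lambda>x::real^'d::finite. x $ j)"
proof (cases k)
  case (Suc m)
  have "(\<lambda>x::real^'d. x $ j) differentiable_on UNIV"
    unfolding differentiable_on_def differentiable_def using has_derivative_component by blast
  then show ?thesis unfolding Suc by (simp add: pd_component Ck_const)
qed (simp add: continuous_on_component)

lemma pd_affine:
  assumes "f differentiable (at (c *\<^sub>R x + b))"
  shows "pd i (\<lambda>x. f (c *\<^sub>R x + b)) x = c * pd i f (c *\<^sub>R x + b)"
    and "(\<lambda>x. f (c *\<^sub>R x + b)) differentiable (at x)"
proof -
  let ?F = "frechet_derivative f (at (c *\<^sub>R x + b))"
  have F: "(f has_derivative ?F) (at (c *\<^sub>R x + b))"
    using assms by (simp add: frechet_derivative_works)
  have "((\<lambda>x. f (c *\<^sub>R x + b)) has_derivative (\<lambda>h. ?F (c *\<^sub>R h))) (at x)"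
    by (rule has_derivative_compose[where g = f and g' = ?F and f = "\<lambda>x. c *\<^sub>R x + b"])
       (auto intro!: derivative_eq_intros F)
  moreover have "?F (c *\<^sub>R h) = c * ?F h" for h
    using linear_scale[OF has_derivative_linear[OF F], of c h] by simp
  ultimately have *: "((\<lambda>x. f (c *\<^sub>R x + b)) has_derivative (\<lambda>h. c * ?F h)) (at x)"
    by simp
  show "pd i (\<lambda>x. f (c *\<^sub>R x + b)) x = c * pd i f (c *\<^sub>R x + b)"
    using pd_eq[OF *] by (simp add: pd_def)
  show "(\<lambda>x. f (c *\<^sub>R x + b)) differentiable (at x)"
    using * differentiable_def by blast
qed

lemma Ck_affine: "Ck k f \<Longrightarrow> Ck k (\<lambda>x. f (c *\<^sub>R x + b))"
proof (induction k arbitrary: f)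
  case 0
  then show ?case
    by (auto intro!: continuous_intros continuous_on_compose2[of UNIV f])
next
  case (Suc k)
  note d = Ck_Suc_differentiable[OF Suc.prems]
  have p: "pd i (\<lambda>x. f (c *\<^sub>R x + b)) = (\<lambda>x. c * pd i f (c *\<^sub>R x + b))" for i
    using pd_affine(1)[OF d] by blast
  have "Ck k (\<lambda>x. c * pd i f (c *\<^sub>R x + b))" for i
    by (rule Ck_mult[OF Ck_const], rule Suc.IH, rule Ck_Suc_pd[OF Suc.prems])
  then show ?case
    by (intro Ck_SucI pd_affine(2) d) (simp add: p)
qed

lemma smooth_const: "smooth (\<lambda>x. c)"
  and smooth_add: "smooth f \<Longrightarrow> smooth g \<Longrightarrow> smooth (\<lambda>x. f x + g x)"
  and smooth_mult: "smooth f \<Longrightarrow> smooth g \<Longrightarrow> smooth (\<lambda>x. f x * g x)"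
  and smooth_affine: "smooth f \<Longrightarrow> smooth (\<lambda>x. f (c *\<^sub>R x + b))"
  by (auto simp: smooth_def Ck_const Ck_add Ck_mult Ck_affine)

lemma smooth_diff: "smooth f \<Longrightarrow> smooth g \<Longrightarrow> smooth (\<lambda>x. f x - g x)"
  using smooth_add[of f "\<lambda>x. (-1) * g x"] smooth_mult[OF smooth_const[of "-1"], of g] by simp

section \<open>Test functions: supports, bounds and uniform continuity\<close>

lemma Cc_inf_iff:
  "\<phi> \<in> Cc_inf \<Omega> \<longleftrightarrow> smooth \<phi> \<and> compact (closure {x. \<phi> x \<noteq> 0}) \<and> closure {x. \<phi> x \<noteq> 0} \<subseteq> \<Omega>"
  by (auto simp: Cc_inf_def smooth_def)

lemma Cc_inf_smooth: "\<phi> \<in> Cc_inf \<Omega> \<Longrightarrow> smooth \<phi>"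
  by (simp add: Cc_inf_iff)

lemma Cc_inf_mono: "\<phi> \<in> Cc_inf A \<Longrightarrow> A \<subseteq> B \<Longrightarrow> \<phi> \<in> Cc_inf B"
  by (auto simp: Cc_inf_def)

lemma Cc_infI:
  assumes "smooth \<phi>" "compact K" "K \<subseteq> \<Omega>" "\<And>x. x \<notin> K \<Longrightarrow> \<phi> x = 0"
  shows "\<phi> \<in> Cc_inf \<Omega>"
proof -
  have "closure {x. \<phi> x \<noteq> 0} \<subseteq> K"
    by (rule closure_minimal) (use assms compact_imp_closed in auto)
  with assms show ?thesis unfolding Cc_inf_iff
    by (meson bounded_subset closed_closure compact_eq_bounded_closed dual_order.trans)
qed

text \<open>Off the closed support \<open>\<phi>\<close> is zero in a whole neighbourhood, so the
  same compact set also carries its partial derivatives.\<close>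

lemma Cc_infE:
  assumes "\<phi> \<in> Cc_inf \<Omega>"
  obtains K where "compact K" "K \<subseteq> \<Omega>" "\<And>x. x \<notin> K \<Longrightarrow> \<phi> x = 0" "\<And>x i. x \<notin> K \<Longrightarrow> pd i \<phi> x = 0"
proof
  let ?K = "closure {x. \<phi> x \<noteq> 0}"
  show "compact ?K" "?K \<subseteq> \<Omega>" using assms by (auto simp: Cc_inf_iff)
  show z: "x \<notin> ?K \<Longrightarrow> \<phi> x = 0" for x using closure_subset[of "{x. \<phi> x \<noteq> 0}"] by auto
  show "pd i \<phi> x = 0" if "x \<notin> ?K" for x i
  proof -
    have "((\<lambda>x. 0) has_derivative (\<lambda>h. 0)) (at x)" by simp
    moreover have "open (- ?K)" by (intro open_Compl closed_closure)
    moreover have "x \<in> - ?K" using that by simp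
    moreover have "0 = \<phi> y" if "y \<in> - ?K" for y using z[of y] that by simp
    ultimately have "(\<phi> has_derivative (\<lambda>h. 0)) (at x)"
      by (rule has_derivative_transform_within_open)
    then show ?thesis by (simp add: pd_eq)
  qed
qed

lemma Cc_inf_pd:
  assumes "\<phi> \<in> Cc_inf \<Omega>" shows "pd i \<phi> \<in> Cc_inf \<Omega>"
proof -
  obtain K where "compact K" "K \<subseteq> \<Omega>" "\<And>x. x \<notin> K \<Longrightarrow> pd i \<phi> x = 0"
    using assms Cc_infE by metis
  then show ?thesis by (rule Cc_infI[OF smooth_pd[OF Cc_inf_smooth[OF assms]]])
qed

lemma Cc_inf_mult:
  assumes "\<phi> \<in> Cc_inf \<Omega>" "smooth f"
  shows "(\<lambda>x. f x * \<phi> x) \<in> Cc_inf \<Omega>"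
proof -
  obtain K where K: "compact K" "K \<subseteq> \<Omega>" "\<And>x. x \<notin> K \<Longrightarrow> \<phi> x = 0"
    using assms(1) Cc_infE by metis
  show ?thesis
    by (rule Cc_infI[OF smooth_mult[OF assms(2) Cc_inf_smooth[OF assms(1)]] K(1,2)]) (simp add: K(3))
qed

lemma Cc_inf_diff:
  assumes "\<phi> \<in> Cc_inf \<Omega>" "\<psi> \<in> Cc_inf \<Omega>"
  shows "(\<lambda>x. \<phi> x - \<psi> x) \<in> Cc_inf \<Omega>"
proof -
  obtain K where K: "compact K" "K \<subseteq> \<Omega>" "\<And>x. x \<notin> K \<Longrightarrow> \<phi> x = 0" using assms(1) Cc_infE by metis
  obtain L where L: "compact L" "L \<subseteq> \<Omega>" "\<And>x. x \<notin> L \<Longrightarrow> \<psi> x = 0" using assms(2) Cc_infE by metis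
  show ?thesis
    by (rule Cc_infI[OF smooth_diff[OF assms[THEN Cc_inf_smooth]], where K = "K \<union> L"])
       (use K L in auto)
qed

lemma Cc_inf_bounded:
  assumes "\<phi> \<in> Cc_inf \<Omega>"
  obtains B where "B > 0" "\<And>x. \<bar>\<phi> x\<bar> \<le> B"
proof -
  obtain K where K: "compact K" "\<And>x. x \<notin> K \<Longrightarrow> \<phi> x = 0" using assms Cc_infE by metis
  have "bounded (\<phi> ` K)"
    using K(1) assms by (intro compact_imp_bounded compact_continuous_image smooth_continuous_on Cc_inf_smooth)
  then obtain B where B: "B > 0" "\<And>x. x \<in> K \<Longrightarrow> \<bar>\<phi> x\<bar> \<le> B"
    unfolding bounded_pos by auto
  have "\<bar>\<phi> x\<bar> \<le> B" for x using B K(2)[of x] by (cases "x \<in> K") auto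
  with B that show ?thesis by blast
qed

text \<open>Continuity is uniform on a ball slightly larger than the support. A step shorter than 1
  with an end outside that ball has both ends outside \<open>K\<close>, where the function is
  0.\<close>

lemma compact_support_uniformly_continuous:
  fixes \<phi> :: "'a::euclidean_space \<Rightarrow> real"
  assumes "continuous_on UNIV \<phi>" and K: "compact K" "\<And>x. x \<notin> K \<Longrightarrow> \<phi> x = 0"
  shows "uniformly_continuous_on UNIV \<phi>"
proof -
  obtain R where R: "R > 0" "\<And>x. x \<in> K \<Longrightarrow> norm x \<le> R"
    using compact_imp_bounded[OF K(1)] unfolding bounded_pos by auto
  have u: "uniformly_continuous_on (cball 0 (R + 1)) \<phi>"
    using assms(1) by (intro compact_uniformly_continuous) (auto intro: continuous_on_subset)
  show ?thesis unfolding uniformly_continuous_on_def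
  proof (intro allI impI)
    fix e :: real assume "e > 0"
    then obtain d where d: "d > 0"
      "\<And>x x'. norm x \<le> R+1 \<Longrightarrow> norm x' \<le> R+1 \<Longrightarrow> dist x' x < d \<Longrightarrow> dist (\<phi> x') (\<phi> x) < e"
      using u unfolding uniformly_continuous_on_def by (auto simp: mem_cball)
    have "dist (\<phi> x') (\<phi> x) < e" if "dist x' x < min d 1" for x x'
    proof (cases "norm x \<le> R+1 \<and> norm x' \<le> R+1")
      case True then show ?thesis using d that by auto
    next
      case False
      have "norm x' \<le> norm x + dist x' x" "norm x \<le> norm x' + dist x' x"
        by (metis dist_norm norm_triangle_sub add.commute)
           (metis dist_norm norm_minus_commute norm_triangle_sub)
      with False that have "norm x > R" "norm x' > R" by auto
      then have "x \<notin> K" "x' \<notin> K" using R by force+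
      then show ?thesis using K \<open>e > 0\<close> by simp
    qed
    then show "\<exists>d>0. \<forall>x\<in>UNIV. \<forall>x'\<in>UNIV. dist x' x < d \<longrightarrow> dist (\<phi> x') (\<phi> x) < e"
      using \<open>d > 0\<close> by (intro exI[of _ "min d 1"]) auto
  qed
qed

lemma Cc_inf_uniformly_continuous:
  assumes "\<phi> \<in> Cc_inf \<Omega>"
  shows "uniformly_continuous_on UNIV \<phi>"
proof -
  obtain K where "compact K" "\<And>x. x \<notin> K \<Longrightarrow> \<phi> x = 0" using assms Cc_infE by metis
  then show ?thesis
    by (rule compact_support_uniformly_continuous[OF smooth_continuous_on[OF Cc_inf_smooth[OF assms]]])
qed

text \<open>The mean value theorem along the segment reduces the first-order remainder to increments
  of the partial derivatives, which are uniformly continuous. Uniformity in the base point is what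
  differentiation under the convolution integral requires.\<close>

lemma Cc_inf_uniformly_differentiable:
  assumes "\<phi> \<in> Cc_inf \<Omega>" "e > 0"
  obtains d where "d > 0"
    "\<And>x h. norm h < d \<Longrightarrow> \<bar>\<phi> (x + h) - \<phi> x - (\<Sum>i\<in>UNIV. h $ i * pd i \<phi> x)\<bar> \<le> e * norm h"
proof -
  let ?n = "real CARD('a)"
  have "\<exists>d>0. \<forall>x y. dist x y < d \<longrightarrow> \<bar>pd i \<phi> x - pd i \<phi> y\<bar> < e / ?n" for i
  proof -
    have "0 < e / ?n" using assms(2) by simp
    with Cc_inf_uniformly_continuous[OF Cc_inf_pd[OF assms(1), of i]]
    show ?thesis unfolding uniformly_continuous_on_def dist_real_def by (metis UNIV_I)
  qed
  then obtain d where d: "\<And>i. d i > 0" "\<And>i x y. dist x y < d i \<Longrightarrow> \<bar>pd i \<phi> x - pd i \<phi> y\<bar> < e / ?n"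
    by metis
  define D where "D = Min (range d)"
  have D: "D > 0" "\<And>i. D \<le> d i" using d unfolding D_def by auto
  show ?thesis
  proof (rule that[OF D(1)])
    fix x h :: "real^'a" assume h: "norm h < D"
    let ?f = "\<lambda>t. \<phi> (x + t *\<^sub>R h)"
    let ?g = "\<lambda>t. \<Sum>i\<in>UNIV. h $ i * pd i \<phi> (x + t *\<^sub>R h)"
    have "(?f has_real_derivative ?g t) (at t)" for t
    proof -
      have "(?f has_derivative (\<lambda>s. \<Sum>i\<in>UNIV. (s *\<^sub>R h) $ i * pd i \<phi> (x + t *\<^sub>R h))) (at t)"
        by (rule has_derivative_compose[OF _ has_derivative_pd[OF smooth_differentiable[OF Cc_inf_smooth[OF assms(1)]]]])
           (auto intro!: derivative_eq_intros)
      then show ?thesis unfolding has_field_derivative_def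
        by (rule has_derivative_eq_rhs) (auto simp: sum_distrib_right sum_distrib_left mult_ac)
    qed
    then obtain t where t: "0 < t" "t < 1" "?f 1 - ?f 0 = ?g t"
      using MVT2[of 0 1 ?f ?g] by auto
    have "\<bar>\<phi> (x + h) - \<phi> x - (\<Sum>i\<in>UNIV. h $ i * pd i \<phi> x)\<bar>
        = \<bar>\<Sum>i\<in>UNIV. h $ i * (pd i \<phi> (x + t *\<^sub>R h) - pd i \<phi> x)\<bar>"
      using t(3) by (simp add: sum_subtractf right_diff_distrib)
    also have "\<dots> \<le> (\<Sum>i\<in>UNIV. \<bar>h $ i\<bar> * \<bar>pd i \<phi> (x + t *\<^sub>R h) - pd i \<phi> x\<bar>)"
      by (rule order_trans[OF sum_abs]) (simp add: abs_mult)
    also have "\<dots> \<le> (\<Sum>i\<in>(UNIV::'a set). norm h * (e / ?n))"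
    proof (intro sum_mono mult_mono)
      fix i :: 'a
      have "dist (x + t *\<^sub>R h) x < d i"
        using h t D(2)[of i] mult_right_mono[of t 1 "norm h"] by (auto simp: dist_norm)
      then show "\<bar>pd i \<phi> (x + t *\<^sub>R h) - pd i \<phi> x\<bar> \<le> e / ?n" using d(2) less_imp_le by blast
    qed (auto simp: component_le_norm_cart)
    also have "\<dots> = e * norm h" by simp
    finally show "\<bar>\<phi> (x + h) - \<phi> x - (\<Sum>i\<in>UNIV. h $ i * pd i \<phi> x)\<bar> \<le> e * norm h" .
  qed
qed

section \<open>A bump function\<close>

text \<open>The usual flat function \<open>exp (-1/s)\<close>, with inverse powers of
  \<open>s\<close> included so that the family is closed under differentiation; smoothness is then
  an induction on \<open>k\<close> with \<open>n\<close> arbitrary.\<close>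

definition flat :: "nat \<Rightarrow> real \<Rightarrow> real" where
  "flat n s = (if s > 0 then exp (- (1/s)) / s ^ n else 0)"

lemma flat_tendsto_0: "((\<lambda>s. exp (- (1/s)) / s ^ n) \<longlongrightarrow> 0) (at_right (0::real))"
proof (rule Lim_transform_eventually)
  show "((\<lambda>s. inverse s ^ n / exp (inverse s)) \<longlongrightarrow> 0) (at_right (0::real))"
    by (rule filterlim_compose[OF tendsto_power_div_exp_0 filterlim_inverse_at_top_right])
qed (auto simp: eventually_at_filter field_simps exp_minus)

lemma flat_has_derivative:
  "(flat n has_real_derivative (flat (n+2) s - real n * flat (n+1) s)) (at s)"
proof -
  consider "s > 0" | "s < 0" | "s = 0" by linarith
  then show ?thesis
  proof cases
    case 1
    have "((\<lambda>s. exp (- (1/s)) / s ^ n) has_real_derivative (flat (n+2) s - real n * flat (n+1) s)) (at s)"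
      using 1 by (cases n) (auto intro!: derivative_eq_intros simp: flat_def field_simps power2_eq_square,
        metis One_nat_def power_eq_if)
    then show ?thesis
      by (rule has_field_derivative_transform_within_open[where S = "{0<..}"])
         (use 1 in \<open>auto simp: flat_def\<close>)
  next
    case 2
    have "((\<lambda>s. 0) has_real_derivative (flat (n+2) s - real n * flat (n+1) s)) (at s)"
      using 2 by (simp add: flat_def)
    then show ?thesis
      by (rule has_field_derivative_transform_within_open[where S = "{..<0}"])
         (use 2 in \<open>auto simp: flat_def\<close>)
  next
    case 3
    \<comment> \<open>From the right the quotient is \<open>exp (- (1/y)) / y ^ Suc n\<close>, again
      a member of the family; from the left it is 0.\<close>
    have "((\<lambda>y. (flat n y - flat n 0) / (y - 0)) \<longlongrightarrow> 0) (at (0::real))"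
    proof (rule filterlim_split_at)
      show "((\<lambda>y. (flat n y - flat n 0) / (y - 0)) \<longlongrightarrow> 0) (at_left 0)"
        by (rule tendsto_eventually) (auto simp: flat_def eventually_at_filter)
      show "((\<lambda>y. (flat n y - flat n 0) / (y - 0)) \<longlongrightarrow> 0) (at_right 0)"
        by (rule Lim_transform_eventually[OF flat_tendsto_0[of "Suc n"]])
           (auto simp: flat_def eventually_at_filter)
    qed
    then show ?thesis unfolding 3 by (simp add: has_field_derivative_iff flat_def)
  qed
qed

lemma Ck_flat:
  fixes Q :: "real^'d::finite \<Rightarrow> real"
  assumes Q: "\<And>k. Ck k Q"
  shows "Ck k (\<lambda>x. flat n (Q x))"
proof (induction k arbitrary: n)
  case 0
  have "continuous_on UNIV (flat n)"
    using flat_has_derivative by (metis DERIV_isCont continuous_at_imp_continuous_on)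
  then show ?case using Q[of 0] by (auto intro: continuous_on_compose2)
next
  case (Suc k)
  have Qd: "Q differentiable (at x)" for x
    using Q[of "Suc 0"] by (simp add: differentiable_on_def)
  have der: "((\<lambda>x. flat n (Q x)) has_derivative
      (\<lambda>h. (flat (n+2) (Q x) - real n * flat (n+1) (Q x)) * (frechet_derivative Q (at x) h))) (at x)" for x
    using has_derivative_compose[OF Qd[unfolded frechet_derivative_works]
        flat_has_derivative[of n, unfolded has_field_derivative_def]] .
  have "pd i (\<lambda>x. flat n (Q x)) = (\<lambda>x. (flat (n+2) (Q x) + (- real n) * flat (n+1) (Q x)) * pd i Q x)" for i
    using pd_eq[OF der, of i] by (auto simp: pd_def)
  moreover have "Ck k (pd i Q)" for i using Q[of "Suc k"] by simp
  ultimately have "Ck k (pd i (\<lambda>x. flat n (Q x)))" for i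
    by (simp only:) (intro Ck_mult Ck_add Ck_const Suc.IH)
  moreover have "(\<lambda>x. flat n (Q x)) differentiable (at x)" for x
    using der unfolding differentiable_def by blast
  ultimately show ?case by (intro Ck_SucI)
qed

lemma bump_exists:
  "\<exists>\<rho> :: real^'d::finite \<Rightarrow> real. smooth \<rho> \<and> (\<forall>x. \<rho> x \<ge> 0) \<and> (\<forall>x. norm x \<ge> 1 \<longrightarrow> \<rho> x = 0) \<and>
     (LINT x|lborel. \<rho> x) = 1"
proof -
  \<comment> \<open>This is \<open>1 - |x|^2\<close>, spelled out as a sum of products of
    coordinates, the form to which the closure rules for \<open>Ck\<close> apply.\<close>
  define Q where "Q x = 1 + (\<Sum>j\<in>UNIV. (- 1) * (x $ j * x $ j))" for x :: "real^'d"
  have Q: "Q x = 1 - (norm x)\<^sup>2" for x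
    by (simp add: Q_def norm_vec_def L2_set_def sum_negf real_sqrt_pow2 sum_nonneg power2_eq_square[symmetric])
  define r where "r x = flat 0 (Q x)" for x
  have "Ck k Q" for k
    unfolding Q_def by (intro Ck_add Ck_const Ck_sum Ck_mult Ck_component)
  then have r: "smooth r" unfolding smooth_def r_def using Ck_flat by blast
  have r0: "r x \<ge> 0" "norm x \<ge> 1 \<Longrightarrow> r x = 0" for x
    using abs_le_square_iff[of 1 "norm x"] by (auto simp: r_def flat_def Q not_less)
  have rpos: "r 0 > 0" by (simp add: r_def flat_def Q)
  have cont: "continuous_on UNIV r" using r by (rule smooth_continuous_on)
  have int: "integrable lborel r"
  proof -
    have "integrable lborel (\<lambda>x. indicator (cball 0 1) x *\<^sub>R r x)"
      by (rule borel_integrable_compact) (use cont continuous_on_subset in auto)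
    also have "(\<lambda>x. indicator (cball 0 1) x *\<^sub>R r x) = r"
      using r0 by (auto simp: indicator_def fun_eq_iff)
    finally show ?thesis .
  qed
  have "open {x. r x > 0}" using cont by (simp add: open_Collect_less continuous_on_const)
  \<comment> \<open>A vanishing integral would make the nonempty open set
    \<open>{x. r x > 0}\<close> a null set.\<close>
  have "(LINT x|lborel. r x) \<noteq> 0"
  proof
    assume "(LINT x|lborel. r x) = 0"
    then have "AE x in lborel. r x = 0"
      using integral_nonneg_eq_0_iff_AE[OF int] r0 by auto
    then have "AE x in lborel. x \<notin> {x. r x > 0}" by eventually_elim auto
    then have "{x. r x > 0} \<in> null_sets lborel"
      using \<open>open {x. r x > 0}\<close> by (subst AE_iff_null_sets) auto
    then have "{x. r x > 0} = {}"
      using \<open>open {x. r x > 0}\<close> open_not_negligible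
      by (metis negligible_iff_null_sets null_sets_completionI)
    then show False using rpos by auto
  qed
  moreover have "(LINT x|lborel. r x) \<ge> 0" using r0 by (simp add: integral_nonneg_AE)
  ultimately show ?thesis
    using r0 by (intro exI[of _ "\<lambda>x. inverse (LINT x|lborel. r x) * r x"])
      (auto intro!: smooth_mult smooth_const r)
qed

section \<open>Affine changes of variables\<close>

lemma nn_integral_lborel_affine:
  fixes t :: "'a::euclidean_space"
  assumes [measurable]: "f \<in> borel_measurable borel" and c: "c \<noteq> 0"
  shows "(\<integral>\<^sup>+x. f x \<partial>lborel) = ennreal (\<bar>c\<bar> ^ DIM('a)) * (\<integral>\<^sup>+x. f (t + c *\<^sub>R x) \<partial>lborel)"
  by (subst lborel_affine[OF c, of t])
     (simp add: nn_integral_density nn_integral_distr nn_integral_cmult)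

lemma nn_integral_lborel_translation:
  fixes t :: "'a::euclidean_space"
  assumes "f \<in> borel_measurable borel"
  shows "(\<integral>\<^sup>+x. f (x + t) \<partial>lborel) = (\<integral>\<^sup>+x. f x \<partial>lborel)"
  using nn_integral_lborel_affine[OF assms, of 1 t] by (simp add: add.commute)

lemma integral_lborel_affine:
  fixes t :: "'a::euclidean_space" and f :: "'a \<Rightarrow> real"
  assumes [measurable]: "f \<in> borel_measurable borel" and c: "c \<noteq> 0"
  shows "(LINT x|lborel. f x) = \<bar>c\<bar> ^ DIM('a) * (LINT x|lborel. f (t + c *\<^sub>R x))"
  by (subst lborel_affine[OF c, of t])
     (simp add: integral_density integral_distr)

lemma integrable_lborel_affine:
  fixes t :: "'a::euclidean_space" and f :: "'a \<Rightarrow> real"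
  assumes f: "integrable lborel f" and c: "c \<noteq> 0"
  shows "integrable lborel (\<lambda>x. f (t + c *\<^sub>R x))"
proof -
  have [measurable]: "f \<in> borel_measurable borel" using borel_measurable_integrable[OF f] by simp
  show ?thesis
    using f c unfolding integrable_iff_bounded
    by (subst (asm) nn_integral_lborel_affine[where c=c and t=t]) (auto simp: ennreal_mult_less_top)
qed

lemma integrable_bounded_support:
  fixes f :: "'a::euclidean_space \<Rightarrow> real"
  assumes [measurable]: "f \<in> borel_measurable borel"
    and "bounded S" "\<And>x. \<bar>f x\<bar> \<le> B" "\<And>x. x \<notin> S \<Longrightarrow> f x = 0"
  shows "integrable lborel f"
proof -
  obtain R where R: "S \<subseteq> cball 0 R" using \<open>bounded S\<close> by (auto simp: bounded_iff subset_iff)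
  have "emeasure lborel (cball (0::'a) R) < \<infinity>" by (rule emeasure_bounded_finite) simp
  then have i: "integrable lborel (\<lambda>x. B * indicator (cball (0::'a) R) x :: real)"
    by (intro integrable_mult_right integrable_real_indicator) auto
  have b: "norm (f x) \<le> norm (B * indicator (cball 0 R) x)" for x
  proof (cases "x \<in> S")
    case True
    with R have "x \<in> cball 0 R" by blast
    then show ?thesis using assms(3)[of x] by simp
  qed (simp add: assms(4))
  show ?thesis
    by (rule Bochner_Integration.integrable_bound[OF i _ AE_I2[OF b]]) simp
qed

lemma Cc_inf_integrable:
  assumes "\<phi> \<in> Cc_inf \<Omega>" shows "integrable lborel \<phi>"
proof -
  obtain K where K: "compact K" "\<And>x. x \<notin> K \<Longrightarrow> \<phi> x = 0" using assms Cc_infE by metis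
  obtain B where B: "\<And>x. \<bar>\<phi> x\<bar> \<le> B" using assms Cc_inf_bounded by metis
  show ?thesis
    by (rule integrable_bounded_support[OF smooth_borel[OF Cc_inf_smooth[OF assms]] compact_imp_bounded[OF K(1)] B K(2)])
qed

section \<open>Convolution\<close>

definition conv :: "(real^'d::finite \<Rightarrow> real) \<Rightarrow> (real^'d \<Rightarrow> real) \<Rightarrow> real^'d \<Rightarrow> real" where
  "conv v \<eta> x = (LINT y|lborel. v y * \<eta> (x - y))"

lemma integrable_conv:
  fixes v \<eta> :: "real^'d::finite \<Rightarrow> real"
  assumes v: "integrable lborel v" and [measurable]: "\<eta> \<in> borel_measurable borel" and B: "\<And>x. \<bar>\<eta> x\<bar> \<le> B"
  shows "integrable lborel (\<lambda>y. v y * \<eta> (x - y))"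
proof -
  have [measurable]: "v \<in> borel_measurable borel" using borel_measurable_integrable[OF v] by simp
  have "integrable lborel (\<lambda>y. B * v y)" by (intro integrable_mult_right v)
  then show ?thesis
  proof (rule Bochner_Integration.integrable_bound)
    have "\<bar>v y\<bar> * \<bar>\<eta> (x - y)\<bar> \<le> \<bar>B\<bar> * \<bar>v y\<bar>" for y
      using mult_right_mono[of "\<bar>\<eta> (x - y)\<bar>" "\<bar>B\<bar>" "\<bar>v y\<bar>"] B[of "x - y"] by (auto simp: mult.commute)
    then show "AE y in lborel. norm (v y * \<eta> (x - y)) \<le> norm (B * v y)"
      by (simp add: abs_mult)
  qed simp
qed

lemma Cc_inf_conv_integrable:
  fixes v \<eta> :: "real^'d::finite \<Rightarrow> real"
  assumes "integrable lborel v" "\<eta> \<in> Cc_inf \<Omega>"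
  shows "integrable lborel (\<lambda>y. v y * \<eta> (x - y))"
proof -
  obtain B where "\<And>x. \<bar>\<eta> x\<bar> \<le> B" using assms(2) Cc_inf_bounded by metis
  then show ?thesis by (rule integrable_conv[OF assms(1) smooth_borel[OF Cc_inf_smooth[OF assms(2)]]])
qed

text \<open>The remainder of the convolution is \<open>v\<close> integrated against the remainder of
  \<open>\<eta>\<close>, and the latter is small uniformly in the base point; the \<open>L^1\<close>
  norm of \<open>v\<close> does the rest.\<close>

lemma conv_has_derivative:
  assumes v: "integrable lborel v" and \<eta>: "\<eta> \<in> Cc_inf \<Omega>"
  shows "(conv v \<eta> has_derivative (\<lambda>h. \<Sum>i\<in>UNIV. h $ i * conv v (pd i \<eta>) x)) (at x)"
  unfolding has_derivative_at_alt
proof (intro conjI allI impI)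
  show "bounded_linear (\<lambda>h. \<Sum>i\<in>UNIV. h $ i * conv v (pd i \<eta>) x)"
    by (intro bounded_linear_sum bounded_linear_mult_const bounded_linear_vec_nth)
next
  fix e :: real assume "e > 0"
  let ?N = "LINT y|lborel. \<bar>v y\<bar>"
  have N: "?N + 1 > 0" by (smt (verit) Bochner_Integration.integral_nonneg abs_ge_zero)
  \<comment> \<open>The \<open>+ 1\<close> avoids a division by zero when \<open>v\<close> vanishes
    almost everywhere.\<close>
  define e' where "e' = e / (?N + 1)"
  have e': "e' > 0" "e' * ?N \<le> e" using \<open>e > 0\<close> N by (simp_all only: e'_def) (auto simp: field_simps)
  obtain d where d: "d > 0"
    "\<And>x h. norm h < d \<Longrightarrow> \<bar>\<eta> (x + h) - \<eta> x - (\<Sum>i\<in>UNIV. h $ i * pd i \<eta> x)\<bar> \<le> e' * norm h"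
    using Cc_inf_uniformly_differentiable[OF \<eta> e'(1)] by metis
  have "norm (conv v \<eta> y - conv v \<eta> x - (\<Sum>i\<in>UNIV. (y - x) $ i * conv v (pd i \<eta>) x)) \<le> e * norm (y - x)"
    if "norm (y - x) < d" for y
  proof -
    let ?R = "\<lambda>s. \<eta> (y - s) - \<eta> (x - s) - (\<Sum>i\<in>UNIV. (y - x) $ i * pd i \<eta> (x - s))"
    note i = Cc_inf_conv_integrable[OF v \<eta>] Cc_inf_conv_integrable[OF v Cc_inf_pd[OF \<eta>]]
    have *: "v s * ?R s = v s * \<eta> (y - s) - v s * \<eta> (x - s) - (\<Sum>i\<in>UNIV. (y - x) $ i * (v s * pd i \<eta> (x - s)))" for s
      by (simp add: right_diff_distrib sum_distrib_left mult_ac)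
    have iR: "integrable lborel (\<lambda>s. v s * ?R s)"
      unfolding * by (intro Bochner_Integration.integrable_diff Bochner_Integration.integrable_sum integrable_mult_right i)
    have "conv v \<eta> y - conv v \<eta> x - (\<Sum>i\<in>UNIV. (y - x) $ i * conv v (pd i \<eta>) x) = (LINT s|lborel. v s * ?R s)"
      unfolding * conv_def
      by (subst Bochner_Integration.integral_diff Bochner_Integration.integral_sum integral_mult_right
          | intro Bochner_Integration.integrable_diff Bochner_Integration.integrable_sum integrable_mult_right i | simp)+
    then have "norm (conv v \<eta> y - conv v \<eta> x - (\<Sum>i\<in>UNIV. (y - x) $ i * conv v (pd i \<eta>) x))
        \<le> (LINT s|lborel. norm (v s * ?R s))"
      by (simp only: integral_norm_bound)
    also have "\<dots> \<le> (LINT s|lborel. (e' * norm (y - x)) * \<bar>v s\<bar>)"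
    proof (rule integral_mono)
      show "integrable lborel (\<lambda>s. norm (v s * ?R s))" using iR by (rule integrable_norm)
      show "integrable lborel (\<lambda>s. (e' * norm (y - x)) * \<bar>v s\<bar>)"
        by (intro integrable_mult_right integrable_abs v)
    next
      fix s
      have "\<bar>?R s\<bar> \<le> e' * norm (y - x)" using d(2)[OF that, of "x - s"] by (simp add: diff_add_eq)
      then have "\<bar>?R s\<bar> * \<bar>v s\<bar> \<le> (e' * norm (y - x)) * \<bar>v s\<bar>" by (rule mult_right_mono) simp
      then show "norm (v s * ?R s) \<le> (e' * norm (y - x)) * \<bar>v s\<bar>" by (simp add: abs_mult mult.commute)
    qed
    also have "\<dots> = (e' * ?N) * norm (y - x)" by simp
    also have "\<dots> \<le> e * norm (y - x)" using e'(2) by (rule mult_right_mono) simp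
    finally show ?thesis .
  qed
  then show "\<exists>d>0. \<forall>y. norm (y - x) < d \<longrightarrow>
      norm (conv v \<eta> y - conv v \<eta> x - (\<Sum>i\<in>UNIV. (y - x) $ i * conv v (pd i \<eta>) x)) \<le> e * norm (y - x)"
    using d(1) by blast
qed

lemma pd_conv:
  assumes "integrable lborel v" "\<eta> \<in> Cc_inf \<Omega>"
  shows "pd i (conv v \<eta>) = conv v (pd i \<eta>)"
  by (rule ext, subst pd_eq[OF conv_has_derivative[OF assms]])
     (simp add: axis_def if_distrib[of "\<lambda>t. t * _"] cong: if_cong)

lemma smooth_conv:
  assumes v: "integrable lborel v" and \<eta>: "\<eta> \<in> Cc_inf \<Omega>"
  shows "smooth (conv v \<eta>)"
proof -
  have d: "conv v \<eta> differentiable (at x)" if "\<eta> \<in> Cc_inf \<Omega>" for x \<eta>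
    using conv_has_derivative[OF v that] unfolding differentiable_def by blast
  have "Ck k (conv v \<eta>)" if "\<eta> \<in> Cc_inf \<Omega>" for k \<eta>
    using that
  proof (induction k arbitrary: \<eta>)
    case 0
    then show ?case using d by (auto intro!: differentiable_imp_continuous_on differentiable_at_imp_differentiable_on)
  next
    case (Suc k)
    show ?case
      by (rule Ck_SucI[OF d[OF Suc.prems]]) (simp add: pd_conv[OF v Suc.prems] Suc.IH[OF Cc_inf_pd[OF Suc.prems]])
  qed
  with \<eta> show ?thesis by (simp add: smooth_def)
qed

lemma conv_Cc_inf:
  assumes v: "integrable lborel v" and \<eta>: "\<eta> \<in> Cc_inf UNIV"
    and "\<And>x. norm x \<ge> t \<Longrightarrow> \<eta> x = 0" "\<And>y. y \<notin> S \<Longrightarrow> v y = 0"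
    and K: "compact K" "K \<subseteq> \<Omega>" "\<And>x y. y \<in> S \<Longrightarrow> norm (x - y) < t \<Longrightarrow> x \<in> K"
  shows "conv v \<eta> \<in> Cc_inf \<Omega>"
proof (rule Cc_infI[OF smooth_conv[OF v \<eta>] K(1,2)])
  fix x assume "x \<notin> K"
  then have "v y * \<eta> (x - y) = 0" for y
    using assms(3)[of "x - y"] assms(4)[of y] K(3)[of y x] by (cases "y \<in> S") force+
  then have "(\<lambda>y. v y * \<eta> (x - y)) = (\<lambda>y. 0)" by (rule ext)
  then show "conv v \<eta> x = 0" by (simp only: conv_def) simp
qed

text \<open>The convolution of \<open>\<eta>\<close> with the indicator of a large ball is constant
  near 0, with value the integral of \<open>\<eta>\<close>. Its derivative at 0 is therefore 0, and
  by \<open>pd_conv\<close> it is also the integral of \<open>pd i \<eta>\<close>.\<close>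

lemma integral_pd_eq_0:
  assumes \<eta>: "\<eta> \<in> Cc_inf \<Omega>"
  shows "(LINT x|lborel. pd i \<eta> x) = 0"
proof -
  obtain K where K: "compact K" "\<And>x. x \<notin> K \<Longrightarrow> \<eta> x = 0" "\<And>x. x \<notin> K \<Longrightarrow> pd i \<eta> x = 0"
    using \<eta> Cc_infE by metis
  obtain R where R: "R > 0" "\<And>x. x \<in> K \<Longrightarrow> norm x \<le> R"
    using compact_imp_bounded[OF K(1)] unfolding bounded_pos by auto
  let ?v = "indicator (cball 0 (R + 1)) :: real^'a \<Rightarrow> real"
  have v: "integrable lborel ?v"
    using emeasure_bounded_finite[of "cball 0 (R+1)"] by (intro integrable_real_indicator) auto
  \<comment> \<open>Only \<open>y\<close> with \<open>x - y\<close> in \<open>K\<close> contribute,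
    and for \<open>norm x < 1\<close> these lie in the ball of radius \<open>R + 1\<close>, where
    the indicator is 1.\<close>
  have flip: "conv ?v f x = (LINT y|lborel. f y)"
    if "norm x < 1" "\<And>x. x \<notin> K \<Longrightarrow> f x = 0" "f \<in> borel_measurable borel" for f x
  proof -
    have "?v y * f (x - y) = f (x + (-1) *\<^sub>R y)" for y
    proof (cases "x - y \<in> K")
      case True
      have "norm y \<le> norm x + norm (x - y)" by (metis norm_minus_commute norm_triangle_sub)
      then show ?thesis using R(2)[OF True] that(1) by (simp add: indicator_def)
    qed (simp add: that)
    then have "conv ?v f x = (LINT y|lborel. f (x + (-1) *\<^sub>R y))" by (simp only: conv_def)
    then show ?thesis using integral_lborel_affine[OF that(3), of "-1" x] by simp
  qed
  have m: "\<eta> \<in> borel_measurable borel" "pd i \<eta> \<in> borel_measurable borel"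
    using \<eta> by (auto intro: smooth_borel[OF Cc_inf_smooth] smooth_borel[OF smooth_pd[OF Cc_inf_smooth]])
  have "((\<lambda>x. LINT y|lborel. \<eta> y) has_derivative (\<lambda>h. 0)) (at (0::real^'a))" by simp
  then have "(conv ?v \<eta> has_derivative (\<lambda>h. 0)) (at 0)"
    by (rule has_derivative_transform_within_open[where s = "ball 0 1"])
       (auto simp: flip[OF _ K(2) m(1)])
  then have "pd i (conv ?v \<eta>) 0 = 0" by (simp add: pd_eq)
  then show ?thesis using flip[OF _ K(3) m(2), of 0] by (simp add: pd_conv[OF v \<eta>])
qed

section \<open>Mollifiers\<close>

definition bump :: "real^'d::finite \<Rightarrow> real" where
  "bump = (SOME \<rho>. smooth \<rho> \<and> (\<forall>x. \<rho> x \<ge> 0) \<and> (\<forall>x. norm x \<ge> 1 \<longrightarrow> \<rho> x = 0) \<and> (LINT x|lborel. \<rho> x) = 1)"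

lemma bump:
  shows smooth_bump: "smooth bump" and bump_nonneg: "bump x \<ge> 0"
    and bump_eq_0: "norm x \<ge> 1 \<Longrightarrow> bump x = 0" and integral_bump: "(LINT x|lborel. bump x) = 1"
  using someI_ex[OF bump_exists, folded bump_def] by auto

lemma bump_Cc_inf: "bump \<in> Cc_inf UNIV"
  by (rule Cc_infI[OF smooth_bump, of "cball 0 1"]) (auto simp: bump_eq_0)

definition moll :: "real \<Rightarrow> real^'d::finite \<Rightarrow> real" where
  "moll t x = bump ((1/t) *\<^sub>R x) / t ^ CARD('d)"

lemma smooth_moll: "smooth (moll t :: real^'d::finite \<Rightarrow> real)"
proof -
  have "smooth (\<lambda>x::real^'d. (1 / t ^ CARD('d)) * bump ((1/t) *\<^sub>R x + 0))"
    by (rule smooth_mult[OF smooth_const smooth_affine[OF smooth_bump]])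
  then show ?thesis by (simp add: moll_def[abs_def])
qed

lemma moll_eq_0: "t > 0 \<Longrightarrow> norm x \<ge> t \<Longrightarrow> moll t x = 0"
  by (simp add: moll_def bump_eq_0)

lemma moll_nonneg: "t > 0 \<Longrightarrow> moll t x \<ge> 0"
  by (simp add: moll_def bump_nonneg)

lemma moll_Cc_inf: "t > 0 \<Longrightarrow> moll t \<in> Cc_inf UNIV"
  by (rule Cc_infI[OF smooth_moll, of "cball 0 t"]) (auto simp: moll_eq_0)

lemma integral_moll:
  assumes "t > 0" shows "(LINT x|lborel. moll t (x::real^'d::finite)) = 1"
proof -
  have "t ^ CARD('d) = (LINT x|lborel. bump ((1 / t) *\<^sub>R (x::real^'d)))"
    using integral_lborel_affine[OF smooth_borel[OF smooth_bump], where c = "1/t" and t = "0::real^'d"] assms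
    by (simp add: power_one_over divide_simps integral_bump split: if_splits)
  moreover have "t ^ CARD('d) > 0" using assms by simp
  ultimately show ?thesis by (simp add: moll_def)
qed

lemma conv_moll_uminus:
  assumes [measurable]: "G \<in> borel_measurable borel"
  shows "conv G (moll t) x = (LINT z|lborel. G (x - z) * moll t z)"
proof -
  have [measurable]: "moll t \<in> borel_measurable borel" by (rule smooth_borel[OF smooth_moll])
  show ?thesis unfolding conv_def
    using integral_lborel_affine[of "\<lambda>y. G y * moll t (x - y)" "-1" x] by simp
qed

section \<open>Mollification in the mean\<close>

lemma nn_integral_eq_integral_abs:
  fixes f :: "'a \<Rightarrow> real"
  assumes "integrable M f"
  shows "(\<integral>\<^sup>+x. ennreal \<bar>f x\<bar> \<partial>M) = ennreal (LINT x|M. \<bar>f x\<bar>)"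
  using assms by (intro nn_integral_eq_integral) auto

text \<open>Measurability supplies continuous functions converging to \<open>G\<close> off a null
  set. Clipping them to \<open>[-C, C]\<close> and multiplying by a cutoff leaves the limit
  unchanged, since \<open>G\<close> obeys the same bounds, and makes dominated convergence
  applicable.\<close>

lemma approximate_continuous_L1:
  fixes G :: "'a::euclidean_space \<Rightarrow> real"
  assumes [measurable]: "G \<in> borel_measurable borel"
    and S: "bounded S" and C: "\<And>x. \<bar>G x\<bar> \<le> C" and G0: "\<And>x. x \<notin> S \<Longrightarrow> G x = 0" and "e > 0"
  obtains c R where "continuous_on UNIV c" "\<And>x. \<bar>c x\<bar> \<le> C" "\<And>x. x \<notin> cball 0 R \<Longrightarrow> c x = 0"
    "(\<integral>\<^sup>+x. ennreal \<bar>G x - c x\<bar> \<partial>lborel) < ennreal e"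
proof -
  obtain R where R: "\<And>x. x \<in> S \<Longrightarrow> norm x \<le> R" using S unfolding bounded_iff by blast
  have C0: "C \<ge> 0" using C[of undefined] by linarith
  have "G \<in> borel_measurable lebesgue" by (simp add: measurable_completion)
  then have "G measurable_on UNIV" by (rule lebesgue_measurable_imp_measurable_on) simp
  then obtain N g where N: "negligible N" and g: "\<And>n::nat. continuous_on UNIV (g n)"
    "\<And>x. x \<notin> N \<Longrightarrow> (\<lambda>n. g n x) \<longlonglongrightarrow> G x"
    unfolding measurable_on_def by auto
  define cut :: "'a \<Rightarrow> real" where "cut x = max 0 (min 1 (R + 1 - norm x))" for x
  define c where "c n x = max (- C) (min C (g n x)) * cut x" for n x
  have cont: "continuous_on UNIV (c n)" for n
    unfolding c_def cut_def by (intro continuous_intros g)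
  have cut: "0 \<le> cut x" "cut x \<le> 1" "x \<notin> cball 0 (R + 1) \<Longrightarrow> cut x = 0" for x
    by (auto simp: cut_def)
  have cb: "\<bar>c n x\<bar> \<le> C" for n x
  proof -
    have "\<bar>max (- C) (min C (g n x))\<bar> * \<bar>cut x\<bar> \<le> C * 1"
      using cut C0 by (intro mult_mono) auto
    then show ?thesis by (simp add: c_def abs_mult)
  qed
  have c0: "c n x = 0" if "x \<notin> cball 0 (R + 1)" for n x
    using cut(3)[OF that] by (simp add: c_def)
  have [measurable]: "c n \<in> borel_measurable borel" for n
    using cont by (rule borel_measurable_continuous_onI)
  have G0': "G x = 0" if "x \<notin> cball 0 (R + 1)" for x
    using G0[of x] R[of x] that by (cases "x \<in> S") auto
  have lim: "(\<lambda>n. G x - c n x) \<longlonglongrightarrow> 0" if "x \<notin> N" for x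
  proof -
    have "(\<lambda>n. c n x) \<longlonglongrightarrow> max (- C) (min C (G x)) * cut x"
      unfolding c_def by (intro tendsto_intros g(2) that)
    moreover have "max (- C) (min C (G x)) * cut x = G x"
    proof (cases "x \<in> S")
      case True
      then show ?thesis using R[OF True] C[of x] by (simp add: cut_def max_def min_def abs_le_iff)
    next
      case False
      then show ?thesis using G0 C0 by simp
    qed
    ultimately show ?thesis using tendsto_diff[OF tendsto_const[of "G x"]] by fastforce
  qed
  have "(\<lambda>n. LINT x|lborel. \<bar>G x - c n x\<bar>) \<longlonglongrightarrow> (LINT (x::'a)|lborel. (0::real))"
  proof (rule integral_dominated_convergence)
    show "integrable lborel (\<lambda>x. 2 * C * indicator (cball (0::'a) (R + 1)) x)"
      by (intro integrable_mult_right integrable_real_indicator emeasure_bounded_finite) auto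
    have "AE x in lborel. x \<notin> N"
      using N AE_not_in[of N lebesgue] by (simp add: negligible_iff_null_sets AE_completion_iff)
    then show "AE x in lborel. (\<lambda>n. \<bar>G x - c n x\<bar>) \<longlonglongrightarrow> 0"
      by eventually_elim (use lim tendsto_rabs_zero in blast)
    show "AE x in lborel. norm \<bar>G x - c n x\<bar> \<le> 2 * C * indicator (cball 0 (R + 1)) x" for n
    proof (rule AE_I2)
      fix x
      show "norm \<bar>G x - c n x\<bar> \<le> 2 * C * indicator (cball 0 (R + 1)) x"
      proof (cases "x \<in> cball 0 (R + 1)")
        case True
        then show ?thesis using C[of x] cb[of n x] by simp
      qed (simp add: G0' c0)
    qed
  qed simp_all
  then have "eventually (\<lambda>n. (LINT x|lborel. \<bar>G x - c n x\<bar>) < e) sequentially"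
    using \<open>e > 0\<close> by (intro order_tendstoD(2)) auto
  then obtain n where n: "(LINT x|lborel. \<bar>G x - c n x\<bar>) < e"
    unfolding eventually_sequentially by blast
  have "integrable lborel (\<lambda>x. G x - c n x)"
    by (intro Bochner_Integration.integrable_diff integrable_bounded_support[OF _ bounded_cball[of 0 "R + 1"] C G0']
        integrable_bounded_support[OF _ bounded_cball[of 0 "R + 1"] cb c0]) simp_all
  then have "(\<integral>\<^sup>+x. ennreal \<bar>G x - c n x\<bar> \<partial>lborel) < ennreal e"
    using n \<open>e > 0\<close> by (simp add: nn_integral_eq_integral_abs ennreal_less_iff)
  then show ?thesis using that[OF cont cb c0] by blast
qed

text \<open>The increment of \<open>G\<close> is compared with that of a continuous approximant
  \<open>c\<close>: two \<open>L^1\<close> errors, equal by translation invariance, and the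
  increment of \<open>c\<close>, which is uniformly small and lives on a bounded set.\<close>

lemma translation_continuous_L1:
  fixes G :: "'a::euclidean_space \<Rightarrow> real"
  assumes [measurable]: "G \<in> borel_measurable borel"
    and S: "bounded S" and C: "\<And>x. \<bar>G x\<bar> \<le> C" and G0: "\<And>x. x \<notin> S \<Longrightarrow> G x = 0" and "e > 0"
  obtains d where "d > 0"
    "\<And>z. norm z < d \<Longrightarrow> (\<integral>\<^sup>+x. ennreal \<bar>G (x - z) - G x\<bar> \<partial>lborel) \<le> ennreal e"
proof -
  have e3: "e / 3 > 0" using \<open>e > 0\<close> by simp
  obtain c R where c: "continuous_on UNIV c" "\<And>x. \<bar>c x\<bar> \<le> C" "\<And>x. x \<notin> cball 0 R \<Longrightarrow> c x = 0"
    and Gc: "(\<integral>\<^sup>+x. ennreal \<bar>G x - c x\<bar> \<partial>lborel) < ennreal (e / 3)"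
    by (rule approximate_continuous_L1[OF assms(1) S C _ e3]) (erule G0, rule that)
  have [measurable]: "c \<in> borel_measurable borel"
    using c(1) by (rule borel_measurable_continuous_onI)
  define V where "V = measure lborel (cball (0::'a) (R + 1))"
  have emV: "emeasure lborel (cball (0::'a) (R + 1)) = ennreal V"
    unfolding V_def by (intro emeasure_eq_ennreal_measure) (use emeasure_bounded_finite[of "cball (0::'a) (R+1)"] in auto)
  have V0: "V \<ge> 0" by (simp add: V_def)
  have "uniformly_continuous_on UNIV c"
    by (rule compact_support_uniformly_continuous[OF c(1) compact_cball c(3)])
  \<comment> \<open>A uniform increment below \<open>k\<close> on a ball of volume \<open>V\<close>
    integrates to at most \<open>e / 3\<close>.\<close>
  moreover define k where "k = e / (3 * (V + 1))"
  moreover have k: "k > 0" "k * V \<le> e / 3" using V0 \<open>e > 0\<close> by (auto simp: k_def field_simps)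
  ultimately obtain d where d: "d > 0" "\<And>x y. dist y x < d \<Longrightarrow> dist (c y) (c x) < k"
    unfolding uniformly_continuous_on_def by (metis UNIV_I)
  show ?thesis
  proof (rule that[of "min d 1"])
    fix z :: 'a assume z: "norm z < min d 1"
    have 1: "(\<integral>\<^sup>+x. ennreal \<bar>G (x - z) - c (x - z)\<bar> \<partial>lborel) \<le> ennreal (e / 3)"
      using nn_integral_lborel_translation[of "\<lambda>x. ennreal \<bar>G x - c x\<bar>" "- z"] Gc by simp
    have "ennreal \<bar>c (x - z) - c x\<bar> \<le> ennreal (k) * indicator (cball 0 (R + 1)) x" for x
    proof (cases "x \<in> cball 0 (R + 1)")
      case True
      have "\<bar>c (x - z) - c x\<bar> \<le> k"
        using d(2)[of "x - z" x] z by (simp add: dist_norm less_imp_le)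
      with True show ?thesis by (simp add: ennreal_leI)
    next
      case False
      have "norm x \<le> norm (x - z) + norm z" using norm_triangle_sub[of x z] by (simp add: add.commute)
      with False z have "x \<notin> cball 0 R" "x - z \<notin> cball 0 R" by auto
      then have "c x = 0" "c (x - z) = 0" using c(3)[of x] c(3)[of "x - z"] by metis+
      then show ?thesis by simp
    qed
    then have "(\<integral>\<^sup>+x. ennreal \<bar>c (x - z) - c x\<bar> \<partial>lborel)
        \<le> (\<integral>\<^sup>+(x::'a). ennreal (k) * indicator (cball 0 (R + 1)) x \<partial>lborel)"
      by (rule nn_integral_mono)
    also have "\<dots> = ennreal (k * V)"
      using k by (subst nn_integral_cmult_indicator) (simp_all add: emV ennreal_mult')
    also have "\<dots> \<le> ennreal (e / 3)"
      by (rule ennreal_leI[OF k(2)])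
    finally have 2: "(\<integral>\<^sup>+x. ennreal \<bar>c (x - z) - c x\<bar> \<partial>lborel) \<le> ennreal (e / 3)" .
    have "(\<integral>\<^sup>+x. ennreal \<bar>G (x - z) - G x\<bar> \<partial>lborel)
        \<le> (\<integral>\<^sup>+x. ennreal \<bar>G (x - z) - c (x - z)\<bar> + ennreal \<bar>c (x - z) - c x\<bar> + ennreal \<bar>G x - c x\<bar> \<partial>lborel)"
      by (intro nn_integral_mono) (simp flip: ennreal_plus)
    also have "\<dots> = (\<integral>\<^sup>+x. ennreal \<bar>G (x - z) - c (x - z)\<bar> \<partial>lborel) + (\<integral>\<^sup>+x. ennreal \<bar>c (x - z) - c x\<bar> \<partial>lborel)
        + (\<integral>\<^sup>+x. ennreal \<bar>G x - c x\<bar> \<partial>lborel)"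
      by (simp add: nn_integral_add)
    also have "\<dots> \<le> ennreal (e/3) + ennreal (e/3) + ennreal (e/3)"
      by (intro add_mono 1 2 less_imp_le[OF Gc])
    also have "\<dots> = ennreal e" using \<open>e > 0\<close> by (simp flip: ennreal_plus)
    finally show "(\<integral>\<^sup>+x. ennreal \<bar>G (x - z) - G x\<bar> \<partial>lborel) \<le> ennreal e" .
  qed (use d in auto)
qed

lemma conv_moll_bounded:
  fixes G :: "real^'d::finite \<Rightarrow> real"
  assumes [measurable]: "G \<in> borel_measurable borel" and C: "\<And>x. \<bar>G x\<bar> \<le> C" and t: "t > 0"
  shows "\<bar>conv G (moll t) x\<bar> \<le> C"
proof -
  have i: "integrable lborel (moll t :: real^'d \<Rightarrow> real)" by (rule Cc_inf_integrable[OF moll_Cc_inf[OF t]])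
  have "\<bar>conv G (moll t) x\<bar> \<le> (LINT z|lborel. \<bar>G (x - z) * moll t z\<bar>)"
    unfolding conv_moll_uminus[OF assms(1)] by (rule integral_abs_bound)
  also have "\<dots> \<le> (LINT z::real^'d|lborel. C * moll t z)"
  proof (rule integral_mono')
    show "integrable lborel (\<lambda>z::real^'d. C * moll t z)" by (intro integrable_mult_right i)
    show "\<bar>G (x - z) * moll t z\<bar> \<le> C * moll t z" for z
      using C[of "x - z"] moll_nonneg[OF t, of z] by (simp add: abs_mult mult_right_mono)
    show "0 \<le> C * moll t z" for z :: "real^'d"
      using C[of 0] moll_nonneg[OF t, of z] by (intro mult_nonneg_nonneg) linarith+
  qed
  also have "\<dots> = C" by (simp add: integral_moll[OF t])
  finally show ?thesis .
qed

text \<open>The mollification error is an average of the increments \<open>G (x - z) - G x\<close>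
  over \<open>z\<close>; exchanging the integrals bounds its \<open>L^1\<close> norm by the worst
  translation error at distance below \<open>t\<close>.\<close>

lemma conv_moll_L1:
  fixes G :: "real^'d::finite \<Rightarrow> real"
  assumes G[measurable]: "G \<in> borel_measurable borel"
    and S: "bounded S" and C: "\<And>x. \<bar>G x\<bar> \<le> C" and G0: "\<And>x. x \<notin> S \<Longrightarrow> G x = 0" and t: "t > 0"
    and e: "\<And>z. norm z < t \<Longrightarrow> (\<integral>\<^sup>+x. ennreal \<bar>G (x - z) - G x\<bar> \<partial>lborel) \<le> ennreal e"
  shows "(\<integral>\<^sup>+x. ennreal \<bar>conv G (moll t) x - G x\<bar> \<partial>lborel) \<le> ennreal e"
proof -
  have i: "integrable lborel (moll t :: real^'d \<Rightarrow> real)" by (rule Cc_inf_integrable[OF moll_Cc_inf[OF t]])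
  have [measurable]: "moll t \<in> borel_measurable (borel :: (real^'d) measure)" by (rule smooth_borel[OF smooth_moll])
  obtain B where B: "\<And>x::real^'d. \<bar>moll t x\<bar> \<le> B" using Cc_inf_bounded[OF moll_Cc_inf[OF t]] by metis
  have le: "ennreal \<bar>conv G (moll t) x - G x\<bar>
      \<le> (\<integral>\<^sup>+z. ennreal (moll t z) * ennreal \<bar>G (x - z) - G x\<bar> \<partial>lborel)" for x
  proof -
    have Gi: "integrable lborel G" by (rule integrable_bounded_support[OF G S C G0])
    have ix: "integrable lborel (\<lambda>z. G (x - z) * moll t z)"
    proof -
      have "integrable lborel (\<lambda>y. G y * moll t (x - y))" by (rule integrable_conv[OF Gi _ B]) simp
      from integrable_lborel_affine[OF this, of "-1" x] show ?thesis by simp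
    qed
    have ic: "integrable lborel (\<lambda>z::real^'d. G x * moll t z)" by (intro integrable_mult_right i)
    have "conv G (moll t) x - G x = (LINT z|lborel. G (x - z) * moll t z - G x * moll t z)"
      unfolding conv_moll_uminus[OF G] using ix ic by (simp add: integral_moll[OF t])
    also have "\<dots> = (LINT z|lborel. moll t z * (G (x - z) - G x))"
      by (simp add: algebra_simps)
    finally have "\<bar>conv G (moll t) x - G x\<bar> \<le> (LINT z|lborel. \<bar>moll t z * (G (x - z) - G x)\<bar>)"
      by (simp only: integral_abs_bound)
    then have "ennreal \<bar>conv G (moll t) x - G x\<bar> \<le> ennreal (LINT z|lborel. \<bar>moll t z * (G (x - z) - G x)\<bar>)"
      by (rule ennreal_leI)
    also have "\<dots> = (\<integral>\<^sup>+z. ennreal \<bar>moll t z * (G (x - z) - G x)\<bar> \<partial>lborel)"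
      using Bochner_Integration.integrable_diff[OF ix ic]
      by (intro nn_integral_eq_integral_abs[symmetric]) (simp add: algebra_simps)
    also have "\<dots> = (\<integral>\<^sup>+z. ennreal (moll t z) * ennreal \<bar>G (x - z) - G x\<bar> \<partial>lborel)"
      using moll_nonneg[OF t, where 'a='d] by (intro nn_integral_cong) (simp add: abs_mult ennreal_mult')
    finally show ?thesis .
  qed
  have "(\<integral>\<^sup>+x. ennreal \<bar>conv G (moll t) x - G x\<bar> \<partial>lborel)
      \<le> (\<integral>\<^sup>+x. \<integral>\<^sup>+z. ennreal (moll t z) * ennreal \<bar>G (x - z) - G x\<bar> \<partial>lborel \<partial>lborel)"
    by (intro nn_integral_mono le)
  also have "\<dots> = (\<integral>\<^sup>+z. \<integral>\<^sup>+x. ennreal (moll t z) * ennreal \<bar>G (x - z) - G x\<bar> \<partial>lborel \<partial>lborel)"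
    by (rule lborel_pair.Fubini') simp
  also have "\<dots> \<le> (\<integral>\<^sup>+(z::real^'d). ennreal (moll t z) * ennreal e \<partial>lborel)"
  proof (rule nn_integral_mono)
    fix z :: "real^'d"
    show "(\<integral>\<^sup>+x. ennreal (moll t z) * ennreal \<bar>G (x - z) - G x\<bar> \<partial>lborel) \<le> ennreal (moll t z) * ennreal e"
    proof (cases "norm z < t")
      case True
      then show ?thesis by (subst nn_integral_cmult) (auto intro!: mult_left_mono e)
    qed (simp add: moll_eq_0[OF t])
  qed
  also have "\<dots> = ennreal e"
    using nn_integral_eq_integral[OF i] moll_nonneg[OF t, where 'a='d]
    by (simp add: nn_integral_multc integral_moll[OF t])
  finally show ?thesis .
qed

text \<open>\<open>L^1\<close> convergence gives almost everywhere convergence along a subsequence.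
  Two functions share the scales because the product rule mollifies a coefficient and its weak
  derivative together; the second subsequence is drawn from the first.\<close>

lemma conv_moll_AE:
  fixes G H :: "real^'d::finite \<Rightarrow> real"
  assumes G[measurable]: "G \<in> borel_measurable borel" "H \<in> borel_measurable borel"
    and S: "bounded S" and C: "\<And>x. \<bar>G x\<bar> \<le> C" "\<And>x. \<bar>H x\<bar> \<le> C"
    and G0: "\<And>x. x \<notin> S \<Longrightarrow> G x = 0" "\<And>x. x \<notin> S \<Longrightarrow> H x = 0" and "r > 0"
  obtains t where "\<And>n::nat. t n > 0" "\<And>n. t n < r"
    "AE x in lborel. (\<lambda>n. conv G (moll (t n)) x) \<longlonglongrightarrow> G x"
    "AE x in lborel. (\<lambda>n. conv H (moll (t n)) x) \<longlonglongrightarrow> H x"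
proof -
  let ?P = "\<lambda>n t. 0 < t \<and> t < r \<and> (\<integral>\<^sup>+x. ennreal \<bar>conv G (moll t) x - G x\<bar> \<partial>lborel) \<le> ennreal (1 / Suc n) \<and>
      (\<integral>\<^sup>+x. ennreal \<bar>conv H (moll t) x - H x\<bar> \<partial>lborel) \<le> ennreal (1 / Suc n)"
  have "\<exists>t. ?P n t" for n
  proof -
    have n: "1 / real (Suc n) > 0" by simp
    obtain d where d: "d > 0"
      "\<And>z. norm z < d \<Longrightarrow> (\<integral>\<^sup>+x. ennreal \<bar>G (x - z) - G x\<bar> \<partial>lborel) \<le> ennreal (1 / Suc n)"
      by (rule translation_continuous_L1[OF G(1) S C(1) _ n]) (erule G0, rule that)
    obtain d' where d': "d' > 0"
      "\<And>z. norm z < d' \<Longrightarrow> (\<integral>\<^sup>+x. ennreal \<bar>H (x - z) - H x\<bar> \<partial>lborel) \<le> ennreal (1 / Suc n)"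
      by (rule translation_continuous_L1[OF G(2) S C(2) _ n]) (erule G0, rule that)
    let ?t = "min (min d d') r / 2"
    have t: "?t > 0" "?t < r" "\<And>z::real^'d. norm z < ?t \<Longrightarrow> norm z < d" "\<And>z::real^'d. norm z < ?t \<Longrightarrow> norm z < d'"
      using d(1) d'(1) \<open>r > 0\<close> by auto
    show ?thesis
      using t(1,2) conv_moll_L1[OF G(1) S C(1) G0(1) t(1) d(2)[OF t(3)]]
        conv_moll_L1[OF G(2) S C(2) G0(2) t(1) d'(2)[OF t(4)]] by blast
  qed
  then have "\<exists>t. \<forall>n. ?P n (t n)" by (intro choice allI)
  then obtain t where "\<forall>n. ?P n (t n)" by (rule exE)
  then have t: "\<And>n. t n > 0" "\<And>n. t n < r"
    and tG: "\<And>n. (\<integral>\<^sup>+x. ennreal \<bar>conv G (moll (t n)) x - G x\<bar> \<partial>lborel) \<le> ennreal (1 / Suc n)"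
    and tH: "\<And>n. (\<integral>\<^sup>+x. ennreal \<bar>conv H (moll (t n)) x - H x\<bar> \<partial>lborel) \<le> ennreal (1 / Suc n)"
    by simp_all
  have sub: "\<exists>r::nat\<Rightarrow>nat. strict_mono r \<and> (AE x in lborel. (\<lambda>n. conv F (moll (s (r n))) x) \<longlonglongrightarrow> F x)"
    if F: "F \<in> borel_measurable borel" "\<And>x. \<bar>F x\<bar> \<le> C" "\<And>x. x \<notin> S \<Longrightarrow> F x = 0" and s: "\<And>n. s n > 0"
     and sF: "\<And>n::nat. (\<integral>\<^sup>+x. ennreal \<bar>conv F (moll (s n)) x - F x\<bar> \<partial>lborel) \<le> ennreal (1 / Suc n)" for F s
  proof -
    note [measurable] = F(1)
    have Fi: "integrable lborel F" by (rule integrable_bounded_support[OF F(1) S F(2,3)])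
    have [measurable]: "conv F (moll (s n)) \<in> borel_measurable borel" for n
      by (rule smooth_borel[OF smooth_conv[OF Fi moll_Cc_inf[OF s]]])
    have i: "integrable lborel (\<lambda>x. conv F (moll (s n)) x - F x)" for n
      using sF[of n] unfolding integrable_iff_bounded by (auto intro: le_less_trans)
    have "(LINT x|lborel. norm (conv F (moll (s n)) x - F x)) \<le> 1 / Suc n" for n
      using sF[of n] nn_integral_eq_integral_abs[OF i[of n]] by (simp add: ennreal_le_iff)
    then have "(\<lambda>n. LINT x|lborel. norm (conv F (moll (s n)) x - F x)) \<longlonglongrightarrow> 0"
      by (intro tendsto_sandwich[OF _ _ tendsto_const LIMSEQ_inverse_real_of_nat])
         (auto simp: inverse_eq_divide)
    from tendsto_L1_AE_subseq[OF i this] obtain q :: "nat \<Rightarrow> nat" where "strict_mono q"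
      "AE x in lborel. (\<lambda>n. conv F (moll (s (q n))) x - F x) \<longlonglongrightarrow> 0" by blast
    then show ?thesis by (auto simp: LIM_zero_iff)
  qed
  obtain q where q: "strict_mono q" "AE x in lborel. (\<lambda>n. conv G (moll (t (q n))) x) \<longlonglongrightarrow> G x"
    using sub[OF G(1) C(1) G0(1) t(1) tG] by blast
  \<comment> \<open>The bound survives the passage to the subsequence because
    \<open>n \<le> q n\<close>.\<close>
  have "(\<integral>\<^sup>+x. ennreal \<bar>conv H (moll (t (q n))) x - H x\<bar> \<partial>lborel) \<le> ennreal (1 / Suc n)" for n
    by (rule order_trans[OF tH]) (use seq_suble[OF q(1), of n] in \<open>auto intro!: ennreal_leI divide_left_mono\<close>)
  from sub[OF G(2) C(2) G0(2) t(1) this] obtain p where p: "strict_mono p"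
    "AE x in lborel. (\<lambda>n. conv H (moll (t (q (p n)))) x) \<longlonglongrightarrow> H x" by blast
  show ?thesis
  proof (rule that[of "\<lambda>n. t (q (p n))"])
    show "AE x in lborel. (\<lambda>n. conv G (moll (t (q (p n)))) x) \<longlonglongrightarrow> G x"
      using q(2) by eventually_elim (use LIMSEQ_subseq_LIMSEQ[OF _ p(1)] in \<open>auto simp: o_def\<close>)
  qed (use t p in auto)
qed

section \<open>Functions on a bounded open set\<close>

lemma AE_lebesgue_on:
  "S \<in> sets borel \<Longrightarrow> (AE x in lebesgue_on S. P x) \<longleftrightarrow> (AE x in lborel. x \<in> S \<longrightarrow> P x)"
  by (simp add: AE_restrict_space_iff AE_completion_iff)

lemma nn_integral_lebesgue_on:
  "S \<in> sets borel \<Longrightarrow> (\<integral>\<^sup>+x. f x \<partial>lebesgue_on S) = (\<integral>\<^sup>+x. f x * indicator S x \<partial>lborel)"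
  by (simp add: nn_integral_restrict_space nn_integral_completion)

lemma borel_measurable_lebesgue_onI:
  "f \<in> borel_measurable borel \<Longrightarrow> f \<in> borel_measurable (lebesgue_on S)"
  by (intro measurable_restrict_space1 measurable_completion) simp

text \<open>Completeness of Lebesgue measure. It provides measurability of functions known only up
  to a null set, such as the arbitrary choice behind \<open>wderiv\<close>.\<close>

lemma borel_measurable_lebesgue_on_AE:
  fixes f g :: "'a::euclidean_space \<Rightarrow> real"
  assumes g: "g \<in> borel_measurable (lebesgue_on S)" and S: "S \<in> sets borel"
    and eq: "AE x in lebesgue_on S. f x = g x"
  shows "f \<in> borel_measurable (lebesgue_on S)"
proof -
  let ?F = "\<lambda>x. indicator S x *\<^sub>R f x" and ?G = "\<lambda>x. indicator S x *\<^sub>R g x"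
  have "?G \<in> borel_measurable lebesgue"
    using g S by (subst (asm) borel_measurable_restrict_space_iff) auto
  then have "?G measurable_on UNIV" by (rule lebesgue_measurable_imp_measurable_on) simp
  moreover have "AE x in lebesgue. ?F x = ?G x"
    using eq S by (auto simp: AE_restrict_space_iff indicator_def elim: eventually_mono)
  then obtain N where "N \<in> null_sets lebesgue" "\<And>x. x \<notin> N \<Longrightarrow> ?F x = ?G x"
    by (auto elim!: AE_E3)
  ultimately have "?F measurable_on UNIV"
    by (intro measurable_on_spike[of ?G UNIV N ?F]) (auto simp: negligible_iff_null_sets)
  then have "?F \<in> borel_measurable lebesgue"
    using measurable_on_imp_borel_measurable_lebesgue_UNIV by blast
  then show ?thesis using S by (subst borel_measurable_restrict_space_iff) auto
qed

text \<open>Passes to a Borel function on the whole space, where Fubini and translation invariance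
  for \<open>lborel\<close> apply, and turns an almost everywhere constraint \<open>A\<close> into
  one valid at every point.\<close>

lemma borel_representative:
  fixes f :: "'a::euclidean_space \<Rightarrow> real"
  assumes f: "f \<in> borel_measurable (lebesgue_on S)" and S[measurable]: "S \<in> sets borel"
    and A[measurable]: "A \<in> sets borel" and "c \<in> A" and fA: "AE x in lebesgue_on S. f x \<in> A"
  obtains g where "g \<in> borel_measurable borel" "\<And>x. g x \<in> A" "\<And>x. x \<notin> S \<Longrightarrow> g x = c"
    "AE x in lebesgue_on S. f x = g x"
proof -
  have "(\<lambda>x. indicator S x *\<^sub>R f x) \<in> borel_measurable lebesgue"
    using f S by (subst (asm) borel_measurable_restrict_space_iff) auto
  then obtain g' where g'[measurable]: "g' \<in> borel_measurable lborel"
    and eq: "AE x in lborel. indicator S x *\<^sub>R f x = g' x"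
    using completion_ex_borel_measurable_real by metis
  define g where "g x = (if x \<in> S \<and> g' x \<in> A then g' x else c)" for x
  show ?thesis
  proof (rule that[of g])
    show "g \<in> borel_measurable borel" unfolding g_def using g' by measurable
    show "AE x in lebesgue_on S. f x = g x"
      using eq fA unfolding AE_lebesgue_on[OF S] by eventually_elim (auto simp: g_def)
  qed (use \<open>c \<in> A\<close> in \<open>auto simp: g_def\<close>)
qed

lemma integral_lebesgue_on_subset:
  fixes f :: "'a::euclidean_space \<Rightarrow> real"
  assumes "K \<in> sets borel" "S \<in> sets borel" "K \<subseteq> S" "\<And>x. x \<in> S \<Longrightarrow> x \<notin> K \<Longrightarrow> f x = 0"
  shows "(LINT x|lebesgue_on S. f x) = (LINT x|lebesgue_on K. f x)"
proof -
  have "(\<lambda>x. indicator S x *\<^sub>R f x) = (\<lambda>x. indicator K x *\<^sub>R f x)"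
    using assms(3,4) by (auto simp: indicator_def fun_eq_iff)
  moreover have "(LINT x|lebesgue_on T. f x) = (LINT x|lebesgue. indicator T x *\<^sub>R f x)"
    if "T \<in> sets borel" for T using that by (intro integral_restrict_space) simp
  ultimately show ?thesis using assms(1,2) by metis
qed

lemma integrable_lebesgue_on_mono:
  fixes f :: "'a::euclidean_space \<Rightarrow> real"
  assumes "integrable (lebesgue_on S) f" "K \<in> sets borel" "S \<in> sets borel" "K \<subseteq> S"
  shows "integrable (lebesgue_on K) f"
proof -
  have r: "integrable (lebesgue_on T) f \<longleftrightarrow> integrable lebesgue (\<lambda>x. indicator T x *\<^sub>R f x)"
    if "T \<in> sets borel" for T using that by (intro integrable_restrict_space) simp
  have "integrable lebesgue (\<lambda>x. indicator K x *\<^sub>R (indicator S x *\<^sub>R f x))"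
    by (rule integrable_mult_indicator) (use assms r in auto)
  also have "(\<lambda>x. indicator K x *\<^sub>R (indicator S x *\<^sub>R f x)) = (\<lambda>x. indicator K x *\<^sub>R f x)"
    using assms(4) by (auto simp: indicator_def fun_eq_iff)
  finally show ?thesis using r[OF assms(2)] by simp
qed

lemma integral_borel_representative:
  fixes f :: "'a::euclidean_space \<Rightarrow> real"
  assumes "S \<in> sets borel" and f: "f \<in> borel_measurable (lebesgue_on S)"
    and [measurable]: "g \<in> borel_measurable borel" "h \<in> borel_measurable borel"
    and eq: "AE x in lebesgue_on S. f x = g x" and g0: "\<And>x. x \<notin> S \<Longrightarrow> g x = 0"
  shows "(LINT x|lebesgue_on S. f x * h x) = (LINT x|lborel. g x * h x)"
proof -
  have [measurable]: "g \<in> borel_measurable (lebesgue_on S)" "h \<in> borel_measurable (lebesgue_on S)"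
    by (simp_all add: borel_measurable_lebesgue_onI)
  have "(LINT x|lebesgue_on S. f x * h x) = (LINT x|lebesgue_on S. g x * h x)"
    using f by (intro integral_cong_AE) (use eq in auto)
  also have "\<dots> = (LINT x|lebesgue. indicator S x *\<^sub>R (g x * h x))"
    using assms(1) by (simp add: integral_restrict_space)
  also have "(\<lambda>x. indicator S x *\<^sub>R (g x * h x)) = (\<lambda>x. g x * h x)"
    using g0 by (auto simp: indicator_def fun_eq_iff)
  also have "(LINT x|lebesgue. g x * h x) = (LINT x|lborel. g x * h x)"
    by (simp add: integral_completion)
  finally show ?thesis .
qed

lemma integrable_mult_bounded:
  fixes f g :: "'a \<Rightarrow> real"
  assumes f: "integrable M f" and [measurable]: "g \<in> borel_measurable M" and B: "AE x in M. \<bar>g x\<bar> \<le> B"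
  shows "integrable M (\<lambda>x. f x * g x)"
proof (rule Bochner_Integration.integrable_bound)
  show "integrable M (\<lambda>x. B * f x)" by (intro integrable_mult_right f)
  show "AE x in M. norm (f x * g x) \<le> norm (B * f x)"
    using B
  proof eventually_elim
    case (elim x)
    then have "\<bar>f x\<bar> * \<bar>g x\<bar> \<le> \<bar>f x\<bar> * \<bar>B\<bar>" by (intro mult_left_mono) auto
    then show ?case by (simp add: abs_mult mult.commute)
  qed
qed (use borel_measurable_integrable[OF f] in measurable)

text \<open>The distance is taken to the complement rather than to the frontier, so it vanishes
  outside \<open>\<Omega>\<close> and positivity characterises membership.\<close>

abbreviation depth :: "'a::metric_space set \<Rightarrow> 'a \<Rightarrow> real" where
  "depth \<Omega> x \<equiv> infdist x (- \<Omega>)"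

locale bounded_open =
  fixes \<Omega> :: "(real^'d::finite) set"
  assumes op: "open \<Omega>" and bdd: "bounded \<Omega>"
begin

lemma borel [measurable, simp]: "\<Omega> \<in> sets borel"
  using op by simp

lemma compl_nonempty: "- \<Omega> \<noteq> {}"
proof
  assume "- \<Omega> = {}"
  then have "\<Omega> = UNIV" by blast
  with bdd show False by simp
qed

lemma depth_pos_iff: "depth \<Omega> x > 0 \<longleftrightarrow> x \<in> \<Omega>"
proof
  show "x \<in> \<Omega> \<Longrightarrow> depth \<Omega> x > 0"
    using infdist_pos_not_in_closed[of "- \<Omega>" x] op compl_nonempty by (simp add: closed_Compl)
  show "depth \<Omega> x > 0 \<Longrightarrow> x \<in> \<Omega>"
    by (metis ComplI infdist_zero less_irrefl)
qed

lemma depth_le: "depth \<Omega> x \<le> depth \<Omega> y + dist x y"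
  by (rule infdist_triangle)

lemma compact_depth_ge: "e > 0 \<Longrightarrow> compact {x. e \<le> depth \<Omega> x}"
proof -
  assume "e > 0"
  then have "{x. e \<le> depth \<Omega> x} \<subseteq> \<Omega>" using depth_pos_iff by fastforce
  moreover have "closed {x. e \<le> depth \<Omega> x}"
    by (intro closed_Collect_le continuous_intros)
  ultimately show ?thesis using bdd bounded_subset compact_eq_bounded_closed by blast
qed

lemma depth_ge_subset: "e > 0 \<Longrightarrow> {x. e \<le> depth \<Omega> x} \<subseteq> \<Omega>"
  using depth_pos_iff by fastforce

lemma compact_subset_depth:
  assumes "compact K" "K \<subseteq> \<Omega>"
  obtains e where "e > 0" "K \<subseteq> {x. e \<le> depth \<Omega> x}"
proof (cases "K = {}")
  case False
  moreover have "continuous_on K (depth \<Omega>)" by (intro continuous_intros)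
  ultimately obtain x where x: "x \<in> K" "\<And>y. y \<in> K \<Longrightarrow> depth \<Omega> x \<le> depth \<Omega> y"
    using continuous_attains_inf[OF assms(1), of "depth \<Omega>"] by blast
  then have "depth \<Omega> x > 0" using depth_pos_iff assms(2) by blast
  then show ?thesis using x that[of "depth \<Omega> x"] by blast
qed (use that[of 1] in simp)

lemma finite_measure_lebesgue_on: "finite_measure (lebesgue_on \<Omega>)"
  by (rule finite_measure_lebesgue_on[OF lmeasurable_open[OF bdd op]])

lemma L2_integrable: "f \<in> L2 (lebesgue_on \<Omega>) \<Longrightarrow> integrable (lebesgue_on \<Omega>) f"
  unfolding L2_def
  using finite_measure.square_integrable_imp_integrable[OF finite_measure_lebesgue_on] by auto

lemma compact_level_sets: "compact (C :: (real^'d) set) \<Longrightarrow> C \<in> sets borel"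
  by (simp add: compact_imp_closed)

text \<open>The sign of \<open>u\<close>, restricted to the points of depth at least
  \<open>e\<close>, is mollified at scales below \<open>e / 2\<close>. The results are test
  functions bounded by 1 that converge almost everywhere, so in the limit the integral of
  \<open>|u|\<close> over that set is 0.\<close>

lemma fundamental_lemma:
  assumes u: "\<And>C. compact C \<Longrightarrow> C \<subseteq> \<Omega> \<Longrightarrow> integrable (lebesgue_on C) u"
    and 0: "\<And>\<phi>. \<phi> \<in> Cc_inf \<Omega> \<Longrightarrow> (LINT x|lebesgue_on \<Omega>. u x * \<phi> x) = 0"
  shows "AE x in lebesgue_on \<Omega>. u x = 0"
proof -
  have zero: "AE x in lborel. e \<le> depth \<Omega> x \<longrightarrow> u x = 0" if "e > 0" for e
  proof -
    let ?K = "{x. e \<le> depth \<Omega> x}" and ?L = "{x. e / 2 \<le> depth \<Omega> x}"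
    have K: "compact ?K" "?K \<subseteq> \<Omega>" "?K \<in> sets borel" and L: "compact ?L" "?L \<subseteq> \<Omega>" "?L \<in> sets borel"
      using that compact_depth_ge[of e] compact_depth_ge[of "e/2"] depth_ge_subset[of e] depth_ge_subset[of "e/2"]
      by (auto simp: compact_level_sets)
    have KL: "?K \<subseteq> ?L" using that by auto
    have uK: "integrable (lebesgue_on ?K) u" and uL: "integrable (lebesgue_on ?L) u"
      by (intro u K L)+
    note [measurable] = borel_measurable_integrable[OF uK] borel_measurable_integrable[OF uL]
    have "(\<lambda>x. sgn (u x)) \<in> borel_measurable (lebesgue_on ?K)" by measurable
    then obtain g where g[measurable]: "g \<in> borel_measurable borel" and g1: "\<And>x. g x \<in> {-1..1}"
      and g0: "\<And>x. x \<notin> ?K \<Longrightarrow> g x = 0" and gu: "AE x in lebesgue_on ?K. sgn (u x) = g x"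
      by (rule borel_representative[where A = "{-1..1}" and c = 0]) (use K in \<open>auto simp: sgn_real_def\<close>)
    have g1': "\<bar>g x\<bar> \<le> 1" for x using g1[of x] by (simp add: abs_le_iff)
    have e2: "e / 2 > 0" using that by simp
    obtain t where t: "\<And>n::nat. t n > 0" "\<And>n. t n < e / 2"
      and lim: "AE x in lborel. (\<lambda>n. conv g (moll (t n)) x) \<longlonglongrightarrow> g x"
      by (rule conv_moll_AE[OF g g compact_imp_bounded[OF K(1)] g1' g1' _ _ e2]) (erule g0, erule g0, rule that)
    let ?\<phi> = "\<lambda>n. conv g (moll (t n))"
    have gi: "integrable lborel g"
      by (rule integrable_bounded_support[OF g compact_imp_bounded[OF K(1)] g1' g0])
    have \<phi>0: "?\<phi> n x = 0" if "x \<notin> ?L" for n x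
    proof -
      have "g y * moll (t n) (x - y) = 0" for y
      proof (cases "y \<in> ?K")
        case True
        then have "t n \<le> norm (x - y)"
          using that depth_le[of y x] t(2)[of n] by (simp add: dist_norm norm_minus_commute)
        then show ?thesis by (simp add: moll_eq_0[OF t(1)])
      qed (simp add: g0)
      then have "(\<lambda>y. g y * moll (t n) (x - y)) = (\<lambda>y. 0)" by (rule ext)
      then show ?thesis by (simp only: conv_def) simp
    qed
    have \<phi>: "?\<phi> n \<in> Cc_inf \<Omega>" for n
      by (rule Cc_infI[OF smooth_conv[OF gi moll_Cc_inf[OF t(1)]] L(1,2) \<phi>0])
    have \<phi>b: "\<bar>?\<phi> n x\<bar> \<le> 1" for n x by (rule conv_moll_bounded[OF g g1' t(1)])
    note [measurable] = borel_measurable_lebesgue_onI[OF g] borel_measurable_lebesgue_onI[OF smooth_borel[OF Cc_inf_smooth[OF \<phi>]]]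
    have int0: "(LINT x|lebesgue_on ?L. u x * ?\<phi> n x) = 0" for n
      using 0[OF \<phi>[of n]] integral_lebesgue_on_subset[OF L(3) borel L(2), of "\<lambda>x. u x * ?\<phi> n x"] \<phi>0 by simp
    have "(\<lambda>n. LINT x|lebesgue_on ?L. u x * ?\<phi> n x) \<longlonglongrightarrow> (LINT x|lebesgue_on ?L. u x * g x)"
    proof (rule integral_dominated_convergence)
      show "integrable (lebesgue_on ?L) (\<lambda>x. \<bar>u x\<bar>)" using uL by (rule integrable_abs)
      show "AE x in lebesgue_on ?L. (\<lambda>n. u x * ?\<phi> n x) \<longlonglongrightarrow> u x * g x"
        unfolding AE_lebesgue_on[OF L(3)] using lim by eventually_elim (auto intro: tendsto_intros)
      show "AE x in lebesgue_on ?L. norm (u x * ?\<phi> n x) \<le> \<bar>u x\<bar>" for n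
        using \<phi>b[of n] by (intro AE_I2) (simp add: abs_mult mult_left_le)
    qed measurable
    then have "(LINT x|lebesgue_on ?L. u x * g x) = 0"
      unfolding int0 using LIMSEQ_unique tendsto_const by blast
    then have "(LINT x|lebesgue_on ?K. u x * g x) = 0"
      using integral_lebesgue_on_subset[OF K(3) L(3) KL, of "\<lambda>x. u x * g x"] g0 by simp
    also have "(LINT x|lebesgue_on ?K. u x * g x) = (LINT x|lebesgue_on ?K. \<bar>u x\<bar>)"
      by (intro integral_cong_AE) (use gu in \<open>auto elim!: eventually_mono simp: abs_sgn\<close>)
    finally have "AE x in lebesgue_on ?K. \<bar>u x\<bar> = 0"
      using integral_nonneg_eq_0_iff_AE[OF integrable_abs[OF uK]] by simp
    then show ?thesis unfolding AE_lebesgue_on[OF K(3)] by simp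
  qed
  \<comment> \<open>Countably many depths exhaust \<open>\<Omega>\<close>, so the exceptional null
    sets can be united.\<close>
  have "AE x in lborel. \<forall>n. 1 / Suc n \<le> depth \<Omega> x \<longrightarrow> u x = 0"
    unfolding AE_all_countable by (intro allI zero) simp
  then show ?thesis unfolding AE_lebesgue_on[OF borel]
  proof eventually_elim
    case (elim x)
    show ?case
    proof
      assume "x \<in> \<Omega>"
      then obtain n where "inverse (real (Suc n)) < depth \<Omega> x"
        using reals_Archimedean depth_pos_iff by blast
      then show "u x = 0" using elim[rule_format, of n] by (simp add: inverse_eq_divide)
    qed
  qed
qed

lemma integrable_mult_test:
  assumes u: "\<And>C. compact C \<Longrightarrow> C \<subseteq> \<Omega> \<Longrightarrow> integrable (lebesgue_on C) u" and \<phi>: "\<phi> \<in> Cc_inf \<Omega>"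
  shows "integrable (lebesgue_on \<Omega>) (\<lambda>x. u x * \<phi> x)"
proof -
  obtain K where K: "compact K" "K \<subseteq> \<Omega>" "\<And>x. x \<notin> K \<Longrightarrow> \<phi> x = 0" using \<phi> Cc_infE by metis
  obtain B where B: "\<And>x. \<bar>\<phi> x\<bar> \<le> B" using \<phi> Cc_inf_bounded by metis
  note [measurable] = borel_measurable_lebesgue_onI[OF smooth_borel[OF Cc_inf_smooth[OF \<phi>]]]
  have "integrable (lebesgue_on K) (\<lambda>x. u x * \<phi> x)"
    by (rule integrable_mult_bounded[OF u[OF K(1,2)]]) (use B in auto)
  then have "integrable lebesgue (\<lambda>x. indicator K x *\<^sub>R (u x * \<phi> x))"
    using K(1) by (subst (asm) integrable_restrict_space) (auto simp: compact_level_sets)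
  also have "(\<lambda>x. indicator K x *\<^sub>R (u x * \<phi> x)) = (\<lambda>x. indicator \<Omega> x *\<^sub>R (u x * \<phi> x))"
    using K(2,3) by (auto simp: indicator_def fun_eq_iff)
  finally show ?thesis by (subst integrable_restrict_space) auto
qed

lemma weak_deriv_unique:
  assumes "weak_deriv \<Omega> is u v" "weak_deriv \<Omega> is u w"
  shows "AE x in lebesgue_on \<Omega>. v x = w x"
proof -
  have v: "integrable (lebesgue_on C) v" and w: "integrable (lebesgue_on C) w" if "compact C" "C \<subseteq> \<Omega>" for C
    using assms that by (auto simp: weak_deriv_def)
  have "AE x in lebesgue_on \<Omega>. v x - w x = 0"
  proof (rule fundamental_lemma)
    fix \<phi> assume \<phi>: "\<phi> \<in> Cc_inf \<Omega>"
    have "(LINT x|lebesgue_on \<Omega>. v x * \<phi> x) = (LINT x|lebesgue_on \<Omega>. w x * \<phi> x)"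
      using assms \<phi> unfolding weak_deriv_def by auto
    then show "(LINT x|lebesgue_on \<Omega>. (v x - w x) * \<phi> x) = 0"
      using integrable_mult_test[OF v \<phi>] integrable_mult_test[OF w \<phi>] by (simp add: left_diff_distrib)
  qed (intro Bochner_Integration.integrable_diff v w)
  then show ?thesis by simp
qed

lemma wderiv_AE: "weak_deriv \<Omega> is u v \<Longrightarrow> AE x in lebesgue_on \<Omega>. wderiv \<Omega> is u x = v x"
  using weak_deriv_unique someI[of "weak_deriv \<Omega> is u"] unfolding wderiv_def by metis

end

section \<open>The product rule for weak derivatives\<close>

context bounded_open
begin

lemma weak_deriv_integral:
  "weak_deriv \<Omega> is u v \<Longrightarrow> \<phi> \<in> Cc_inf \<Omega> \<Longrightarrow>
    (LINT x|lebesgue_on \<Omega>. u x * foldr pd is \<phi> x) = (-1) ^ length is * (LINT x|lebesgue_on \<Omega>. v x * \<phi> x)"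
  by (simp add: weak_deriv_def)

text \<open>This is the kernel of the mollification at \<open>x\<close>, seen as a function of the
  integration variable. It is an admissible test function once \<open>x\<close> lies deeper than
  \<open>t\<close>, and the reflection produces the sign that weak differentiation needs.\<close>

lemma moll_reflected:
  fixes x :: "real^'d"
  assumes "t > 0" "depth \<Omega> x > t"
  shows "(\<lambda>y. moll t (x - y)) \<in> Cc_inf \<Omega>" "pd i (\<lambda>y. moll t (x - y)) y = - pd i (moll t) (x - y)"
proof -
  have eq: "(\<lambda>y. moll t (x - y)) = (\<lambda>y. moll t ((-1) *\<^sub>R y + x))" by simp
  have "cball x t \<subseteq> \<Omega>"
  proof
    fix y assume "y \<in> cball x t"
    then have "depth \<Omega> y > 0" using depth_le[of x y] assms(2) by simp
    then show "y \<in> \<Omega>" by (simp add: depth_pos_iff)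
  qed
  then show "(\<lambda>y. moll t (x - y)) \<in> Cc_inf \<Omega>"
    unfolding eq by (intro Cc_infI[OF smooth_affine[OF smooth_moll], of "cball x t"])
      (auto simp: moll_eq_0[OF assms(1)] dist_norm)
  show "pd i (\<lambda>y. moll t (x - y)) y = - pd i (moll t) (x - y)"
    unfolding eq by (subst pd_affine[OF smooth_differentiable[OF smooth_moll]]) simp
qed

text \<open>With \<open>a\<close> mollified, \<open>a * \<zeta>\<close> is a test function and the
  weak derivative of \<open>v\<close> may be tested with it. Well inside \<open>\<Omega>\<close> the
  derivative of the mollified \<open>a\<close> is the mollified \<open>a'\<close>; both are bounded
  by \<open>C\<close> at every scale, so dominated convergence removes the mollification.\<close>

lemma weak_deriv_mult_Linf:
  assumes a: "a \<in> Linf (lebesgue_on \<Omega>)" "a' \<in> Linf (lebesgue_on \<Omega>)" "weak_deriv \<Omega> [i] a a'"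
    and v: "integrable (lebesgue_on \<Omega>) v" "integrable (lebesgue_on \<Omega>) v'" "weak_deriv \<Omega> [i] v v'"
  shows "weak_deriv \<Omega> [i] (\<lambda>x. a x * v x) (\<lambda>x. a x * v' x + a' x * v x)"
proof -
  let ?M = "lebesgue_on \<Omega>"
  have am[measurable]: "a \<in> borel_measurable ?M" "a' \<in> borel_measurable ?M" using a by (auto simp: Linf_def)
  note [measurable] = borel_measurable_integrable[OF v(1)] borel_measurable_integrable[OF v(2)]
  obtain C1 C2 where C12: "AE x in ?M. \<bar>a x\<bar> \<le> C1" "AE x in ?M. \<bar>a' x\<bar> \<le> C2"
    using a by (auto simp: Linf_def)
  define C where "C = max 0 (max C1 C2)"
  have C: "AE x in ?M. a x \<in> {-C..C}" "AE x in ?M. a' x \<in> {-C..C}" "C \<ge> 0"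
    using C12 by (auto simp: C_def elim: eventually_mono)
  have iav: "integrable ?M (\<lambda>x. v x * a x)" "integrable ?M (\<lambda>x. v' x * a x)" "integrable ?M (\<lambda>x. v x * a' x)"
    using C by (auto intro!: integrable_mult_bounded[where B = C] v simp: abs_le_iff elim: eventually_mono)
  obtain A where A[measurable]: "A \<in> borel_measurable borel" and AC: "\<And>x. A x \<in> {-C..C}"
    and A0: "\<And>x. x \<notin> \<Omega> \<Longrightarrow> A x = 0" and aA: "AE x in ?M. a x = A x"
    by (rule borel_representative[OF am(1) borel _ _ C(1), where c = 0]) (use C(3) in auto)
  obtain A' where A'[measurable]: "A' \<in> borel_measurable borel" and AC': "\<And>x. A' x \<in> {-C..C}"
    and A0': "\<And>x. x \<notin> \<Omega> \<Longrightarrow> A' x = 0" and aA': "AE x in ?M. a' x = A' x"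
    by (rule borel_representative[OF am(2) borel _ _ C(2), where c = 0]) (use C(3) in auto)
  have AC: "\<bar>A x\<bar> \<le> C" "\<bar>A' x\<bar> \<le> C" for x using AC[of x] AC'[of x] by (auto simp: abs_le_iff)
  have Ai: "integrable lborel A" by (rule integrable_bounded_support[OF A bdd AC(1) A0])
  note [measurable] = borel_measurable_lebesgue_onI[OF A] borel_measurable_lebesgue_onI[OF A']
  have pd_moll: "pd i (conv A (moll t)) x = conv A' (moll t) x" if t: "t > 0" "depth \<Omega> x > t" for t x
  proof -
    have [measurable]: "(\<lambda>y. moll t (x - y)) \<in> borel_measurable borel" "(\<lambda>y. - pd i (moll t) (x - y)) \<in> borel_measurable borel"
      using smooth_borel[OF smooth_moll[where 'd='d, of t]] smooth_borel[OF smooth_pd[OF smooth_moll[where 'd='d, of t], of i]]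
      by measurable
    have "pd i (conv A (moll t)) x = (LINT y|lborel. A y * pd i (moll t) (x - y))"
      by (simp add: pd_conv[OF Ai moll_Cc_inf[OF t(1)]] conv_def)
    also have "\<dots> = - (LINT y|lborel. A y * (- pd i (moll t) (x - y)))" by simp
    also have "(LINT y|lborel. A y * (- pd i (moll t) (x - y))) = (LINT y|?M. a y * (- pd i (moll t) (x - y)))"
      by (rule integral_borel_representative[OF borel am(1) A _ aA A0, symmetric]) measurable
    also have "\<dots> = - (LINT y|?M. a' y * moll t (x - y))"
      using weak_deriv_integral[OF a(3) moll_reflected(1)[OF t]] by (simp add: moll_reflected(2)[OF t])
    also have "(LINT y|?M. a' y * moll t (x - y)) = conv A' (moll t) x"
      unfolding conv_def by (rule integral_borel_representative[OF borel am(2) A' _ aA' A0']) measurable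
    finally show ?thesis by simp
  qed
  have "(LINT x|?M. (a x * v x) * pd i \<zeta> x) = - (LINT x|?M. (a x * v' x + a' x * v x) * \<zeta> x)"
    if \<zeta>: "\<zeta> \<in> Cc_inf \<Omega>" for \<zeta>
  proof -
    obtain K where K: "compact K" "K \<subseteq> \<Omega>" "\<And>x. x \<notin> K \<Longrightarrow> \<zeta> x = 0" using \<zeta> Cc_infE by metis
    obtain r where r: "r > 0" "K \<subseteq> {x. r \<le> depth \<Omega> x}" using compact_subset_depth[OF K(1,2)] by metis
    obtain B1 where B1: "\<And>x. \<bar>\<zeta> x\<bar> \<le> B1" using \<zeta> Cc_inf_bounded by metis
    obtain B2 where B2: "\<And>x. \<bar>pd i \<zeta> x\<bar> \<le> B2" using Cc_inf_pd[OF \<zeta>] Cc_inf_bounded by metis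
    have B0: "B1 \<ge> 0" "B2 \<ge> 0" using B1[of 0] B2[of 0] by linarith+
    obtain t where t: "\<And>n::nat. t n > 0" "\<And>n. t n < r"
      and lim: "AE x in lborel. (\<lambda>n. conv A (moll (t n)) x) \<longlonglongrightarrow> A x"
      and lim': "AE x in lborel. (\<lambda>n. conv A' (moll (t n)) x) \<longlonglongrightarrow> A' x"
      by (rule conv_moll_AE[OF A A' bdd AC _ _ r(1)]) (erule A0, erule A0', rule that)
    let ?a = "\<lambda>n. conv A (moll (t n))" and ?b = "\<lambda>n. conv A' (moll (t n))"
    have as: "smooth (?a n)" for n by (rule smooth_conv[OF Ai moll_Cc_inf[OF t(1)]])
    have bs: "smooth (?b n)" for n
      by (rule smooth_conv[OF integrable_bounded_support[OF A' bdd AC(2) A0'] moll_Cc_inf[OF t(1)]])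
    have ab: "\<bar>?a n x\<bar> \<le> C" for n x by (rule conv_moll_bounded[OF A AC(1) t(1)])
    have bb: "\<bar>?b n x\<bar> \<le> C" for n x by (rule conv_moll_bounded[OF A' AC(2) t(1)])
    note [measurable] = borel_measurable_lebesgue_onI[OF smooth_borel[OF as]] borel_measurable_lebesgue_onI[OF smooth_borel[OF bs]]
      borel_measurable_lebesgue_onI[OF smooth_borel[OF Cc_inf_smooth[OF \<zeta>]]]
      borel_measurable_lebesgue_onI[OF smooth_borel[OF Cc_inf_smooth[OF Cc_inf_pd[OF \<zeta>]]]]
    \<comment> \<open>On the support \<open>K\<close> of \<open>\<zeta>\<close> the depth is at
      least \<open>r > t n\<close>, so \<open>pd_moll\<close> applies; off \<open>K\<close> the
      factor \<open>\<zeta>\<close> is 0.\<close>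
    have pd: "pd i (\<lambda>x. ?a n x * \<zeta> x) x = ?a n x * pd i \<zeta> x + ?b n x * \<zeta> x" for n x
    proof -
      have "pd i (?a n) x * \<zeta> x = ?b n x * \<zeta> x"
      proof (cases "x \<in> K")
        case True
        then have "depth \<Omega> x > t n" using r(2) t(2)[of n] by auto
        then show ?thesis by (simp add: pd_moll[OF t(1)])
      qed (simp add: K(3))
      then show ?thesis
        by (subst pd_mult[OF smooth_differentiable[OF as] smooth_differentiable[OF Cc_inf_smooth[OF \<zeta>]]]) simp
    qed
    let ?F = "\<lambda>n x. v x * (?a n x * pd i \<zeta> x + ?b n x * \<zeta> x) + v' x * (?a n x * \<zeta> x)"
    let ?G = "\<lambda>x. v x * (A x * pd i \<zeta> x + A' x * \<zeta> x) + v' x * (A x * \<zeta> x)"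
    have bound: "\<bar>v x * (p * pd i \<zeta> x + q * \<zeta> x) + v' x * (p * \<zeta> x)\<bar> \<le> C * (B1 + B2) * (\<bar>v x\<bar> + \<bar>v' x\<bar>)"
      if "\<bar>p\<bar> \<le> C" "\<bar>q\<bar> \<le> C" for p q x
    proof -
      have m: "\<bar>p * pd i \<zeta> x\<bar> \<le> C * B2" "\<bar>q * \<zeta> x\<bar> \<le> C * B1" "\<bar>p * \<zeta> x\<bar> \<le> C * B1"
        unfolding abs_mult using that B1[of x] B2[of x] C(3) by (auto intro!: mult_mono)
      have "\<bar>v x * (p * pd i \<zeta> x + q * \<zeta> x) + v' x * (p * \<zeta> x)\<bar>
          \<le> \<bar>v x\<bar> * \<bar>p * pd i \<zeta> x + q * \<zeta> x\<bar> + \<bar>v' x\<bar> * \<bar>p * \<zeta> x\<bar>"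
        by (metis abs_mult abs_triangle_ineq)
      also have "\<dots> \<le> \<bar>v x\<bar> * (C * (B1 + B2)) + \<bar>v' x\<bar> * (C * (B1 + B2))"
        using m B0 C(3) mult_nonneg_nonneg[OF C(3) B0(2)]
        by (intro add_mono mult_left_mono) (auto simp: distrib_left)
      finally show ?thesis by (simp add: algebra_simps)
    qed
    have ibound: "integrable ?M (\<lambda>x. C * (B1 + B2) * (\<bar>v x\<bar> + \<bar>v' x\<bar>))"
      by (intro integrable_mult_right Bochner_Integration.integrable_add integrable_abs v)
    \<comment> \<open>The weak derivative of \<open>v\<close> tested with the mollified
      \<open>a\<close> times \<open>\<zeta>\<close>.\<close>
    have F0: "(LINT x|?M. ?F n x) = 0" for n
    proof -
      have \<phi>: "(\<lambda>x. ?a n x * \<zeta> x) \<in> Cc_inf \<Omega>" by (rule Cc_inf_mult[OF \<zeta> as])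
      have i1: "integrable ?M (\<lambda>x. v x * (?a n x * pd i \<zeta> x + ?b n x * \<zeta> x))"
      proof (rule integrable_mult_bounded[OF v(1)])
        have "\<bar>?a n x * pd i \<zeta> x + ?b n x * \<zeta> x\<bar> \<le> C * B2 + C * B1" for x
        proof -
          have "\<bar>?a n x * pd i \<zeta> x\<bar> \<le> C * B2" "\<bar>?b n x * \<zeta> x\<bar> \<le> C * B1"
            unfolding abs_mult using ab[of n x] bb[of n x] B1[of x] B2[of x] C(3) by (auto intro!: mult_mono)
          then show ?thesis by linarith
        qed
        then show "AE x in ?M. \<bar>?a n x * pd i \<zeta> x + ?b n x * \<zeta> x\<bar> \<le> C * B2 + C * B1" by (intro AE_I2)
      qed measurable
      have i2: "integrable ?M (\<lambda>x. v' x * (?a n x * \<zeta> x))"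
      proof (rule integrable_mult_bounded[OF v(2)])
        have "\<bar>?a n x * \<zeta> x\<bar> \<le> C * B1" for x
          unfolding abs_mult using ab[of n x] B1[of x] C(3) by (auto intro!: mult_mono)
        then show "AE x in ?M. \<bar>?a n x * \<zeta> x\<bar> \<le> C * B1" by (intro AE_I2)
      qed measurable
      have "(LINT x|?M. v x * (?a n x * pd i \<zeta> x + ?b n x * \<zeta> x)) = - (LINT x|?M. v' x * (?a n x * \<zeta> x))"
        using weak_deriv_integral[OF v(3) \<phi>] by (simp add: pd)
      then show ?thesis using Bochner_Integration.integral_add[OF i1 i2] by simp
    qed
    have "(\<lambda>n. LINT x|?M. ?F n x) \<longlonglongrightarrow> (LINT x|?M. ?G x)"
    proof (rule integral_dominated_convergence[OF _ _ ibound])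
      have "AE x in ?M. (\<lambda>n. ?a n x) \<longlonglongrightarrow> A x" "AE x in ?M. (\<lambda>n. ?b n x) \<longlonglongrightarrow> A' x"
        unfolding AE_lebesgue_on[OF borel] using lim lim' by (auto elim: eventually_mono)
      then show "AE x in ?M. (\<lambda>n. ?F n x) \<longlonglongrightarrow> ?G x"
        by eventually_elim (intro tendsto_intros)
      show "AE x in ?M. norm (?F n x) \<le> C * (B1 + B2) * (\<bar>v x\<bar> + \<bar>v' x\<bar>)" for n
        using bound[OF ab[of n] bb[of n]] by (intro AE_I2) simp
    qed measurable
    then have G0: "(LINT x|?M. ?G x) = 0"
      unfolding F0 using LIMSEQ_unique tendsto_const by blast
    have iz: "integrable ?M (\<lambda>x. (v x * a x) * pd i \<zeta> x)" "integrable ?M (\<lambda>x. (v x * a' x) * \<zeta> x)"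
        "integrable ?M (\<lambda>x. (v' x * a x) * \<zeta> x)"
      using B1 B2 by (auto intro!: integrable_mult_bounded[OF iav(1)] integrable_mult_bounded[OF iav(2)]
        integrable_mult_bounded[OF iav(3)])
    have "(LINT x|?M. ?G x) = (LINT x|?M. (v x * a x) * pd i \<zeta> x + ((v x * a' x) * \<zeta> x + (v' x * a x) * \<zeta> x))"
      by (intro integral_cong_AE) (use aA aA' in \<open>auto elim!: eventually_elim2 simp: algebra_simps\<close>)
    also have "\<dots> = (LINT x|?M. (v x * a x) * pd i \<zeta> x) + (LINT x|?M. (v x * a' x) * \<zeta> x + (v' x * a x) * \<zeta> x)"
      by (intro Bochner_Integration.integral_add Bochner_Integration.integrable_add iz)
    finally show ?thesis using G0 by (simp add: algebra_simps)
  qed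
  moreover have "integrable (lebesgue_on D) (\<lambda>x. a x * v x)" "integrable (lebesgue_on D) (\<lambda>x. a x * v' x + a' x * v x)"
    if "compact D" "D \<subseteq> \<Omega>" for D
    using Bochner_Integration.integrable_add[OF iav(2,3)] iav(1) that
    by (auto intro!: integrable_lebesgue_on_mono[of \<Omega> _ D] simp: compact_level_sets mult.commute)
  ultimately show ?thesis unfolding weak_deriv_def by simp
qed

end

section \<open>Square integrable functions\<close>

lemma L2_measurable [measurable_dest]: "f \<in> L2 M \<Longrightarrow> f \<in> borel_measurable M"
  by (simp add: L2_def)

lemma L2_nn_integral_eq:
  assumes "f \<in> L2 M"
  shows "(\<integral>\<^sup>+x. ennreal ((f x)\<^sup>2) \<partial>M) = ennreal ((l2norm M f)\<^sup>2)"
  using assms by (subst nn_integral_eq_integral) (auto simp: L2_def l2norm_def)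

lemma L2_iff: "f \<in> L2 M \<longleftrightarrow> f \<in> borel_measurable M \<and> (\<integral>\<^sup>+x. ennreal ((f x)\<^sup>2) \<partial>M) < \<infinity>"
  unfolding L2_def integrable_iff_bounded by auto

text \<open>\<open>l2norm\<close> rests on the Bochner integral and is 0 for functions that are not
  square integrable. A bound on the nonnegative integral yields membership and norm bound
  together.\<close>

lemma l2norm_leI:
  assumes "f \<in> borel_measurable M" "(\<integral>\<^sup>+x. ennreal ((f x)\<^sup>2) \<partial>M) \<le> ennreal (c\<^sup>2)" "c \<ge> 0"
  shows "f \<in> L2 M" "l2norm M f \<le> c"
proof -
  show f: "f \<in> L2 M" using assms(1,2) unfolding L2_iff by (auto intro: le_less_trans)
  have "(l2norm M f)\<^sup>2 \<le> c\<^sup>2"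
    using assms(2) unfolding L2_nn_integral_eq[OF f] by (simp add: ennreal_le_iff)
  then show "l2norm M f \<le> c" using assms(3) by (rule power2_le_imp_le)
qed

lemma l2norm_nonneg: "l2norm M f \<ge> 0"
  by (simp add: l2norm_def)

lemma power2_l2norm: "(l2norm M f)\<^sup>2 = (LINT x|M. (f x)\<^sup>2)"
  by (simp add: l2norm_def)

lemma L2_add:
  assumes "f \<in> L2 M" "g \<in> L2 M" shows "(\<lambda>x. f x + g x) \<in> L2 M"
proof -
  have m: "f \<in> borel_measurable M" "g \<in> borel_measurable M" using assms by (auto simp: L2_def)
  have "integrable M (\<lambda>x. 2 * (f x)\<^sup>2 + 2 * (g x)\<^sup>2)"
    using assms by (auto simp: L2_def)
  then have "integrable M (\<lambda>x. (f x + g x)\<^sup>2)"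
  proof (rule Bochner_Integration.integrable_bound)
    show "AE x in M. norm ((f x + g x)\<^sup>2) \<le> norm (2 * (f x)\<^sup>2 + 2 * (g x)\<^sup>2)"
    proof (rule AE_I2)
      fix x
      have "(f x + g x)\<^sup>2 \<le> 2 * (f x)\<^sup>2 + 2 * (g x)\<^sup>2"
        using zero_le_power2[of "f x - g x"] by (simp add: power2_eq_square algebra_simps)
      then show "norm ((f x + g x)\<^sup>2) \<le> norm (2 * (f x)\<^sup>2 + 2 * (g x)\<^sup>2)" by simp
    qed
  qed (use m in measurable)
  with m show ?thesis by (simp add: L2_def)
qed

lemma L2_cmult: "f \<in> L2 M \<Longrightarrow> (\<lambda>x. c * f x) \<in> L2 M"
  by (auto simp: L2_def power_mult_distrib)

lemma L2_diff: "f \<in> L2 M \<Longrightarrow> g \<in> L2 M \<Longrightarrow> (\<lambda>x. f x - g x) \<in> L2 M"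
  using L2_add[OF _ L2_cmult[of g M "-1"]] by simp

lemma L2_sum: "(\<And>i. i \<in> I \<Longrightarrow> f i \<in> L2 M) \<Longrightarrow> (\<lambda>x. \<Sum>i\<in>I. f i x) \<in> L2 M"
  by (induction I rule: infinite_finite_induct) (simp_all add: L2_add, simp_all add: L2_def)

lemma l2norm_minus_commute: "l2norm M (\<lambda>x. f x - g x) = l2norm M (\<lambda>x. g x - f x)"
  by (simp add: l2norm_def power2_commute)

lemma l2norm_cmult: "l2norm M (\<lambda>x. c * f x) = \<bar>c\<bar> * l2norm M f"
  by (simp add: l2norm_def power_mult_distrib real_sqrt_mult)

lemma L2_Linf_mult:
  assumes f: "f \<in> L2 M" and [measurable]: "b \<in> borel_measurable M"
    and B: "AE x in M. \<bar>b x\<bar> \<le> B" and "B \<ge> 0"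
  shows "(\<lambda>x. b x * f x) \<in> L2 M" "l2norm M (\<lambda>x. b x * f x) \<le> B * l2norm M f"
proof -
  have [measurable]: "f \<in> borel_measurable M" using f by (rule L2_measurable)
  have "(\<integral>\<^sup>+x. ennreal ((b x * f x)\<^sup>2) \<partial>M) \<le> (\<integral>\<^sup>+x. ennreal (B\<^sup>2) * ennreal ((f x)\<^sup>2) \<partial>M)"
  proof (rule nn_integral_mono_AE)
    show "AE x in M. ennreal ((b x * f x)\<^sup>2) \<le> ennreal (B\<^sup>2) * ennreal ((f x)\<^sup>2)"
      using B
    proof eventually_elim
      case (elim x)
      then have "(b x)\<^sup>2 \<le> B\<^sup>2" by (metis abs_ge_zero power2_abs power_mono)
      then show ?case by (simp add: power_mult_distrib mult_right_mono flip: ennreal_mult)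
    qed
  qed
  also have "\<dots> = ennreal ((B * l2norm M f)\<^sup>2)"
    by (simp add: nn_integral_cmult L2_nn_integral_eq[OF f] power_mult_distrib ennreal_mult)
  finally have *: "(\<integral>\<^sup>+x. ennreal ((b x * f x)\<^sup>2) \<partial>M) \<le> ennreal ((B * l2norm M f)\<^sup>2)" .
  have "B * l2norm M f \<ge> 0" using \<open>B \<ge> 0\<close> l2norm_nonneg by (rule mult_nonneg_nonneg)
  with * show "(\<lambda>x. b x * f x) \<in> L2 M" "l2norm M (\<lambda>x. b x * f x) \<le> B * l2norm M f"
    by (auto intro: l2norm_leI)
qed

lemma ennreal_power2_le_imp_le:
  assumes "a\<^sup>2 \<le> (ennreal c)\<^sup>2" "c \<ge> 0" shows "a \<le> ennreal c"
proof (cases a)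
  case (real r)
  then have "r\<^sup>2 \<le> c\<^sup>2" using assms by (simp add: ennreal_power)
  then have "r \<le> c" using assms(2) by (rule power2_le_imp_le)
  then show ?thesis using real by (simp add: ennreal_leI)
next
  case top
  then show ?thesis using assms by (simp add: ennreal_power power2_eq_square ennreal_top_mult top_unique flip: ennreal_mult)
qed

lemma L2_Cauchy_Schwarz:
  assumes f: "f \<in> L2 M" and g: "g \<in> L2 M"
  shows "integrable M (\<lambda>x. f x * g x)" "\<bar>LINT x|M. f x * g x\<bar> \<le> l2norm M f * l2norm M g"
proof -
  note [measurable] = L2_measurable[OF f] L2_measurable[OF g]
  have "(\<integral>\<^sup>+x. ennreal \<bar>f x\<bar> * ennreal \<bar>g x\<bar> \<partial>M)\<^sup>2
      \<le> (\<integral>\<^sup>+x. (ennreal \<bar>f x\<bar>)\<^sup>2 \<partial>M) * (\<integral>\<^sup>+x. (ennreal \<bar>g x\<bar>)\<^sup>2 \<partial>M)"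
    by (rule Cauchy_Schwarz_nn_integral) measurable
  also have "\<dots> = ennreal ((l2norm M f * l2norm M g)\<^sup>2)"
    by (simp add: ennreal_power L2_nn_integral_eq[OF f] L2_nn_integral_eq[OF g] power_mult_distrib ennreal_mult)
  finally have sq: "(\<integral>\<^sup>+x. ennreal \<bar>f x * g x\<bar> \<partial>M)\<^sup>2 \<le> (ennreal (l2norm M f * l2norm M g))\<^sup>2"
    by (simp only: abs_mult ennreal_mult[OF abs_ge_zero abs_ge_zero]
        ennreal_power[OF mult_nonneg_nonneg[OF l2norm_nonneg l2norm_nonneg]])
  have le: "(\<integral>\<^sup>+x. ennreal \<bar>f x * g x\<bar> \<partial>M) \<le> ennreal (l2norm M f * l2norm M g)"
    using sq mult_nonneg_nonneg[OF l2norm_nonneg l2norm_nonneg] by (rule ennreal_power2_le_imp_le)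
  then show i: "integrable M (\<lambda>x. f x * g x)"
    unfolding integrable_iff_bounded by (auto intro: le_less_trans)
  have "\<bar>LINT x|M. f x * g x\<bar> \<le> (LINT x|M. \<bar>f x * g x\<bar>)" by (rule integral_abs_bound)
  also have "\<dots> \<le> l2norm M f * l2norm M g"
    using le unfolding nn_integral_eq_integral_abs[OF i]
    by (subst (asm) ennreal_le_iff) (auto intro: mult_nonneg_nonneg l2norm_nonneg)
  finally show "\<bar>LINT x|M. f x * g x\<bar> \<le> l2norm M f * l2norm M g" .
qed

lemma l2norm_square_add:
  assumes f: "f \<in> L2 M" and g: "g \<in> L2 M"
  shows "(l2norm M (\<lambda>x. f x + g x))\<^sup>2 = (l2norm M f)\<^sup>2 + 2 * (LINT x|M. f x * g x) + (l2norm M g)\<^sup>2"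
proof -
  have "(l2norm M (\<lambda>x. f x + g x))\<^sup>2 = (LINT x|M. (f x)\<^sup>2 + (2 * (f x * g x) + (g x)\<^sup>2))"
    unfolding power2_l2norm by (simp add: power2_sum algebra_simps)
  also have "\<dots> = (LINT x|M. (f x)\<^sup>2) + (2 * (LINT x|M. f x * g x) + (LINT x|M. (g x)\<^sup>2))"
    using f g L2_Cauchy_Schwarz(1)[OF f g] by (simp add: L2_def)
  finally show ?thesis by (simp add: power2_l2norm)
qed

lemma l2norm_triangle:
  assumes f: "f \<in> L2 M" and g: "g \<in> L2 M"
  shows "l2norm M (\<lambda>x. f x + g x) \<le> l2norm M f + l2norm M g"
proof (rule power2_le_imp_le)
  show "(l2norm M (\<lambda>x. f x + g x))\<^sup>2 \<le> (l2norm M f + l2norm M g)\<^sup>2"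
    unfolding l2norm_square_add[OF f g] power2_sum
    using L2_Cauchy_Schwarz(2)[OF f g] by (simp add: abs_le_iff)
qed (simp add: l2norm_nonneg)

lemma l2norm_sum_le:
  assumes "finite I" "\<And>i. i \<in> I \<Longrightarrow> f i \<in> L2 M"
  shows "l2norm M (\<lambda>x. \<Sum>i\<in>I. f i x) \<le> (\<Sum>i\<in>I. l2norm M (f i))"
  using assms
proof (induction I rule: finite_induct)
  case (insert j I)
  have "l2norm M (\<lambda>x. f j x + (\<Sum>i\<in>I. f i x)) \<le> l2norm M (f j) + l2norm M (\<lambda>x. \<Sum>i\<in>I. f i x)"
    using insert.prems by (intro l2norm_triangle L2_sum) auto
  then show ?case using insert by (simp add: order_trans)
qed (simp add: l2norm_def)

lemma Linf_bound:
  assumes "f \<in> Linf M" obtains B where "B \<ge> 0" "AE x in M. \<bar>f x\<bar> \<le> B"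
proof -
  obtain C where "AE x in M. \<bar>f x\<bar> \<le> C" using assms by (auto simp: Linf_def)
  then have "AE x in M. \<bar>f x\<bar> \<le> max 0 C" by (rule eventually_mono) simp
  then show ?thesis by (rule that[rotated]) simp
qed

section \<open>The very weak form of the equation\<close>

context bounded_open
begin

lemma Cc_inf_L2: "\<phi> \<in> Cc_inf UNIV \<Longrightarrow> \<phi> \<in> L2 (lebesgue_on \<Omega>)"
proof -
  assume \<phi>: "\<phi> \<in> Cc_inf UNIV"
  obtain B where B: "\<And>x. \<bar>\<phi> x\<bar> \<le> B" using \<phi> Cc_inf_bounded by metis
  interpret finite_measure "lebesgue_on \<Omega>" by (rule finite_measure_lebesgue_on)
  have m: "\<phi> \<in> borel_measurable (lebesgue_on \<Omega>)"
    by (rule borel_measurable_lebesgue_onI[OF smooth_borel[OF Cc_inf_smooth[OF \<phi>]]])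
  have "(\<lambda>x. 1 :: real) \<in> L2 (lebesgue_on \<Omega>)" by (simp add: L2_def)
  from L2_Linf_mult(1)[OF this m AE_I2[OF B]] B[of 0] show ?thesis by simp
qed

text \<open>The equation differentiates \<open>a\<close> times \<open>wderiv\<close>, an unspecified
  representative; this lemma lets a representative known to be in \<open>L^2\<close> take its
  place.\<close>

lemma weak_deriv_cong_AE:
  assumes w: "weak_deriv \<Omega> is u v" and eq: "AE x in lebesgue_on \<Omega>. u' x = u x"
    and [measurable]: "u \<in> borel_measurable (lebesgue_on \<Omega>)"
  shows "weak_deriv \<Omega> is u' v"
proof -
  have [measurable]: "u' \<in> borel_measurable (lebesgue_on \<Omega>)"
    by (rule borel_measurable_lebesgue_on_AE[OF _ borel eq]) measurable
  have "integrable (lebesgue_on C) u'" if C: "compact C" "C \<subseteq> \<Omega>" for C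
  proof -
    have iu: "integrable (lebesgue_on C) u" using w C by (simp add: weak_deriv_def)
    have eqC: "AE x in lebesgue_on C. u' x = u x"
      using eq C(2) compact_level_sets[OF C(1)] by (auto simp: AE_lebesgue_on elim: eventually_mono)
    then show ?thesis
      using iu borel_measurable_lebesgue_on_AE[OF borel_measurable_integrable[OF iu] compact_level_sets[OF C(1)] eqC]
      by (subst integrable_cong_AE) auto
  qed
  moreover have "(LINT x|lebesgue_on \<Omega>. u' x * foldr pd is \<phi> x) = (LINT x|lebesgue_on \<Omega>. u x * foldr pd is \<phi> x)"
    if "\<phi> \<in> Cc_inf \<Omega>" for \<phi>
  proof -
    have "foldr pd is \<phi> \<in> Cc_inf \<Omega>" using that by (induction "is") (auto intro: Cc_inf_pd)
    note [measurable] = borel_measurable_lebesgue_onI[OF smooth_borel[OF Cc_inf_smooth[OF this]]]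
    show ?thesis by (intro integral_cong_AE) (use eq in \<open>auto elim: eventually_mono\<close>)
  qed
  ultimately show ?thesis using w by (simp add: weak_deriv_def)
qed

text \<open>Two integrations by parts. The sum is the divergence of \<open>a\<close> times the
  gradient of \<open>\<psi>\<close>, written out: one derivative of \<open>a\<close> is available in
  \<open>L^\<infinity>\<close>, and only pure second derivatives occur.\<close>

lemma very_weak_solution:
  assumes U: "is_solution \<Omega> a f g q U" and a: "a \<in> Linf (lebesgue_on \<Omega>)"
    and a': "\<And>i. a' i \<in> Linf (lebesgue_on \<Omega>)" "\<And>i. weak_deriv \<Omega> [i] a (a' i)"
    and q: "q \<in> Linf (lebesgue_on \<Omega>)" and \<psi>: "\<psi> \<in> Cc_inf \<Omega>"
  shows "integrable (lebesgue_on \<Omega>) (\<lambda>x. U x * (q x * \<psi> x - (\<Sum>i\<in>UNIV. a' i x * pd i \<psi> x + a x * pd i (pd i \<psi>) x)))"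
    "(LINT x|lebesgue_on \<Omega>. U x * (q x * \<psi> x - (\<Sum>i\<in>UNIV. a' i x * pd i \<psi> x + a x * pd i (pd i \<psi>) x)))
      = (LINT x|lebesgue_on \<Omega>. f x * \<psi> x)"
proof -
  let ?M = "lebesgue_on \<Omega>"
  have UL: "U \<in> L2 ?M" and ex: "\<And>is. length is \<le> 2 \<Longrightarrow> \<exists>v\<in>L2 ?M. weak_deriv \<Omega> is U v"
    and eq: "AE x in ?M. - (\<Sum>i\<in>UNIV. wderiv \<Omega> [i] (\<lambda>y. a y * wderiv \<Omega> [i] U y) x) + q x * U x = f x"
    using U by (auto simp: is_solution_def sobolev_def)
  have "\<forall>i. \<exists>v. v \<in> L2 ?M \<and> weak_deriv \<Omega> [i] U v" using ex[of "[_]"] by auto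
  then obtain V where V: "\<And>i. V i \<in> L2 ?M" "\<And>i. weak_deriv \<Omega> [i] U (V i)" by metis
  have "\<forall>i. \<exists>v. v \<in> L2 ?M \<and> weak_deriv \<Omega> [i,i] U v" using ex[of "[_,_]"] by auto
  then obtain W where W: "\<And>i. W i \<in> L2 ?M" "\<And>i. weak_deriv \<Omega> [i,i] U (W i)" by metis
  have int: "integrable ?M U" "integrable ?M (V i)" "integrable ?M (W i)" for i
    using UL V W L2_integrable by auto
  note [measurable] = borel_measurable_integrable[OF int(1)] borel_measurable_integrable[OF int(2)] borel_measurable_integrable[OF int(3)]
  have am[measurable]: "a \<in> borel_measurable ?M" "\<And>i. a' i \<in> borel_measurable ?M" "q \<in> borel_measurable ?M"
    using a a' q by (auto simp: Linf_def)
  \<comment> \<open>The second derivative of \<open>U\<close>, given as a single weak derivative of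
    order two, is the weak derivative of \<open>V i\<close>: test the definition of
    \<open>V i\<close> with \<open>pd i \<phi>\<close>.\<close>
  have VW: "weak_deriv \<Omega> [i] (V i) (W i)" for i
  proof -
    have "(LINT x|?M. V i x * pd i \<phi> x) = - (LINT x|?M. W i x * \<phi> x)" if \<phi>: "\<phi> \<in> Cc_inf \<Omega>" for \<phi>
      using weak_deriv_integral[OF V(2) Cc_inf_pd[OF \<phi>], of i i] weak_deriv_integral[OF W(2) \<phi>, of i]
      by simp
    then show ?thesis using V(2)[of i] W(2)[of i] by (auto simp: weak_deriv_def)
  qed
  let ?P = "\<lambda>i x. a x * W i x + a' i x * V i x"
  have aV: "weak_deriv \<Omega> [i] (\<lambda>x. a x * V i x) (?P i)" for i
    by (rule weak_deriv_mult_Linf[OF a a' int(2,3) VW])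
  have aU: "weak_deriv \<Omega> [i] (\<lambda>x. a x * U x) (\<lambda>x. a x * V i x + a' i x * U x)" for i
    by (rule weak_deriv_mult_Linf[OF a a' int(1,2) V(2)])
  have "AE x in ?M. wderiv \<Omega> [i] (\<lambda>y. a y * wderiv \<Omega> [i] U y) x = ?P i x" for i
  proof (rule wderiv_AE[OF weak_deriv_cong_AE[OF aV]])
    show "AE x in ?M. a x * wderiv \<Omega> [i] U x = a x * V i x"
      using wderiv_AE[OF V(2)[of i]] by (rule eventually_mono) simp
  qed measurable
  then have "AE x in ?M. \<forall>i\<in>UNIV. wderiv \<Omega> [i] (\<lambda>y. a y * wderiv \<Omega> [i] U y) x = ?P i x"
    by (intro AE_finite_allI) auto
  with eq have eq': "AE x in ?M. f x * \<psi> x = q x * U x * \<psi> x - (\<Sum>i\<in>UNIV. ?P i x * \<psi> x)"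
    by eventually_elim (simp add: algebra_simps sum_distrib_left)
  obtain Ba where Ba: "AE x in ?M. \<bar>a x\<bar> \<le> Ba" using a Linf_bound by metis
  have "\<exists>B. AE x in ?M. \<bar>a' i x\<bar> \<le> B" for i using a'(1)[of i] by (auto simp: Linf_def)
  then obtain Ba' where Ba': "\<And>i. AE x in ?M. \<bar>a' i x\<bar> \<le> Ba' i" by metis
  obtain Bq where Bq: "AE x in ?M. \<bar>q x\<bar> \<le> Bq" using q Linf_bound by metis
  have test: "integrable ?M (\<lambda>x. h x * \<phi> x)" if h: "integrable ?M h" and \<phi>: "\<phi> \<in> Cc_inf \<Omega>" for h \<phi>
  proof -
    obtain B where B: "\<And>x. \<bar>\<phi> x\<bar> \<le> B" using \<phi> Cc_inf_bounded by metis
    show ?thesis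
      by (rule integrable_mult_bounded[OF h borel_measurable_lebesgue_onI[OF smooth_borel[OF Cc_inf_smooth[OF \<phi>]]] AE_I2[OF B]])
  qed
  note \<psi>' = Cc_inf_pd[OF \<psi>] Cc_inf_pd[OF Cc_inf_pd[OF \<psi>]]
  have iaV: "integrable ?M (\<lambda>x. a x * V i x)" "integrable ?M (\<lambda>x. a' i x * U x)" "integrable ?M (\<lambda>x. a x * U x)"
      "integrable ?M (\<lambda>x. q x * U x)" "integrable ?M (?P i)" for i
    using integrable_mult_bounded[OF int(2) am(1) Ba] integrable_mult_bounded[OF int(1) am(2) Ba']
      integrable_mult_bounded[OF int(1) am(1) Ba] integrable_mult_bounded[OF int(1) am(3) Bq]
      integrable_mult_bounded[OF int(3) am(1) Ba] integrable_mult_bounded[OF int(2) am(2) Ba']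
    by (simp_all add: mult.commute)
  \<comment> \<open>Both identities contain the integral of \<open>a * V i * pd i \<psi>\<close>:
    the product rule for \<open>a * V i\<close> is tested with \<open>\<psi>\<close>, that for
    \<open>a * U\<close> with \<open>pd i \<psi>\<close>, and the common term is eliminated.\<close>
  have part: "(LINT x|?M. ?P i x * \<psi> x) = (LINT x|?M. (a' i x * U x) * pd i \<psi> x) + (LINT x|?M. (a x * U x) * pd i (pd i \<psi>) x)" for i
  proof -
    have "(LINT x|?M. ?P i x * \<psi> x) = - (LINT x|?M. (a x * V i x) * pd i \<psi> x)"
      using weak_deriv_integral[OF aV \<psi>, of i] by simp
    moreover have "(LINT x|?M. (a x * U x) * pd i (pd i \<psi>) x) = - (LINT x|?M. (a x * V i x) * pd i \<psi> x + (a' i x * U x) * pd i \<psi> x)"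
      using weak_deriv_integral[OF aU \<psi>'(1), of i i] by (simp add: distrib_right)
    ultimately show ?thesis
      using Bochner_Integration.integral_add[OF test[OF iaV(1) \<psi>'(1)] test[OF iaV(2) \<psi>'(1)], of i i i i] by simp
  qed
  have rew: "U x * (q x * \<psi> x - (\<Sum>i\<in>UNIV. a' i x * pd i \<psi> x + a x * pd i (pd i \<psi>) x))
      = q x * U x * \<psi> x - (\<Sum>i\<in>UNIV. (a' i x * U x) * pd i \<psi> x + (a x * U x) * pd i (pd i \<psi>) x)" for x
    by (simp add: algebra_simps sum_distrib_left sum.distrib)
  show "integrable ?M (\<lambda>x. U x * (q x * \<psi> x - (\<Sum>i\<in>UNIV. a' i x * pd i \<psi> x + a x * pd i (pd i \<psi>) x)))"
    unfolding rew
    by (intro Bochner_Integration.integrable_diff Bochner_Integration.integrable_sum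
        Bochner_Integration.integrable_add test iaV \<psi> \<psi>')
  have "(LINT x|?M. U x * (q x * \<psi> x - (\<Sum>i\<in>UNIV. a' i x * pd i \<psi> x + a x * pd i (pd i \<psi>) x)))
      = (LINT x|?M. q x * U x * \<psi> x) - (LINT x|?M. (\<Sum>i\<in>UNIV. (a' i x * U x) * pd i \<psi> x + (a x * U x) * pd i (pd i \<psi>) x))"
    unfolding rew
    by (intro Bochner_Integration.integral_diff Bochner_Integration.integrable_sum
        Bochner_Integration.integrable_add test iaV \<psi> \<psi>')
  also have "(LINT x|?M. (\<Sum>i\<in>UNIV. (a' i x * U x) * pd i \<psi> x + (a x * U x) * pd i (pd i \<psi>) x))
      = (\<Sum>i\<in>UNIV. (LINT x|?M. (a' i x * U x) * pd i \<psi> x + (a x * U x) * pd i (pd i \<psi>) x))"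
    by (intro Bochner_Integration.integral_sum Bochner_Integration.integrable_add test iaV \<psi> \<psi>')
  also have "\<dots> = (\<Sum>i\<in>UNIV. (LINT x|?M. ?P i x * \<psi> x))"
    unfolding part by (intro sum.cong refl Bochner_Integration.integral_add test iaV \<psi> \<psi>')
  also have "\<dots> = (LINT x|?M. (\<Sum>i\<in>UNIV. ?P i x * \<psi> x))"
    by (intro Bochner_Integration.integral_sum[symmetric] test iaV \<psi>)
  also have "(LINT x|?M. q x * U x * \<psi> x) - (LINT x|?M. (\<Sum>i\<in>UNIV. ?P i x * \<psi> x))
      = (LINT x|?M. q x * U x * \<psi> x - (\<Sum>i\<in>UNIV. ?P i x * \<psi> x))"
    by (intro Bochner_Integration.integral_diff[symmetric] Bochner_Integration.integrable_sum test iaV \<psi>)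
  also have "\<dots> = (LINT x|?M. f x * \<psi> x)"
  proof (rule integral_cong_AE)
    note [measurable] = borel_measurable_lebesgue_onI[OF smooth_borel[OF Cc_inf_smooth[OF \<psi>]]]
    show m: "(\<lambda>x. q x * U x * \<psi> x - (\<Sum>i\<in>UNIV. ?P i x * \<psi> x)) \<in> borel_measurable ?M" by measurable
    show "(\<lambda>x. f x * \<psi> x) \<in> borel_measurable ?M"
      by (rule borel_measurable_lebesgue_on_AE[OF m borel eq'])
    show "AE x in ?M. q x * U x * \<psi> x - (\<Sum>i\<in>UNIV. ?P i x * \<psi> x) = f x * \<psi> x"
      using eq' by (rule eventually_mono) simp
  qed
  finally show "(LINT x|?M. U x * (q x * \<psi> x - (\<Sum>i\<in>UNIV. a' i x * pd i \<psi> x + a x * pd i (pd i \<psi>) x)))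
      = (LINT x|?M. f x * \<psi> x)" .
qed

text \<open>Both solutions satisfy the very weak identity with the same right-hand side. The
  operator with coefficient \<open>q\<close> is applied to the difference, so that the other side
  contains the fixed solution \<open>U0\<close> and \<open>q\<close> itself enters only through its
  bound. The factor \<open>1 + 2 * d\<close> counts the zeroth-order term and, per coordinate, one
  term with \<open>a'\<close> and one with \<open>a\<close>.\<close>

lemma duality_bound:
  assumes U: "is_solution \<Omega> a f g q U" and U0: "is_solution \<Omega> a f g q0 U0"
    and a: "a \<in> Linf (lebesgue_on \<Omega>)" "AE x in lebesgue_on \<Omega>. \<bar>a x\<bar> \<le> B"
    and a': "\<And>i. a' i \<in> Linf (lebesgue_on \<Omega>)" "\<And>i. weak_deriv \<Omega> [i] a (a' i)"
      "\<And>i. AE x in lebesgue_on \<Omega>. \<bar>a' i x\<bar> \<le> B"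
    and q: "q \<in> Linf (lebesgue_on \<Omega>)" "AE x in lebesgue_on \<Omega>. \<bar>q x\<bar> \<le> B"
    and q0: "q0 \<in> Linf (lebesgue_on \<Omega>)" and \<psi>: "\<psi> \<in> Cc_inf \<Omega>" and "B \<ge> 0"
    and N: "l2norm (lebesgue_on \<Omega>) \<psi> \<le> N" "\<And>i. l2norm (lebesgue_on \<Omega>) (pd i \<psi>) \<le> N"
      "\<And>i. l2norm (lebesgue_on \<Omega>) (pd i (pd i \<psi>)) \<le> N"
  shows "\<bar>LINT x|lebesgue_on \<Omega>. (q0 x - q x) * (U0 x * \<psi> x)\<bar>
    \<le> l2norm (lebesgue_on \<Omega>) (\<lambda>x. U x - U0 x) * (B * N * (1 + 2 * real CARD('d)))"
proof -
  let ?M = "lebesgue_on \<Omega>"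
  let ?S = "\<lambda>x. \<Sum>i\<in>UNIV. a' i x * pd i \<psi> x + a x * pd i (pd i \<psi>) x"
  let ?T = "\<lambda>x. q x * \<psi> x - ?S x"
  have meas: "a \<in> borel_measurable ?M" "\<And>i. a' i \<in> borel_measurable ?M" "q \<in> borel_measurable ?M"
    using a a' q by (auto simp: Linf_def)
  note cc = Cc_inf_mono[OF \<psi> subset_UNIV] Cc_inf_mono[OF Cc_inf_pd[OF \<psi>] subset_UNIV]
    Cc_inf_mono[OF Cc_inf_pd[OF Cc_inf_pd[OF \<psi>]] subset_UNIV]
  note L = cc[THEN Cc_inf_L2]
  have UL: "U \<in> L2 ?M" "U0 \<in> L2 ?M" using U U0 by (auto simp: is_solution_def sobolev_def)
  have h: "(\<lambda>x. U x - U0 x) \<in> L2 ?M" by (rule L2_diff[OF UL])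
  have t1: "(\<lambda>x. q x * \<psi> x) \<in> L2 ?M" "l2norm ?M (\<lambda>x. q x * \<psi> x) \<le> B * N"
    using L2_Linf_mult[OF L(1) meas(3) q(2) \<open>B \<ge> 0\<close>] mult_left_mono[OF N(1) \<open>B \<ge> 0\<close>] by auto
  have t2: "(\<lambda>x. a' i x * pd i \<psi> x) \<in> L2 ?M" "l2norm ?M (\<lambda>x. a' i x * pd i \<psi> x) \<le> B * N" for i
    using L2_Linf_mult[OF L(2) meas(2) a'(3) \<open>B \<ge> 0\<close>, of i i] mult_left_mono[OF N(2)[of i] \<open>B \<ge> 0\<close>] by auto
  have t3: "(\<lambda>x. a x * pd i (pd i \<psi>) x) \<in> L2 ?M" "l2norm ?M (\<lambda>x. a x * pd i (pd i \<psi>) x) \<le> B * N" for i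
    using L2_Linf_mult[OF L(3) meas(1) a(2) \<open>B \<ge> 0\<close>, of i i] mult_left_mono[OF N(3)[of i] \<open>B \<ge> 0\<close>] by auto
  have S: "?S \<in> L2 ?M" by (intro L2_sum L2_add t2 t3)
  have "l2norm ?M ?S \<le> (\<Sum>i\<in>UNIV. l2norm ?M (\<lambda>x. a' i x * pd i \<psi> x + a x * pd i (pd i \<psi>) x))"
    by (intro l2norm_sum_le L2_add t2 t3) simp
  also have "\<dots> \<le> (\<Sum>i\<in>(UNIV::'d set). B * N + B * N)"
    by (intro sum_mono order_trans[OF l2norm_triangle[OF t2(1) t3(1)]] add_mono t2 t3)
  finally have Sn: "l2norm ?M ?S \<le> 2 * real CARD('d) * (B * N)" by simp
  have TL: "?T \<in> L2 ?M" by (rule L2_diff[OF t1(1) S])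
  have "l2norm ?M ?T = l2norm ?M (\<lambda>x. q x * \<psi> x + (-1) * ?S x)" by simp
  also have "\<dots> \<le> l2norm ?M (\<lambda>x. q x * \<psi> x) + l2norm ?M (\<lambda>x. (-1) * ?S x)"
    by (rule l2norm_triangle[OF t1(1) L2_cmult[OF S]])
  also have "l2norm ?M (\<lambda>x. (-1) * ?S x) = l2norm ?M ?S" unfolding l2norm_cmult by simp
  finally have Tn: "l2norm ?M ?T \<le> B * N * (1 + 2 * real CARD('d))"
    using t1(2) Sn by (simp add: algebra_simps)
  note v = very_weak_solution[OF U a(1) a'(1,2) q(1) \<psi>] very_weak_solution[OF U0 a(1) a'(1,2) q0 \<psi>]
  have "(LINT x|?M. (U x - U0 x) * ?T x) = (LINT x|?M. U x * ?T x) - (LINT x|?M. U0 x * ?T x)"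
    using L2_Cauchy_Schwarz(1)[OF UL(1) TL] L2_Cauchy_Schwarz(1)[OF UL(2) TL]
    by (simp add: left_diff_distrib)
  also have "\<dots> = (LINT x|?M. U0 x * (q0 x * \<psi> x - ?S x)) - (LINT x|?M. U0 x * ?T x)"
    using v(2,4) by simp
  also have "\<dots> = (LINT x|?M. U0 x * (q0 x * \<psi> x - ?S x) - U0 x * ?T x)"
    by (rule Bochner_Integration.integral_diff[symmetric, OF v(3) L2_Cauchy_Schwarz(1)[OF UL(2) TL]])
  also have "\<dots> = (LINT x|?M. (q0 x - q x) * (U0 x * \<psi> x))"
    by (rule arg_cong[where f = "integral\<^sup>L ?M"]) (auto simp: algebra_simps)
  finally have "\<bar>LINT x|?M. (q0 x - q x) * (U0 x * \<psi> x)\<bar> = \<bar>LINT x|?M. (U x - U0 x) * ?T x\<bar>" by simp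
  also have "\<dots> \<le> l2norm ?M (\<lambda>x. U x - U0 x) * l2norm ?M ?T" by (rule L2_Cauchy_Schwarz(2)[OF h TL])
  also have "\<dots> \<le> l2norm ?M (\<lambda>x. U x - U0 x) * (B * N * (1 + 2 * real CARD('d)))"
    by (rule mult_left_mono[OF Tn l2norm_nonneg])
  finally show ?thesis .
qed

end

section \<open>Approximation by test functions\<close>

text \<open>Subtracting \<open>c\<close> times the mass of the kernel replaces \<open>v\<close> by
  \<open>v - c\<close> under the integral; Cauchy-Schwarz on the ball of radius \<open>e\<close>
  follows. For a kernel of mass 1 this measures the distance of the mollification from
  \<open>c\<close>; for a derivative kernel, of mass 0, it bounds the derivative by the same
  deviation with \<open>c\<close> free.\<close>

lemma conv_deviation:
  fixes v \<eta> :: "real^'d::finite \<Rightarrow> real"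
  assumes v: "integrable lborel v" and \<eta>: "\<eta> \<in> Cc_inf UNIV"
    and B: "\<And>x. \<bar>\<eta> x\<bar> \<le> B" and e: "\<And>x. norm x \<ge> e \<Longrightarrow> \<eta> x = 0" "e > 0"
  shows "ennreal ((conv v \<eta> x - c * (LINT y|lborel. \<eta> y))\<^sup>2)
    \<le> ennreal (B\<^sup>2 * measure lborel (ball (0::real^'d) e)) *
      (\<integral>\<^sup>+y. indicator {..<e} (dist x y) * ennreal ((v y - c)\<^sup>2) \<partial>lborel)"
proof -
  have vm[measurable]: "v \<in> borel_measurable borel" using borel_measurable_integrable[OF v] by simp
  have [measurable]: "\<eta> \<in> borel_measurable borel" by (rule smooth_borel[OF Cc_inf_smooth[OF \<eta>]])
  have \<eta>i: "integrable lborel \<eta>" by (rule Cc_inf_integrable[OF \<eta>])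
  have \<eta>ix: "integrable lborel (\<lambda>y. \<eta> (x - y))" using integrable_lborel_affine[OF \<eta>i, of "-1" x] by simp
  have J: "(LINT y|lborel. \<eta> (x - y)) = (LINT y|lborel. \<eta> y)"
    using integral_lborel_affine[of \<eta> "-1" x] by simp
  note i1 = Cc_inf_conv_integrable[OF v \<eta>, of x]
  have ic: "integrable lborel (\<lambda>y. c * \<eta> (x - y))" by (intro integrable_mult_right \<eta>ix)
  have B0: "B \<ge> 0" using B[of 0] by linarith
  have "conv v \<eta> x - c * (LINT y|lborel. \<eta> y) = (LINT y|lborel. v y * \<eta> (x - y) - c * \<eta> (x - y))"
    unfolding conv_def using i1 ic by (simp add: J)
  also have "\<dots> = (LINT y|lborel. (v y - c) * \<eta> (x - y))" by (simp add: left_diff_distrib)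
  finally have eq: "conv v \<eta> x - c * (LINT y|lborel. \<eta> y) = (LINT y|lborel. (v y - c) * \<eta> (x - y))" .
  have i: "integrable lborel (\<lambda>y. (v y - c) * \<eta> (x - y))"
    using Bochner_Integration.integrable_diff[OF i1 ic] by (simp add: left_diff_distrib)
  have "ennreal \<bar>conv v \<eta> x - c * (LINT y|lborel. \<eta> y)\<bar> \<le> ennreal (LINT y|lborel. \<bar>(v y - c) * \<eta> (x - y)\<bar>)"
    unfolding eq by (intro ennreal_leI integral_abs_bound)
  also have "\<dots> = (\<integral>\<^sup>+y. ennreal \<bar>(v y - c) * \<eta> (x - y)\<bar> \<partial>lborel)"
    by (rule nn_integral_eq_integral_abs[OF i, symmetric])
  also have "\<dots> \<le> (\<integral>\<^sup>+y. (ennreal B * indicator {..<e} (dist x y)) * (indicator {..<e} (dist x y) * ennreal \<bar>v y - c\<bar>) \<partial>lborel)"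
  proof (rule nn_integral_mono)
    fix y
    show "ennreal \<bar>(v y - c) * \<eta> (x - y)\<bar> \<le> (ennreal B * indicator {..<e} (dist x y)) * (indicator {..<e} (dist x y) * ennreal \<bar>v y - c\<bar>)"
    proof (cases "dist x y < e")
      case True
      have "\<bar>(v y - c) * \<eta> (x - y)\<bar> \<le> B * \<bar>v y - c\<bar>"
        using mult_right_mono[OF B[of "x - y"], of "\<bar>v y - c\<bar>"] by (simp add: abs_mult mult.commute)
      then have "ennreal \<bar>(v y - c) * \<eta> (x - y)\<bar> \<le> ennreal (B * \<bar>v y - c\<bar>)" by (rule ennreal_leI)
      with True B0 show ?thesis by (simp add: ennreal_mult)
    qed (simp add: e(1) dist_norm)
  qed
  finally have "(ennreal \<bar>conv v \<eta> x - c * (LINT y|lborel. \<eta> y)\<bar>)\<^sup>2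
      \<le> (\<integral>\<^sup>+y. (ennreal B * indicator {..<e} (dist x y)) * (indicator {..<e} (dist x y) * ennreal \<bar>v y - c\<bar>) \<partial>lborel)\<^sup>2"
    by (rule power_mono) simp
  also have "\<dots> \<le> (\<integral>\<^sup>+y. (ennreal B * indicator {..<e} (dist x y))\<^sup>2 \<partial>lborel) *
      (\<integral>\<^sup>+y. (indicator {..<e} (dist x y) * ennreal \<bar>v y - c\<bar>)\<^sup>2 \<partial>lborel)"
    by (rule Cauchy_Schwarz_nn_integral) measurable
  also have "(\<integral>\<^sup>+y. (ennreal B * indicator {..<e} (dist x y))\<^sup>2 \<partial>lborel) = ennreal (B\<^sup>2 * measure lborel (ball (0::real^'d) e))"
  proof -
    have "(\<integral>\<^sup>+y. (ennreal B * indicator {..<e} (dist x y))\<^sup>2 \<partial>lborel) = (\<integral>\<^sup>+y. ennreal (B\<^sup>2) * indicator (ball x e) y \<partial>lborel)"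
      using B0 by (intro nn_integral_cong) (simp add: indicator_def ennreal_power power_mult_distrib)
    also have "\<dots> = ennreal (B\<^sup>2) * ennreal (measure lborel (ball x e))"
      using emeasure_bounded_finite[of "ball x e"]
      by (subst nn_integral_cmult_indicator) (auto simp: emeasure_eq_ennreal_measure)
    also have "measure lborel (ball x e) = measure lborel (ball (0::real^'d) e)"
      using e(2) content_ball[of e x] content_ball[of e "0::real^'d"] by simp
    finally show ?thesis by (simp add: ennreal_mult)
  qed
  also have "(\<integral>\<^sup>+y. (indicator {..<e} (dist x y) * ennreal \<bar>v y - c\<bar>)\<^sup>2 \<partial>lborel)
      = (\<integral>\<^sup>+y. indicator {..<e} (dist x y) * ennreal ((v y - c)\<^sup>2) \<partial>lborel)"
    by (intro nn_integral_cong) (simp add: indicator_def ennreal_power power_mult_distrib)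
  finally show ?thesis by (simp add: ennreal_power)
qed

lemma moll_derivative_bounds:
  obtains B where "B > 0"
    "\<And>t (x::real^'d::finite). t > 0 \<Longrightarrow> \<bar>moll t x\<bar> \<le> B / t ^ CARD('d)"
    "\<And>t (x::real^'d::finite) i. t > 0 \<Longrightarrow> \<bar>pd i (moll t) x\<bar> \<le> B / t ^ (CARD('d) + 1)"
    "\<And>t (x::real^'d::finite) i. t > 0 \<Longrightarrow> \<bar>pd i (pd i (moll t)) x\<bar> \<le> B / t ^ (CARD('d) + 2)"
proof -
  let ?n = "CARD('d)"
  have "\<exists>B>0. \<forall>x. \<bar>(pd i bump :: real^'d \<Rightarrow> real) x\<bar> \<le> B" for i
    using Cc_inf_bounded[OF Cc_inf_pd[OF bump_Cc_inf]] by metis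
  then obtain B1 where B1: "\<And>i. B1 i > 0" "\<And>i x. \<bar>(pd i bump :: real^'d \<Rightarrow> real) x\<bar> \<le> B1 i" by metis
  have "\<exists>B>0. \<forall>x. \<bar>(pd i (pd i bump) :: real^'d \<Rightarrow> real) x\<bar> \<le> B" for i
    using Cc_inf_bounded[OF Cc_inf_pd[OF Cc_inf_pd[OF bump_Cc_inf]]] by metis
  then obtain B2 where B2: "\<And>i. B2 i > 0" "\<And>i x. \<bar>(pd i (pd i bump) :: real^'d \<Rightarrow> real) x\<bar> \<le> B2 i" by metis
  obtain B0 where B0: "B0 > 0" "\<And>x. \<bar>(bump :: real^'d \<Rightarrow> real) x\<bar> \<le> B0"
    using Cc_inf_bounded[OF bump_Cc_inf] by metis
  define B where "B = B0 + (\<Sum>i\<in>UNIV. B1 i) + (\<Sum>i\<in>UNIV. B2 i)"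
  have s: "(\<Sum>i\<in>UNIV. B1 i) \<ge> B1 j" "(\<Sum>i\<in>UNIV. B2 i) \<ge> B2 j" for j
    using member_le_sum[of j UNIV B1] member_le_sum[of j UNIV B2] B1(1) B2(1) by (simp_all add: less_imp_le)
  have B: "B > 0" "\<bar>bump x\<bar> \<le> B" "\<bar>pd i bump x\<bar> \<le> B" "\<bar>pd i (pd i bump) x\<bar> \<le> B" for i and x :: "real^'d"
    using B0(1) B0(2)[of x] B1(1)[of i] B1(2)[of i x] B2(1)[of i] B2(2)[of i x] s[of i] unfolding B_def by linarith+
  have sb: "smooth (bump :: real^'d \<Rightarrow> real)" by (rule smooth_bump)
  have aff: "pd i (\<lambda>x. f ((1/t) *\<^sub>R x) / c) x = pd i f ((1/t) *\<^sub>R x) / (c * t)" if "smooth f" for f :: "real^'d \<Rightarrow> real" and i t c x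
  proof -
    have "f differentiable (at ((1/t) *\<^sub>R x + 0))" by (rule smooth_differentiable[OF that])
    note a = pd_affine(1)[OF this, of i, unfolded add_0_right] pd_affine(2)[OF this, unfolded add_0_right]
    have "pd i (\<lambda>x. (1/c) * f ((1/t) *\<^sub>R x)) x = (1/c) * pd i (\<lambda>x. f ((1/t) *\<^sub>R x)) x"
      using pd_mult[of "\<lambda>x. 1/c" x "\<lambda>x. f ((1/t) *\<^sub>R x)" i] a(2) by (simp add: pd_const)
    then show ?thesis using a(1) by (simp add: field_simps)
  qed
  have p1: "pd i (moll t) = (\<lambda>x::real^'d. pd i bump ((1/t) *\<^sub>R x) / (t ^ ?n * t))" for i t
    unfolding moll_def[abs_def] by (rule ext, rule aff[OF sb])
  have p2: "pd i (pd i (moll t)) x = pd i (pd i bump) ((1/t) *\<^sub>R x) / (t ^ ?n * t * t)" for i t and x :: "real^'d"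
    unfolding p1 by (rule aff[OF smooth_pd[OF sb]])
  show ?thesis
  proof (rule that[OF B(1)])
    fix t :: real and x :: "real^'d" and i assume t: "t > 0"
    show "\<bar>moll t x\<bar> \<le> B / t ^ ?n" using B(2) t by (simp add: moll_def divide_right_mono)
    show "\<bar>pd i (moll t) x\<bar> \<le> B / t ^ (?n + 1)"
      unfolding p1 using B(3) t by (simp add: abs_mult divide_right_mono mult_ac)
    show "\<bar>pd i (pd i (moll t)) x\<bar> \<le> B / t ^ (?n + 2)"
      unfolding p2 using B(4) t by (simp add: abs_mult divide_right_mono mult_ac)
  qed
qed

text \<open>Squared increments integrated over pairs at distance below \<open>e\<close>, with
  \<open>x\<close> deeper than \<open>e\<close> so that \<open>y\<close> stays in
  \<open>\<Omega>\<close>. There is no division by the ball volume: regularity of order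
  \<open>k\<close> corresponds to the size \<open>e^(d + 2k)\<close>.\<close>

definition osc :: "(real^'d::finite) set \<Rightarrow> real \<Rightarrow> (real^'d \<Rightarrow> real) \<Rightarrow> ennreal" where
  "osc \<Omega> e w = (\<integral>\<^sup>+x. indicator {x. e < depth \<Omega> x} x *
     (\<integral>\<^sup>+y. indicator {..<e} (dist x y) * ennreal ((w x - w y)\<^sup>2) \<partial>lborel) \<partial>lborel)"

definition layer :: "(real^'d::finite) set \<Rightarrow> real \<Rightarrow> (real^'d \<Rightarrow> real) \<Rightarrow> ennreal" where
  "layer \<Omega> e w = (\<integral>\<^sup>+x. indicator {x \<in> \<Omega>. depth \<Omega> x < e} x * ennreal ((w x)\<^sup>2) \<partial>lborel)"

text \<open>Outside the closed ball \<open>f\<close> vanishes on an open set; the sphere itself is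
  reached by continuity of the derivative. It is included because \<open>conv_deviation\<close> asks
  for vanishing from radius \<open>e\<close> on.\<close>

lemma pd_eq_0_outside:
  fixes f :: "real^'d::finite \<Rightarrow> real"
  assumes f: "smooth f" and 0: "\<And>x. norm x \<ge> e \<Longrightarrow> f x = 0" and "e > 0" and x: "norm x \<ge> e"
  shows "pd i f x = 0"
proof -
  have out: "pd i f y = 0" if "norm y > e" for y
  proof -
    have "((\<lambda>y. 0) has_derivative (\<lambda>h. 0)) (at y)" by simp
    moreover have "open {y::real^'d. norm y > e}" by (intro open_Collect_less continuous_intros)
    moreover have "y \<in> {y. norm y > e}" using that by simp
    moreover have "0 = f z" if "z \<in> {y. norm y > e}" for z using 0[of z] that by simp
    ultimately have "(f has_derivative (\<lambda>h. 0)) (at y)"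
      by (rule has_derivative_transform_within_open)
    then show ?thesis by (simp add: pd_eq)
  qed
  let ?y = "\<lambda>n. (1 + 1 / real (Suc n)) *\<^sub>R x"
  have y: "norm (?y n) > e" for n
  proof -
    have "norm x > 0" using x \<open>e > 0\<close> by linarith
    then have "1 * norm x < (1 + 1 / real (Suc n)) * norm x" by (intro mult_strict_right_mono) auto
    then show ?thesis using x by simp
  qed
  have "(\<lambda>n. 1 + 1 / real (Suc n)) \<longlonglongrightarrow> 1 + 0"
    by (intro tendsto_add tendsto_const LIMSEQ_Suc[OF lim_1_over_n])
  then have "?y \<longlonglongrightarrow> (1 + 0) *\<^sub>R x" by (rule tendsto_scaleR[OF _ tendsto_const])
  then have "?y \<longlonglongrightarrow> x" by (simp only: add_0_right scaleR_one)
  moreover have "isCont (pd i f) x"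
    using smooth_continuous_on[OF smooth_pd[OF f], of UNIV] by (simp add: continuous_on_eq_continuous_at)
  ultimately have "(\<lambda>n. pd i f (?y n)) \<longlonglongrightarrow> pd i f x"
    by (rule isCont_tendsto_compose[rotated])
  moreover have "(\<lambda>n. pd i f (?y n)) = (\<lambda>n. 0)" using out y by blast
  ultimately show ?thesis using LIMSEQ_unique tendsto_const by metis
qed

lemma power2_sum3_le: "(p + q + r)\<^sup>2 \<le> 3 * p\<^sup>2 + 3 * q\<^sup>2 + 3 * (r::real)\<^sup>2"
  using zero_le_power2[of "p - q"] zero_le_power2[of "q - r"] zero_le_power2[of "p - r"]
  by (simp add: power2_eq_square algebra_simps)

lemma nn_integral_lincomb3:
  assumes [measurable]: "f \<in> borel_measurable M" "g \<in> borel_measurable M" "h \<in> borel_measurable M"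
  shows "(\<integral>\<^sup>+x. a * f x + b * g x + c * h x \<partial>M)
    = a * (\<integral>\<^sup>+x. f x \<partial>M) + b * (\<integral>\<^sup>+x. g x \<partial>M) + c * (\<integral>\<^sup>+x. h x \<partial>M)"
  by (simp add: nn_integral_add nn_integral_cmult)

context bounded_open
begin

lemma borel_depth [measurable]: "(\<lambda>x. depth \<Omega> x) \<in> borel_measurable borel"
  by (intro borel_measurable_continuous_onI continuous_intros)

text \<open>The candidate is \<open>w / u\<close>, cut off at depth \<open>2 * e\<close> and
  mollified at scale \<open>e\<close>. At a point \<open>x\<close> deeper than \<open>e\<close> all
  quantities are deviations from \<open>w x / u x\<close>, which are controlled by increments of
  \<open>w\<close> and \<open>u\<close>, and by \<open>|w|\<close> where the cut is visible. Each
  derivative of the kernel costs a factor \<open>1 / e\<close>. The parameter \<open>s\<close> is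
  the common size of the three hypotheses, later \<open>e powr k\<close>.\<close>

lemma test_function_approximation:
  fixes w u :: "real^'d \<Rightarrow> real"
  assumes wm[measurable]: "w \<in> borel_measurable borel" and um[measurable]: "u \<in> borel_measurable borel"
    and W: "\<And>x. \<bar>w x\<bar> \<le> W" and c0: "c0 > 0" "\<And>x. c0 \<le> \<bar>u x\<bar>" and K: "K \<ge> 0"
  obtains K' where "K' \<ge> 0"
    "\<And>e s. e > 0 \<Longrightarrow> osc \<Omega> e w \<le> ennreal (K * (e ^ CARD('d) * s\<^sup>2)) \<Longrightarrow>
      osc \<Omega> e u \<le> ennreal (K * (e ^ CARD('d) * s\<^sup>2)) \<Longrightarrow> layer \<Omega> (3 * e) w \<le> ennreal (K * s\<^sup>2) \<Longrightarrow>
      \<exists>\<psi>\<in>Cc_inf \<Omega>. (\<forall>x. \<bar>\<psi> x\<bar> \<le> W / c0) \<and>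
        (\<integral>\<^sup>+x. indicator \<Omega> x * ennreal ((w x - u x * \<psi> x)\<^sup>2) \<partial>lborel) \<le> ennreal (K' * s\<^sup>2) \<and>
        (\<forall>i. (\<integral>\<^sup>+x. ennreal ((pd i \<psi> x)\<^sup>2) \<partial>lborel) \<le> ennreal (K' * (s / e)\<^sup>2)) \<and>
        (\<forall>i. (\<integral>\<^sup>+x. ennreal ((pd i (pd i \<psi>) x)\<^sup>2) \<partial>lborel) \<le> ennreal (K' * (s / e\<^sup>2)\<^sup>2))"
proof -
  let ?n = "CARD('d)"
  obtain B where B: "B > 0"
    "\<And>t (x::real^'d). t > 0 \<Longrightarrow> \<bar>moll t x\<bar> \<le> B / t ^ ?n"
    "\<And>t (x::real^'d) i. t > 0 \<Longrightarrow> \<bar>pd i (moll t) x\<bar> \<le> B / t ^ (?n + 1)"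
    "\<And>t (x::real^'d) i. t > 0 \<Longrightarrow> \<bar>pd i (pd i (moll t)) x\<bar> \<le> B / t ^ (?n + 2)"
    by (rule moll_derivative_bounds) (rule that)
  define om where "om = unit_ball_vol (real ?n)"
  have om: "om \<ge> 0" by (simp add: om_def)
  have W0: "W \<ge> 0" using W[of 0] by linarith
  \<comment> \<open>The 3 comes from squaring a sum of three terms. The summands in the bracket
    belong to the increments of \<open>w\<close>, to those of \<open>u\<close>, and to the layer,
    whose share carries the ball volume.\<close>
  define L where "L = 3 * K * (1 + (W / c0)\<^sup>2 + om)"
  have L0: "L \<ge> 0" using K om by (auto simp: L_def intro!: mult_nonneg_nonneg add_nonneg_nonneg)
  define K1 where "K1 = B\<^sup>2 * om * L"
  have K1: "K1 \<ge> 0" using om L0 by (simp add: K1_def)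
  define K' where "K' = K1 + K1 / c0\<^sup>2 + K"
  have K': "K' \<ge> 0" "K1 + K \<le> K'" "K1 / c0\<^sup>2 \<le> K'" using K K1 by (auto simp: K'_def)
  show ?thesis
  proof (rule that[OF K'(1)])
    fix e s :: real
    assume e: "e > 0" and ow: "osc \<Omega> e w \<le> ennreal (K * (e ^ ?n * s\<^sup>2))"
      and ou: "osc \<Omega> e u \<le> ennreal (K * (e ^ ?n * s\<^sup>2))" and lw: "layer \<Omega> (3 * e) w \<le> ennreal (K * s\<^sup>2)"
    define V where "V = measure lborel (ball (0::real^'d) e)"
    have V: "V = om * e ^ ?n" using content_ball[of e "0::real^'d"] e by (simp add: V_def om_def)
    have V0: "V \<ge> 0" by (simp add: V_def)
    have emV: "emeasure lborel (ball x e) = ennreal V" for x :: "real^'d"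
    proof -
      have "emeasure lborel (ball x e) = ennreal (measure lborel (ball x e))"
        using emeasure_bounded_finite[of "ball x e"] by (intro emeasure_eq_ennreal_measure) auto
      then show ?thesis using e content_ball[of e x] content_ball[of e "0::real^'d"] by (simp add: V_def)
    qed
    \<comment> \<open>Majorant for the change of the cut quotient, weighted by \<open>|u x|\<close>.
      The last term is active at depth below \<open>3 * e\<close>, where a point within distance
      \<open>e\<close> may have been cut off.\<close>
    define m where "m x y = \<bar>w x - w y\<bar> + W / c0 * \<bar>u x - u y\<bar> + \<bar>w x\<bar> * indicator {..<3 * e} (depth \<Omega> x)" for x y
    have [measurable]: "(\<lambda>(x, y). m x y) \<in> borel_measurable (lborel \<Otimes>\<^sub>M lborel)"
      unfolding m_def by measurable
    define N where "N x = (\<integral>\<^sup>+y. indicator {..<e} (dist x y) * ennreal ((m x y)\<^sup>2) \<partial>lborel)" for x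
    have Nm[measurable]: "N \<in> borel_measurable borel" unfolding N_def by measurable
    have Nle: "N x \<le> 3 * (\<integral>\<^sup>+y. indicator {..<e} (dist x y) * ennreal ((w x - w y)\<^sup>2) \<partial>lborel)
        + ennreal (3 * (W / c0)\<^sup>2) * (\<integral>\<^sup>+y. indicator {..<e} (dist x y) * ennreal ((u x - u y)\<^sup>2) \<partial>lborel)
        + ennreal (3 * V) * (indicator {..<3 * e} (depth \<Omega> x) * ennreal ((w x)\<^sup>2))" for x
    proof -
      have "N x \<le> (\<integral>\<^sup>+y. 3 * (indicator {..<e} (dist x y) * ennreal ((w x - w y)\<^sup>2))
          + ennreal (3 * (W / c0)\<^sup>2) * (indicator {..<e} (dist x y) * ennreal ((u x - u y)\<^sup>2))
          + 3 * (indicator {..<3 * e} (depth \<Omega> x) * ennreal ((w x)\<^sup>2)) * indicator (ball x e) y \<partial>lborel)"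
        unfolding N_def
      proof (rule nn_integral_mono)
        fix y
        let ?p = "\<bar>w x - w y\<bar>" and ?q = "W / c0 * \<bar>u x - u y\<bar>" and ?r = "\<bar>w x\<bar> * indicator {..<3 * e} (depth \<Omega> x) :: real"
        have "(?p + ?q + ?r)\<^sup>2 \<le> 3 * ?p\<^sup>2 + 3 * ?q\<^sup>2 + 3 * ?r\<^sup>2"
          by (rule power2_sum3_le)
        also have "\<dots> = 3 * (w x - w y)\<^sup>2 + 3 * (W / c0)\<^sup>2 * (u x - u y)\<^sup>2 + 3 * (indicator {..<3 * e} (depth \<Omega> x) * (w x)\<^sup>2)"
          by (auto simp: power_mult_distrib power_divide indicator_def)
        finally have "ennreal ((m x y)\<^sup>2) \<le> ennreal (3 * (w x - w y)\<^sup>2 + 3 * (W / c0)\<^sup>2 * (u x - u y)\<^sup>2 + 3 * (indicator {..<3 * e} (depth \<Omega> x) * (w x)\<^sup>2))"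
          unfolding m_def by (rule ennreal_leI)
        also have "\<dots> = 3 * ennreal ((w x - w y)\<^sup>2) + ennreal (3 * (W / c0)\<^sup>2) * ennreal ((u x - u y)\<^sup>2)
            + 3 * (indicator {..<3 * e} (depth \<Omega> x) * ennreal ((w x)\<^sup>2))"
          by (simp add: ennreal_plus ennreal_mult indicator_def)
        finally show "indicator {..<e} (dist x y) * ennreal ((m x y)\<^sup>2) \<le>
            3 * (indicator {..<e} (dist x y) * ennreal ((w x - w y)\<^sup>2))
          + ennreal (3 * (W / c0)\<^sup>2) * (indicator {..<e} (dist x y) * ennreal ((u x - u y)\<^sup>2))
          + 3 * (indicator {..<3 * e} (depth \<Omega> x) * ennreal ((w x)\<^sup>2)) * indicator (ball x e) y"
          by (cases "dist x y < e") (simp_all add: indicator_def)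
      qed
      also have "\<dots> = 3 * (\<integral>\<^sup>+y. indicator {..<e} (dist x y) * ennreal ((w x - w y)\<^sup>2) \<partial>lborel)
        + ennreal (3 * (W / c0)\<^sup>2) * (\<integral>\<^sup>+y. indicator {..<e} (dist x y) * ennreal ((u x - u y)\<^sup>2) \<partial>lborel)
        + 3 * (indicator {..<3 * e} (depth \<Omega> x) * ennreal ((w x)\<^sup>2)) * (\<integral>\<^sup>+y. indicator (ball x e) y \<partial>lborel)"
      proof (rule nn_integral_lincomb3)
        show "(\<lambda>y. indicator {..<e} (dist x y) * ennreal ((w x - w y)\<^sup>2)) \<in> borel_measurable lborel" by measurable
        show "(\<lambda>y. indicator {..<e} (dist x y) * ennreal ((u x - u y)\<^sup>2)) \<in> borel_measurable lborel" by measurable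
        show "(\<lambda>y. indicator (ball x e) y) \<in> borel_measurable lborel"
          by (intro borel_measurable_indicator) simp
      qed
      also have "(\<integral>\<^sup>+y. indicator (ball x e) y \<partial>lborel) = ennreal V"
        by (subst nn_integral_indicator) (simp_all add: emV)
      finally show ?thesis using V0 by (simp add: ennreal_mult mult_ac)
    qed
    have intN: "(\<integral>\<^sup>+x. indicator {x. e < depth \<Omega> x} x * N x \<partial>lborel) \<le> ennreal (L * (e ^ ?n * s\<^sup>2))"
    proof -
      have "(\<integral>\<^sup>+x. indicator {x. e < depth \<Omega> x} x * N x \<partial>lborel)
        \<le> (\<integral>\<^sup>+x. 3 * (indicator {x. e < depth \<Omega> x} x * (\<integral>\<^sup>+y. indicator {..<e} (dist x y) * ennreal ((w x - w y)\<^sup>2) \<partial>lborel))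
          + ennreal (3 * (W / c0)\<^sup>2) * (indicator {x. e < depth \<Omega> x} x * (\<integral>\<^sup>+y. indicator {..<e} (dist x y) * ennreal ((u x - u y)\<^sup>2) \<partial>lborel))
          + ennreal (3 * V) * (indicator {x\<in>\<Omega>. depth \<Omega> x < 3 * e} x * ennreal ((w x)\<^sup>2)) \<partial>lborel)"
      proof (rule nn_integral_mono)
        fix x
        have "x \<in> \<Omega>" if "e < depth \<Omega> x" using that e depth_pos_iff[of x] by linarith
        then show "indicator {x. e < depth \<Omega> x} x * N x \<le>
          3 * (indicator {x. e < depth \<Omega> x} x * (\<integral>\<^sup>+y. indicator {..<e} (dist x y) * ennreal ((w x - w y)\<^sup>2) \<partial>lborel))
          + ennreal (3 * (W / c0)\<^sup>2) * (indicator {x. e < depth \<Omega> x} x * (\<integral>\<^sup>+y. indicator {..<e} (dist x y) * ennreal ((u x - u y)\<^sup>2) \<partial>lborel))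
          + ennreal (3 * V) * (indicator {x\<in>\<Omega>. depth \<Omega> x < 3 * e} x * ennreal ((w x)\<^sup>2))"
          using Nle[of x] by (cases "e < depth \<Omega> x") (simp_all add: indicator_def)
      qed
      also have "\<dots> = 3 * osc \<Omega> e w + ennreal (3 * (W / c0)\<^sup>2) * osc \<Omega> e u + ennreal (3 * V) * layer \<Omega> (3 * e) w"
        unfolding osc_def layer_def by (rule nn_integral_lincomb3) measurable
      also have "\<dots> \<le> 3 * ennreal (K * (e ^ ?n * s\<^sup>2)) + ennreal (3 * (W / c0)\<^sup>2) * ennreal (K * (e ^ ?n * s\<^sup>2))
          + ennreal (3 * V) * ennreal (K * s\<^sup>2)"
        by (intro add_mono mult_left_mono ow ou lw) auto
      also have "\<dots> = ennreal (3 * (K * (e ^ ?n * s\<^sup>2)) + 3 * (W / c0)\<^sup>2 * (K * (e ^ ?n * s\<^sup>2)) + 3 * V * (K * s\<^sup>2))"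
        using K e V0 by (simp add: ennreal_plus ennreal_mult)
      also have "3 * (K * (e ^ ?n * s\<^sup>2)) + 3 * (W / c0)\<^sup>2 * (K * (e ^ ?n * s\<^sup>2)) + 3 * V * (K * s\<^sup>2) = L * (e ^ ?n * s\<^sup>2)"
        by (simp add: L_def V algebra_simps)
      finally show ?thesis .
    qed
    define v where "v x = w x / u x" for x
    \<comment> \<open>Cutting at \<open>2 * e\<close> leaves room for the mollification radius
      \<open>e\<close>: the convolution is supported at depth at least \<open>e\<close>, in a
      compact subset of \<open>\<Omega>\<close>.\<close>
    define v0 where "v0 x = (if 2 * e \<le> depth \<Omega> x then v x else 0)" for x
    have u0: "u x \<noteq> 0" for x using c0(1) c0(2)[of x] by auto
    have vb: "\<bar>v x\<bar> \<le> W / c0" for x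
      using W[of x] c0(1) c0(2)[of x] W0 unfolding v_def abs_divide by (intro frac_le) auto
    have v0b: "\<bar>v0 x\<bar> \<le> W / c0" for x using vb[of x] W0 c0(1) by (simp add: v0_def)
    have v0m[measurable]: "v0 \<in> borel_measurable borel" unfolding v0_def v_def by measurable
    have v00: "v0 x = 0" if "x \<notin> \<Omega>" for x
      using that e depth_pos_iff[of x] by (auto simp: v0_def)
    have v0i: "integrable lborel v0" by (rule integrable_bounded_support[OF v0m bdd v0b v00])
    let ?\<psi> = "conv v0 (moll e)"
    have mc: "moll e \<in> Cc_inf (UNIV :: (real^'d) set)" by (rule moll_Cc_inf[OF e])
    have \<psi>: "?\<psi> \<in> Cc_inf \<Omega>"
    proof (rule conv_Cc_inf[OF v0i mc moll_eq_0[OF e] _ compact_depth_ge[OF e] depth_ge_subset[OF e]])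
      show "v0 y = 0" if "y \<notin> {y. 2 * e \<le> depth \<Omega> y}" for y using that by (simp add: v0_def)
      show "x \<in> {x. e \<le> depth \<Omega> x}" if "y \<in> {y. 2 * e \<le> depth \<Omega> y}" "norm (x - y) < e" for x y
        using depth_le[of y x] that by (simp add: dist_norm norm_minus_commute)
    qed
    \<comment> \<open>If \<open>y\<close> is kept,
      \<open>u x * (v y - v x) = (w y - w x) + v y * (u x - u y)\<close> with \<open>v\<close>
      bounded; if \<open>y\<close> is cut off, the difference is \<open>- v x\<close> and
      \<open>u x * v x = w x\<close>. The weight \<open>c0\<close> serves the derivatives of the
      test function, the weight \<open>|u x|\<close> its error.\<close>
    have near: "c0 * \<bar>v0 y - v x\<bar> \<le> m x y \<and> \<bar>u x\<bar> * \<bar>v0 y - v x\<bar> \<le> m x y" if "e < depth \<Omega> x" "dist x y < e" for x y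
    proof (cases "2 * e \<le> depth \<Omega> y")
      case True
      have "u x * (v0 y - v x) = (w y - w x) + w y / u y * (u x - u y)"
        using True u0 by (simp add: v0_def v_def field_simps)
      then have "\<bar>u x\<bar> * \<bar>v0 y - v x\<bar> = \<bar>(w y - w x) + v y * (u x - u y)\<bar>"
        unfolding abs_mult[symmetric] v_def by simp
      also have "\<dots> \<le> \<bar>w x - w y\<bar> + W / c0 * \<bar>u x - u y\<bar>"
        using mult_right_mono[OF vb[of y], of "\<bar>u x - u y\<bar>"] abs_triangle_ineq[of "w y - w x" "v y * (u x - u y)"]
        by (simp add: abs_mult abs_minus_commute)
      also have "\<dots> \<le> m x y" by (simp add: m_def)
      finally have "\<bar>u x\<bar> * \<bar>v0 y - v x\<bar> \<le> m x y" .
      then show ?thesis using mult_right_mono[OF c0(2)[of x], of "\<bar>v0 y - v x\<bar>"] by simp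
    next
      case False
      then have "depth \<Omega> x < 3 * e" using depth_le[of x y] that by simp
      then have "\<bar>w x\<bar> \<le> m x y" using W0 c0(1) by (simp add: m_def)
      moreover have "\<bar>u x\<bar> * \<bar>v0 y - v x\<bar> = \<bar>w x\<bar>" using False u0[of x] by (simp add: v0_def v_def)
      ultimately show ?thesis using mult_right_mono[OF c0(2)[of x], of "\<bar>v0 y - v x\<bar>"] by simp
    qed
    define I where "I x = (\<integral>\<^sup>+y. indicator {..<e} (dist x y) * ennreal ((v0 y - v x)\<^sup>2) \<partial>lborel)" for x
    have IN: "ennreal (k\<^sup>2) * I x \<le> N x"
      if k: "\<And>y. dist x y < e \<Longrightarrow> \<bar>k\<bar> * \<bar>v0 y - v x\<bar> \<le> m x y" for k x
    proof -
      have "ennreal (k\<^sup>2) * I x = (\<integral>\<^sup>+y. ennreal (k\<^sup>2) * (indicator {..<e} (dist x y) * ennreal ((v0 y - v x)\<^sup>2)) \<partial>lborel)"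
        unfolding I_def by (rule nn_integral_cmult[symmetric]) measurable
      also have "\<dots> \<le> N x" unfolding N_def
      proof (rule nn_integral_mono)
        fix y
        show "ennreal (k\<^sup>2) * (indicator {..<e} (dist x y) * ennreal ((v0 y - v x)\<^sup>2)) \<le> indicator {..<e} (dist x y) * ennreal ((m x y)\<^sup>2)"
        proof (cases "dist x y < e")
          case True
          have "(\<bar>k\<bar> * \<bar>v0 y - v x\<bar>)\<^sup>2 \<le> (m x y)\<^sup>2" by (rule power_mono[OF k[OF True]]) simp
          then have "ennreal (k\<^sup>2 * (v0 y - v x)\<^sup>2) \<le> ennreal ((m x y)\<^sup>2)"
            by (intro ennreal_leI) (simp add: power_mult_distrib)
          then show ?thesis using True by (simp add: ennreal_mult)
        qed simp
      qed
      finally show ?thesis .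
    qed
    have far0: "conv v0 \<eta> x = 0" if "depth \<Omega> x \<le> e" "\<And>z. norm z \<ge> e \<Longrightarrow> \<eta> z = 0" for \<eta> x
    proof -
      have "v0 y * \<eta> (x - y) = 0" for y
      proof (cases "2 * e \<le> depth \<Omega> y")
        case True
        then have "norm (x - y) \<ge> e" using depth_le[of y x] that(1) by (simp add: dist_norm norm_minus_commute)
        then show ?thesis using that(2) by simp
      qed (simp add: v0_def)
      then have "(\<lambda>y. v0 y * \<eta> (x - y)) = (\<lambda>y. 0)" by (rule ext)
      then show ?thesis by (simp only: conv_def) simp
    qed
    \<comment> \<open>Here \<open>k\<close> counts the derivatives on the kernel. As the kernel has
      integral 0, any constant may be subtracted from \<open>v0\<close>; the choice is
      \<open>v x\<close>.\<close>
    have deriv: "(\<integral>\<^sup>+x. ennreal ((conv v0 \<eta> x)\<^sup>2) \<partial>lborel) \<le> ennreal (K' * (s / e ^ k)\<^sup>2)"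
      if \<eta>: "\<eta> \<in> Cc_inf UNIV" "\<And>x. \<bar>\<eta> x\<bar> \<le> B / e ^ (?n + k)" "\<And>z. norm z \<ge> e \<Longrightarrow> \<eta> z = 0"
        "(LINT y|lborel. \<eta> y) = 0" for \<eta> k
    proof -
      let ?c = "(B / e ^ (?n + k))\<^sup>2 * V / c0\<^sup>2"
      have c: "?c \<ge> 0" using V0 by simp
      have "ennreal ((conv v0 \<eta> x)\<^sup>2) \<le> ennreal ?c * (indicator {x. e < depth \<Omega> x} x * N x)" for x
      proof (cases "e < depth \<Omega> x")
        case True
        have "ennreal ((conv v0 \<eta> x)\<^sup>2) \<le> ennreal ((B / e ^ (?n + k))\<^sup>2 * V) * I x"
          using conv_deviation[OF v0i \<eta>(1,2,3) e, of x "v x"] unfolding I_def V_def \<eta>(4) by simp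
        also have "\<dots> = ennreal ?c * (ennreal (c0\<^sup>2) * I x)"
          using c0(1) V0 by (simp add: mult.assoc[symmetric] ennreal_mult[symmetric])
        also have "\<dots> \<le> ennreal ?c * N x"
          using near[OF True] c0(1) by (intro mult_left_mono IN) auto
        finally show ?thesis using True by simp
      next
        case False
        then show ?thesis using far0[OF _ \<eta>(3), of x] by simp
      qed
      then have "(\<integral>\<^sup>+x. ennreal ((conv v0 \<eta> x)\<^sup>2) \<partial>lborel)
          \<le> (\<integral>\<^sup>+x. ennreal ?c * (indicator {x. e < depth \<Omega> x} x * N x) \<partial>lborel)"
        by (rule nn_integral_mono)
      also have "\<dots> = ennreal ?c * (\<integral>\<^sup>+x. indicator {x. e < depth \<Omega> x} x * N x \<partial>lborel)"
        by (rule nn_integral_cmult) measurable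
      also have "\<dots> \<le> ennreal ?c * ennreal (L * (e ^ ?n * s\<^sup>2))"
        by (intro mult_left_mono intN) simp
      also have "\<dots> = ennreal (?c * (L * (e ^ ?n * s\<^sup>2)))" using c L0 e by (intro ennreal_mult[symmetric]) auto
      \<comment> \<open>The kernel contributes \<open>e^(-2(d+k))\<close>, the ball volume
        \<open>e^d\<close> and the oscillation \<open>e^d\<close>; what remains is
        \<open>e^(-2k)\<close>.\<close>
      also have "?c * (L * (e ^ ?n * s\<^sup>2)) = (K1 / c0\<^sup>2) * (s / e ^ k)\<^sup>2"
        using e c0(1) by (simp add: K1_def V field_simps power_add power2_eq_square)
      also have "ennreal ((K1 / c0\<^sup>2) * (s / e ^ k)\<^sup>2) \<le> ennreal (K' * (s / e ^ k)\<^sup>2)"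
        by (intro ennreal_leI mult_right_mono K') simp
      finally show ?thesis .
    qed
    have \<eta>1: "pd i (moll e) \<in> Cc_inf (UNIV::(real^'d) set)" "norm z \<ge> e \<Longrightarrow> pd i (moll e) z = 0" for i and z :: "real^'d"
      by (rule Cc_inf_pd[OF mc], rule pd_eq_0_outside[OF smooth_moll moll_eq_0[OF e] e])
    have \<eta>2: "pd i (pd i (moll e)) \<in> Cc_inf (UNIV::(real^'d) set)" "norm z \<ge> e \<Longrightarrow> pd i (pd i (moll e)) z = 0" for i and z :: "real^'d"
      by (rule Cc_inf_pd[OF \<eta>1(1)], rule pd_eq_0_outside[OF smooth_pd[OF smooth_moll] \<eta>1(2) e])
    have err: "(\<integral>\<^sup>+x. indicator \<Omega> x * ennreal ((w x - u x * ?\<psi> x)\<^sup>2) \<partial>lborel) \<le> ennreal (K' * s\<^sup>2)"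
    proof -
      let ?c = "(B / e ^ ?n)\<^sup>2 * V"
      have c: "?c \<ge> 0" using V0 by simp
      have "indicator \<Omega> x * ennreal ((w x - u x * ?\<psi> x)\<^sup>2) \<le> ennreal ?c * (indicator {x. e < depth \<Omega> x} x * N x)
          + indicator {x \<in> \<Omega>. depth \<Omega> x < 3 * e} x * ennreal ((w x)\<^sup>2)" for x
      proof (cases "e < depth \<Omega> x")
        case True
        have "ennreal ((?\<psi> x - v x)\<^sup>2) \<le> ennreal ?c * I x"
          using conv_deviation[OF v0i mc B(2)[OF e] moll_eq_0[OF e] e, of x "v x"]
          unfolding I_def V_def integral_moll[OF e] by simp
        then have "ennreal ((u x)\<^sup>2) * ennreal ((?\<psi> x - v x)\<^sup>2) \<le> ennreal ((u x)\<^sup>2) * (ennreal ?c * I x)"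
          by (rule mult_left_mono) simp
        also have "\<dots> = ennreal ?c * (ennreal ((u x)\<^sup>2) * I x)" by (simp add: mult_ac)
        also have "\<dots> \<le> ennreal ?c * N x"
          using near[OF True] by (intro mult_left_mono IN) auto
        also have "ennreal ((u x)\<^sup>2) * ennreal ((?\<psi> x - v x)\<^sup>2) = ennreal ((w x - u x * ?\<psi> x)\<^sup>2)"
        proof -
          have "w x - u x * ?\<psi> x = u x * (v x - ?\<psi> x)" using u0[of x] by (simp add: v_def field_simps)
          then show ?thesis by (simp add: power_mult_distrib power2_commute ennreal_mult)
        qed
        finally have "ennreal ((w x - u x * ?\<psi> x)\<^sup>2) \<le> ennreal ?c * N x" .
        then show ?thesis using True by (cases "x \<in> \<Omega>") (simp_all add: add_increasing2)
      next
        case False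
        then have "?\<psi> x = 0" by (intro far0 moll_eq_0[OF e]) auto
        then show ?thesis using False e by (cases "x \<in> \<Omega>") simp_all
      qed
      then have "(\<integral>\<^sup>+x. indicator \<Omega> x * ennreal ((w x - u x * ?\<psi> x)\<^sup>2) \<partial>lborel)
        \<le> (\<integral>\<^sup>+x. ennreal ?c * (indicator {x. e < depth \<Omega> x} x * N x) + indicator {x \<in> \<Omega>. depth \<Omega> x < 3 * e} x * ennreal ((w x)\<^sup>2) \<partial>lborel)"
        by (rule nn_integral_mono)
      also have "\<dots> = ennreal ?c * (\<integral>\<^sup>+x. indicator {x. e < depth \<Omega> x} x * N x \<partial>lborel) + layer \<Omega> (3 * e) w"
        unfolding layer_def by (subst nn_integral_add) (measurable, simp add: nn_integral_cmult)
      also have "\<dots> \<le> ennreal ?c * ennreal (L * (e ^ ?n * s\<^sup>2)) + ennreal (K * s\<^sup>2)"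
        by (intro add_mono mult_left_mono intN lw) simp
      also have "\<dots> = ennreal (?c * (L * (e ^ ?n * s\<^sup>2)) + K * s\<^sup>2)"
        using c L0 e K by (subst ennreal_mult[symmetric]; (subst ennreal_plus[symmetric])?) auto
      also have "?c * (L * (e ^ ?n * s\<^sup>2)) + K * s\<^sup>2 = (K1 + K) * s\<^sup>2"
        using e by (simp add: K1_def V field_simps power2_eq_square)
      also have "ennreal ((K1 + K) * s\<^sup>2) \<le> ennreal (K' * s\<^sup>2)"
        by (intro ennreal_leI mult_right_mono K') simp
      finally show ?thesis .
    qed
    show "\<exists>\<psi>\<in>Cc_inf \<Omega>. (\<forall>x. \<bar>\<psi> x\<bar> \<le> W / c0) \<and>
        (\<integral>\<^sup>+x. indicator \<Omega> x * ennreal ((w x - u x * \<psi> x)\<^sup>2) \<partial>lborel) \<le> ennreal (K' * s\<^sup>2) \<and>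
        (\<forall>i. (\<integral>\<^sup>+x. ennreal ((pd i \<psi> x)\<^sup>2) \<partial>lborel) \<le> ennreal (K' * (s / e)\<^sup>2)) \<and>
        (\<forall>i. (\<integral>\<^sup>+x. ennreal ((pd i (pd i \<psi>) x)\<^sup>2) \<partial>lborel) \<le> ennreal (K' * (s / e\<^sup>2)\<^sup>2))"
    proof (intro bexI[OF _ \<psi>] conjI allI err)
      show "\<bar>?\<psi> x\<bar> \<le> W / c0" for x by (rule conv_moll_bounded[OF v0m v0b e])
      show "(\<integral>\<^sup>+x. ennreal ((pd i ?\<psi> x)\<^sup>2) \<partial>lborel) \<le> ennreal (K' * (s / e)\<^sup>2)" for i
        using deriv[OF \<eta>1(1) B(3)[OF e] \<eta>1(2) integral_pd_eq_0[OF mc], of i] unfolding pd_conv[OF v0i mc] by simp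
      show "(\<integral>\<^sup>+x. ennreal ((pd i (pd i ?\<psi>) x)\<^sup>2) \<partial>lborel) \<le> ennreal (K' * (s / e\<^sup>2)\<^sup>2)" for i
        using deriv[OF \<eta>2(1) B(4)[OF e] \<eta>2(2) integral_pd_eq_0[OF \<eta>1(1)], of i]
        unfolding pd_conv[OF v0i mc] pd_conv[OF v0i \<eta>1(1)] by simp
    qed
  qed
qed

end

section \<open>Mean oscillation\<close>

definition grad_sq :: "(real^'d::finite \<Rightarrow> real) \<Rightarrow> real^'d \<Rightarrow> real" where
  "grad_sq \<phi> x = (\<Sum>i\<in>UNIV. (pd i \<phi> x)\<^sup>2)"

lemma grad_sq_nonneg: "grad_sq \<phi> x \<ge> 0"
  by (simp add: grad_sq_def sum_nonneg)

lemma borel_grad_sq: "smooth \<phi> \<Longrightarrow> grad_sq \<phi> \<in> borel_measurable borel"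
  unfolding grad_sq_def[abs_def] by (intro borel_measurable_sum borel_measurable_power smooth_borel smooth_pd)

text \<open>Fundamental theorem of calculus along the segment, then Cauchy-Schwarz twice: in the
  parameter \<open>t\<close> and over the coordinates.\<close>

lemma smooth_increment_le:
  fixes \<phi> :: "real^'d::finite \<Rightarrow> real"
  assumes \<phi>: "smooth \<phi>"
  shows "ennreal ((\<phi> (x + z) - \<phi> x)\<^sup>2)
    \<le> ennreal ((norm z)\<^sup>2) * (\<integral>\<^sup>+t. indicator {0..1} t * ennreal (grad_sq \<phi> (x + t *\<^sub>R z)) \<partial>lborel)"
proof -
  note [measurable] = borel_grad_sq[OF \<phi>]
  let ?g = "\<lambda>t. \<Sum>i\<in>UNIV. z $ i * pd i \<phi> (x + t *\<^sub>R z)"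
  have der: "((\<lambda>t. \<phi> (x + t *\<^sub>R z)) has_vector_derivative ?g t) (at t within {0..1})" for t
  proof -
    have "((\<lambda>t. \<phi> (x + t *\<^sub>R z)) has_derivative (\<lambda>s. \<Sum>i\<in>UNIV. (s *\<^sub>R z) $ i * pd i \<phi> (x + t *\<^sub>R z))) (at t)"
      by (rule has_derivative_compose[OF _ has_derivative_pd[OF smooth_differentiable[OF \<phi>]]])
         (auto intro!: derivative_eq_intros)
    then have "((\<lambda>t. \<phi> (x + t *\<^sub>R z)) has_vector_derivative ?g t) (at t)"
      unfolding has_vector_derivative_def
      by (rule has_derivative_eq_rhs) (auto simp: sum_distrib_right sum_distrib_left mult_ac)
    then show ?thesis by (rule has_vector_derivative_at_within)
  qed
  have cont: "continuous_on UNIV ?g"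
    by (intro continuous_intros continuous_on_compose2[OF smooth_continuous_on[OF smooth_pd[OF \<phi>], of UNIV]]) auto
  then have gm[measurable]: "?g \<in> borel_measurable borel" by (rule borel_measurable_continuous_onI)
  have "\<phi> (x + z) - \<phi> x = (LINT t|lborel. indicator {0..1} t *\<^sub>R ?g t)"
    using integral_FTC_atLeastAtMost[of 0 1 "\<lambda>t. \<phi> (x + t *\<^sub>R z)" ?g] der continuous_on_subset[OF cont] by simp
  moreover have int: "integrable lborel (\<lambda>t. indicator {0..1} t *\<^sub>R ?g t)"
    by (rule borel_integrable_compact[OF compact_Icc continuous_on_subset[OF cont subset_UNIV]])
  ultimately have "ennreal \<bar>\<phi> (x + z) - \<phi> x\<bar> \<le> (\<integral>\<^sup>+t. ennreal \<bar>indicator {0..1} t *\<^sub>R ?g t\<bar> \<partial>lborel)"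
    unfolding nn_integral_eq_integral_abs[OF int] by (intro ennreal_leI) simp
  also have "\<dots> = (\<integral>\<^sup>+t. indicator {0..1} t * (indicator {0..1} t * ennreal \<bar>?g t\<bar>) \<partial>lborel)"
    by (intro nn_integral_cong) (simp add: indicator_def)
  finally have "(ennreal \<bar>\<phi> (x + z) - \<phi> x\<bar>)\<^sup>2 \<le> (\<integral>\<^sup>+t. indicator {0..1} t * (indicator {0..1} t * ennreal \<bar>?g t\<bar>) \<partial>lborel)\<^sup>2"
    by (rule power_mono) simp
  also have "\<dots> \<le> (\<integral>\<^sup>+t. (indicator {0..1::real} t)\<^sup>2 \<partial>lborel) * (\<integral>\<^sup>+t. (indicator {0..1} t * ennreal \<bar>?g t\<bar>)\<^sup>2 \<partial>lborel)"
    by (rule Cauchy_Schwarz_nn_integral) (simp, measurable)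
  also have "(\<integral>\<^sup>+t. (indicator {0..1::real} t)\<^sup>2 \<partial>lborel) = (1::ennreal)"
  proof -
    have "(\<integral>\<^sup>+t. (indicator {0..1::real} t)\<^sup>2 \<partial>lborel) = (\<integral>\<^sup>+t. (indicator {0..1::real} t :: ennreal) \<partial>lborel)"
      by (intro nn_integral_cong) (simp add: indicator_def)
    then show ?thesis by simp
  qed
  also have "1 * (\<integral>\<^sup>+t. (indicator {0..1} t * ennreal \<bar>?g t\<bar>)\<^sup>2 \<partial>lborel)
      \<le> (\<integral>\<^sup>+t. ennreal ((norm z)\<^sup>2) * (indicator {0..1} t * ennreal (grad_sq \<phi> (x + t *\<^sub>R z))) \<partial>lborel)"
    unfolding mult_1
  proof (rule nn_integral_mono)
    fix t :: real
    have "(?g t)\<^sup>2 \<le> (\<Sum>i\<in>UNIV. (z $ i)\<^sup>2) * grad_sq \<phi> (x + t *\<^sub>R z)"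
      unfolding grad_sq_def by (rule Cauchy_Schwarz_ineq_sum)
    also have "(\<Sum>i\<in>UNIV. (z $ i)\<^sup>2) = (norm z)\<^sup>2"
      by (simp add: norm_vec_def L2_set_def sum_nonneg)
    finally have "ennreal ((?g t)\<^sup>2) \<le> ennreal ((norm z)\<^sup>2 * grad_sq \<phi> (x + t *\<^sub>R z))" by (rule ennreal_leI)
    then show "(indicator {0..1} t * ennreal \<bar>?g t\<bar>)\<^sup>2 \<le> ennreal ((norm z)\<^sup>2) * (indicator {0..1} t * ennreal (grad_sq \<phi> (x + t *\<^sub>R z)))"
      by (simp add: indicator_def ennreal_power ennreal_mult grad_sq_nonneg)
  qed
  also have "\<dots> = ennreal ((norm z)\<^sup>2) * (\<integral>\<^sup>+t. indicator {0..1} t * ennreal (grad_sq \<phi> (x + t *\<^sub>R z)) \<partial>lborel)"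
    by (rule nn_integral_cmult) measurable
  finally show ?thesis by (simp add: ennreal_power)
qed

text \<open>The pointwise bound is integrated over \<open>X\<close> and the order of integration
  exchanged; for each \<open>t\<close> a translation turns the inner integral into one over
  \<open>Y\<close>, which contains every segment starting in \<open>X\<close>.\<close>

lemma translation_gradient:
  fixes \<phi> :: "real^'d::finite \<Rightarrow> real"
  assumes \<phi>: "smooth \<phi>" and [measurable]: "X \<in> sets borel" "Y \<in> sets borel"
    and XY: "\<And>x t. x \<in> X \<Longrightarrow> 0 \<le> t \<Longrightarrow> t \<le> 1 \<Longrightarrow> x + t *\<^sub>R z \<in> Y"
  shows "(\<integral>\<^sup>+x. indicator X x * ennreal ((\<phi> (x + z) - \<phi> x)\<^sup>2) \<partial>lborel)
    \<le> ennreal ((norm z)\<^sup>2) * (\<integral>\<^sup>+x. indicator Y x * ennreal (grad_sq \<phi> x) \<partial>lborel)"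
proof -
  note [measurable] = borel_grad_sq[OF \<phi>]
  let ?G = "\<integral>\<^sup>+x. indicator Y x * ennreal (grad_sq \<phi> x) \<partial>lborel"
  have "(\<integral>\<^sup>+x. indicator X x * ennreal ((\<phi> (x + z) - \<phi> x)\<^sup>2) \<partial>lborel)
    \<le> (\<integral>\<^sup>+x. ennreal ((norm z)\<^sup>2) * (\<integral>\<^sup>+t. indicator X x * (indicator {0..1} t * ennreal (grad_sq \<phi> (x + t *\<^sub>R z))) \<partial>lborel) \<partial>lborel)"
  proof (rule nn_integral_mono)
    fix x
    have "indicator X x * ennreal ((\<phi> (x + z) - \<phi> x)\<^sup>2) \<le> indicator X x * (ennreal ((norm z)\<^sup>2) * (\<integral>\<^sup>+t. indicator {0..1} t * ennreal (grad_sq \<phi> (x + t *\<^sub>R z)) \<partial>lborel))"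
      by (intro mult_left_mono smooth_increment_le[OF \<phi>]) simp
    also have "\<dots> = ennreal ((norm z)\<^sup>2) * (indicator X x * (\<integral>\<^sup>+t. indicator {0..1} t * ennreal (grad_sq \<phi> (x + t *\<^sub>R z)) \<partial>lborel))"
      by (simp add: mult_ac)
    also have "indicator X x * (\<integral>\<^sup>+t. indicator {0..1} t * ennreal (grad_sq \<phi> (x + t *\<^sub>R z)) \<partial>lborel)
      = (\<integral>\<^sup>+t. indicator X x * (indicator {0..1} t * ennreal (grad_sq \<phi> (x + t *\<^sub>R z))) \<partial>lborel)"
      by (rule nn_integral_cmult[symmetric]) measurable
    finally show "indicator X x * ennreal ((\<phi> (x + z) - \<phi> x)\<^sup>2) \<le> ennreal ((norm z)\<^sup>2) * (\<integral>\<^sup>+t. indicator X x * (indicator {0..1} t * ennreal (grad_sq \<phi> (x + t *\<^sub>R z))) \<partial>lborel)" .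
  qed
  also have "\<dots> = ennreal ((norm z)\<^sup>2) * (\<integral>\<^sup>+x. \<integral>\<^sup>+t. indicator X x * (indicator {0..1} t * ennreal (grad_sq \<phi> (x + t *\<^sub>R z))) \<partial>lborel \<partial>lborel)"
    by (rule nn_integral_cmult) measurable
  also have "(\<integral>\<^sup>+x. \<integral>\<^sup>+t. indicator X x * (indicator {0..1} t * ennreal (grad_sq \<phi> (x + t *\<^sub>R z))) \<partial>lborel \<partial>lborel)
      = (\<integral>\<^sup>+t. \<integral>\<^sup>+x. indicator X x * (indicator {0..1::real} t * ennreal (grad_sq \<phi> (x + t *\<^sub>R z))) \<partial>lborel \<partial>lborel)"
    by (rule pair_sigma_finite.Fubini'[OF pair_sigma_finite.intro[OF sigma_finite_lborel sigma_finite_lborel]]) measurable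
  also have "\<dots> \<le> (\<integral>\<^sup>+t. indicator {0..1::real} t * ?G \<partial>lborel)"
  proof (rule nn_integral_mono)
    fix t :: real
    show "(\<integral>\<^sup>+x. indicator X x * (indicator {0..1} t * ennreal (grad_sq \<phi> (x + t *\<^sub>R z))) \<partial>lborel) \<le> indicator {0..1} t * ?G"
    proof (cases "t \<in> {0..1}")
      case True
      have "(\<integral>\<^sup>+x. indicator X x * (indicator {0..1} t * ennreal (grad_sq \<phi> (x + t *\<^sub>R z))) \<partial>lborel)
        \<le> (\<integral>\<^sup>+x. indicator Y (x + t *\<^sub>R z) * ennreal (grad_sq \<phi> (x + t *\<^sub>R z)) \<partial>lborel)"
        using True XY by (intro nn_integral_mono) (auto simp: indicator_def)
      also have "\<dots> = ?G" by (rule nn_integral_lborel_translation) measurable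
      finally show ?thesis using True by simp
    qed simp
  qed
  also have "\<dots> = ?G" by (simp add: nn_integral_multc)
  finally show ?thesis by (simp add: mult_left_mono)
qed

context bounded_open
begin

text \<open>By Fubini the oscillation becomes an integral over shifts, so that estimates for a
  single translation can be integrated over a ball.\<close>

lemma osc_translation:
  assumes [measurable]: "w \<in> borel_measurable borel"
  shows "osc \<Omega> e w = (\<integral>\<^sup>+z. indicator (ball 0 e) z * (\<integral>\<^sup>+x. indicator {x. e < depth \<Omega> x} x * ennreal ((w (x + z) - w x)\<^sup>2) \<partial>lborel) \<partial>lborel)"
proof -
  have "(\<integral>\<^sup>+y. indicator {..<e} (dist x y) * ennreal ((w x - w y)\<^sup>2) \<partial>lborel)
    = (\<integral>\<^sup>+z. indicator {..<e} (norm z) * ennreal ((w (x + z) - w x)\<^sup>2) \<partial>lborel)" for x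
    using nn_integral_lborel_translation[of "\<lambda>y. indicator {..<e} (dist x y) * ennreal ((w x - w y)\<^sup>2)" x]
    by (simp add: dist_norm add.commute power2_commute)
  then have "osc \<Omega> e w = (\<integral>\<^sup>+x. indicator {x. e < depth \<Omega> x} x * (\<integral>\<^sup>+z. indicator {..<e} (norm z) * ennreal ((w (x + z) - w x)\<^sup>2) \<partial>lborel) \<partial>lborel)"
    by (simp add: osc_def)
  also have "\<dots> = (\<integral>\<^sup>+x. \<integral>\<^sup>+z. indicator {x. e < depth \<Omega> x} x * (indicator {..<e} (norm z) * ennreal ((w (x + z) - w x)\<^sup>2)) \<partial>lborel \<partial>lborel)"
    by (intro nn_integral_cong nn_integral_cmult[symmetric]) measurable
  also have "\<dots> = (\<integral>\<^sup>+z. \<integral>\<^sup>+x. indicator {x. e < depth \<Omega> x} x * (indicator {..<e} (norm z) * ennreal ((w (x + z) - w x)\<^sup>2)) \<partial>lborel \<partial>lborel)"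
    by (rule lborel_pair.Fubini'[symmetric]) measurable
  also have "\<dots> = (\<integral>\<^sup>+z. indicator (ball 0 e) z * (\<integral>\<^sup>+x. indicator {x. e < depth \<Omega> x} x * ennreal ((w (x + z) - w x)\<^sup>2) \<partial>lborel) \<partial>lborel)"
  proof (intro nn_integral_cong)
    fix z :: "real^'d"
    have "(\<integral>\<^sup>+x. indicator {x. e < depth \<Omega> x} x * (indicator {..<e} (norm z) * ennreal ((w (x + z) - w x)\<^sup>2)) \<partial>lborel)
      = (\<integral>\<^sup>+x. indicator (ball 0 e) z * (indicator {x. e < depth \<Omega> x} x * ennreal ((w (x + z) - w x)\<^sup>2)) \<partial>lborel)"
      by (intro nn_integral_cong) (simp add: indicator_def)
    also have "\<dots> = indicator (ball 0 e) z * (\<integral>\<^sup>+x. indicator {x. e < depth \<Omega> x} x * ennreal ((w (x + z) - w x)\<^sup>2) \<partial>lborel)"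
      by (rule nn_integral_cmult) measurable
    finally show "(\<integral>\<^sup>+x. indicator {x. e < depth \<Omega> x} x * (indicator {..<e} (norm z) * ennreal ((w (x + z) - w x)\<^sup>2)) \<partial>lborel)
      = indicator (ball 0 e) z * (\<integral>\<^sup>+x. indicator {x. e < depth \<Omega> x} x * ennreal ((w (x + z) - w x)\<^sup>2) \<partial>lborel)" .
  qed
  finally show ?thesis .
qed

lemma emeasure_ball: "e \<ge> 0 \<Longrightarrow> emeasure lborel (ball (x::real^'d) e) = ennreal (unit_ball_vol (real CARD('d)) * e ^ CARD('d))"
  using emeasure_bounded_finite[of "ball x e"] content_ball[of e x]
  by (subst emeasure_eq_ennreal_measure) auto

lemma osc_le_translation:
  assumes [measurable]: "w \<in> borel_measurable borel" and e: "e > 0"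
    and le: "\<And>z. norm z < e \<Longrightarrow> (\<integral>\<^sup>+x. indicator {x. e < depth \<Omega> x} x * ennreal ((w (x + z) - w x)\<^sup>2) \<partial>lborel) \<le> ennreal c"
    and "c \<ge> 0"
  shows "osc \<Omega> e w \<le> ennreal (unit_ball_vol (real CARD('d)) * e ^ CARD('d) * c)"
proof -
  have "osc \<Omega> e w \<le> (\<integral>\<^sup>+(z::real^'d). ennreal c * indicator (ball 0 e) z \<partial>lborel)"
    unfolding osc_translation[OF assms(1)]
  proof (rule nn_integral_mono)
    fix z :: "real^'d"
    show "indicator (ball 0 e) z * (\<integral>\<^sup>+x. indicator {x. e < depth \<Omega> x} x * ennreal ((w (x + z) - w x)\<^sup>2) \<partial>lborel)
        \<le> ennreal c * indicator (ball 0 e) z"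
      using le[of z] by (cases "z \<in> ball 0 e") simp_all
  qed
  also have "\<dots> = ennreal c * emeasure lborel (ball (0::real^'d) e)"
    by (rule nn_integral_cmult_indicator) simp
  also have "\<dots> = ennreal (unit_ball_vol (real CARD('d)) * e ^ CARD('d) * c)"
    using e \<open>c \<ge> 0\<close> by (simp add: emeasure_ball ennreal_mult mult_ac)
  finally show ?thesis .
qed

lemma osc_gradient:
  assumes \<phi>: "smooth \<phi>" and e: "e > 0" and "G \<ge> 0"
    and G: "(\<integral>\<^sup>+x. indicator \<Omega> x * ennreal (grad_sq \<phi> x) \<partial>lborel) \<le> ennreal G"
  shows "osc \<Omega> e \<phi> \<le> ennreal (unit_ball_vol (real CARD('d)) * e ^ CARD('d) * (e\<^sup>2 * G))"
proof (rule osc_le_translation[OF smooth_borel[OF \<phi>] e])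
  fix z :: "real^'d" assume z: "norm z < e"
  have "(\<integral>\<^sup>+x. indicator {x. e < depth \<Omega> x} x * ennreal ((\<phi> (x + z) - \<phi> x)\<^sup>2) \<partial>lborel)
      \<le> ennreal ((norm z)\<^sup>2) * (\<integral>\<^sup>+x. indicator \<Omega> x * ennreal (grad_sq \<phi> x) \<partial>lborel)"
  proof (rule translation_gradient[OF \<phi> _ borel])
    show "{x. e < depth \<Omega> x} \<in> sets borel" by measurable
    show "x + t *\<^sub>R z \<in> \<Omega>" if "x \<in> {x. e < depth \<Omega> x}" "0 \<le> t" "t \<le> 1" for x t
    proof -
      have "dist x (x + t *\<^sub>R z) \<le> 1 * norm z"
        using that by (simp add: dist_norm mult_left_le_one_le)
      then have "depth \<Omega> (x + t *\<^sub>R z) > 0" using depth_le[of x "x + t *\<^sub>R z"] that z by simp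
      then show ?thesis by (simp add: depth_pos_iff)
    qed
  qed
  also have "\<dots> \<le> ennreal (e\<^sup>2) * ennreal G"
    using z by (intro mult_mono G ennreal_leI power_mono) auto
  finally show "(\<integral>\<^sup>+x. indicator {x. e < depth \<Omega> x} x * ennreal ((\<phi> (x + z) - \<phi> x)\<^sup>2) \<partial>lborel) \<le> ennreal (e\<^sup>2 * G)"
    using \<open>G \<ge> 0\<close> by (simp add: ennreal_mult)
qed (use \<open>G \<ge> 0\<close> in simp)

text \<open>Transfers an oscillation bound from a smooth approximant to \<open>w\<close>. The square
  of a sum of three terms gives the factor 3; the errors at \<open>x\<close> and at
  \<open>x + z\<close>, both points of \<open>\<Omega>\<close>, contribute \<open>3 * c\<close> each
  for every shift, hence the 6.\<close>

lemma osc_perturb: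
  assumes wm[measurable]: "w \<in> borel_measurable borel" and \<phi>m[measurable]: "\<phi> \<in> borel_measurable borel" and e: "e > 0"
    and d: "(\<integral>\<^sup>+x. indicator \<Omega> x * ennreal ((\<phi> x - w x)\<^sup>2) \<partial>lborel) \<le> ennreal c" "c \<ge> 0"
  shows "osc \<Omega> e w \<le> 3 * osc \<Omega> e \<phi> + ennreal (6 * unit_ball_vol (real CARD('d)) * e ^ CARD('d) * c)"
proof -
  let ?D = "\<lambda>x. indicator \<Omega> x * ennreal ((\<phi> x - w x)\<^sup>2)"
  let ?A = "{x. e < depth \<Omega> x}"
  have in\<Omega>: "x + z \<in> \<Omega>" "x \<in> \<Omega>" if "norm z < e" "x \<in> ?A" for x z
  proof -
    have "depth \<Omega> (x + z) > 0" using depth_le[of x "x + z"] that by (simp add: dist_norm)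
    then show "x + z \<in> \<Omega>" by (simp add: depth_pos_iff)
    show "x \<in> \<Omega>" using that e depth_pos_iff[of x] by simp
  qed
  have pw: "indicator ?A x * ennreal ((w (x + z) - w x)\<^sup>2)
      \<le> 3 * (indicator ?A x * ennreal ((\<phi> (x + z) - \<phi> x)\<^sup>2)) + 3 * ?D (x + z) + 3 * ?D x" if z: "norm z < e" for x z
  proof (cases "x \<in> ?A")
    case True
    have "(w (x + z) - w x)\<^sup>2 = ((\<phi> (x + z) - \<phi> x) + (w (x + z) - \<phi> (x + z)) + (\<phi> x - w x))\<^sup>2" by simp
    also have "\<dots> \<le> 3 * (\<phi> (x + z) - \<phi> x)\<^sup>2 + 3 * (w (x + z) - \<phi> (x + z))\<^sup>2 + 3 * (\<phi> x - w x)\<^sup>2"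
      by (rule power2_sum3_le)
    finally have "ennreal ((w (x + z) - w x)\<^sup>2) \<le> ennreal (3 * (\<phi> (x + z) - \<phi> x)\<^sup>2 + 3 * (\<phi> (x + z) - w (x + z))\<^sup>2 + 3 * (\<phi> x - w x)\<^sup>2)"
      by (intro ennreal_leI) (simp add: power2_commute)
    also have "\<dots> = 3 * ennreal ((\<phi> (x + z) - \<phi> x)\<^sup>2) + 3 * ennreal ((\<phi> (x + z) - w (x + z))\<^sup>2) + 3 * ennreal ((\<phi> x - w x)\<^sup>2)"
      by (simp add: ennreal_plus ennreal_mult)
    finally show ?thesis using True in\<Omega>[OF z True] by simp
  qed simp
  \<comment> \<open>The summand \<open>0 * 0\<close> pads the integrand to the three terms of
    \<open>nn_integral_lincomb3\<close>; the same device recurs below.\<close>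
  have "osc \<Omega> e w \<le> (\<integral>\<^sup>+z. 3 * (indicator (ball 0 e) z * (\<integral>\<^sup>+x. indicator ?A x * ennreal ((\<phi> (x + z) - \<phi> x)\<^sup>2) \<partial>lborel))
      + 6 * ennreal c * indicator (ball 0 e) z + 0 * 0 \<partial>lborel)"
    unfolding osc_translation[OF wm]
  proof (rule nn_integral_mono)
    fix z :: "real^'d"
    show "indicator (ball 0 e) z * (\<integral>\<^sup>+x. indicator ?A x * ennreal ((w (x + z) - w x)\<^sup>2) \<partial>lborel)
      \<le> 3 * (indicator (ball 0 e) z * (\<integral>\<^sup>+x. indicator ?A x * ennreal ((\<phi> (x + z) - \<phi> x)\<^sup>2) \<partial>lborel))
      + 6 * ennreal c * indicator (ball 0 e) z + 0 * 0"
    proof (cases "norm z < e")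
      case True
      have "(\<integral>\<^sup>+x. indicator ?A x * ennreal ((w (x + z) - w x)\<^sup>2) \<partial>lborel)
        \<le> (\<integral>\<^sup>+x. 3 * (indicator ?A x * ennreal ((\<phi> (x + z) - \<phi> x)\<^sup>2)) + 3 * ?D (x + z) + 3 * ?D x \<partial>lborel)"
        by (rule nn_integral_mono) (rule pw[OF True])
      also have "\<dots> = 3 * (\<integral>\<^sup>+x. indicator ?A x * ennreal ((\<phi> (x + z) - \<phi> x)\<^sup>2) \<partial>lborel)
          + 3 * (\<integral>\<^sup>+x. ?D (x + z) \<partial>lborel) + 3 * (\<integral>\<^sup>+x. ?D x \<partial>lborel)"
        by (rule nn_integral_lincomb3) measurable
      also have "(\<integral>\<^sup>+x. ?D (x + z) \<partial>lborel) = (\<integral>\<^sup>+x. ?D x \<partial>lborel)"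
        by (rule nn_integral_lborel_translation) measurable
      also have "3 * (\<integral>\<^sup>+x. indicator ?A x * ennreal ((\<phi> (x + z) - \<phi> x)\<^sup>2) \<partial>lborel)
          + 3 * (\<integral>\<^sup>+x. ?D x \<partial>lborel) + 3 * (\<integral>\<^sup>+x. ?D x \<partial>lborel)
          \<le> 3 * (\<integral>\<^sup>+x. indicator ?A x * ennreal ((\<phi> (x + z) - \<phi> x)\<^sup>2) \<partial>lborel) + 3 * ennreal c + 3 * ennreal c"
        by (intro add_mono mult_left_mono d order_refl) auto
      also have "\<dots> = 3 * (\<integral>\<^sup>+x. indicator ?A x * ennreal ((\<phi> (x + z) - \<phi> x)\<^sup>2) \<partial>lborel) + 6 * ennreal c"
        by (simp add: add.assoc flip: distrib_right)
      finally show ?thesis using True by simp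
    qed simp
  qed
  also have "\<dots> = 3 * osc \<Omega> e \<phi> + 6 * ennreal c * (\<integral>\<^sup>+z. indicator (ball (0::real^'d) e) z \<partial>lborel) + 0 * (\<integral>\<^sup>+(z::real^'d). 0 \<partial>lborel)"
    unfolding osc_translation[OF \<phi>m]
  proof (rule nn_integral_lincomb3)
    show "(\<lambda>z. indicator (ball 0 e) z * (\<integral>\<^sup>+x. indicator ?A x * ennreal ((\<phi> (x + z) - \<phi> x)\<^sup>2) \<partial>lborel)) \<in> borel_measurable lborel"
    proof (rule borel_measurable_times_ennreal)
      show "(\<lambda>z. indicator (ball (0::real^'d) e) z :: ennreal) \<in> borel_measurable lborel"
        by (intro borel_measurable_indicator) simp
      show "(\<lambda>z. \<integral>\<^sup>+x. indicator ?A x * ennreal ((\<phi> (x + z) - \<phi> x)\<^sup>2) \<partial>lborel) \<in> borel_measurable lborel" by measurable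
    qed
    show "(\<lambda>z. indicator (ball (0::real^'d) e) z :: ennreal) \<in> borel_measurable lborel"
      by (intro borel_measurable_indicator) simp
  qed simp
  also have "(\<integral>\<^sup>+z. indicator (ball (0::real^'d) e) z \<partial>lborel) = ennreal (unit_ball_vol (real CARD('d)) * e ^ CARD('d))"
    using e by (subst nn_integral_indicator) (simp_all add: emeasure_ball)
  also have "6 * ennreal c * ennreal (unit_ball_vol (real CARD('d)) * e ^ CARD('d)) = ennreal (6 * unit_ball_vol (real CARD('d)) * e ^ CARD('d) * c)"
    using d(2) e by (simp add: ennreal_mult mult_ac)
  finally show ?thesis by simp
qed

text \<open>The Gagliardo seminorm with indicators over \<open>lborel\<close> in place of restricted
  Lebesgue measures, the form in which measurability and translations are handled.\<close>

definition gagliardo_borel :: "real \<Rightarrow> (real^'d \<Rightarrow> real) \<Rightarrow> ennreal" where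
  "gagliardo_borel \<sigma> \<phi> = (\<integral>\<^sup>+x. indicator \<Omega> x * (\<integral>\<^sup>+y. indicator \<Omega> y *
     ennreal ((\<phi> x - \<phi> y)\<^sup>2 / norm (x - y) powr (real CARD('d) + 2 * \<sigma>)) \<partial>lborel) \<partial>lborel)"

lemma increment_le_gagliardo:
  fixes x y :: "real^'d"
  assumes "norm (x - y) \<le> R" "\<sigma> > 0"
  shows "ennreal ((\<phi> x - \<phi> y)\<^sup>2) \<le> ennreal (R powr (real CARD('d) + 2 * \<sigma>)) *
    ennreal ((\<phi> x - \<phi> y)\<^sup>2 / norm (x - y) powr (real CARD('d) + 2 * \<sigma>))"
proof (cases "x = y")
  case False
  then have p: "norm (x - y) powr (real CARD('d) + 2 * \<sigma>) > 0" by simp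
  have "norm (x - y) powr (real CARD('d) + 2 * \<sigma>) \<le> R powr (real CARD('d) + 2 * \<sigma>)"
    using assms by (intro powr_mono2) auto
  then have "(\<phi> x - \<phi> y)\<^sup>2 * norm (x - y) powr (real CARD('d) + 2 * \<sigma>) \<le> (\<phi> x - \<phi> y)\<^sup>2 * R powr (real CARD('d) + 2 * \<sigma>)"
    by (intro mult_left_mono) auto
  then have "(\<phi> x - \<phi> y)\<^sup>2 \<le> R powr (real CARD('d) + 2 * \<sigma>) * ((\<phi> x - \<phi> y)\<^sup>2 / norm (x - y) powr (real CARD('d) + 2 * \<sigma>))"
    using p by (simp add: pos_le_divide_eq mult.commute)
  then show ?thesis by (subst ennreal_mult[symmetric]) (auto intro: ennreal_leI)
qed simp

text \<open>For pairs at distance below \<open>e\<close> the Gagliardo weight is at least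
  \<open>e^(-(d + 2\<sigma>))\<close>, and the depth condition puts both points into
  \<open>\<Omega>\<close>.\<close>

lemma osc_gagliardo:
  assumes [measurable]: "\<phi> \<in> borel_measurable borel" and e: "e > 0" and \<sigma>: "\<sigma> > 0"
  shows "osc \<Omega> e \<phi> \<le> ennreal (e powr (real CARD('d) + 2 * \<sigma>)) * gagliardo_borel \<sigma> \<phi>"
proof -
  let ?q = "\<lambda>x y. ennreal ((\<phi> x - \<phi> y)\<^sup>2 / norm (x - y) powr (real CARD('d) + 2 * \<sigma>))"
  let ?R = "ennreal (e powr (real CARD('d) + 2 * \<sigma>))"
  have "osc \<Omega> e \<phi> \<le> (\<integral>\<^sup>+x. ?R * (indicator \<Omega> x * (\<integral>\<^sup>+y. indicator \<Omega> y * ?q x y \<partial>lborel)) \<partial>lborel)"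
    unfolding osc_def
  proof (rule nn_integral_mono)
    fix x
    show "indicator {x. e < depth \<Omega> x} x * (\<integral>\<^sup>+y. indicator {..<e} (dist x y) * ennreal ((\<phi> x - \<phi> y)\<^sup>2) \<partial>lborel)
      \<le> ?R * (indicator \<Omega> x * (\<integral>\<^sup>+y. indicator \<Omega> y * ?q x y \<partial>lborel))"
    proof (cases "e < depth \<Omega> x")
      case True
      then have x: "x \<in> \<Omega>" using e depth_pos_iff[of x] by linarith
      have "(\<integral>\<^sup>+y. indicator {..<e} (dist x y) * ennreal ((\<phi> x - \<phi> y)\<^sup>2) \<partial>lborel)
        \<le> (\<integral>\<^sup>+y. ?R * (indicator \<Omega> y * ?q x y) \<partial>lborel)"
      proof (rule nn_integral_mono)
        fix y
        show "indicator {..<e} (dist x y) * ennreal ((\<phi> x - \<phi> y)\<^sup>2) \<le> ?R * (indicator \<Omega> y * ?q x y)"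
        proof (cases "dist x y < e")
          case d: True
          then have "depth \<Omega> y > 0" using depth_le[of x y] True by linarith
          then have "y \<in> \<Omega>" by (simp add: depth_pos_iff)
          then show ?thesis using d increment_le_gagliardo[of x y e \<sigma> \<phi>] \<sigma> by (simp add: dist_norm)
        qed simp
      qed
      also have "\<dots> = ?R * (\<integral>\<^sup>+y. indicator \<Omega> y * ?q x y \<partial>lborel)"
        by (rule nn_integral_cmult) measurable
      finally show ?thesis using x True by simp
    qed simp
  qed
  also have "\<dots> = ?R * gagliardo_borel \<sigma> \<phi>"
    unfolding gagliardo_borel_def by (rule nn_integral_cmult) measurable
  finally show ?thesis .
qed

end

section \<open>Boundary charts\<close>

text \<open>Dyadic induction towards 0: the base case is the octave just below
  \<open>\<rho>\<close>, and every smaller scale reaches it by finitely many doublings.\<close>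

lemma halving_induct:
  fixes s \<rho> :: real
  assumes s: "0 < s" "s \<le> \<rho>" and base: "\<And>s. \<rho> / 2 < s \<Longrightarrow> s \<le> \<rho> \<Longrightarrow> P s"
    and step: "\<And>s. 0 < s \<Longrightarrow> 2 * s \<le> \<rho> \<Longrightarrow> P (2 * s) \<Longrightarrow> P s"
  shows "P s"
proof -
  have "P s" if "\<rho> < 2 ^ Suc k * s" "0 < s" "s \<le> \<rho>" for k s
    using that
  proof (induction k arbitrary: s)
    case 0
    then show ?case by (intro base) simp_all
  next
    case (Suc k)
    show ?case
    proof (cases "2 * s \<le> \<rho>")
      case True
      have "P (2 * s)" by (rule Suc.IH) (use Suc.prems True in \<open>simp_all add: mult_ac\<close>)
      then show ?thesis by (rule step[OF Suc.prems(2) True])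
    next
      case False
      then show ?thesis using Suc.prems by (intro base) simp_all
    qed
  qed
  moreover obtain k where "\<rho> / s < 2 ^ k" using real_arch_pow[of 2 "\<rho> / s"] by auto
  then have "\<rho> < 2 ^ Suc k * s" using s by (simp add: field_simps)
  ultimately show ?thesis using s by blast
qed

text \<open>Dyadic induction away from 0. The threshold \<open>d\<close> below which the base case
  holds may be arbitrarily small and does not enter the conclusion; this keeps constants independent
  of the support of a test function.\<close>

lemma doubling_induct:
  fixes s \<rho> d :: real
  assumes s: "0 < s" "s \<le> \<rho>" and "d > 0" and base: "\<And>s. 0 < s \<Longrightarrow> s \<le> \<rho> \<Longrightarrow> s < d \<Longrightarrow> P s"
    and step: "\<And>s. 0 < s \<Longrightarrow> 2 * s \<le> \<rho> \<Longrightarrow> P s \<Longrightarrow> P (2 * s)"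
  shows "P s"
proof -
  have "P s" if "s < 2 ^ k * d" "0 < s" "s \<le> \<rho>" for k s
    using that
  proof (induction k arbitrary: s)
    case 0
    then show ?case by (intro base) simp_all
  next
    case (Suc k)
    have "P (s / 2)" by (rule Suc.IH) (use Suc.prems in simp_all)
    then have "P (2 * (s / 2))" by (rule step[rotated 2]) (use Suc.prems in simp_all)
    then show ?case by simp
  qed
  moreover obtain k where "s / d < 2 ^ k" using real_arch_pow[of 2 "s / d"] by auto
  then have "s < 2 ^ k * d" using \<open>d > 0\<close> by (simp add: field_simps)
  ultimately show ?thesis using s by blast
qed

lemma ennreal_le_divideI:
  assumes "ennreal V * D \<le> ennreal X" "V > 0"
  shows "D \<le> ennreal (X / V)"
proof -
  have "D = ennreal (1 / V) * (ennreal V * D)"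
    using assms(2) by (simp add: mult.assoc[symmetric] ennreal_mult[symmetric])
  also have "\<dots> \<le> ennreal (1 / V) * ennreal X" by (intro mult_left_mono assms(1)) simp
  also have "\<dots> = ennreal (X / V)" using assms(2) by (simp add: ennreal_mult'[symmetric])
  finally show ?thesis .
qed

text \<open>What the layer estimates use of a graph representation: a Lipschitz height
  \<open>t\<close> whose sign decides membership in \<open>\<Omega>\<close> and which grows at unit
  speed along \<open>e\<close>. Shifts along \<open>e\<close> then act on heights exactly.\<close>

locale boundary_chart = bounded_open \<Omega> for \<Omega> :: "(real^'d::finite) set" +
  fixes x0 e :: "real^'d" and t :: "real^'d \<Rightarrow> real" and r L :: real
  assumes r: "r > 0" and L: "L \<ge> 1" and e1: "norm e = 1"
    and shift: "\<And>x s. t (x + s *\<^sub>R e) = t x + s"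
    and lip: "\<And>x y. x \<in> ball x0 r \<Longrightarrow> y \<in> ball x0 r \<Longrightarrow> \<bar>t x - t y\<bar> \<le> L * norm (x - y)"
    and side: "\<And>x. x \<in> ball x0 r \<Longrightarrow> x \<in> \<Omega> \<longleftrightarrow> t x > 0"
    and t0: "t x0 = 0" and tm [measurable]: "t \<in> borel_measurable borel"
begin

text \<open>The value makes \<open>\<rho> + (1 + L) * \<rho> = r / 4\<close>, the bound found in
  \<open>norm_le_of_chart\<close>: strips of width up to \<open>\<rho>\<close> stay in the ball of
  the chart, with room for the auxiliary balls of \<open>band_increment_gagliardo\<close>.\<close>

definition \<rho> :: real where "\<rho> = r / (4 * (2 + L))"

definition pr :: "real^'d \<Rightarrow> real^'d" where "pr v = v - (v \<bullet> e) *\<^sub>R e"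

text \<open>Height intervals are half-open so that \<open>strip (2 * s)\<close> is the disjoint
  union of \<open>strip s\<close> and \<open>band s\<close>, the latter being \<open>strip s\<close>
  moved by \<open>s\<close> along \<open>e\<close>.\<close>

definition strip :: "real \<Rightarrow> (real^'d) set" where
  "strip s = {x. norm (pr (x - x0)) < \<rho> \<and> 0 < t x \<and> t x \<le> s}"

definition band :: "real \<Rightarrow> (real^'d) set" where
  "band s = {x. norm (pr (x - x0)) < \<rho> \<and> s < t x \<and> t x \<le> 2 * s}"

lemma rho: "\<rho> > 0" "(2 + L) * \<rho> = r / 4" "\<rho> < r"
proof -
  show p: "\<rho> > 0" using r L by (simp add: \<rho>_def)
  show q: "(2 + L) * \<rho> = r / 4" using L by (simp add: \<rho>_def field_simps)
  show "\<rho> < r" using mult_right_mono[of 1 "2 + L" \<rho>] p q r L by simp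
qed

lemma ee: "e \<bullet> e = 1"
  using e1 by (simp add: dot_square_norm)

lemma pr_shift: "pr (x + s *\<^sub>R e - x0) = pr (x - x0)"
  by (simp add: pr_def inner_add_left inner_diff_left ee algebra_simps)

lemma norm_pr: "norm (pr v) \<le> norm v"
proof -
  have "pr v \<bullet> pr v = v \<bullet> v - (v \<bullet> e)\<^sup>2"
    by (simp add: pr_def inner_diff_left inner_diff_right ee power2_eq_square inner_commute)
  then have "(norm (pr v))\<^sup>2 \<le> (norm v)\<^sup>2" by (simp add: dot_square_norm[symmetric])
  then show ?thesis by (rule power2_le_imp_le) simp
qed

lemma borel_pr [measurable]: "pr \<in> borel_measurable borel"
  unfolding pr_def by (intro borel_measurable_continuous_onI continuous_intros)

lemma borel_strip [measurable]: "strip s \<in> sets borel" and borel_band [measurable]: "band s \<in> sets borel"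
  unfolding strip_def band_def by measurable

text \<open>Split \<open>x - x0\<close> into its tangential part and a multiple of \<open>e\<close>.
  The height of the tangential point is at most \<open>L * \<rho>\<close> by the Lipschitz bound at
  \<open>x0\<close>, so the multiple is at most \<open>(1 + L) * \<rho>\<close>.\<close>

lemma norm_le_of_chart:
  assumes "norm (pr (x - x0)) < \<rho>" "\<bar>t x\<bar> \<le> \<rho>"
  shows "norm (x - x0) < r / 2" "x \<in> ball x0 r"
proof -
  let ?p = "x0 + pr (x - x0)" and ?a = "(x - x0) \<bullet> e"
  have p: "?p \<in> ball x0 r" using assms(1) rho(3) by (simp add: dist_norm)
  have "x = ?p + ?a *\<^sub>R e" by (simp add: pr_def)
  then have tx: "t x = t ?p + ?a" using shift by metis
  have "\<bar>t ?p\<bar> \<le> L * norm (pr (x - x0))" using lip[OF p, of x0] r t0 by simp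
  also have "\<dots> \<le> L * \<rho>" using assms(1) L by (intro mult_left_mono) auto
  finally have "\<bar>?a\<bar> \<le> (1 + L) * \<rho>" using tx assms(2) by (simp add: algebra_simps)
  moreover have "norm (x - x0) \<le> norm (pr (x - x0)) + norm (?a *\<^sub>R e)"
    using norm_triangle_ineq[of "pr (x - x0)" "?a *\<^sub>R e"] by (simp add: pr_def)
  ultimately have "norm (x - x0) \<le> \<rho> + (1 + L) * \<rho>" using assms(1) e1 by simp
  also have "\<dots> = r / 4" using rho(2) by (simp add: algebra_simps)
  finally show *: "norm (x - x0) < r / 2" using r by simp
  then show "x \<in> ball x0 r" using r by (simp add: dist_norm norm_minus_commute)
qed

lemma strip_subset: "s \<le> \<rho> \<Longrightarrow> strip s \<subseteq> \<Omega>" "s \<le> \<rho> \<Longrightarrow> strip s \<subseteq> ball x0 r"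
  using norm_le_of_chart(2) side by (auto simp: strip_def)

lemma band_subset: "2 * s \<le> \<rho> \<Longrightarrow> 0 < s \<Longrightarrow> band s \<subseteq> strip (2 * s)"
  by (auto simp: strip_def band_def)

lemma strip_double: "s > 0 \<Longrightarrow> strip (2 * s) = strip s \<union> band s" "strip s \<inter> band s = {}"
  by (auto simp: strip_def band_def)

lemma band_shift: "x - s *\<^sub>R e \<in> strip s \<longleftrightarrow> x \<in> band s"
  using pr_shift[of x "-s"] shift[of x "-s"] by (auto simp: strip_def band_def)

lemma nn_integral_band_shift:
  assumes [measurable]: "F \<in> borel_measurable borel"
  shows "(\<integral>\<^sup>+x. indicator (band s) x * F (x - s *\<^sub>R e) \<partial>lborel) = (\<integral>\<^sup>+x. indicator (strip s) x * F x \<partial>lborel)"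
proof -
  have "(\<integral>\<^sup>+x. indicator (strip s) (x + (- s) *\<^sub>R e) * F (x + (- s) *\<^sub>R e) \<partial>lborel) = (\<integral>\<^sup>+x. indicator (strip s) x * F x \<partial>lborel)"
    by (rule nn_integral_lborel_translation) measurable
  then show ?thesis by (simp add: indicator_def band_shift)
qed

text \<open>A strip of width \<open>2 * s\<close> consists of two translates of the strip of width
  \<open>s\<close>, so its volume halves exactly with the width. At widths comparable to
  \<open>\<rho>\<close> the volume of the chart ball is a sufficient bound.\<close>

lemma emeasure_strip_le:
  obtains K where "K \<ge> 0" "\<And>s. 0 < s \<Longrightarrow> s \<le> \<rho> \<Longrightarrow> emeasure lborel (strip s) \<le> ennreal (K * s)"
proof -
  define V where "V = unit_ball_vol (real CARD('d)) * r ^ CARD('d)"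
  have V: "V \<ge> 0" using r by (simp add: V_def)
  have "emeasure lborel (strip s) \<le> ennreal (2 * V / \<rho> * s)" if "0 < s" "s \<le> \<rho>" for s
    using that
  proof (rule halving_induct)
    fix s assume s: "\<rho> / 2 < s" "s \<le> \<rho>"
    have "emeasure lborel (strip s) \<le> emeasure lborel (ball x0 r)"
      using strip_subset(2)[OF s(2)] by (intro emeasure_mono) auto
    also have "\<dots> = ennreal V" using r by (simp add: emeasure_ball V_def)
    also have "\<dots> \<le> ennreal (2 * V / \<rho> * s)"
    proof (rule ennreal_leI)
      have "V * \<rho> \<le> V * (2 * s)" using s V by (intro mult_left_mono) auto
      then show "V \<le> 2 * V / \<rho> * s" using rho(1) by (simp add: field_simps)
    qed
    finally show "emeasure lborel (strip s) \<le> ennreal (2 * V / \<rho> * s)" .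
  next
    fix s assume s: "0 < s" "2 * s \<le> \<rho>" and IH: "emeasure lborel (strip (2 * s)) \<le> ennreal (2 * V / \<rho> * (2 * s))"
    have "emeasure lborel (band s) = emeasure lborel (strip s)"
      using nn_integral_band_shift[of "\<lambda>_. 1" s] by simp
    then have "emeasure lborel (strip (2 * s)) = emeasure lborel (strip s) + emeasure lborel (strip s)"
      unfolding strip_double(1)[OF s(1)] using strip_double(2)[of s]
      by (subst plus_emeasure[symmetric]) auto
    also have "\<dots> = ennreal 2 * emeasure lborel (strip s)" by (simp add: mult_2)
    finally have "ennreal 2 * emeasure lborel (strip s) \<le> ennreal (2 * V / \<rho> * (2 * s))" using IH by simp
    from ennreal_le_divideI[OF this] show "emeasure lborel (strip s) \<le> ennreal (2 * V / \<rho> * s)"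
      by (simp add: mult.assoc)
  qed
  moreover have "2 * V / \<rho> \<ge> 0" using V rho(1) by simp
  ultimately show ?thesis using that by blast
qed

text \<open>On the strip of width \<open>2s\<close> the outer half is compared with the inner half by a shift, so the
  mass \<open>S\<close> of \<open>\<phi>\<^sup>2\<close> satisfies \<open>S(2s) \<le> (2 + \<eta>) S(s) + (1 + 1/\<eta>) C s\<^bsup>2\<sigma>\<^esup>\<close>. This recursion starts at \<open>S(s) = 0\<close>
  for small \<open>s\<close>, and \<open>2 + \<eta> < 2\<^bsup>2\<sigma>\<^esup>\<close> is possible because \<open>\<sigma> > 1/2\<close>.\<close>

lemma hardy_strip:
  assumes \<sigma>: "\<sigma> > 1/2"
  obtains H where "H \<ge> 0"
    "\<And>\<phi> C s. \<phi> \<in> Cc_inf \<Omega> \<Longrightarrow> C \<ge> 0 \<Longrightarrow>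
      \<forall>s. 0 < s \<longrightarrow> 2 * s \<le> \<rho> \<longrightarrow> (\<integral>\<^sup>+x. indicator (band s) x * ennreal ((\<phi> (x - s *\<^sub>R e) - \<phi> x)\<^sup>2) \<partial>lborel) \<le> ennreal (C * s powr (2 * \<sigma>)) \<Longrightarrow>
      0 < s \<Longrightarrow> s \<le> \<rho> \<Longrightarrow> (\<integral>\<^sup>+x. indicator (strip s) x * ennreal ((\<phi> x)\<^sup>2) \<partial>lborel) \<le> ennreal (H * C * s powr (2 * \<sigma>))"
proof -
  define \<theta> :: real where "\<theta> = 2 powr (2 * \<sigma>)"
  have "\<theta> > 2 powr 1" unfolding \<theta>_def using \<sigma> by (intro powr_less_mono) auto
  then have \<theta>: "\<theta> > 2" by simp
  define \<eta> where "\<eta> = (\<theta> - 2) / 2"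
  have \<eta>: "\<eta> > 0" "2 + \<eta> + \<eta> = \<theta>" using \<theta> by (auto simp: \<eta>_def field_simps)
  \<comment> \<open>Fixed point of the recursion:
    \<open>H * (2 + \<eta>) + (1 + 1 / \<eta>) = H * \<theta>\<close>, because
    \<open>\<theta> = 2 + 2 * \<eta>\<close>.\<close>
  define H where "H = (1 + 1 / \<eta>) / \<eta>"
  have H: "H \<ge> 0" "H * \<eta> = 1 + 1 / \<eta>" using \<eta> by (auto simp: H_def)
  show ?thesis
  proof (rule that[OF H(1)])
    fix \<phi> and C s :: real
    assume \<phi>: "\<phi> \<in> Cc_inf \<Omega>" and C: "C \<ge> 0"
      and D: "\<forall>s. 0 < s \<longrightarrow> 2 * s \<le> \<rho> \<longrightarrow> (\<integral>\<^sup>+x. indicator (band s) x * ennreal ((\<phi> (x - s *\<^sub>R e) - \<phi> x)\<^sup>2) \<partial>lborel) \<le> ennreal (C * s powr (2 * \<sigma>))"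
      and s: "0 < s" "s \<le> \<rho>"
    have \<phi>m[measurable]: "\<phi> \<in> borel_measurable borel" by (rule smooth_borel[OF Cc_inf_smooth[OF \<phi>]])
    obtain K where K: "compact K" "K \<subseteq> \<Omega>" "\<And>x. x \<notin> K \<Longrightarrow> \<phi> x = 0" using \<phi> Cc_infE by metis
    obtain d where d: "d > 0" "K \<subseteq> {x. d \<le> depth \<Omega> x}" using compact_subset_depth[OF K(1,2)] by metis
    let ?S = "\<lambda>s. \<integral>\<^sup>+x. indicator (strip s) x * ennreal ((\<phi> x)\<^sup>2) \<partial>lborel"
    show "?S s \<le> ennreal (H * C * s powr (2 * \<sigma>))"
      using s d(1)
    proof (rule doubling_induct)
      fix s assume s: "0 < s" "s \<le> \<rho>" "s < d"
      have 0: "indicator (strip s) x * ennreal ((\<phi> x)\<^sup>2) = 0" for x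
      proof (cases "x \<in> strip s")
        case True
        \<comment> \<open>Descending by the height leads out of \<open>\<Omega>\<close>; as the
          height is at most \<open>s < d\<close>, the point \<open>x\<close> is too shallow to lie
          in the support.\<close>
        let ?y = "x + (- t x) *\<^sub>R e"
        have "norm (pr (?y - x0)) < \<rho>" "t ?y = 0"
          using True shift[of x "- t x"] pr_shift[of x "- t x"] by (auto simp: strip_def)
        then have "?y \<notin> \<Omega>" using norm_le_of_chart(2)[of ?y] side[of ?y] rho(1) by simp
        then have "depth \<Omega> x \<le> dist x ?y" by (intro infdist_le) simp
        also have "\<dots> < d" using True s e1 by (simp add: strip_def dist_norm)
        finally have "x \<notin> K" using d(2) by auto
        then show ?thesis using K(3) by simp
      qed simp
      show "?S s \<le> ennreal (H * C * s powr (2 * \<sigma>))" by (simp only: 0) simp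
    next
      fix s assume s: "0 < s" "2 * s \<le> \<rho>" and IH: "?S s \<le> ennreal (H * C * s powr (2 * \<sigma>))"
      let ?B = "\<lambda>x. indicator (band s) x * ennreal ((\<phi> (x - s *\<^sub>R e))\<^sup>2)"
      let ?E = "\<lambda>x. indicator (band s) x * ennreal ((\<phi> (x - s *\<^sub>R e) - \<phi> x)\<^sup>2)"
      have "?S (2 * s) \<le> (\<integral>\<^sup>+x. 1 * (indicator (strip s) x * ennreal ((\<phi> x)\<^sup>2)) + ennreal (1 + \<eta>) * ?B x + ennreal (1 + 1 / \<eta>) * ?E x \<partial>lborel)"
      proof (rule nn_integral_mono)
        fix x
        let ?p = "\<phi> (x - s *\<^sub>R e)" and ?q = "\<phi> x"
        \<comment> \<open>Young's inequality with parameter \<open>\<eta>\<close> for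
          \<open>?q = ?p - (?p - ?q)\<close>, obtained by completing the square.\<close>
        have "0 \<le> (\<eta> * ?p + (?p - ?q))\<^sup>2 / \<eta>" using \<eta>(1) by simp
        also have "\<dots> = (1 + \<eta>) * ?p\<^sup>2 + (1 + 1 / \<eta>) * (?p - ?q)\<^sup>2 - ?q\<^sup>2"
          using \<eta>(1) by (simp add: field_simps power2_eq_square)
        finally have "?q\<^sup>2 \<le> (1 + \<eta>) * ?p\<^sup>2 + (1 + 1 / \<eta>) * (?p - ?q)\<^sup>2" by simp
        then have "ennreal (?q\<^sup>2) \<le> ennreal ((1 + \<eta>) * ?p\<^sup>2 + (1 + 1 / \<eta>) * (?p - ?q)\<^sup>2)" by (rule ennreal_leI)
        also have "\<dots> = ennreal (1 + \<eta>) * ennreal (?p\<^sup>2) + ennreal (1 + 1 / \<eta>) * ennreal ((?p - ?q)\<^sup>2)"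
          using \<eta>(1) by (subst ennreal_plus) (auto simp: ennreal_mult simp del: ennreal_plus)
        finally show "indicator (strip (2 * s)) x * ennreal (?q\<^sup>2) \<le> 1 * (indicator (strip s) x * ennreal (?q\<^sup>2)) + ennreal (1 + \<eta>) * ?B x + ennreal (1 + 1 / \<eta>) * ?E x"
          unfolding strip_double(1)[OF s(1)] using strip_double(2)[of s]
          by (cases "x \<in> strip s"; cases "x \<in> band s") auto
      qed
      also have "\<dots> = 1 * ?S s + ennreal (1 + \<eta>) * (\<integral>\<^sup>+x. ?B x \<partial>lborel) + ennreal (1 + 1 / \<eta>) * (\<integral>\<^sup>+x. ?E x \<partial>lborel)"
        by (rule nn_integral_lincomb3) measurable
      also have "(\<integral>\<^sup>+x. ?B x \<partial>lborel) = ?S s"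
        by (rule nn_integral_band_shift) measurable
      also have "1 * ?S s + ennreal (1 + \<eta>) * ?S s + ennreal (1 + 1 / \<eta>) * (\<integral>\<^sup>+x. ?E x \<partial>lborel)
          \<le> 1 * ennreal (H * C * s powr (2 * \<sigma>)) + ennreal (1 + \<eta>) * ennreal (H * C * s powr (2 * \<sigma>)) + ennreal (1 + 1 / \<eta>) * ennreal (C * s powr (2 * \<sigma>))"
        by (intro add_mono mult_left_mono IH D[rule_format, OF s]) auto
      also have "\<dots> = ennreal (H * C * s powr (2 * \<sigma>) + (1 + \<eta>) * (H * C * s powr (2 * \<sigma>)) + (1 + 1 / \<eta>) * (C * s powr (2 * \<sigma>)))"
        using \<eta>(1) H(1) C by (simp add: ennreal_mult[symmetric] ennreal_plus[symmetric] del: ennreal_plus)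
      also have "H * C * s powr (2 * \<sigma>) + (1 + \<eta>) * (H * C * s powr (2 * \<sigma>)) + (1 + 1 / \<eta>) * (C * s powr (2 * \<sigma>)) = H * C * (2 * s) powr (2 * \<sigma>)"
      proof -
        have "H * C * (2 * s) powr (2 * \<sigma>) = (2 + \<eta> + \<eta>) * (H * C * s powr (2 * \<sigma>))"
          using s(1) by (simp add: powr_mult \<eta>(2) \<theta>_def)
        also have "\<dots> = (2 + \<eta>) * (H * C * s powr (2 * \<sigma>)) + (H * \<eta>) * (C * s powr (2 * \<sigma>))"
          by (simp add: algebra_simps)
        finally show ?thesis unfolding H(2) by (simp add: algebra_simps)
      qed
      finally show "?S (2 * s) \<le> ennreal (H * C * (2 * s) powr (2 * \<sigma>))" .
    qed
  qed
qed

text \<open>The exponent is kept as \<open>2 * 1\<close> to match the hypothesis of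
  \<open>hardy_strip\<close> at \<open>\<sigma> = 1\<close>.\<close>

lemma band_increment_gradient:
  assumes \<phi>: "smooth \<phi>" and G: "(\<integral>\<^sup>+x. ennreal (grad_sq \<phi> x) \<partial>lborel) \<le> ennreal G" and s: "0 < s"
  shows "(\<integral>\<^sup>+x. indicator (band s) x * ennreal ((\<phi> (x - s *\<^sub>R e) - \<phi> x)\<^sup>2) \<partial>lborel) \<le> ennreal (G * s powr (2 * 1))"
proof -
  have "(\<integral>\<^sup>+x. indicator (band s) x * ennreal ((\<phi> (x + (- s) *\<^sub>R e) - \<phi> x)\<^sup>2) \<partial>lborel)
      \<le> ennreal ((norm ((- s) *\<^sub>R e))\<^sup>2) * (\<integral>\<^sup>+x. indicator UNIV x * ennreal (grad_sq \<phi> x) \<partial>lborel)"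
    by (rule translation_gradient[OF \<phi>]) auto
  also have "\<dots> \<le> ennreal (s\<^sup>2) * ennreal G"
    using G e1 by (intro mult_mono) auto
  also have "\<dots> = ennreal (s\<^sup>2 * G)" by (simp add: ennreal_mult')
  also have "s\<^sup>2 * G = G * s powr (2 * 1)" using s by simp
  finally show ?thesis by simp
qed

text \<open>The two values are compared through an intermediate point, averaged over a ball of
  radius \<open>s\<close>. Its centre lies \<open>(L + 1) * s\<close> above \<open>x\<close>, high
  enough for the Lipschitz bound to keep the ball in \<open>\<Omega>\<close>, and all distances stay
  below \<open>(L + 3) * s\<close>. The 4 is a 2 from splitting the square times 2 for the integrals
  over \<open>band s\<close> and its shift \<open>strip s\<close>.\<close>

lemma band_increment_gagliardo:
  assumes [measurable]: "\<phi> \<in> borel_measurable borel" and \<sigma>: "\<sigma> > 0"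
    and G: "gagliardo_borel \<sigma> \<phi> \<le> ennreal G" "G \<ge> 0" and s: "0 < s" "2 * s \<le> \<rho>"
  shows "(\<integral>\<^sup>+x. indicator (band s) x * ennreal ((\<phi> (x - s *\<^sub>R e) - \<phi> x)\<^sup>2) \<partial>lborel)
    \<le> ennreal (4 * (L + 3) powr (real CARD('d) + 2 * \<sigma>) / unit_ball_vol (real CARD('d)) * G * s powr (2 * \<sigma>))"
proof -
  let ?n = "real CARD('d)" and ?M = "L + 1"
  define q where "q x y = ennreal ((\<phi> x - \<phi> y)\<^sup>2 / norm (x - y) powr (?n + 2 * \<sigma>))" for x y
  define Q where "Q x = (\<integral>\<^sup>+y. indicator \<Omega> y * q x y \<partial>lborel)" for x
  have [measurable]: "(\<lambda>(x, y). q x y) \<in> borel_measurable (lborel \<Otimes>\<^sub>M lborel)" unfolding q_def by measurable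
  have Qm[measurable]: "Q \<in> borel_measurable borel" unfolding Q_def by measurable
  have gag: "gagliardo_borel \<sigma> \<phi> = (\<integral>\<^sup>+x. indicator \<Omega> x * Q x \<partial>lborel)"
    by (simp add: gagliardo_borel_def Q_def q_def)
  let ?R = "((L + 3) * s) powr (?n + 2 * \<sigma>)"
  let ?V = "unit_ball_vol ?n * s ^ CARD('d)"
  have om: "unit_ball_vol ?n > 0" by simp
  have V: "?V > 0" using s om by simp
  have pw: "ennreal ?V * ennreal ((\<phi> (x - s *\<^sub>R e) - \<phi> x)\<^sup>2) \<le> ennreal (2 * ?R) * Q x + ennreal (2 * ?R) * Q (x - s *\<^sub>R e)"
    if x: "x \<in> band s" for x
  proof -
    let ?c = "x + (?M * s) *\<^sub>R e"
    have xs: "norm (pr (x - x0)) < \<rho>" "s < t x" "t x \<le> 2 * s" using x by (auto simp: band_def)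
    have xr: "norm (x - x0) \<le> r / 2" using norm_le_of_chart(1)[of x] xs s by (simp add: less_imp_le)
    \<comment> \<open>Together with \<open>norm (x - x0) \<le> r / 2\<close> this keeps the whole
      intermediate ball inside the chart ball.\<close>
    have Ms: "(?M + 1) * s \<le> r / 8"
      using mult_left_mono[OF s(2), of "L + 2"] L rho(2) by (simp add: algebra_simps)
    have cr: "norm (?c - x0) \<le> r / 2 + ?M * s"
    proof -
      have "norm (?c - x0) \<le> norm (x - x0) + norm ((?M * s) *\<^sub>R e)"
        using norm_triangle_ineq[of "x - x0" "(?M * s) *\<^sub>R e"] by (simp add: algebra_simps)
      then show ?thesis using xr e1 L s by (simp add: abs_mult)
    qed
    have y: "y \<in> \<Omega>" "norm (x - y) \<le> (L + 3) * s" "norm (x - s *\<^sub>R e - y) \<le> (L + 3) * s" if "y \<in> ball ?c s" for y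
    proof -
      have d: "norm (?c - y) < s" using that by (simp add: dist_norm)
      have "norm (y - x0) \<le> norm (?c - x0) + norm (?c - y)"
        using norm_triangle_ineq4[of "?c - x0" "?c - y"] by simp
      then have "norm (y - x0) < r" "norm (?c - x0) < r" using cr d Ms r s by (auto simp: algebra_simps)
      then have br: "y \<in> ball x0 r" "?c \<in> ball x0 r" by (auto simp: dist_norm norm_minus_commute)
      have "\<bar>t ?c - t y\<bar> \<le> L * norm (?c - y)" by (rule lip[OF br(2,1)])
      also have "\<dots> \<le> L * s" using d L by (intro mult_left_mono) auto
      finally have "t y > 0" using shift[of x "?M * s"] xs s by (simp add: algebra_simps)
      then show "y \<in> \<Omega>" using side[OF br(1)] by simp
      have "norm (x - y) \<le> norm (?c - y) + norm ((?M * s) *\<^sub>R e)"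
        using norm_triangle_ineq4[of "?c - y" "(?M * s) *\<^sub>R e"] by simp
      then have a: "norm (x - y) \<le> s + ?M * s" using d e1 L s by (simp add: abs_mult)
      then show "norm (x - y) \<le> (L + 3) * s" using s by (simp add: algebra_simps)
      have "norm (x - s *\<^sub>R e - y) \<le> norm (x - y) + norm (s *\<^sub>R e)"
        using norm_triangle_ineq4[of "x - y" "s *\<^sub>R e"] by (simp add: algebra_simps)
      then show "norm (x - s *\<^sub>R e - y) \<le> (L + 3) * s" using a e1 s by (simp add: algebra_simps)
    qed
    have "ennreal ?V * ennreal ((\<phi> (x - s *\<^sub>R e) - \<phi> x)\<^sup>2) = (\<integral>\<^sup>+y. ennreal ((\<phi> (x - s *\<^sub>R e) - \<phi> x)\<^sup>2) * indicator (ball ?c s) y \<partial>lborel)"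
      using s by (subst nn_integral_cmult_indicator) (simp_all add: emeasure_ball mult.commute)
    also have "\<dots> \<le> (\<integral>\<^sup>+y. ennreal (2 * ?R) * (indicator \<Omega> y * q x y) + ennreal (2 * ?R) * (indicator \<Omega> y * q (x - s *\<^sub>R e) y) + 0 * 0 \<partial>lborel)"
    proof (rule nn_integral_mono)
      fix y
      show "ennreal ((\<phi> (x - s *\<^sub>R e) - \<phi> x)\<^sup>2) * indicator (ball ?c s) y \<le> ennreal (2 * ?R) * (indicator \<Omega> y * q x y) + ennreal (2 * ?R) * (indicator \<Omega> y * q (x - s *\<^sub>R e) y) + 0 * 0"
      proof (cases "y \<in> ball ?c s")
        case True
        have "(\<phi> (x - s *\<^sub>R e) - \<phi> x)\<^sup>2 \<le> 2 * (\<phi> x - \<phi> y)\<^sup>2 + 2 * (\<phi> (x - s *\<^sub>R e) - \<phi> y)\<^sup>2"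
          using zero_le_power2[of "(\<phi> (x - s *\<^sub>R e) - \<phi> y) + (\<phi> x - \<phi> y)"] by (simp add: power2_eq_square algebra_simps)
        then have "ennreal ((\<phi> (x - s *\<^sub>R e) - \<phi> x)\<^sup>2) \<le> ennreal (2 * (\<phi> x - \<phi> y)\<^sup>2 + 2 * (\<phi> (x - s *\<^sub>R e) - \<phi> y)\<^sup>2)"
          by (rule ennreal_leI)
        also have "\<dots> = 2 * ennreal ((\<phi> x - \<phi> y)\<^sup>2) + 2 * ennreal ((\<phi> (x - s *\<^sub>R e) - \<phi> y)\<^sup>2)"
          by (simp add: ennreal_plus ennreal_mult)
        also have "\<dots> \<le> 2 * (ennreal ?R * q x y) + 2 * (ennreal ?R * q (x - s *\<^sub>R e) y)"
          unfolding q_def using y[OF True] \<sigma>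
          by (intro add_mono mult_left_mono increment_le_gagliardo) auto
        also have "\<dots> = ennreal (2 * ?R) * q x y + ennreal (2 * ?R) * q (x - s *\<^sub>R e) y"
          by (simp add: ennreal_mult mult.assoc)
        finally show ?thesis using True y(1)[OF True] by simp
      qed simp
    qed
    also have "\<dots> = ennreal (2 * ?R) * Q x + ennreal (2 * ?R) * Q (x - s *\<^sub>R e) + 0 * (\<integral>\<^sup>+(y::real^'d). 0 \<partial>lborel)"
      unfolding Q_def by (rule nn_integral_lincomb3) measurable
    finally show ?thesis by simp
  qed
  let ?D = "\<integral>\<^sup>+x. indicator (band s) x * ennreal ((\<phi> (x - s *\<^sub>R e) - \<phi> x)\<^sup>2) \<partial>lborel"
  have "ennreal ?V * ?D = (\<integral>\<^sup>+x. ennreal ?V * (indicator (band s) x * ennreal ((\<phi> (x - s *\<^sub>R e) - \<phi> x)\<^sup>2)) \<partial>lborel)"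
    by (rule nn_integral_cmult[symmetric]) measurable
  also have "\<dots> \<le> (\<integral>\<^sup>+x. ennreal (2 * ?R) * (indicator (band s) x * Q x) + ennreal (2 * ?R) * (indicator (band s) x * Q (x - s *\<^sub>R e)) + 0 * 0 \<partial>lborel)"
  proof (rule nn_integral_mono)
    fix x
    show "ennreal ?V * (indicator (band s) x * ennreal ((\<phi> (x - s *\<^sub>R e) - \<phi> x)\<^sup>2)) \<le>
        ennreal (2 * ?R) * (indicator (band s) x * Q x) + ennreal (2 * ?R) * (indicator (band s) x * Q (x - s *\<^sub>R e)) + 0 * 0"
      using pw[of x] by (cases "x \<in> band s") simp_all
  qed
  also have "\<dots> = ennreal (2 * ?R) * (\<integral>\<^sup>+x. indicator (band s) x * Q x \<partial>lborel)
      + ennreal (2 * ?R) * (\<integral>\<^sup>+x. indicator (band s) x * Q (x - s *\<^sub>R e) \<partial>lborel) + 0 * (\<integral>\<^sup>+(y::real^'d). 0 \<partial>lborel)"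
    by (rule nn_integral_lincomb3) measurable
  also have "(\<integral>\<^sup>+x. indicator (band s) x * Q (x - s *\<^sub>R e) \<partial>lborel) = (\<integral>\<^sup>+x. indicator (strip s) x * Q x \<partial>lborel)"
    by (rule nn_integral_band_shift) measurable
  also have "ennreal (2 * ?R) * (\<integral>\<^sup>+x. indicator (band s) x * Q x \<partial>lborel)
      + ennreal (2 * ?R) * (\<integral>\<^sup>+x. indicator (strip s) x * Q x \<partial>lborel) + 0 * (\<integral>\<^sup>+(y::real^'d). 0 \<partial>lborel)
      \<le> ennreal (2 * ?R) * ennreal G + ennreal (2 * ?R) * ennreal G + 0"
  proof (intro add_mono mult_left_mono)
    have "band s \<subseteq> \<Omega>" "strip s \<subseteq> \<Omega>" using band_subset[OF s(2,1)] strip_subset(1)[OF s(2)] strip_subset(1)[of s] s by auto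
    then have "(\<integral>\<^sup>+x. indicator (band s) x * Q x \<partial>lborel) \<le> gagliardo_borel \<sigma> \<phi>"
      "(\<integral>\<^sup>+x. indicator (strip s) x * Q x \<partial>lborel) \<le> gagliardo_borel \<sigma> \<phi>"
      unfolding gag by (auto intro!: nn_integral_mono simp: indicator_def)
    then show "(\<integral>\<^sup>+x. indicator (band s) x * Q x \<partial>lborel) \<le> ennreal G"
      "(\<integral>\<^sup>+x. indicator (strip s) x * Q x \<partial>lborel) \<le> ennreal G" using G(1) by auto
  qed auto
  also have "\<dots> = ennreal (4 * ?R * G)" using G(2) by (simp add: ennreal_mult[symmetric] ennreal_plus[symmetric] del: ennreal_plus)
  finally have "ennreal ?V * ?D \<le> ennreal (4 * ?R * G)" .
  from ennreal_le_divideI[OF this V] have "?D \<le> ennreal (4 * ?R * G / ?V)" .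
  also have "4 * ?R * G / ?V = 4 * (L + 3) powr (?n + 2 * \<sigma>) / unit_ball_vol ?n * G * s powr (2 * \<sigma>)"
  proof -
    have "?R = (L + 3) powr (?n + 2 * \<sigma>) * (s ^ CARD('d) * s powr (2 * \<sigma>))"
      using s L by (simp add: powr_mult powr_add[of s] powr_realpow)
    then show ?thesis using s om by simp
  qed
  finally show ?thesis .
qed

end

section \<open>From a C^2 boundary to charts and a global layer estimate\<close>

lemma Ck_lipschitz_on_cball:
  fixes \<gamma> :: "real^'d::finite \<Rightarrow> real"
  assumes \<gamma>: "Ck 2 \<gamma>"
  obtains M where "M \<ge> 0" "\<And>p q. p \<in> cball 0 R \<Longrightarrow> q \<in> cball 0 R \<Longrightarrow> \<bar>\<gamma> p - \<gamma> q\<bar> \<le> M * norm (p - q)"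
proof -
  have C: "Ck (Suc (Suc 0)) \<gamma>" using \<gamma> by (simp only: numeral_2_eq_2)
  have "\<exists>B\<ge>0. \<forall>x\<in>cball 0 R. \<bar>pd i \<gamma> x\<bar> \<le> B" for i
  proof -
    have "continuous_on UNIV (pd i \<gamma>)" using Ck_continuous[OF Ck_Suc_pd[OF C]] .
    then have "bounded (pd i \<gamma> ` cball 0 R)"
      by (intro compact_imp_bounded compact_continuous_image) (auto intro: continuous_on_subset)
    then obtain B where "B > 0" "\<And>x. x \<in> cball 0 R \<Longrightarrow> \<bar>pd i \<gamma> x\<bar> \<le> B"
      unfolding bounded_pos by auto
    then show ?thesis by (intro exI[of _ B]) auto
  qed
  then obtain B where B: "\<And>i. B i \<ge> 0" "\<And>i x. x \<in> cball 0 R \<Longrightarrow> \<bar>pd i \<gamma> x\<bar> \<le> B i" by metis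
  define M where "M = (\<Sum>i\<in>UNIV. B i)"
  have M: "M \<ge> 0" unfolding M_def by (intro sum_nonneg B(1))
  have "\<bar>\<gamma> p - \<gamma> q\<bar> \<le> M * norm (p - q)" if "p \<in> cball 0 R" "q \<in> cball 0 R" for p q
  proof -
    have "norm (\<gamma> p - \<gamma> q) \<le> M * norm (p - q)"
    proof (rule differentiable_bound[OF convex_cball _ _ that])
      fix x :: "real^'d" assume x: "x \<in> cball 0 R"
      show "(\<gamma> has_derivative (\<lambda>h. \<Sum>i\<in>UNIV. h $ i * pd i \<gamma> x)) (at x within cball 0 R)"
        by (rule has_derivative_at_withinI[OF has_derivative_pd[OF Ck_Suc_differentiable[OF C]]])
      show "onorm (\<lambda>h. \<Sum>i\<in>UNIV. h $ i * pd i \<gamma> x) \<le> M"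
      proof (rule onorm_le)
        fix h :: "real^'d"
        have "norm (\<Sum>i\<in>UNIV. h $ i * pd i \<gamma> x) \<le> (\<Sum>i\<in>UNIV. \<bar>h $ i\<bar> * \<bar>pd i \<gamma> x\<bar>)"
          using sum_abs[of "\<lambda>i. h $ i * pd i \<gamma> x" UNIV] by (simp add: abs_mult)
        also have "\<dots> \<le> (\<Sum>i\<in>UNIV. norm h * B i)"
          by (intro sum_mono mult_mono B(2)[OF x] component_le_norm_cart) auto
        also have "\<dots> = M * norm h" by (simp add: M_def sum_distrib_left mult.commute)
        finally show "norm (\<Sum>i\<in>UNIV. h $ i * pd i \<gamma> x) \<le> M * norm h" .
      qed
    qed
    then show ?thesis by simp
  qed
  with M show ?thesis by (rule that)
qed

context bounded_open
begin

text \<open>The height is the \<open>k\<close>-th coordinate of \<open>T x\<close> minus the graph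
  function. With \<open>e\<close> the preimage of the \<open>k\<close>-th axis, a move along
  \<open>e\<close> leaves the graph argument unchanged. As \<open>T\<close> is an isometry, the
  Lipschitz constant is 1 plus that of \<open>\<gamma>\<close>.\<close>

lemma C2_chart:
  assumes "C2_boundary \<Omega>" and x0: "x0 \<in> frontier \<Omega>"
  obtains e t r L where "boundary_chart \<Omega> x0 e t r L"
proof -
  obtain r and T :: "real^'d \<Rightarrow> real^'d" and k \<gamma> where r: "r > 0" and T: "orthogonal_transformation T"
    and \<gamma>: "Ck 2 \<gamma>"
    and side: "\<Omega> \<inter> ball x0 r = {x \<in> ball x0 r. T x $ k > \<gamma> (\<chi> i. if i = k then 0 else T x $ i)}"
    using assms(1)[unfolded C2_boundary_def, rule_format, OF x0] by (elim exE conjE) (rule that)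
  define P :: "real^'d \<Rightarrow> real^'d" where "P y = (\<chi> i. if i = k then 0 else y $ i)" for y
  define t where "t x = T x $ k - \<gamma> (P (T x))" for x
  have lin: "linear T" using T by (simp add: orthogonal_transformation_def)
  have nT: "norm (T v) = norm v" for v using T by (simp add: orthogonal_transformation)
  obtain e where e: "T e = axis k 1" using orthogonal_transformation_surj[OF T] by (metis surjD)
  have e1: "norm e = 1" using nT[of e] e by (simp add: norm_axis_1)
  have Psub: "P x - P y = P (x - y)" for x y by (simp add: P_def vec_eq_iff)
  have Pn: "norm (P v) \<le> norm v" for v
    by (rule norm_le_componentwise_cart) (simp add: P_def)
  have shift: "t (x + s *\<^sub>R e) = t x + s" for x s
  proof -
    have Tx: "T (x + s *\<^sub>R e) = T x + s *\<^sub>R axis k 1"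
      using lin by (simp add: linear_add linear_scale e)
    have "P (T x + s *\<^sub>R axis k 1) = P (T x)" by (simp add: P_def vec_eq_iff axis_def)
    then show ?thesis unfolding t_def Tx by (simp add: axis_def)
  qed
  \<comment> \<open>\<open>T\<close> preserves norms and the projection \<open>P\<close> does not
    increase them, so all arguments of \<open>\<gamma>\<close> that matter lie in this ball.\<close>
  define R where "R = norm x0 + r"
  obtain M where M: "M \<ge> 0" "\<And>p q. p \<in> cball 0 R \<Longrightarrow> q \<in> cball 0 R \<Longrightarrow> \<bar>\<gamma> p - \<gamma> q\<bar> \<le> M * norm (p - q)"
    using Ck_lipschitz_on_cball[OF \<gamma>] by metis
  have lip: "\<bar>t x - t y\<bar> \<le> (1 + M) * norm (x - y)" if "x \<in> ball x0 r" "y \<in> ball x0 r" for x y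
  proof -
    have in_cball: "P (T x) \<in> cball 0 R" if "x \<in> ball x0 r" for x
    proof -
      have "norm x \<le> norm x0 + dist x0 x"
        by (metis dist_norm norm_minus_commute norm_triangle_sub)
      then show ?thesis using that Pn[of "T x"] nT[of x] by (simp add: R_def)
    qed
    have sub: "T x - T y = T (x - y)" using lin by (simp add: linear_diff)
    have "\<bar>T x $ k - T y $ k\<bar> \<le> norm (x - y)"
    proof -
      have "\<bar>T (x - y) $ k\<bar> \<le> norm (x - y)"
        using component_le_norm_cart[of "T (x - y)" k] unfolding nT .
      then show ?thesis unfolding sub[symmetric] by simp
    qed
    moreover have "\<bar>\<gamma> (P (T x)) - \<gamma> (P (T y))\<bar> \<le> M * norm (P (T x) - P (T y))"
      by (rule M(2)[OF in_cball[OF that(1)] in_cball[OF that(2)]])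
    moreover have "M * norm (P (T x) - P (T y)) \<le> M * norm (x - y)"
      using Pn[of "T (x - y)"] M(1) unfolding Psub sub nT by (rule mult_left_mono)
    ultimately show ?thesis by (simp add: t_def algebra_simps)
  qed
  have cont: "continuous_on UNIV t"
  proof -
    have cT: "continuous_on UNIV T" by (rule linear_continuous_on[OF linear_linear[THEN iffD2, OF lin]])
    have "linear P" by (rule linearI) (simp_all add: P_def vec_eq_iff)
    then have cP: "continuous_on UNIV P" by (rule linear_continuous_on[OF linear_linear[THEN iffD2]])
    show ?thesis unfolding t_def
      by (intro continuous_on_diff continuous_on_compose2[OF Ck_continuous[OF \<gamma>]] continuous_on_compose2[OF cP]
          continuous_on_component cT) auto
  qed
  have side': "x \<in> \<Omega> \<longleftrightarrow> t x > 0" if "x \<in> ball x0 r" for x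
  proof -
    have "x \<in> \<Omega> \<inter> ball x0 r \<longleftrightarrow> x \<in> {x \<in> ball x0 r. T x $ k > \<gamma> (P (T x))}"
      unfolding side P_def by (rule refl)
    then show ?thesis using that unfolding t_def by (simp only: Int_iff mem_Collect_eq diff_gt_0_iff_gt) simp
  qed
  \<comment> \<open>A positive height would put \<open>x0\<close> into the open set
    \<open>\<Omega>\<close>; a negative one would give it a neighbourhood disjoint from
    \<open>\<Omega>\<close>.\<close>
  have t0: "t x0 = 0"
  proof -
    have "x0 \<notin> \<Omega>" using x0 op by (simp add: frontier_def interior_open)
    then have "t x0 \<le> 0" using side'[of x0] r by simp
    moreover have "\<not> t x0 < 0"
    proof
      assume "t x0 < 0"
      then have "x0 \<in> {x. t x < 0} \<inter> ball x0 r" using r by simp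
      moreover have "open ({x. t x < 0} \<inter> ball x0 r)"
        by (intro open_Int open_Collect_less cont continuous_intros) auto
      moreover have "x0 \<in> closure \<Omega>" using x0 by (simp add: frontier_def)
      ultimately obtain y where "y \<in> \<Omega>" "t y < 0" "y \<in> ball x0 r"
        by (metis (no_types, lifting) IntE disjoint_iff mem_Collect_eq open_Int_closure_eq_empty)
      then show False using side'[of y] by simp
    qed
    ultimately show ?thesis by simp
  qed
  have "boundary_chart \<Omega> x0 e t r (1 + M)"
    by unfold_locales (use r M(1) e1 shift lip side' t0 borel_measurable_continuous_onI[OF cont] in auto)
  then show ?thesis by (rule that)
qed

text \<open>The squared seminorm of order \<open>\<sigma>\<close>, becoming the Dirichlet integral
  at order 1. The latter runs over the whole space; for test functions on \<open>\<Omega>\<close>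
  this equals the integral over \<open>\<Omega>\<close>.\<close>

definition energy :: "real \<Rightarrow> (real^'d \<Rightarrow> real) \<Rightarrow> ennreal" where
  "energy \<sigma> \<phi> = (if \<sigma> < 1 then gagliardo_borel \<sigma> \<phi> else (\<integral>\<^sup>+x. ennreal (grad_sq \<phi> x) \<partial>lborel))"

text \<open>Everything a chart provides, packed into one existential statement so that charts can be
  selected pointwise and finitely many retained. The sets are \<open>strip (L * s)\<close>: a point
  of \<open>\<Omega>\<close> within distance \<open>s\<close> of the complement has height at most
  \<open>L * s\<close>.\<close>

lemma local_layer:
  assumes C2: "C2_boundary \<Omega>" and x0: "x0 \<in> frontier \<Omega>" and \<sigma>: "1/2 < \<sigma>" "\<sigma> \<le> 1"
  shows "\<exists>\<beta> K St. \<beta> > 0 \<and> K \<ge> 0 \<and> (\<forall>s. St s \<in> sets borel) \<and>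
    (\<forall>x y s. x \<in> \<Omega> \<longrightarrow> y \<notin> \<Omega> \<longrightarrow> x \<in> ball x0 (2 * \<beta>) \<longrightarrow> y \<in> ball x0 (2 * \<beta>) \<longrightarrow> norm (x - y) < s \<longrightarrow> x \<in> St s) \<and>
    (\<forall>s. 0 < s \<longrightarrow> s \<le> \<beta> \<longrightarrow> emeasure lborel (St s) \<le> ennreal (K * s)) \<and>
    (\<forall>\<phi> G s. \<phi> \<in> Cc_inf \<Omega> \<longrightarrow> G \<ge> 0 \<longrightarrow> energy \<sigma> \<phi> \<le> ennreal G \<longrightarrow> 0 < s \<longrightarrow> s \<le> \<beta> \<longrightarrow>
      (\<integral>\<^sup>+x. indicator (St s) x * ennreal ((\<phi> x)\<^sup>2) \<partial>lborel) \<le> ennreal (K * G * s powr (2 * \<sigma>)))"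
proof -
  obtain e t r L where "boundary_chart \<Omega> x0 e t r L" using C2_chart[OF C2 x0] by metis
  then interpret boundary_chart \<Omega> x0 e t r L .
  obtain K1 where K1: "K1 \<ge> 0" "\<And>s. 0 < s \<Longrightarrow> s \<le> \<rho> \<Longrightarrow> emeasure lborel (strip s) \<le> ennreal (K1 * s)"
    using emeasure_strip_le by metis
  obtain H where H: "H \<ge> 0"
    "\<And>\<phi> C s. \<phi> \<in> Cc_inf \<Omega> \<Longrightarrow> C \<ge> 0 \<Longrightarrow>
      \<forall>s. 0 < s \<longrightarrow> 2 * s \<le> \<rho> \<longrightarrow> (\<integral>\<^sup>+x. indicator (band s) x * ennreal ((\<phi> (x - s *\<^sub>R e) - \<phi> x)\<^sup>2) \<partial>lborel) \<le> ennreal (C * s powr (2 * \<sigma>)) \<Longrightarrow>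
      0 < s \<Longrightarrow> s \<le> \<rho> \<Longrightarrow> (\<integral>\<^sup>+x. indicator (strip s) x * ennreal ((\<phi> x)\<^sup>2) \<partial>lborel) \<le> ennreal (H * C * s powr (2 * \<sigma>))"
    by (rule hardy_strip[OF \<sigma>(1)]) (rule that)
  define c where "c = (if \<sigma> < 1 then 4 * (L + 3) powr (real CARD('d) + 2 * \<sigma>) / unit_ball_vol (real CARD('d)) else 1)"
  have c: "c \<ge> 0" by (simp add: c_def)
  \<comment> \<open>Ensures \<open>L * s \<le> \<rho>\<close> for \<open>s \<le> \<beta>\<close>,
    and a ball of radius \<open>2 * \<beta>\<close> within the tangential radius
    \<open>\<rho>\<close>.\<close>
  define \<beta> where "\<beta> = \<rho> / (2 * L)"
  have \<beta>: "\<beta> > 0" "2 * (L * \<beta>) = \<rho>" using rho(1) L by (auto simp: \<beta>_def)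
  have \<beta>1: "2 * \<beta> \<le> \<rho>"
  proof -
    have "1 * \<beta> \<le> L * \<beta>" using L \<beta>(1) by (intro mult_right_mono) auto
    then show ?thesis using \<beta>(2) by linarith
  qed
  have Ls: "0 < L * s" "L * s \<le> \<rho>" if "0 < s" "s \<le> \<beta>" for s
  proof -
    show "0 < L * s" using that L by simp
    have "L * s \<le> L * \<beta>" using that L by (intro mult_left_mono) auto
    then show "L * s \<le> \<rho>" using \<beta>(2) rho(1) by linarith
  qed
  let ?St = "\<lambda>s. strip (L * s)"
  define K where "K = K1 * L + H * c * L powr (2 * \<sigma>)"
  have K: "K \<ge> 0" "K1 * L \<le> K" "H * c * L powr (2 * \<sigma>) \<le> K" using K1(1) H(1) c L by (auto simp: K_def)
  have cover: "x \<in> ?St s" if x: "x \<in> \<Omega>" "x \<in> ball x0 (2 * \<beta>)" and y: "y \<notin> \<Omega>" "y \<in> ball x0 (2 * \<beta>)" and s: "norm (x - y) < s" for x y s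
  proof -
    have b: "x \<in> ball x0 r" "y \<in> ball x0 r" using x y \<beta>1 rho(3) by auto
    have "norm (pr (x - x0)) < \<rho>"
      using norm_pr[of "x - x0"] x(2) \<beta>1 by (simp add: dist_norm norm_minus_commute)
    moreover have "t x > 0" using side[OF b(1)] x by simp
    moreover have "t x \<le> L * s"
    proof -
      have "t y \<le> 0" using side[OF b(2)] y by simp
      then have "t x \<le> L * norm (x - y)" using lip[OF b] by simp
      also have "\<dots> \<le> L * s" using s L by (intro mult_left_mono) auto
      finally show ?thesis .
    qed
    ultimately show ?thesis by (simp add: strip_def)
  qed
  have vol: "emeasure lborel (?St s) \<le> ennreal (K * s)" if "0 < s" "s \<le> \<beta>" for s
  proof -
    have "emeasure lborel (?St s) \<le> ennreal (K1 * (L * s))" by (rule K1(2)[OF Ls[OF that]])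
    also have "\<dots> \<le> ennreal (K * s)"
      using mult_right_mono[OF K(2), of s] that by (intro ennreal_leI) (simp add: mult.assoc)
    finally show ?thesis .
  qed
  have hardy: "(\<integral>\<^sup>+x. indicator (?St s) x * ennreal ((\<phi> x)\<^sup>2) \<partial>lborel) \<le> ennreal (K * G * s powr (2 * \<sigma>))"
    if \<phi>: "\<phi> \<in> Cc_inf \<Omega>" and G: "G \<ge> 0" "energy \<sigma> \<phi> \<le> ennreal G" and s: "0 < s" "s \<le> \<beta>" for \<phi> G s
  proof -
    have "(\<integral>\<^sup>+x. indicator (?St s) x * ennreal ((\<phi> x)\<^sup>2) \<partial>lborel) \<le> ennreal (H * (c * G) * (L * s) powr (2 * \<sigma>))"
    proof (rule H(2)[OF \<phi> _ _ Ls[OF s]], goal_cases)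
      case 1
      show ?case using c G by simp
    next
      case 2
      show ?case
      proof (intro allI impI)
      fix s assume s: "0 < s" "2 * s \<le> \<rho>"
      show "(\<integral>\<^sup>+x. indicator (band s) x * ennreal ((\<phi> (x - s *\<^sub>R e) - \<phi> x)\<^sup>2) \<partial>lborel) \<le> ennreal (c * G * s powr (2 * \<sigma>))"
      proof (cases "\<sigma> < 1")
        case True
        then show ?thesis
          using band_increment_gagliardo[OF smooth_borel[OF Cc_inf_smooth[OF \<phi>]] _ _ G(1) s, of \<sigma>] G(2) \<sigma>(1)
          by (simp add: c_def energy_def)
      next
        case False
        then have "\<sigma> = 1" using \<sigma> by simp
        then show ?thesis
          using band_increment_gradient[OF Cc_inf_smooth[OF \<phi>] _ s(1), of G] G(2)
          by (simp add: c_def energy_def)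
      qed
      qed
    qed
    also have "\<dots> \<le> ennreal (K * G * s powr (2 * \<sigma>))"
    proof (rule ennreal_leI)
      have "H * (c * G) * (L * s) powr (2 * \<sigma>) = (H * c * L powr (2 * \<sigma>)) * (G * s powr (2 * \<sigma>))"
        using L s by (simp add: powr_mult)
      also have "\<dots> \<le> K * (G * s powr (2 * \<sigma>))" using K(3) G(1) by (intro mult_right_mono) auto
      finally show "H * (c * G) * (L * s) powr (2 * \<sigma>) \<le> K * G * s powr (2 * \<sigma>)" by (simp add: mult.assoc)
    qed
    finally show ?thesis .
  qed
  show ?thesis
    by (intro exI[of _ \<beta>] exI[of _ K] exI[of _ "?St"] conjI allI impI;
        (rule \<beta>(1) | rule K(1) | rule borel_strip | (rule cover; assumption) | (rule vol; assumption)
          | (rule hardy; assumption)))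
qed

text \<open>The closed complement contains a nearest point, and the segment towards it meets the
  frontier no further away.\<close>

lemma depth_attained:
  assumes "x \<in> \<Omega>" obtains y where "y \<in> frontier \<Omega>" "norm (x - y) \<le> depth \<Omega> x"
proof -
  obtain y where y: "y \<in> - \<Omega>" "depth \<Omega> x = dist x y"
    using infdist_attains_inf[of "- \<Omega>" x] op compl_nonempty by (auto simp: closed_Compl)
  have "closed_segment x y \<inter> frontier \<Omega> \<noteq> {}"
    using assms y(1) by (intro connected_Int_frontier connected_segment) auto
  then obtain z where z: "z \<in> closed_segment x y" "z \<in> frontier \<Omega>" by blast
  have "norm (x - z) \<le> norm (x - y)" using segment_bound(1)[OF z(1)] by (simp add: norm_minus_commute)
  then show ?thesis using that[OF z(2)] y(2) by (simp add: dist_norm)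
qed

text \<open>Compactness of the frontier leaves finitely many charts. A point of depth below
  \<open>e\<close> has a frontier point within \<open>e\<close>; that point lies in some ball of
  radius \<open>\<beta> j\<close>, so both lie in the ball of radius \<open>2 * \<beta> j\<close>
  that the chart controls.\<close>

lemma boundary_layer:
  assumes C2: "C2_boundary \<Omega>" and \<sigma>: "1/2 < \<sigma>" "\<sigma> \<le> 1"
  obtains K b where "K \<ge> 0" "b > 0"
    "\<And>e. 0 < e \<Longrightarrow> e \<le> b \<Longrightarrow> emeasure lborel {x \<in> \<Omega>. depth \<Omega> x < e} \<le> ennreal (K * e)"
    "\<And>\<phi> G e. \<phi> \<in> Cc_inf \<Omega> \<Longrightarrow> G \<ge> 0 \<Longrightarrow> energy \<sigma> \<phi> \<le> ennreal G \<Longrightarrow> 0 < e \<Longrightarrow> e \<le> b \<Longrightarrow>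
      layer \<Omega> e \<phi> \<le> ennreal (K * G * e powr (2 * \<sigma>))"
proof -
  let ?Q = "\<lambda>x0 \<beta> K St. \<beta> > 0 \<and> K \<ge> 0 \<and> (\<forall>s. St s \<in> sets borel) \<and>
    (\<forall>x y s. x \<in> \<Omega> \<longrightarrow> y \<notin> \<Omega> \<longrightarrow> x \<in> ball x0 (2 * \<beta>) \<longrightarrow> y \<in> ball x0 (2 * \<beta>) \<longrightarrow> norm (x - y) < s \<longrightarrow> x \<in> St s) \<and>
    (\<forall>s. 0 < s \<longrightarrow> s \<le> \<beta> \<longrightarrow> emeasure lborel (St s) \<le> ennreal (K * s)) \<and>
    (\<forall>\<phi> G s. \<phi> \<in> Cc_inf \<Omega> \<longrightarrow> G \<ge> 0 \<longrightarrow> energy \<sigma> \<phi> \<le> ennreal G \<longrightarrow> 0 < s \<longrightarrow> s \<le> \<beta> \<longrightarrow>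
      (\<integral>\<^sup>+x. indicator (St s) x * ennreal ((\<phi> x)\<^sup>2) \<partial>lborel) \<le> ennreal (K * G * s powr (2 * \<sigma>)))"
  have "\<forall>x0\<in>frontier \<Omega>. \<exists>\<beta> K St. ?Q x0 \<beta> K St" using local_layer[OF C2 _ \<sigma>] by blast
  then obtain \<beta> where "\<forall>x0\<in>frontier \<Omega>. \<exists>K St. ?Q x0 (\<beta> x0) K St" by (rule bchoice[THEN exE])
  then obtain K where "\<forall>x0\<in>frontier \<Omega>. \<exists>St. ?Q x0 (\<beta> x0) (K x0) St" by (rule bchoice[THEN exE])
  then obtain St where Q: "\<forall>x0\<in>frontier \<Omega>. ?Q x0 (\<beta> x0) (K x0) (St x0)" by (rule bchoice[THEN exE])
  have cpt: "compact (frontier \<Omega>)" using bdd by (simp add: compact_frontier_bounded)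
  have "x \<in> ball x (\<beta> x)" if "x \<in> frontier \<Omega>" for x using Q that by simp
  then have cov: "frontier \<Omega> \<subseteq> (\<Union>x\<in>frontier \<Omega>. ball x (\<beta> x))" by blast
  obtain J where J: "J \<subseteq> frontier \<Omega>" "finite J" "frontier \<Omega> \<subseteq> (\<Union>x\<in>J. ball x (\<beta> x))"
    by (rule compactE_image[OF cpt _ cov]) (simp, rule that)
  \<comment> \<open>The inserted 1 keeps the set nonempty, so \<open>Min\<close> is meaningful in
    all cases.\<close>
  define b where "b = Min (insert 1 (\<beta> ` J))"
  have b: "b > 0" "\<And>j. j \<in> J \<Longrightarrow> b \<le> \<beta> j" using J Q unfolding b_def by auto
  define KK where "KK = (\<Sum>j\<in>J. K j)"
  have K0: "K j \<ge> 0" if "j \<in> J" for j using Q J that by auto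
  have KK: "KK \<ge> 0" unfolding KK_def by (intro sum_nonneg K0)
  let ?L = "\<lambda>e. {x \<in> \<Omega>. depth \<Omega> x < e}"
  have Stm[measurable]: "St j s \<in> sets borel" if "j \<in> J" for j s using Q J that by blast
  have cover: "?L e \<subseteq> (\<Union>j\<in>J. St j e)" if e: "0 < e" "e \<le> b" for e
  proof
    fix x assume x: "x \<in> ?L e"
    then obtain y where y: "y \<in> frontier \<Omega>" "norm (x - y) \<le> depth \<Omega> x" using depth_attained by blast
    then obtain j where j: "j \<in> J" "y \<in> ball j (\<beta> j)" using J by auto
    have \<beta>j: "\<beta> j > 0" "b \<le> \<beta> j" using Q J j b by auto
    have xy: "norm (x - y) < e" using x y by simp
    have "dist j x \<le> dist j y + norm (x - y)"
      using dist_triangle[of j x y] by (simp add: dist_norm norm_minus_commute)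
    then have "x \<in> ball j (2 * \<beta> j)" "y \<in> ball j (2 * \<beta> j)" using j(2) xy e \<beta>j by auto
    moreover have "y \<notin> \<Omega>" using y(1) op by (simp add: frontier_def interior_open)
    ultimately have "x \<in> St j e" using Q J j(1) x xy by blast
    then show "x \<in> (\<Union>j\<in>J. St j e)" using j(1) by blast
  qed
  show ?thesis
  proof (rule that[OF KK b(1)])
    fix e :: real assume e: "0 < e" "e \<le> b"
    have "emeasure lborel (?L e) \<le> emeasure lborel (\<Union>j\<in>J. St j e)"
      by (rule emeasure_mono[OF cover[OF e]]) (use J Stm in auto)
    also have "\<dots> \<le> (\<Sum>j\<in>J. emeasure lborel (St j e))"
      by (rule emeasure_subadditive_finite) (use J Stm in auto)
    also have "\<dots> \<le> (\<Sum>j\<in>J. ennreal (K j * e))"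
    proof (rule sum_mono)
      fix j assume j: "j \<in> J"
      then have "e \<le> \<beta> j" using b e by force
      then show "emeasure lborel (St j e) \<le> ennreal (K j * e)" using Q J j e by blast
    qed
    also have "\<dots> = ennreal (KK * e)"
      using K0 e by (subst sum_ennreal) (auto simp: KK_def sum_distrib_right)
    finally show "emeasure lborel (?L e) \<le> ennreal (KK * e)" .
  next
    fix \<phi> and G e :: real
    assume \<phi>: "\<phi> \<in> Cc_inf \<Omega>" and G: "G \<ge> 0" "energy \<sigma> \<phi> \<le> ennreal G" and e: "0 < e" "e \<le> b"
    note [measurable] = smooth_borel[OF Cc_inf_smooth[OF \<phi>]]
    have "layer \<Omega> e \<phi> \<le> (\<integral>\<^sup>+x. (\<Sum>j\<in>J. indicator (St j e) x * ennreal ((\<phi> x)\<^sup>2)) \<partial>lborel)"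
      unfolding layer_def
    proof (rule nn_integral_mono)
      fix x
      show "indicator (?L e) x * ennreal ((\<phi> x)\<^sup>2) \<le> (\<Sum>j\<in>J. indicator (St j e) x * ennreal ((\<phi> x)\<^sup>2))"
      proof (cases "x \<in> ?L e")
        case True
        then obtain j where j: "j \<in> J" "x \<in> St j e" using cover[OF e] by blast
        have "indicator (St j e) x * ennreal ((\<phi> x)\<^sup>2) \<le> (\<Sum>j\<in>J. indicator (St j e) x * ennreal ((\<phi> x)\<^sup>2))"
          by (rule member_le_sum[OF j(1)]) (use J in auto)
        then show ?thesis using True j by simp
      qed simp
    qed
    also have "\<dots> = (\<Sum>j\<in>J. \<integral>\<^sup>+x. indicator (St j e) x * ennreal ((\<phi> x)\<^sup>2) \<partial>lborel)"
      by (rule nn_integral_sum) (use Stm in measurable)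
    also have "\<dots> \<le> (\<Sum>j\<in>J. ennreal (K j * (G * e powr (2 * \<sigma>))))"
    proof (rule sum_mono)
      fix j assume j: "j \<in> J"
      then have "e \<le> \<beta> j" using b e by force
      then have "(\<integral>\<^sup>+x. indicator (St j e) x * ennreal ((\<phi> x)\<^sup>2) \<partial>lborel) \<le> ennreal (K j * G * e powr (2 * \<sigma>))"
        using Q J j e \<phi> G by blast
      then show "(\<integral>\<^sup>+x. indicator (St j e) x * ennreal ((\<phi> x)\<^sup>2) \<partial>lborel) \<le> ennreal (K j * (G * e powr (2 * \<sigma>)))"
        by (simp add: mult.assoc)
    qed
    also have "\<dots> = ennreal (KK * (G * e powr (2 * \<sigma>)))"
      using K0 G(1) by (subst sum_ennreal) (auto simp: KK_def sum_distrib_right)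
    finally show "layer \<Omega> e \<phi> \<le> ennreal (KK * G * e powr (2 * \<sigma>))" by (simp add: mult.assoc)
  qed
qed

section \<open>Smooth approximants of Sobolev functions\<close>

lemma l2norm_cong_AE:
  assumes g: "g \<in> borel_measurable (lebesgue_on \<Omega>)" and eq: "AE x in lebesgue_on \<Omega>. f x = g x"
  shows "l2norm (lebesgue_on \<Omega>) f = l2norm (lebesgue_on \<Omega>) g"
proof -
  note [measurable] = g borel_measurable_lebesgue_on_AE[OF g borel eq]
  have "(LINT x|lebesgue_on \<Omega>. (f x)\<^sup>2) = (LINT x|lebesgue_on \<Omega>. (g x)\<^sup>2)"
    by (intro integral_cong_AE) (use eq in auto)
  then show ?thesis by (simp add: l2norm_def)
qed

lemma l2norm_eq_nn_integral:
  assumes f: "f \<in> borel_measurable borel" and L2: "f \<in> L2 (lebesgue_on \<Omega>)"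
  shows "(\<integral>\<^sup>+x. indicator \<Omega> x * ennreal ((f x)\<^sup>2) \<partial>lborel) = ennreal ((l2norm (lebesgue_on \<Omega>) f)\<^sup>2)"
  using L2_nn_integral_eq[OF L2] by (simp add: nn_integral_lebesgue_on[OF borel] mult.commute)

lemma finite_lists: "finite {is :: 'd list. length is \<le> n}" "finite {is :: 'd list. length is = n}"
  using finite_lists_length_le[of "UNIV :: 'd set" n] finite_lists_length_eq[of "UNIV :: 'd set" n] by simp_all

lemma l2norm_le_sobolev_norm:
  assumes "length is \<le> nat \<lfloor>s\<rfloor>"
  shows "l2norm (lebesgue_on \<Omega>) (wderiv \<Omega> is f) \<le> sobolev_norm \<Omega> s f"
proof -
  have "(l2norm (lebesgue_on \<Omega>) (wderiv \<Omega> is f))\<^sup>2 \<le> (\<Sum>is | length is \<le> nat \<lfloor>s\<rfloor>. (l2norm (lebesgue_on \<Omega>) (wderiv \<Omega> is f))\<^sup>2)"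
    using assms finite_lists by (intro member_le_sum) auto
  also have "\<dots> \<le> (\<Sum>is | length is \<le> nat \<lfloor>s\<rfloor>. (l2norm (lebesgue_on \<Omega>) (wderiv \<Omega> is f))\<^sup>2) +
     (if frac s > 0 then \<Sum>is | length is = nat \<lfloor>s\<rfloor>. enn2real (gagliardo_sq \<Omega> (frac s) (wderiv \<Omega> is f)) else 0)"
    by (simp add: sum_nonneg)
  finally show ?thesis unfolding sobolev_norm_def by (rule real_le_rsqrt)
qed

lemma gagliardo_le_sobolev_norm:
  assumes "0 < s" "s < 1"
  shows "enn2real (gagliardo_sq \<Omega> s (wderiv \<Omega> [] f)) \<le> (sobolev_norm \<Omega> s f)\<^sup>2"
proof -
  have fl: "\<lfloor>s\<rfloor> = 0" using assms by linarith
  then have fr: "frac s = s" by (simp add: frac_def)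
  have "0 \<le> (\<Sum>is | length is \<le> nat \<lfloor>s\<rfloor>. (l2norm (lebesgue_on \<Omega>) (wderiv \<Omega> is f))\<^sup>2)" by (rule sum_nonneg) simp
  then show ?thesis
    using assms unfolding sobolev_norm_def fr by (simp add: fl)
qed

lemma weak_deriv_Nil:
  assumes "integrable (lebesgue_on \<Omega>) f" shows "weak_deriv \<Omega> [] f f"
  unfolding weak_deriv_def using integrable_lebesgue_on_mono[OF assms] by (auto simp: compact_level_sets)

lemma integrable_lebesgue_on_smooth:
  fixes f :: "real^'d \<Rightarrow> real"
  assumes f: "smooth f" and C: "compact C" shows "integrable (lebesgue_on C) f"
proof -
  have "integrable lborel (\<lambda>x. indicator C x *\<^sub>R f x)"
    by (rule borel_integrable_compact[OF C smooth_continuous_on[OF f]])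
  moreover have "(\<lambda>x. indicator C x *\<^sub>R f x) \<in> borel_measurable borel"
    using smooth_borel[OF f] compact_level_sets[OF C] by measurable
  ultimately have "integrable lebesgue (\<lambda>x. indicator C x *\<^sub>R f x)"
    by (simp add: integrable_completion)
  then show ?thesis using compact_level_sets[OF C] by (subst integrable_restrict_space) auto
qed

text \<open>The product of \<open>f\<close> with a test function is a test function, and its partial
  derivative integrates to 0.\<close>

lemma weak_deriv_smooth:
  assumes f: "smooth f" shows "weak_deriv \<Omega> [i] f (pd i f)"
proof -
  have "(LINT x|lebesgue_on \<Omega>. f x * pd i \<zeta> x) = - (LINT x|lebesgue_on \<Omega>. pd i f x * \<zeta> x)"
    if \<zeta>: "\<zeta> \<in> Cc_inf \<Omega>" for \<zeta>
  proof -
    have f\<zeta>: "(\<lambda>x. f x * \<zeta> x) \<in> Cc_inf \<Omega>" by (rule Cc_inf_mult[OF \<zeta> f])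
    have pd: "pd i (\<lambda>x. f x * \<zeta> x) = (\<lambda>x. f x * pd i \<zeta> x + pd i f x * \<zeta> x)"
      by (rule ext, rule pd_mult) (auto intro: smooth_differentiable f Cc_inf_smooth[OF \<zeta>])
    obtain K where K: "compact K" "K \<subseteq> \<Omega>" "\<And>x i. x \<notin> K \<Longrightarrow> pd i (\<lambda>x. f x * \<zeta> x) x = 0"
      by (rule Cc_infE[OF f\<zeta>]) (rule that)
    have m: "pd i (\<lambda>x. f x * \<zeta> x) \<in> borel_measurable borel"
      by (rule smooth_borel[OF smooth_pd[OF Cc_inf_smooth[OF f\<zeta>]]])
    have "(LINT x|lebesgue_on \<Omega>. pd i (\<lambda>x. f x * \<zeta> x) x * 1) = (LINT x|lborel. pd i (\<lambda>x. f x * \<zeta> x) x * 1)"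
    proof (rule integral_borel_representative[OF borel borel_measurable_lebesgue_onI[OF m] m])
      show "pd i (\<lambda>x. f x * \<zeta> x) x = 0" if "x \<notin> \<Omega>" for x
        by (rule K(3)) (use that K(2) in blast)
    qed simp_all
    then have "(LINT x|lebesgue_on \<Omega>. f x * pd i \<zeta> x + pd i f x * \<zeta> x) = 0"
      using integral_pd_eq_0[OF f\<zeta>, of i] by (simp add: pd)
    moreover have "integrable (lebesgue_on \<Omega>) (\<lambda>x. f x * pd i \<zeta> x)" "integrable (lebesgue_on \<Omega>) (\<lambda>x. pd i f x * \<zeta> x)"
      by (intro integrable_mult_test integrable_lebesgue_on_smooth f smooth_pd \<zeta> Cc_inf_pd; assumption)+
    ultimately show ?thesis by simp
  qed
  then show ?thesis
    unfolding weak_deriv_def using integrable_lebesgue_on_smooth f smooth_pd[OF f] by simp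
qed

lemma weak_deriv_diff:
  assumes w1: "weak_deriv \<Omega> is u1 v1" and w2: "weak_deriv \<Omega> is u2 v2"
  shows "weak_deriv \<Omega> is (\<lambda>x. u1 x - u2 x) (\<lambda>x. v1 x - v2 x)"
proof -
  have i: "integrable (lebesgue_on C) u1" "integrable (lebesgue_on C) v1" "integrable (lebesgue_on C) u2" "integrable (lebesgue_on C) v2"
    if "compact C" "C \<subseteq> \<Omega>" for C using w1 w2 that by (auto simp: weak_deriv_def)
  have "(LINT x|lebesgue_on \<Omega>. (u1 x - u2 x) * foldr pd is \<phi> x) = (-1) ^ length is * (LINT x|lebesgue_on \<Omega>. (v1 x - v2 x) * \<phi> x)"
    if \<phi>: "\<phi> \<in> Cc_inf \<Omega>" for \<phi>
  proof -
    have \<phi>': "foldr pd is \<phi> \<in> Cc_inf \<Omega>" using \<phi> by (induction "is") (auto intro: Cc_inf_pd)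
    show ?thesis
      using weak_deriv_integral[OF w1 \<phi>] weak_deriv_integral[OF w2 \<phi>]
        integrable_mult_test[OF i(1) \<phi>'] integrable_mult_test[OF i(3) \<phi>'] integrable_mult_test[OF i(2) \<phi>] integrable_mult_test[OF i(4) \<phi>]
      by (simp add: left_diff_distrib right_diff_distrib)
  qed
  with i show ?thesis unfolding weak_deriv_def by simp
qed

lemma grad_sq_le:
  assumes \<phi>: "\<phi> \<in> Cc_inf UNIV" and B: "\<And>i. l2norm (lebesgue_on \<Omega>) (pd i \<phi>) \<le> B i"
  shows "(\<integral>\<^sup>+x. indicator \<Omega> x * ennreal (grad_sq \<phi> x) \<partial>lborel) \<le> ennreal (\<Sum>i\<in>UNIV. (B i)\<^sup>2)"
proof -
  have m[measurable]: "pd i \<phi> \<in> borel_measurable borel" for i by (rule smooth_borel[OF Cc_inf_smooth[OF Cc_inf_pd[OF \<phi>]]])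
  have "ennreal (grad_sq \<phi> x) = (\<Sum>i\<in>UNIV. ennreal ((pd i \<phi> x)\<^sup>2))" for x
    unfolding grad_sq_def by (rule sum_ennreal[symmetric]) simp
  then have "(\<integral>\<^sup>+x. indicator \<Omega> x * ennreal (grad_sq \<phi> x) \<partial>lborel) = (\<integral>\<^sup>+x. (\<Sum>i\<in>UNIV. indicator \<Omega> x * ennreal ((pd i \<phi> x)\<^sup>2)) \<partial>lborel)"
    by (simp only: sum_distrib_left)
  also have "\<dots> = (\<Sum>i\<in>UNIV. \<integral>\<^sup>+x. indicator \<Omega> x * ennreal ((pd i \<phi> x)\<^sup>2) \<partial>lborel)"
    by (rule nn_integral_sum) measurable
  also have "\<dots> = (\<Sum>i\<in>UNIV. ennreal ((l2norm (lebesgue_on \<Omega>) (pd i \<phi>))\<^sup>2))"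
    by (intro sum.cong refl l2norm_eq_nn_integral m Cc_inf_L2 Cc_inf_pd \<phi>)
  also have "\<dots> \<le> (\<Sum>i\<in>UNIV. ennreal ((B i)\<^sup>2))"
    by (intro sum_mono ennreal_leI power_mono B l2norm_nonneg)
  also have "\<dots> = ennreal (\<Sum>i\<in>UNIV. (B i)\<^sup>2)" by (rule sum_ennreal) simp
  finally show ?thesis .
qed

text \<open>The trace condition supplies functions smooth on the whole space that converge to
  \<open>U\<close> in \<open>H^1\<close>. Their gradients are eventually bounded by those of
  \<open>U\<close> plus 1, while the \<open>L^2\<close> error is as small as desired; the
  approximant may thus depend on the scale with \<open>G\<close> fixed.\<close>

lemma trace_approximation:
  assumes tr: "has_trace \<Omega> U g"
  obtains G where "G \<ge> 0" "\<And>e. e > 0 \<Longrightarrow> \<exists>\<phi>\<in>Cc_inf UNIV.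
    (\<integral>\<^sup>+x. indicator \<Omega> x * ennreal (grad_sq \<phi> x) \<partial>lborel) \<le> ennreal G \<and>
    l2norm (lebesgue_on \<Omega>) (\<lambda>x. \<phi> x - U x) \<le> e"
proof -
  let ?M = "lebesgue_on \<Omega>"
  obtain \<phi> where \<phi>: "\<And>n::nat. \<phi> n \<in> Cc_inf UNIV" and lim: "(\<lambda>n. sobolev_norm \<Omega> 1 (\<lambda>x. \<phi> n x - U x)) \<longlonglongrightarrow> 0"
    using tr unfolding has_trace_def by blast
  have U: "U \<in> L2 ?M" and ex: "\<And>i. \<exists>v\<in>L2 ?M. weak_deriv \<Omega> [i] U v"
    using tr unfolding has_trace_def sobolev_def by auto
  have "\<forall>i. \<exists>v. v \<in> L2 ?M \<and> weak_deriv \<Omega> [i] U v" using ex by blast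
  then obtain V where V: "\<And>i. V i \<in> L2 ?M" "\<And>i. weak_deriv \<Omega> [i] U (V i)" by metis
  have d0: "l2norm ?M (\<lambda>x. \<phi> n x - U x) \<le> sobolev_norm \<Omega> 1 (\<lambda>x. \<phi> n x - U x)" for n
  proof -
    have L: "(\<lambda>x. \<phi> n x - U x) \<in> L2 ?M" by (rule L2_diff[OF Cc_inf_L2[OF \<phi>] U])
    have "l2norm ?M (wderiv \<Omega> [] (\<lambda>x. \<phi> n x - U x)) = l2norm ?M (\<lambda>x. \<phi> n x - U x)"
      by (rule l2norm_cong_AE[OF L2_measurable[OF L] wderiv_AE[OF weak_deriv_Nil[OF L2_integrable[OF L]]]])
    then show ?thesis using l2norm_le_sobolev_norm[of "[]" 1 "\<lambda>x. \<phi> n x - U x"] by simp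
  qed
  have d1: "l2norm ?M (pd i (\<phi> n)) \<le> l2norm ?M (V i) + sobolev_norm \<Omega> 1 (\<lambda>x. \<phi> n x - U x)" for i n
  proof -
    have p: "pd i (\<phi> n) \<in> L2 ?M" by (rule Cc_inf_L2[OF Cc_inf_pd[OF \<phi>]])
    have L: "(\<lambda>x. pd i (\<phi> n) x - V i x) \<in> L2 ?M" by (rule L2_diff[OF p V(1)])
    have "l2norm ?M (wderiv \<Omega> [i] (\<lambda>x. \<phi> n x - U x)) = l2norm ?M (\<lambda>x. pd i (\<phi> n) x - V i x)"
      by (rule l2norm_cong_AE[OF L2_measurable[OF L] wderiv_AE[OF weak_deriv_diff[OF weak_deriv_smooth[OF Cc_inf_smooth[OF \<phi>]] V(2)]]])
    then have "l2norm ?M (\<lambda>x. pd i (\<phi> n) x - V i x) \<le> sobolev_norm \<Omega> 1 (\<lambda>x. \<phi> n x - U x)"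
      using l2norm_le_sobolev_norm[of "[i]" 1 "\<lambda>x. \<phi> n x - U x"] by simp
    then show ?thesis using l2norm_triangle[OF V(1)[of i] L] by simp
  qed
  define G where "G = (\<Sum>i\<in>UNIV. (l2norm ?M (V i) + 1)\<^sup>2)"
  have "G \<ge> 0" by (simp add: G_def sum_nonneg)
  then show ?thesis
  proof (rule that)
    fix e :: real assume "e > 0"
    then have "eventually (\<lambda>n. sobolev_norm \<Omega> 1 (\<lambda>x. \<phi> n x - U x) < min e 1) sequentially"
      using lim by (intro order_tendstoD(2)) auto
    then obtain n where n: "sobolev_norm \<Omega> 1 (\<lambda>x. \<phi> n x - U x) < min e 1"
      unfolding eventually_sequentially by blast
    have "(\<integral>\<^sup>+x. indicator \<Omega> x * ennreal (grad_sq (\<phi> n) x) \<partial>lborel) \<le> ennreal G"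
      unfolding G_def
    proof (rule grad_sq_le[OF \<phi>])
      show "l2norm ?M (pd i (\<phi> n)) \<le> l2norm ?M (V i) + 1" for i using d1[of i n] n by simp
    qed
    moreover have "l2norm ?M (\<lambda>x. \<phi> n x - U x) \<le> e" using d0[of n] n by simp
    ultimately show "\<exists>\<phi>\<in>Cc_inf UNIV. (\<integral>\<^sup>+x. indicator \<Omega> x * ennreal (grad_sq \<phi> x) \<partial>lborel) \<le> ennreal G \<and>
      l2norm ?M (\<lambda>x. \<phi> x - U x) \<le> e" using \<phi> by blast
  qed
qed

section \<open>Finiteness of the Gagliardo seminorm on test functions\<close>

lemma gagliardo_sq_eq:
  "gagliardo_sq \<Omega> \<sigma> f = gagliardo_borel \<sigma> f"
  unfolding gagliardo_sq_def gagliardo_borel_def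
  by (simp add: nn_integral_lebesgue_on[OF borel] mult.commute)

lemma gagliardo_sq_cong_AE:
  assumes "AE x in lebesgue_on \<Omega>. f x = g x"
  shows "gagliardo_sq \<Omega> \<sigma> f = gagliardo_sq \<Omega> \<sigma> g"
  unfolding gagliardo_sq_def
proof (rule nn_integral_cong_AE)
  show "AE x in lebesgue_on \<Omega>. (\<integral>\<^sup>+y. ennreal (\<bar>f x - f y\<bar>\<^sup>2 / norm (x - y) powr (real CARD('d) + 2 * \<sigma>)) \<partial>lebesgue_on \<Omega>)
      = (\<integral>\<^sup>+y. ennreal (\<bar>g x - g y\<bar>\<^sup>2 / norm (x - y) powr (real CARD('d) + 2 * \<sigma>)) \<partial>lebesgue_on \<Omega>)"
    using assms
  proof eventually_elim
    case (elim x)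
    show ?case by (rule nn_integral_cong_AE) (use assms elim in \<open>auto elim: eventually_mono\<close>)
  qed
qed

text \<open>Dyadic decomposition around the singularity: in the shell below radius
  \<open>R / 2^j\<close> the integrand is at most \<open>c j\<close>, and \<open>c j\<close> times
  the volume of the ball is a geometric sequence with ratio \<open>2 powr (- a)\<close>.\<close>

lemma nn_integral_norm_powr_finite:
  assumes a: "0 < a" "a \<le> real CARD('d)" and R: "R > 0"
  shows "(\<integral>\<^sup>+z. indicator (ball (0::real^'d) R) z * ennreal (norm z powr (a - real CARD('d))) \<partial>lborel) < \<infinity>"
proof -
  let ?n = "real CARD('d)"
  define r where "r j = R / 2 ^ j" for j :: nat
  have r: "r j > 0" for j using R by (simp add: r_def)
  define c where "c j = (r j / 2) powr (a - ?n)" for j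
  define om where "om = unit_ball_vol ?n"
  have om: "om \<ge> 0" by (simp add: om_def)
  have "indicator (ball (0::real^'d) R) z * ennreal (norm z powr (a - ?n))
      \<le> (\<Sum>j. ennreal (c j) * indicator (ball 0 (r j)) z)" for z
  proof (cases "z \<in> ball 0 R \<and> z \<noteq> 0")
    case True
    then have z: "norm z > 0" "norm z < R" by auto
    obtain k where "R / norm z < 2 ^ k" using real_arch_pow[of 2 "R / norm z"] by auto
    then have "r k < norm z" using z by (simp add: r_def field_simps)
    then have ex: "\<exists>k. r k \<le> norm z" by (auto intro: less_imp_le)
    \<comment> \<open>The first dyadic radius not exceeding \<open>norm z\<close>. It is not the
      zeroth one, since \<open>norm z < R\<close>, so \<open>z\<close> lies in the shell just before
      it.\<close>
    define m where "m = (LEAST k. r k \<le> norm z)"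
    have m: "r m \<le> norm z" unfolding m_def by (rule LeastI_ex[OF ex])
    have "m \<noteq> 0"
    proof
      assume "m = 0"
      then show False using m z by (simp add: r_def)
    qed
    then obtain j where j: "m = Suc j" using not0_implies_Suc by blast
    have "\<not> r j \<le> norm z" using not_less_Least[of j "\<lambda>k. r k \<le> norm z"] j unfolding m_def by simp
    then have zj: "z \<in> ball 0 (r j)" by simp
    have "norm z powr (a - ?n) \<le> c j"
      unfolding c_def using m r[of j] a by (intro powr_mono2') (auto simp: j r_def)
    then have "indicator (ball (0::real^'d) R) z * ennreal (norm z powr (a - ?n)) \<le> ennreal (c j) * indicator (ball 0 (r j)) z"
      using True zj by (simp add: ennreal_leI)
    also have "\<dots> \<le> (\<Sum>j. ennreal (c j) * indicator (ball 0 (r j)) z)"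
    proof -
      define h where "h = (\<lambda>j. ennreal (c j) * indicator (ball 0 (r j)) z)"
      have "h j \<le> suminf h" using sum_le_suminf[of h "{j}"] by (simp add: summableI)
      then show ?thesis unfolding h_def .
    qed
    finally show ?thesis .
  qed auto
  then have "(\<integral>\<^sup>+z. indicator (ball (0::real^'d) R) z * ennreal (norm z powr (a - ?n)) \<partial>lborel)
      \<le> (\<integral>\<^sup>+z. (\<Sum>j. ennreal (c j) * indicator (ball (0::real^'d) (r j)) z) \<partial>lborel)"
    by (rule nn_integral_mono)
  also have "\<dots> = (\<Sum>j. \<integral>\<^sup>+z. ennreal (c j) * indicator (ball (0::real^'d) (r j)) z \<partial>lborel)"
    by (intro nn_integral_suminf borel_measurable_times_ennreal borel_measurable_const borel_measurable_indicator) simp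
  also have "\<dots> = (\<Sum>j. ennreal (om * 2 powr (?n - a) * R powr a * (2 powr (- a)) ^ j))"
  proof (intro suminf_cong)
    fix j
    have "(\<integral>\<^sup>+z. ennreal (c j) * indicator (ball (0::real^'d) (r j)) z \<partial>lborel) = ennreal (c j) * ennreal (om * r j ^ CARD('d))"
      using r[of j] by (subst nn_integral_cmult_indicator) (simp_all add: emeasure_ball om_def)
    also have "\<dots> = ennreal (c j * (om * r j ^ CARD('d)))" using om r[of j] by (simp add: c_def ennreal_mult)
    also have "c j * (om * r j ^ CARD('d)) = om * 2 powr (?n - a) * R powr a * (2 powr (- a)) ^ j"
    proof -
      have "c j = r j powr (a - ?n) * 2 powr (?n - a)"
        using r[of j] by (simp add: c_def powr_divide powr_minus_divide[of 2 "?n - a", symmetric] powr_diff field_simps)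
      moreover have "r j powr (a - ?n) * r j ^ CARD('d) = r j powr a"
        using r[of j] by (simp add: powr_realpow[symmetric] powr_add[symmetric])
      moreover have "r j powr a = R powr a * (2 powr (- a)) ^ j"
        using R by (simp add: r_def powr_divide powr_minus_divide power_divide powr_power powr_powr mult.commute flip: powr_realpow)
      ultimately show ?thesis by (simp add: mult_ac)
    qed
    finally show "(\<integral>\<^sup>+z. ennreal (c j) * indicator (ball (0::real^'d) (r j)) z \<partial>lborel) = ennreal (om * 2 powr (?n - a) * R powr a * (2 powr (- a)) ^ j)" .
  qed
  also have "\<dots> < \<infinity>"
  proof -
    have "2 powr (- a) < 2 powr 0" using a by (intro powr_less_mono) auto
    then have "summable (\<lambda>j. om * 2 powr (?n - a) * R powr a * (2 powr (- a)) ^ j)"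
      by (intro summable_mult summable_geometric) simp
    then show ?thesis using om by (subst suminf_ennreal2) (auto intro!: mult_nonneg_nonneg)
  qed
  finally show ?thesis .
qed

text \<open>Since \<^const>\<open>enn2real\<close> sends infinity to 0, a small Sobolev norm bounds the Gagliardo seminorm
  only once the latter is known to be finite.\<close>

lemma gagliardo_finite:
  assumes \<phi>: "\<phi> \<in> Cc_inf UNIV" and \<sigma>: "0 < \<sigma>" "\<sigma> < 1" and n: "CARD('d) \<ge> 2"
  shows "gagliardo_borel \<sigma> \<phi> < \<infinity>"
proof -
  let ?n = "real CARD('d)"
  have \<phi>m[measurable]: "\<phi> \<in> borel_measurable borel" by (rule smooth_borel[OF Cc_inf_smooth[OF \<phi>]])
  have "\<exists>B>0. \<forall>x. \<bar>pd i \<phi> x\<bar> \<le> B" for i using Cc_inf_bounded[OF Cc_inf_pd[OF \<phi>]] by metis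
  then obtain B where B: "\<And>i. B i > 0" "\<And>i x. \<bar>pd i \<phi> x\<bar> \<le> B i" by metis
  define M where "M = (\<Sum>i\<in>UNIV. (B i)\<^sup>2)"
  have M: "M \<ge> 0" by (simp add: M_def sum_nonneg)
  have g: "grad_sq \<phi> x \<le> M" for x
    unfolding grad_sq_def M_def using B by (intro sum_mono power2_le_iff_abs_le[THEN iffD2]) (auto simp: less_imp_le)
  have inc: "(\<phi> x - \<phi> y)\<^sup>2 \<le> (norm (x - y))\<^sup>2 * M" for x y
  proof -
    have "ennreal ((\<phi> (y + (x - y)) - \<phi> y)\<^sup>2) \<le> ennreal ((norm (x - y))\<^sup>2) * (\<integral>\<^sup>+t. indicator {0..1} t * ennreal (grad_sq \<phi> (y + t *\<^sub>R (x - y))) \<partial>lborel)"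
      by (rule smooth_increment_le[OF Cc_inf_smooth[OF \<phi>]])
    also have "\<dots> \<le> ennreal ((norm (x - y))\<^sup>2) * (\<integral>\<^sup>+t. ennreal M * indicator {0..1::real} t \<partial>lborel)"
      using g by (intro mult_left_mono nn_integral_mono) (auto simp: indicator_def intro: ennreal_leI)
    also have "\<dots> = ennreal ((norm (x - y))\<^sup>2 * M)"
      by (simp add: nn_integral_cmult_indicator ennreal_mult')
    finally show ?thesis using M by (simp add: ennreal_le_iff)
  qed
  obtain R where R: "R > 0" "\<And>x. x \<in> \<Omega> \<Longrightarrow> norm x \<le> R" using bdd unfolding bounded_pos by auto
  \<comment> \<open>A bounded gradient makes the numerator \<open>O(|z|^2)\<close>, leaving the
    power \<open>2 - (d + 2\<sigma>) = a - d\<close>; the bound \<open>a \<le> d\<close> holds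
    because \<open>d \<ge> 2\<close>.\<close>
  define a where "a = 2 - 2 * \<sigma>"
  have a: "0 < a" "a \<le> ?n" using \<sigma> n by (auto simp: a_def)
  let ?I = "\<integral>\<^sup>+z. indicator (ball (0::real^'d) (3 * R)) z * ennreal (norm z powr (a - ?n)) \<partial>lborel"
  have I: "?I < \<infinity>" by (rule nn_integral_norm_powr_finite[OF a]) (use R in simp)
  have inner: "(\<integral>\<^sup>+y. indicator \<Omega> y * ennreal ((\<phi> x - \<phi> y)\<^sup>2 / norm (x - y) powr (?n + 2 * \<sigma>)) \<partial>lborel) \<le> ennreal M * ?I"
    if x: "x \<in> \<Omega>" for x
  proof -
    let ?F = "\<lambda>y. indicator \<Omega> y * ennreal ((\<phi> x - \<phi> y)\<^sup>2 / norm (x - y) powr (?n + 2 * \<sigma>))"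
    have "(\<integral>\<^sup>+y. ?F y \<partial>lborel) = (\<integral>\<^sup>+z. ?F (z + x) \<partial>lborel)"
      by (rule nn_integral_lborel_translation[symmetric]) measurable
    also have "\<dots> \<le> (\<integral>\<^sup>+(z::real^'d). ennreal M * (indicator (ball 0 (3 * R)) z * ennreal (norm z powr (a - ?n))) \<partial>lborel)"
    proof (rule nn_integral_mono)
      fix z
      show "?F (z + x) \<le> ennreal M * (indicator (ball 0 (3 * R)) z * ennreal (norm z powr (a - ?n)))"
      proof (cases "z + x \<in> \<Omega> \<and> z \<noteq> 0")
        case True
        have "norm z \<le> norm (z + x) + norm x" using norm_triangle_ineq4[of "z + x" x] by simp
        then have zb: "z \<in> ball 0 (3 * R)" using R(2)[OF x] R(2)[of "z + x"] True R(1) by simp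
        have z: "norm z > 0" using True by simp
        have "(\<phi> x - \<phi> (z + x))\<^sup>2 / norm z powr (?n + 2 * \<sigma>) \<le> (norm z)\<^sup>2 * M / norm z powr (?n + 2 * \<sigma>)"
          using inc[of x "z + x"] by (intro divide_right_mono) auto
        also have "(norm z)\<^sup>2 * M / norm z powr (?n + 2 * \<sigma>) = M * norm z powr (a - ?n)"
        proof -
          have "(norm z)\<^sup>2 = norm z powr 2" using z by simp
          then have "(norm z)\<^sup>2 / norm z powr (?n + 2 * \<sigma>) = norm z powr (2 - (?n + 2 * \<sigma>))"
            by (simp only: powr_diff)
          also have "2 - (?n + 2 * \<sigma>) = a - ?n" by (simp add: a_def)
          finally have "M * ((norm z)\<^sup>2 / norm z powr (?n + 2 * \<sigma>)) = M * norm z powr (a - ?n)"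
            by (simp only:)
          then show ?thesis by (simp only: times_divide_eq_right mult.commute[of _ M])
        qed
        finally have "ennreal ((\<phi> x - \<phi> (z + x))\<^sup>2 / norm z powr (?n + 2 * \<sigma>)) \<le> ennreal (M * norm z powr (a - ?n))"
          by (rule ennreal_leI)
        then show ?thesis using True zb M by (simp add: ennreal_mult)
      qed auto
    qed
    also have "\<dots> = ennreal M * ?I"
    proof (rule nn_integral_cmult)
      show "(\<lambda>z. indicator (ball (0::real^'d) (3 * R)) z * ennreal (norm z powr (a - ?n))) \<in> borel_measurable lborel"
        by (intro borel_measurable_times_ennreal borel_measurable_indicator) (simp, measurable)
    qed
    finally show ?thesis .
  qed
  have "gagliardo_borel \<sigma> \<phi> \<le> (\<integral>\<^sup>+x. (ennreal M * ?I) * indicator \<Omega> x \<partial>lborel)"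
    unfolding gagliardo_borel_def
  proof (rule nn_integral_mono)
    fix x
    show "indicator \<Omega> x * (\<integral>\<^sup>+y. indicator \<Omega> y * ennreal ((\<phi> x - \<phi> y)\<^sup>2 / norm (x - y) powr (?n + 2 * \<sigma>)) \<partial>lborel)
      \<le> (ennreal M * ?I) * indicator \<Omega> x" using inner[of x] by (cases "x \<in> \<Omega>") simp_all
  qed
  also have "\<dots> = (ennreal M * ?I) * emeasure lborel \<Omega>" by (rule nn_integral_cmult_indicator) simp
  also have "\<dots> < \<infinity>" using I emeasure_bounded_finite[OF bdd] by (simp add: ennreal_mult_less_top)
  finally show ?thesis .
qed

end

section \<open>Oscillation and layer bounds for the solution and the source difference\<close>

lemma ennreal_twice_add: "a \<ge> 0 \<Longrightarrow> b \<ge> 0 \<Longrightarrow> ennreal (2 * a + 2 * b) = 2 * ennreal a + 2 * ennreal b"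
  by (simp add: ennreal_plus ennreal_mult)

context bounded_open
begin

text \<open>At scale \<open>e\<close> an approximant with \<open>L^2\<close> error \<open>e\<close>
  is used, so that the gradient part and the perturbation part both have order
  \<open>e^(d+2)\<close>.\<close>

lemma trace_oscillation:
  assumes tr: "has_trace \<Omega> U g" and vm: "v \<in> borel_measurable borel" and eq: "AE x in lebesgue_on \<Omega>. U x = v x"
  obtains K where "K \<ge> 0" "\<And>e. e > 0 \<Longrightarrow> osc \<Omega> e v \<le> ennreal (K * (e ^ CARD('d) * e\<^sup>2))"
proof -
  let ?M = "lebesgue_on \<Omega>" and ?om = "unit_ball_vol (real CARD('d))"
  have om: "?om \<ge> 0" by simp
  have U: "U \<in> L2 ?M" using tr by (simp add: has_trace_def sobolev_def)
  obtain G where G: "G \<ge> 0" "\<And>e. e > 0 \<Longrightarrow> \<exists>\<phi>\<in>Cc_inf UNIV.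
    (\<integral>\<^sup>+x. indicator \<Omega> x * ennreal (grad_sq \<phi> x) \<partial>lborel) \<le> ennreal G \<and> l2norm ?M (\<lambda>x. \<phi> x - U x) \<le> e"
    by (rule trace_approximation[OF tr]) (rule that)
  have "3 * ?om * G + 6 * ?om \<ge> 0" using om G(1) by simp
  then show ?thesis
  proof (rule that)
    fix e :: real assume e: "e > 0"
    obtain \<phi> where \<phi>: "\<phi> \<in> Cc_inf UNIV" and gr: "(\<integral>\<^sup>+x. indicator \<Omega> x * ennreal (grad_sq \<phi> x) \<partial>lborel) \<le> ennreal G"
      and d: "l2norm ?M (\<lambda>x. \<phi> x - U x) \<le> e" using G(2)[OF e] by blast
    have sm: "smooth \<phi>" and \<phi>m[measurable]: "\<phi> \<in> borel_measurable borel"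
      by (rule Cc_inf_smooth[OF \<phi>], rule smooth_borel[OF Cc_inf_smooth[OF \<phi>]])
    have c: "(\<integral>\<^sup>+x. indicator \<Omega> x * ennreal ((\<phi> x - v x)\<^sup>2) \<partial>lborel) \<le> ennreal (e\<^sup>2)"
    proof -
      have "(\<integral>\<^sup>+x. indicator \<Omega> x * ennreal ((\<phi> x - v x)\<^sup>2) \<partial>lborel) = (\<integral>\<^sup>+x. ennreal ((\<phi> x - v x)\<^sup>2) \<partial>?M)"
        by (simp add: nn_integral_lebesgue_on[OF borel] mult.commute)
      also have "\<dots> = (\<integral>\<^sup>+x. ennreal ((\<phi> x - U x)\<^sup>2) \<partial>?M)"
        using eq by (intro nn_integral_cong_AE) (auto elim: eventually_mono)
      also have "\<dots> = ennreal ((l2norm ?M (\<lambda>x. \<phi> x - U x))\<^sup>2)"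
        by (rule L2_nn_integral_eq[OF L2_diff[OF Cc_inf_L2[OF \<phi>] U]])
      also have "\<dots> \<le> ennreal (e\<^sup>2)" by (intro ennreal_leI power_mono d l2norm_nonneg)
      finally show ?thesis .
    qed
    have "osc \<Omega> e v \<le> 3 * osc \<Omega> e \<phi> + ennreal (6 * ?om * e ^ CARD('d) * e\<^sup>2)"
      by (rule osc_perturb[OF vm \<phi>m e c]) simp
    also have "\<dots> \<le> 3 * ennreal (?om * e ^ CARD('d) * (e\<^sup>2 * G)) + ennreal (6 * ?om * e ^ CARD('d) * e\<^sup>2)"
      by (intro add_mono mult_left_mono osc_gradient[OF sm e G(1) gr]) auto
    also have "\<dots> = ennreal (3 * (?om * e ^ CARD('d) * (e\<^sup>2 * G)) + 6 * ?om * e ^ CARD('d) * e\<^sup>2)"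
      using e G(1) by (subst ennreal_plus) (auto simp: ennreal_mult simp del: ennreal_plus)
    also have "3 * (?om * e ^ CARD('d) * (e\<^sup>2 * G)) + 6 * ?om * e ^ CARD('d) * e\<^sup>2 = (3 * ?om * G + 6 * ?om) * (e ^ CARD('d) * e\<^sup>2)"
      by (simp add: algebra_simps)
    finally show "osc \<Omega> e v \<le> ennreal ((3 * ?om * G + 6 * ?om) * (e ^ CARD('d) * e\<^sup>2))" .
  qed
qed

text \<open>From some index \<open>N\<close> on, the Cauchy property keeps the sequence within
  distance 1 of \<open>\<phi> N\<close>. The energies are thus bounded by one \<open>G\<close>,
  while the \<open>L^2\<close> error tends to 0. From order 1 on, the first derivatives alone are
  read off the norm.\<close>

lemma sobolev0_approximation:
  assumes f: "f \<in> sobolev0 \<Omega> \<kappa>" and \<kappa>: "\<kappa> > 0" and n: "CARD('d) \<ge> 2"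
  obtains G where "G \<ge> 0" "\<And>e. e > 0 \<Longrightarrow> \<exists>\<phi>\<in>Cc_inf \<Omega>. energy (min \<kappa> 1) \<phi> \<le> ennreal G \<and>
    l2norm (lebesgue_on \<Omega>) (\<lambda>x. \<phi> x - f x) \<le> e"
proof -
  let ?M = "lebesgue_on \<Omega>"
  obtain \<phi> where \<phi>: "\<And>n::nat. \<phi> n \<in> Cc_inf \<Omega>"
    and cauchy: "\<And>e. e > 0 \<Longrightarrow> \<exists>N. \<forall>m\<ge>N. \<forall>n\<ge>N. sobolev_norm \<Omega> \<kappa> (\<lambda>x. \<phi> m x - \<phi> n x) < e"
    and lim: "(\<lambda>n. l2norm ?M (\<lambda>x. \<phi> n x - f x)) \<longlonglongrightarrow> 0"
    using f unfolding sobolev0_def by blast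
  have \<phi>U: "\<phi> n \<in> Cc_inf UNIV" for n by (rule Cc_inf_mono[OF \<phi> subset_UNIV])
  obtain N where N: "\<And>m. m \<ge> N \<Longrightarrow> sobolev_norm \<Omega> \<kappa> (\<lambda>x. \<phi> m x - \<phi> N x) < 1"
    using cauchy[of 1] by auto
  have dU: "(\<lambda>x. \<phi> m x - \<phi> N x) \<in> Cc_inf UNIV" for m by (rule Cc_inf_diff[OF \<phi>U \<phi>U])
  have "\<exists>G\<ge>0. \<forall>m\<ge>N. energy (min \<kappa> 1) (\<phi> m) \<le> ennreal G"
  proof (cases "\<kappa> < 1")
    case True
    have fin: "gagliardo_borel \<kappa> (\<phi> N) < \<infinity>" by (rule gagliardo_finite[OF \<phi>U \<kappa> True n])
    define G where "G = 2 + 2 * enn2real (gagliardo_borel \<kappa> (\<phi> N))"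
    have "gagliardo_borel \<kappa> (\<phi> m) \<le> ennreal G" if m: "m \<ge> N" for m
    proof -
      let ?d = "\<lambda>x. \<phi> m x - \<phi> N x"
      note [measurable] = smooth_borel[OF Cc_inf_smooth[OF \<phi>U]]
      have "AE x in ?M. wderiv \<Omega> [] ?d x = ?d x"
        by (rule wderiv_AE[OF weak_deriv_Nil[OF L2_integrable[OF Cc_inf_L2[OF dU]]]])
      then have "enn2real (gagliardo_borel \<kappa> ?d) = enn2real (gagliardo_sq \<Omega> \<kappa> (wderiv \<Omega> [] ?d))"
        by (simp only: gagliardo_sq_cong_AE gagliardo_sq_eq[symmetric])
      also have "\<dots> \<le> (sobolev_norm \<Omega> \<kappa> ?d)\<^sup>2" by (rule gagliardo_le_sobolev_norm[OF \<kappa> True])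
      also have "\<dots> \<le> 1"
      proof -
        have "0 \<le> sobolev_norm \<Omega> \<kappa> ?d" using order_trans[OF l2norm_nonneg l2norm_le_sobolev_norm[of "[]" \<kappa>]] by simp
        then show ?thesis using N[OF m] by (simp add: power_le_one)
      qed
      finally have "enn2real (gagliardo_borel \<kappa> ?d) \<le> 1" .
      moreover have "gagliardo_borel \<kappa> ?d < \<infinity>" by (rule gagliardo_finite[OF dU \<kappa> True n])
      ultimately have d1: "gagliardo_borel \<kappa> ?d \<le> 1"
        by (metis ennreal_1 ennreal_enn2real ennreal_leI infinity_ennreal_def)
      let ?p = "\<lambda>x y. norm (x - y) powr (real CARD('d) + 2 * \<kappa>)"
      have "gagliardo_borel \<kappa> (\<phi> m) \<le> (\<integral>\<^sup>+x. 2 * (indicator \<Omega> x * (\<integral>\<^sup>+y. indicator \<Omega> y * ennreal ((?d x - ?d y)\<^sup>2 / ?p x y) \<partial>lborel))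
          + 2 * (indicator \<Omega> x * (\<integral>\<^sup>+y. indicator \<Omega> y * ennreal ((\<phi> N x - \<phi> N y)\<^sup>2 / ?p x y) \<partial>lborel)) + 0 * 0 \<partial>lborel)"
        unfolding gagliardo_borel_def
      proof (rule nn_integral_mono)
        fix x
        have "(\<integral>\<^sup>+y. indicator \<Omega> y * ennreal ((\<phi> m x - \<phi> m y)\<^sup>2 / ?p x y) \<partial>lborel)
          \<le> (\<integral>\<^sup>+y. 2 * (indicator \<Omega> y * ennreal ((?d x - ?d y)\<^sup>2 / ?p x y)) + 2 * (indicator \<Omega> y * ennreal ((\<phi> N x - \<phi> N y)\<^sup>2 / ?p x y)) + 0 * 0 \<partial>lborel)"
        proof (rule nn_integral_mono)
          fix y
          have "(\<phi> m x - \<phi> m y)\<^sup>2 \<le> 2 * (?d x - ?d y)\<^sup>2 + 2 * (\<phi> N x - \<phi> N y)\<^sup>2"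
            using zero_le_power2[of "(?d x - ?d y) - (\<phi> N x - \<phi> N y)"] by (simp add: power2_eq_square algebra_simps)
          then have "(\<phi> m x - \<phi> m y)\<^sup>2 / ?p x y \<le> (2 * (?d x - ?d y)\<^sup>2 + 2 * (\<phi> N x - \<phi> N y)\<^sup>2) / ?p x y"
            by (intro divide_right_mono) auto
          then have "ennreal ((\<phi> m x - \<phi> m y)\<^sup>2 / ?p x y) \<le> ennreal (2 * ((?d x - ?d y)\<^sup>2 / ?p x y) + 2 * ((\<phi> N x - \<phi> N y)\<^sup>2 / ?p x y))"
            by (intro ennreal_leI) (simp add: add_divide_distrib)
          also have "\<dots> = 2 * ennreal ((?d x - ?d y)\<^sup>2 / ?p x y) + 2 * ennreal ((\<phi> N x - \<phi> N y)\<^sup>2 / ?p x y)"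
            by (rule ennreal_twice_add) auto
          finally show "indicator \<Omega> y * ennreal ((\<phi> m x - \<phi> m y)\<^sup>2 / ?p x y) \<le>
              2 * (indicator \<Omega> y * ennreal ((?d x - ?d y)\<^sup>2 / ?p x y)) + 2 * (indicator \<Omega> y * ennreal ((\<phi> N x - \<phi> N y)\<^sup>2 / ?p x y)) + 0 * 0"
            by (cases "y \<in> \<Omega>") simp_all
        qed
        also have "\<dots> = 2 * (\<integral>\<^sup>+y. indicator \<Omega> y * ennreal ((?d x - ?d y)\<^sup>2 / ?p x y) \<partial>lborel)
            + 2 * (\<integral>\<^sup>+y. indicator \<Omega> y * ennreal ((\<phi> N x - \<phi> N y)\<^sup>2 / ?p x y) \<partial>lborel) + 0 * (\<integral>\<^sup>+(y::real^'d). 0 \<partial>lborel)"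
          by (rule nn_integral_lincomb3) measurable
        finally show "indicator \<Omega> x * (\<integral>\<^sup>+y. indicator \<Omega> y * ennreal ((\<phi> m x - \<phi> m y)\<^sup>2 / ?p x y) \<partial>lborel)
          \<le> 2 * (indicator \<Omega> x * (\<integral>\<^sup>+y. indicator \<Omega> y * ennreal ((?d x - ?d y)\<^sup>2 / ?p x y) \<partial>lborel))
          + 2 * (indicator \<Omega> x * (\<integral>\<^sup>+y. indicator \<Omega> y * ennreal ((\<phi> N x - \<phi> N y)\<^sup>2 / ?p x y) \<partial>lborel)) + 0 * 0"
          by (cases "x \<in> \<Omega>") simp_all
      qed
      also have "\<dots> = 2 * gagliardo_borel \<kappa> ?d + 2 * gagliardo_borel \<kappa> (\<phi> N) + 0 * (\<integral>\<^sup>+(y::real^'d). 0 \<partial>lborel)"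
        unfolding gagliardo_borel_def by (rule nn_integral_lincomb3) measurable
      also have "\<dots> \<le> 2 * 1 + 2 * ennreal (enn2real (gagliardo_borel \<kappa> (\<phi> N))) + 0"
        using d1 fin by (intro add_mono mult_left_mono) auto
      also have "\<dots> = ennreal G"
        unfolding G_def by (subst ennreal_plus) (auto simp: ennreal_mult simp del: ennreal_plus)
      finally show ?thesis .
    qed
    moreover have "G \<ge> 0" by (simp add: G_def)
    ultimately show ?thesis using True unfolding energy_def by auto
  next
    case False
    then have fl: "nat \<lfloor>\<kappa>\<rfloor> \<ge> 1" by linarith
    have d: "l2norm ?M (pd i (\<phi> m)) \<le> l2norm ?M (pd i (\<phi> N)) + 1" if m: "m \<ge> N" for m i
    proof -
      have L: "pd i (\<phi> n) \<in> L2 ?M" for n by (rule Cc_inf_L2[OF Cc_inf_pd[OF \<phi>U]])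
      have Ld: "(\<lambda>x. pd i (\<phi> m) x - pd i (\<phi> N) x) \<in> L2 ?M" by (rule L2_diff[OF L L])
      have "l2norm ?M (wderiv \<Omega> [i] (\<lambda>x. \<phi> m x - \<phi> N x)) = l2norm ?M (\<lambda>x. pd i (\<phi> m) x - pd i (\<phi> N) x)"
        by (rule l2norm_cong_AE[OF L2_measurable[OF Ld] wderiv_AE[OF weak_deriv_diff[OF
              weak_deriv_smooth[OF Cc_inf_smooth[OF \<phi>]] weak_deriv_smooth[OF Cc_inf_smooth[OF \<phi>]]]]])
      then have "l2norm ?M (\<lambda>x. pd i (\<phi> m) x - pd i (\<phi> N) x) \<le> 1"
        using l2norm_le_sobolev_norm[of "[i]" \<kappa> "\<lambda>x. \<phi> m x - \<phi> N x"] N[OF m] fl by simp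
      then show ?thesis using l2norm_triangle[OF L[of N] Ld] by simp
    qed
    define G where "G = (\<Sum>i\<in>UNIV. (l2norm ?M (pd i (\<phi> N)) + 1)\<^sup>2)"
    have "energy (min \<kappa> 1) (\<phi> m) \<le> ennreal G" if m: "m \<ge> N" for m
    proof -
      obtain K where K: "compact K" "K \<subseteq> \<Omega>" "\<And>x i. x \<notin> K \<Longrightarrow> pd i (\<phi> m) x = 0"
        by (rule Cc_infE[OF \<phi>[of m]]) (rule that)
      have "ennreal (grad_sq (\<phi> m) x) = indicator \<Omega> x * ennreal (grad_sq (\<phi> m) x)" for x
      proof (cases "x \<in> \<Omega>")
        case False
        then have "x \<notin> K" using K(2) by blast
        then have "grad_sq (\<phi> m) x = 0" by (simp add: grad_sq_def K(3))
        then show ?thesis by simp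
      qed simp
      then have "energy (min \<kappa> 1) (\<phi> m) = (\<integral>\<^sup>+x. indicator \<Omega> x * ennreal (grad_sq (\<phi> m) x) \<partial>lborel)"
        using False by (simp add: energy_def)
      also have "\<dots> \<le> ennreal G" unfolding G_def by (rule grad_sq_le[OF \<phi>U d[OF m]])
      finally show ?thesis .
    qed
    moreover have "G \<ge> 0" by (simp add: G_def sum_nonneg)
    ultimately show ?thesis by blast
  qed
  then obtain G where G: "G \<ge> 0" "\<And>m. m \<ge> N \<Longrightarrow> energy (min \<kappa> 1) (\<phi> m) \<le> ennreal G" by blast
  show ?thesis
  proof (rule that[OF G(1)])
    fix e :: real assume "e > 0"
    then have "eventually (\<lambda>n. l2norm ?M (\<lambda>x. \<phi> n x - f x) < e) sequentially"
      by (rule order_tendstoD(2)[OF lim])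
    then obtain n where n: "\<And>m. m \<ge> n \<Longrightarrow> l2norm ?M (\<lambda>x. \<phi> m x - f x) < e"
      unfolding eventually_sequentially by blast
    show "\<exists>\<phi>\<in>Cc_inf \<Omega>. energy (min \<kappa> 1) \<phi> \<le> ennreal G \<and> l2norm ?M (\<lambda>x. \<phi> x - f x) \<le> e"
      using \<phi>[of "max n N"] G(2)[of "max n N"] n[of "max n N"] by (intro bexI[of _ "\<phi> (max n N)"]) auto
  qed
qed

lemma layer_perturb:
  assumes wm[measurable]: "w \<in> borel_measurable borel" and \<phi>m[measurable]: "\<phi> \<in> borel_measurable borel"
  shows "layer \<Omega> e w \<le> 2 * layer \<Omega> e \<phi> + 2 * (\<integral>\<^sup>+x. indicator \<Omega> x * ennreal ((\<phi> x - w x)\<^sup>2) \<partial>lborel)"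
proof -
  let ?L = "{x \<in> \<Omega>. depth \<Omega> x < e}"
  have "layer \<Omega> e w \<le> (\<integral>\<^sup>+x. 2 * (indicator ?L x * ennreal ((\<phi> x)\<^sup>2)) + 2 * (indicator \<Omega> x * ennreal ((\<phi> x - w x)\<^sup>2)) + 0 * 0 \<partial>lborel)"
    unfolding layer_def
  proof (rule nn_integral_mono)
    fix x
    have "(w x)\<^sup>2 \<le> 2 * (\<phi> x)\<^sup>2 + 2 * (\<phi> x - w x)\<^sup>2"
      using zero_le_power2[of "2 * \<phi> x - w x"] by (simp add: power2_eq_square algebra_simps)
    then have "ennreal ((w x)\<^sup>2) \<le> ennreal (2 * (\<phi> x)\<^sup>2 + 2 * (\<phi> x - w x)\<^sup>2)" by (rule ennreal_leI)
    also have "\<dots> = 2 * ennreal ((\<phi> x)\<^sup>2) + 2 * ennreal ((\<phi> x - w x)\<^sup>2)"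
      by (subst ennreal_plus) (auto simp: ennreal_mult simp del: ennreal_plus)
    finally show "indicator ?L x * ennreal ((w x)\<^sup>2) \<le> 2 * (indicator ?L x * ennreal ((\<phi> x)\<^sup>2)) + 2 * (indicator \<Omega> x * ennreal ((\<phi> x - w x)\<^sup>2)) + 0 * 0"
      by (cases "x \<in> ?L") simp_all
  qed
  also have "\<dots> = 2 * layer \<Omega> e \<phi> + 2 * (\<integral>\<^sup>+x. indicator \<Omega> x * ennreal ((\<phi> x - w x)\<^sup>2) \<partial>lborel) + 0 * (\<integral>\<^sup>+(y::real^'d). 0 \<partial>lborel)"
    unfolding layer_def by (rule nn_integral_lincomb3) measurable
  finally show ?thesis by simp
qed

text \<open>At each scale \<open>e\<close> an approximant with \<open>L^2\<close> error
  \<open>e powr k\<close> is taken. Its energy controls its oscillation and, for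
  \<open>k > 1/2\<close>, its layer mass; returning to \<open>w\<close> costs the squared error,
  which has the same order.\<close>

lemma source_regularity:
  assumes C2: "C2_boundary \<Omega>" and f: "f \<in> sobolev0 \<Omega> \<kappa>" and \<kappa>: "\<kappa> > 0" and n: "CARD('d) \<ge> 2"
    and wm: "w \<in> borel_measurable borel" and W: "\<And>x. \<bar>w x\<bar> \<le> W" and eq: "AE x in lebesgue_on \<Omega>. f x = w x"
  obtains K b where "K \<ge> 0" "b > 0"
    "\<And>e. 0 < e \<Longrightarrow> e \<le> b \<Longrightarrow> osc \<Omega> e w \<le> ennreal (K * (e ^ CARD('d) * (e powr (min \<kappa> 1))\<^sup>2))"
    "\<And>e. 0 < e \<Longrightarrow> e \<le> b \<Longrightarrow> layer \<Omega> (3 * e) w \<le> ennreal (K * (e powr (min \<kappa> 1))\<^sup>2)"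
proof -
  let ?M = "lebesgue_on \<Omega>" and ?om = "unit_ball_vol (real CARD('d))"
  note [measurable] = wm
  define k where "k = min \<kappa> 1"
  have k: "0 < k" "k \<le> 1" using \<kappa> by (auto simp: k_def)
  have om: "?om \<ge> 0" by simp
  have fL: "f \<in> L2 ?M" using f by (simp add: sobolev0_def)
  obtain G where G: "G \<ge> 0" "\<And>e. e > 0 \<Longrightarrow> \<exists>\<phi>\<in>Cc_inf \<Omega>. energy (min \<kappa> 1) \<phi> \<le> ennreal G \<and>
    l2norm (lebesgue_on \<Omega>) (\<lambda>x. \<phi> x - f x) \<le> e"
    by (rule sobolev0_approximation[OF f \<kappa> n]) (rule that)
  \<comment> \<open>for \<open>k \<le> 1/2\<close> only the volume bound of the layer is used, and \<open>\<tau>\<close> is irrelevant\<close>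
  define \<tau> where "\<tau> = (if k \<le> 1/2 then 1 else k)"
  have \<tau>: "1/2 < \<tau>" "\<tau> \<le> 1" using k by (auto simp: \<tau>_def)
  obtain K1 b1 where K1: "K1 \<ge> 0" "b1 > 0"
    "\<And>e. 0 < e \<Longrightarrow> e \<le> b1 \<Longrightarrow> emeasure lborel {x \<in> \<Omega>. depth \<Omega> x < e} \<le> ennreal (K1 * e)"
    "\<And>\<phi> G e. \<phi> \<in> Cc_inf \<Omega> \<Longrightarrow> G \<ge> 0 \<Longrightarrow> energy \<tau> \<phi> \<le> ennreal G \<Longrightarrow> 0 < e \<Longrightarrow> e \<le> b1 \<Longrightarrow>
      layer \<Omega> e \<phi> \<le> ennreal (K1 * G * e powr (2 * \<tau>))"
    by (rule boundary_layer[OF C2 \<tau>]) (rule that)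
  define b where "b = min 1 (b1 / 3)"
  have b: "b > 0" using K1(2) by (simp add: b_def)
  have ex: "\<exists>\<phi>\<in>Cc_inf \<Omega>. energy k \<phi> \<le> ennreal G \<and>
      (\<integral>\<^sup>+x. indicator \<Omega> x * ennreal ((\<phi> x - w x)\<^sup>2) \<partial>lborel) \<le> ennreal ((e powr k)\<^sup>2)" if e: "e > 0" for e
  proof -
    have "e powr k > 0" using e by simp
    from G(2)[OF this] obtain \<phi> where \<phi>: "\<phi> \<in> Cc_inf \<Omega>" "energy k \<phi> \<le> ennreal G" "l2norm ?M (\<lambda>x. \<phi> x - f x) \<le> e powr k"
      unfolding k_def by blast
    have "(\<integral>\<^sup>+x. indicator \<Omega> x * ennreal ((\<phi> x - w x)\<^sup>2) \<partial>lborel) = (\<integral>\<^sup>+x. ennreal ((\<phi> x - w x)\<^sup>2) \<partial>?M)"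
      by (simp add: nn_integral_lebesgue_on[OF borel] mult.commute)
    also have "\<dots> = (\<integral>\<^sup>+x. ennreal ((\<phi> x - f x)\<^sup>2) \<partial>?M)"
      using eq by (intro nn_integral_cong_AE) (auto elim: eventually_mono)
    also have "\<dots> = ennreal ((l2norm ?M (\<lambda>x. \<phi> x - f x))\<^sup>2)"
      by (rule L2_nn_integral_eq[OF L2_diff[OF Cc_inf_L2[OF Cc_inf_mono[OF \<phi>(1) subset_UNIV]] fL]])
    also have "\<dots> \<le> ennreal ((e powr k)\<^sup>2)" by (intro ennreal_leI power_mono \<phi>(3) l2norm_nonneg)
    finally show ?thesis using \<phi> by blast
  qed
  have sq: "(e powr k)\<^sup>2 = e powr (2 * k)" if "e > 0" for e :: real
    using that by (simp add: power2_eq_square powr_add[symmetric])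
  \<comment> \<open>The 3 and the 6 stem from \<open>osc_perturb\<close>; \<open>1 + ?om\<close>
    covers both the fractional estimate, with constant 1, and the gradient estimate, with the ball
    volume.\<close>
  define Ko where "Ko = 3 * (1 + ?om) * G + 6 * ?om"
  have Ko: "Ko \<ge> 0" using om G(1) by (simp add: Ko_def)
  have osc: "osc \<Omega> e w \<le> ennreal (Ko * (e ^ CARD('d) * (e powr k)\<^sup>2))" if e: "0 < e" for e
  proof -
    obtain \<phi> where \<phi>: "\<phi> \<in> Cc_inf \<Omega>" "energy k \<phi> \<le> ennreal G"
      "(\<integral>\<^sup>+x. indicator \<Omega> x * ennreal ((\<phi> x - w x)\<^sup>2) \<partial>lborel) \<le> ennreal ((e powr k)\<^sup>2)" using ex[OF e] by blast
    have \<phi>m: "\<phi> \<in> borel_measurable borel" by (rule smooth_borel[OF Cc_inf_smooth[OF \<phi>(1)]])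
    have o\<phi>: "osc \<Omega> e \<phi> \<le> ennreal ((1 + ?om) * (e ^ CARD('d) * (e powr k)\<^sup>2) * G)"
    proof (cases "k < 1")
      case True
      have "osc \<Omega> e \<phi> \<le> ennreal (e powr (real CARD('d) + 2 * k)) * gagliardo_borel k \<phi>"
        by (rule osc_gagliardo[OF \<phi>m e k(1)])
      also have "\<dots> \<le> ennreal (e powr (real CARD('d) + 2 * k)) * ennreal G"
        using \<phi>(2) True by (intro mult_left_mono) (auto simp: energy_def)
      also have "\<dots> = ennreal (e ^ CARD('d) * (e powr k)\<^sup>2 * G)"
        using e G(1) by (simp add: ennreal_mult powr_add powr_realpow sq)
      also have "\<dots> \<le> ennreal ((1 + ?om) * (e ^ CARD('d) * (e powr k)\<^sup>2) * G)"
        using e G(1) om by (intro ennreal_leI mult_right_mono) (auto simp: distrib_right)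
      finally show ?thesis .
    next
      case False
      then have k1: "k = 1" using k by simp
      have "(\<integral>\<^sup>+x. indicator \<Omega> x * ennreal (grad_sq \<phi> x) \<partial>lborel) \<le> energy k \<phi>"
        using k1 unfolding energy_def by (auto intro!: nn_integral_mono simp: indicator_def)
      also note \<phi>(2)
      finally have "osc \<Omega> e \<phi> \<le> ennreal (?om * e ^ CARD('d) * (e\<^sup>2 * G))"
        by (rule osc_gradient[OF Cc_inf_smooth[OF \<phi>(1)] e G(1)])
      also have "\<dots> \<le> ennreal ((1 + ?om) * (e ^ CARD('d) * (e powr k)\<^sup>2) * G)"
        using e G(1) om by (intro ennreal_leI) (simp add: k1 distrib_right mult.assoc)
      finally show ?thesis .
    qed
    have "osc \<Omega> e w \<le> 3 * osc \<Omega> e \<phi> + ennreal (6 * ?om * e ^ CARD('d) * (e powr k)\<^sup>2)"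
      by (rule osc_perturb[OF wm \<phi>m e \<phi>(3)]) simp
    also have "\<dots> \<le> 3 * ennreal ((1 + ?om) * (e ^ CARD('d) * (e powr k)\<^sup>2) * G) + ennreal (6 * ?om * e ^ CARD('d) * (e powr k)\<^sup>2)"
      by (intro add_mono mult_left_mono o\<phi>) auto
    also have "\<dots> = ennreal (3 * ((1 + ?om) * (e ^ CARD('d) * (e powr k)\<^sup>2) * G) + 6 * ?om * e ^ CARD('d) * (e powr k)\<^sup>2)"
      using e G(1) om by (subst ennreal_plus) (auto simp: ennreal_mult simp del: ennreal_plus)
    also have "3 * ((1 + ?om) * (e ^ CARD('d) * (e powr k)\<^sup>2) * G) + 6 * ?om * e ^ CARD('d) * (e powr k)\<^sup>2 = Ko * (e ^ CARD('d) * (e powr k)\<^sup>2)"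
      by (simp add: Ko_def algebra_simps)
    finally show ?thesis .
  qed
  \<comment> \<open>First case: sup bound times the volume of the layer of width
    \<open>3 * e\<close>. Second case: the factors 2 of \<open>layer_perturb\<close>, and
    \<open>3 powr (2 * k)\<close> from that same width.\<close>
  define Kl where "Kl = (if k \<le> 1/2 then W\<^sup>2 * K1 * 3 else 2 * K1 * G * 3 powr (2 * k) + 2)"
  have Kl: "Kl \<ge> 0" using K1(1) G(1) by (simp add: Kl_def)
  have lay: "layer \<Omega> (3 * e) w \<le> ennreal (Kl * (e powr k)\<^sup>2)" if e: "0 < e" "e \<le> b" for e
  proof (cases "k \<le> 1/2")
    case True
    have e3: "0 < 3 * e" "3 * e \<le> b1" using e by (auto simp: b_def)
    let ?L = "{x \<in> \<Omega>. depth \<Omega> x < 3 * e}"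
    have "layer \<Omega> (3 * e) w \<le> (\<integral>\<^sup>+x. ennreal (W\<^sup>2) * indicator ?L x \<partial>lborel)"
      unfolding layer_def
    proof (rule nn_integral_mono)
      fix x
      have "(w x)\<^sup>2 \<le> W\<^sup>2" using W[of x] by (metis abs_ge_zero power2_abs power_mono)
      then show "indicator ?L x * ennreal ((w x)\<^sup>2) \<le> ennreal (W\<^sup>2) * indicator ?L x"
        by (cases "x \<in> ?L") (simp_all add: ennreal_leI)
    qed
    also have "\<dots> = ennreal (W\<^sup>2) * emeasure lborel ?L"
      by (rule nn_integral_cmult_indicator) measurable
    also have "\<dots> \<le> ennreal (W\<^sup>2) * ennreal (K1 * (3 * e))"
      by (intro mult_left_mono K1(3) e3) simp
    also have "\<dots> = ennreal (Kl * e)" using True by (simp add: Kl_def ennreal_mult'[symmetric] mult_ac)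
    also have "\<dots> \<le> ennreal (Kl * (e powr k)\<^sup>2)"
    proof (intro ennreal_leI mult_left_mono Kl)
      \<comment> \<open>A volume of order \<open>e\<close> is good enough, since
        \<open>2 * k \<le> 1\<close> and \<open>e \<le> 1\<close>.\<close>
      have "e powr 1 \<le> e powr (2 * k)" using e True by (intro powr_mono') (auto simp: b_def)
      then show "e \<le> (e powr k)\<^sup>2" using e by (simp add: sq)
    qed
    finally show ?thesis .
  next
    case False
    then have \<tau>k: "\<tau> = k" by (simp add: \<tau>_def)
    have e3: "0 < 3 * e" "3 * e \<le> b1" using e by (auto simp: b_def)
    obtain \<phi> where \<phi>: "\<phi> \<in> Cc_inf \<Omega>" "energy k \<phi> \<le> ennreal G"
      "(\<integral>\<^sup>+x. indicator \<Omega> x * ennreal ((\<phi> x - w x)\<^sup>2) \<partial>lborel) \<le> ennreal ((e powr k)\<^sup>2)" using ex[OF e(1)] by blast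
    have "layer \<Omega> (3 * e) w \<le> 2 * layer \<Omega> (3 * e) \<phi> + 2 * (\<integral>\<^sup>+x. indicator \<Omega> x * ennreal ((\<phi> x - w x)\<^sup>2) \<partial>lborel)"
      by (rule layer_perturb[OF wm smooth_borel[OF Cc_inf_smooth[OF \<phi>(1)]]])
    also have "\<dots> \<le> 2 * ennreal (K1 * G * (3 * e) powr (2 * k)) + 2 * ennreal ((e powr k)\<^sup>2)"
      using K1(4)[OF \<phi>(1) G(1) _ e3] \<phi>(2,3) \<tau>k by (intro add_mono mult_left_mono) auto
    also have "\<dots> = ennreal (2 * (K1 * G * (3 * e) powr (2 * k)) + 2 * (e powr k)\<^sup>2)"
      using K1(1) G(1) by (subst ennreal_plus) (auto simp: ennreal_mult simp del: ennreal_plus)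
    also have "2 * (K1 * G * (3 * e) powr (2 * k)) + 2 * (e powr k)\<^sup>2 = Kl * (e powr k)\<^sup>2"
      using e False by (simp add: Kl_def powr_mult sq algebra_simps)
    finally show ?thesis .
  qed
  show ?thesis
  proof (rule that[of "Ko + Kl" b])
    show "Ko + Kl \<ge> 0" using Ko Kl by simp
    show "osc \<Omega> e w \<le> ennreal ((Ko + Kl) * (e ^ CARD('d) * (e powr (min \<kappa> 1))\<^sup>2))" if "0 < e" for e
      by (rule order_trans[OF osc[OF that]]) (use Kl that in \<open>auto intro!: ennreal_leI mult_right_mono simp: k_def[symmetric]\<close>)
    show "layer \<Omega> (3 * e) w \<le> ennreal ((Ko + Kl) * (e powr (min \<kappa> 1))\<^sup>2)" if "0 < e" "e \<le> b" for e
      by (rule order_trans[OF lay[OF that]]) (use Ko in \<open>auto intro!: ennreal_leI mult_right_mono simp: k_def[symmetric]\<close>)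
  qed (rule b)
qed

section \<open>The approximate source condition and the convergence rates\<close>

lemma l2norm_le_lborel:
  assumes f: "f \<in> borel_measurable borel" and c: "c \<ge> 0" and le: "(\<integral>\<^sup>+x. ennreal ((f x)\<^sup>2) \<partial>lborel) \<le> ennreal (c\<^sup>2)"
  shows "l2norm (lebesgue_on \<Omega>) f \<le> c"
proof (rule l2norm_leI(2)[OF borel_measurable_lebesgue_onI[OF f] _ c])
  have "(\<integral>\<^sup>+x. ennreal ((f x)\<^sup>2) \<partial>lebesgue_on \<Omega>) \<le> (\<integral>\<^sup>+x. ennreal ((f x)\<^sup>2) \<partial>lborel)"
    unfolding nn_integral_lebesgue_on[OF borel] by (intro nn_integral_mono) (simp add: indicator_def)
  with le show "(\<integral>\<^sup>+x. ennreal ((f x)\<^sup>2) \<partial>lebesgue_on \<Omega>) \<le> ennreal (c\<^sup>2)" by (rule order_trans[rotated])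
qed

lemma admissible_L2: "q \<in> admissible \<Omega> ql qu \<Longrightarrow> q \<in> L2 (lebesgue_on \<Omega>)"
  by (simp add: admissible_def)

lemma admissible_bound:
  assumes "q \<in> admissible \<Omega> ql qu" "0 < ql"
  shows "AE x in lebesgue_on \<Omega>. \<bar>q x\<bar> \<le> qu" "q \<in> Linf (lebesgue_on \<Omega>)"
proof -
  have "AE x in lebesgue_on \<Omega>. ql \<le> q x \<and> q x \<le> qu" using assms by (simp add: admissible_def)
  then show "AE x in lebesgue_on \<Omega>. \<bar>q x\<bar> \<le> qu"
    by (rule eventually_mono) (use assms(2) in \<open>auto simp: abs_le_iff\<close>)
  then show "q \<in> Linf (lebesgue_on \<Omega>)" using assms L2_measurable by (auto simp: Linf_def admissible_def)
qed

text \<open>With the test function of scale \<open>e\<close>, \<open>qd - qs\<close> is split into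
  \<open>u qd * \<psi>\<close> and an error. The error is paired with \<open>qd - q\<close> by
  Cauchy-Schwarz, the main part by \<open>duality_bound\<close>. All constants are fixed before
  \<open>e\<close> and \<open>q\<close>, so that \<open>e\<close> may follow the noise level and
  \<open>q\<close> may be any minimizer.\<close>

lemma source_inequality:
  fixes u :: "(real^'d \<Rightarrow> real) \<Rightarrow> real^'d \<Rightarrow> real"
  assumes n: "CARD('d) \<ge> 2" and C2: "C2_boundary \<Omega>" and a: "a \<in> W1inf \<Omega>"
    and bounds: "0 < ql" "ql \<le> qu"
    and u: "\<And>q. q \<in> admissible \<Omega> ql qu \<Longrightarrow> is_solution \<Omega> a f g q (u q)"
    and qd: "qd \<in> admissible \<Omega> ql qu" and qs: "qs \<in> admissible \<Omega> ql qu"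
    and c0: "c0 > 0" "AE x in lebesgue_on \<Omega>. c0 \<le> \<bar>u qd x\<bar>"
    and \<kappa>: "\<kappa> > 0" and source: "(\<lambda>x. qd x - qs x) \<in> sobolev0 \<Omega> \<kappa>"
  obtains C b where "C \<ge> 0" "b > 0"
    "\<And>e q. 0 < e \<Longrightarrow> e \<le> b \<Longrightarrow> q \<in> admissible \<Omega> ql qu \<Longrightarrow>
      (LINT x|lebesgue_on \<Omega>. (qd x - qs x) * (qd x - q x))
        \<le> C * (e powr (min \<kappa> 1) * l2norm (lebesgue_on \<Omega>) (\<lambda>x. q x - qd x) +
          e powr (min \<kappa> 1 - 2) * l2norm (lebesgue_on \<Omega>) (\<lambda>x. u q x - u qd x))"
proof -
  let ?M = "lebesgue_on \<Omega>"
  define k where "k = min \<kappa> 1"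
  have k: "0 < k" "k \<le> 1" using \<kappa> by (auto simp: k_def)
  \<comment> \<open>Two admissible functions differ by at most this almost everywhere; this is the
    sup bound on \<open>w\<close>.\<close>
  define W where "W = qu - ql"
  have W0: "W \<ge> 0" using bounds by (simp add: W_def)
  have sol: "is_solution \<Omega> a f g qd (u qd)" by (rule u[OF qd])
  have tr: "has_trace \<Omega> (u qd) g" using sol by (simp add: is_solution_def)
  have UL: "u q \<in> L2 ?M" if "q \<in> admissible \<Omega> ql qu" for q using u[OF that] by (simp add: is_solution_def sobolev_def)
  have qsdL: "(\<lambda>x. qd x - qs x) \<in> L2 ?M" by (rule L2_diff[OF admissible_L2[OF qd] admissible_L2[OF qs]])
  have "AE x in ?M. ql \<le> qd x \<and> qd x \<le> qu" "AE x in ?M. ql \<le> qs x \<and> qs x \<le> qu"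
    using qd qs by (simp_all add: admissible_def)
  then have Wb: "AE x in ?M. qd x - qs x \<in> {-W..W}" by eventually_elim (auto simp: W_def)
  obtain w where w[measurable]: "w \<in> borel_measurable borel" and wW: "\<And>x. w x \<in> {-W..W}"
    and weq: "AE x in ?M. qd x - qs x = w x"
    by (rule borel_representative[OF L2_measurable[OF qsdL] borel _ _ Wb, where c = 0]) (use W0 in auto)
  have wW': "\<bar>w x\<bar> \<le> W" for x using wW[of x] by (auto simp: abs_le_iff)
  have c0': "AE x in ?M. u qd x \<in> {y. c0 \<le> \<bar>y\<bar>}" using c0(2) by simp
  \<comment> \<open>The representative satisfies \<open>|v x| \<ge> c0\<close> at every point, with
    value \<open>c0\<close> off \<open>\<Omega>\<close>, so the quotient \<open>w / v\<close> can be
    formed on the whole space.\<close>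
  obtain v where v[measurable]: "v \<in> borel_measurable borel" and vc: "\<And>x. v x \<in> {y. c0 \<le> \<bar>y\<bar>}"
    and veq: "AE x in ?M. u qd x = v x"
    by (rule borel_representative[OF L2_measurable[OF UL[OF qd]] borel _ _ c0', where c = c0]) (use c0 in auto)
  have vc': "c0 \<le> \<bar>v x\<bar>" for x using vc[of x] by simp
  obtain K1 where K1: "K1 \<ge> 0" "\<And>e. e > 0 \<Longrightarrow> osc \<Omega> e v \<le> ennreal (K1 * (e ^ CARD('d) * e\<^sup>2))"
    by (rule trace_oscillation[OF tr v veq]) (rule that)
  obtain K2 b0 where K2: "K2 \<ge> 0" "b0 > 0"
    "\<And>e. 0 < e \<Longrightarrow> e \<le> b0 \<Longrightarrow> osc \<Omega> e w \<le> ennreal (K2 * (e ^ CARD('d) * (e powr (min \<kappa> 1))\<^sup>2))"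
    "\<And>e. 0 < e \<Longrightarrow> e \<le> b0 \<Longrightarrow> layer \<Omega> (3 * e) w \<le> ennreal (K2 * (e powr (min \<kappa> 1))\<^sup>2)"
    by (rule source_regularity[OF C2 source \<kappa> n w wW' weq]) (rule that)
  define K where "K = K1 + K2"
  have K: "K \<ge> 0" "K1 \<le> K" "K2 \<le> K" using K1 K2 by (auto simp: K_def)
  obtain K' where K': "K' \<ge> 0"
    "\<And>e s. e > 0 \<Longrightarrow> osc \<Omega> e w \<le> ennreal (K * (e ^ CARD('d) * s\<^sup>2)) \<Longrightarrow>
      osc \<Omega> e v \<le> ennreal (K * (e ^ CARD('d) * s\<^sup>2)) \<Longrightarrow> layer \<Omega> (3 * e) w \<le> ennreal (K * s\<^sup>2) \<Longrightarrow>
      \<exists>\<psi>\<in>Cc_inf \<Omega>. (\<forall>x. \<bar>\<psi> x\<bar> \<le> W / c0) \<and>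
        (\<integral>\<^sup>+x. indicator \<Omega> x * ennreal ((w x - v x * \<psi> x)\<^sup>2) \<partial>lborel) \<le> ennreal (K' * s\<^sup>2) \<and>
        (\<forall>i. (\<integral>\<^sup>+x. ennreal ((pd i \<psi> x)\<^sup>2) \<partial>lborel) \<le> ennreal (K' * (s / e)\<^sup>2)) \<and>
        (\<forall>i. (\<integral>\<^sup>+x. ennreal ((pd i (pd i \<psi>) x)\<^sup>2) \<partial>lborel) \<le> ennreal (K' * (s / e\<^sup>2)\<^sup>2))"
    by (rule test_function_approximation[OF w v wW' c0(1) vc' K(1)]) (rule that)
  have aL: "a \<in> Linf ?M" and "\<forall>i. \<exists>a'. a' \<in> Linf ?M \<and> weak_deriv \<Omega> [i] a a'"
    using a by (auto simp: W1inf_def)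
  then obtain a' where a': "\<And>i. a' i \<in> Linf ?M" "\<And>i. weak_deriv \<Omega> [i] a (a' i)" by metis
  obtain Ba where Ba: "Ba \<ge> 0" "AE x in ?M. \<bar>a x\<bar> \<le> Ba" using aL Linf_bound by metis
  have "\<exists>B\<ge>0. AE x in ?M. \<bar>a' i x\<bar> \<le> B" for i using a'(1)[of i] Linf_bound by metis
  then obtain Ba' where Ba': "\<And>i. Ba' i \<ge> 0" "\<And>i. AE x in ?M. \<bar>a' i x\<bar> \<le> Ba' i" by metis
  define B where "B = Ba + (\<Sum>i\<in>UNIV. Ba' i) + qu"
  have s0: "(\<Sum>i\<in>UNIV. Ba' i) \<ge> 0" and si: "Ba' i \<le> (\<Sum>i\<in>UNIV. Ba' i)" for i
    using Ba'(1) by (auto intro: sum_nonneg member_le_sum)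
  have B: "B \<ge> 0" "Ba \<le> B" "Ba' i \<le> B" "qu \<le> B" for i
    using s0 si[of i] Ba(1) bounds unfolding B_def by linarith+
  have aB: "AE x in ?M. \<bar>a x\<bar> \<le> B" using Ba(2) B(2) by (auto elim: eventually_mono)
  have a'B: "AE x in ?M. \<bar>a' i x\<bar> \<le> B" for i
    using Ba'(2)[of i] by (rule eventually_mono) (use B(3)[of i] in linarith)
  have one: "(\<lambda>_. 1 :: real) \<in> L2 ?M"
    using finite_measure.integrable_const[OF finite_measure_lebesgue_on] by (simp add: L2_def)
  define N where "N = W / c0 * l2norm ?M (\<lambda>_. 1) + sqrt K'"
  have N: "N \<ge> 0" "W / c0 * l2norm ?M (\<lambda>_. 1) \<le> N" "sqrt K' \<le> N"
    using W0 c0(1) K'(1) l2norm_nonneg[of ?M "\<lambda>_. 1"] by (auto simp: N_def)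
  define C where "C = sqrt K' + B * N * (1 + 2 * real CARD('d))"
  have C: "C \<ge> 0" "sqrt K' \<le> C" "B * N * (1 + 2 * real CARD('d)) \<le> C" using K'(1) B(1) N(1) by (auto simp: C_def)
  define b where "b = min 1 b0"
  have "b > 0" using K2(2) by (simp add: b_def)
  with C(1) show ?thesis
  proof (rule that)
    fix e q
    assume e: "0 < e" "e \<le> b" and q: "q \<in> admissible \<Omega> ql qu"
    have e1: "e \<le> 1" "e \<le> b0" using e by (auto simp: b_def)
    let ?s = "e powr k"
    have s: "?s > 0" using e by simp
    \<comment> \<open>As \<open>k \<le> 1\<close> and \<open>e \<le> 1\<close>, the first-order
      oscillation of \<open>v\<close> is within the bound of order \<open>k\<close>.\<close>
    have es: "e \<le> ?s" using powr_mono'[of k 1 e] k e e1 by simp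
    have "osc \<Omega> e w \<le> ennreal (K * (e ^ CARD('d) * ?s\<^sup>2))"
      by (rule order_trans[OF K2(3)[OF e(1) e1(2)]]) (use K e in \<open>auto intro!: ennreal_leI mult_right_mono simp: k_def[symmetric]\<close>)
    moreover have "osc \<Omega> e v \<le> ennreal (K * (e ^ CARD('d) * ?s\<^sup>2))"
    proof (rule order_trans[OF K1(2)[OF e(1)]], rule ennreal_leI)
      show "K1 * (e ^ CARD('d) * e\<^sup>2) \<le> K * (e ^ CARD('d) * ?s\<^sup>2)"
        using K K1 e es by (intro mult_mono power_mono) auto
    qed
    moreover have "layer \<Omega> (3 * e) w \<le> ennreal (K * ?s\<^sup>2)"
      by (rule order_trans[OF K2(4)[OF e(1) e1(2)]]) (use K in \<open>auto intro!: ennreal_leI mult_right_mono simp: k_def[symmetric]\<close>)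
    ultimately obtain \<psi> where \<psi>: "\<psi> \<in> Cc_inf \<Omega>" and \<psi>b: "\<And>x. \<bar>\<psi> x\<bar> \<le> W / c0"
      and err: "(\<integral>\<^sup>+x. indicator \<Omega> x * ennreal ((w x - v x * \<psi> x)\<^sup>2) \<partial>lborel) \<le> ennreal (K' * ?s\<^sup>2)"
      and d1: "\<And>i. (\<integral>\<^sup>+x. ennreal ((pd i \<psi> x)\<^sup>2) \<partial>lborel) \<le> ennreal (K' * (?s / e)\<^sup>2)"
      and d2: "\<And>i. (\<integral>\<^sup>+x. ennreal ((pd i (pd i \<psi>) x)\<^sup>2) \<partial>lborel) \<le> ennreal (K' * (?s / e\<^sup>2)\<^sup>2)"
      using K'(2)[OF e(1), of ?s] by blast
    note \<psi>m = smooth_borel[OF Cc_inf_smooth[OF \<psi>]] smooth_borel[OF Cc_inf_smooth[OF Cc_inf_pd[OF \<psi>]]]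
      smooth_borel[OF Cc_inf_smooth[OF Cc_inf_pd[OF Cc_inf_pd[OF \<psi>]]]]
    note [measurable] = \<psi>m(1) borel_measurable_lebesgue_onI[OF \<psi>m(1)] borel_measurable_lebesgue_onI[OF w] borel_measurable_lebesgue_onI[OF v]
      L2_measurable[OF UL[OF qd]] L2_measurable[OF qsdL]
    have sq: "K' * t\<^sup>2 = (sqrt K' * t)\<^sup>2" for t using K'(1) by (simp add: power_mult_distrib)
    let ?t = "e powr (k - 2)"
    have t: "?s / e\<^sup>2 = ?t" using e by (simp add: powr_diff)
    \<comment> \<open>The factor \<open>?t\<close> belongs to the second derivatives. For
      \<open>e \<le> 1\<close> it dominates those of the lower orders, so \<open>N * ?t\<close>
      serves as the single bound required by \<open>duality_bound\<close>.\<close>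
    have t1: "1 \<le> ?t" using powr_mono'[of "k - 2" 0 e] k e e1 by simp
    have t2: "?s / e \<le> ?t"
      unfolding t[symmetric] using e e1 s by (intro divide_left_mono) (auto simp: power2_eq_square mult_left_le_one_le)
    have n0: "l2norm ?M \<psi> \<le> N * ?t"
    proof -
      have "l2norm ?M (\<lambda>x. \<psi> x * 1) \<le> W / c0 * l2norm ?M (\<lambda>_. 1)"
        using \<psi>b W0 c0(1) by (intro L2_Linf_mult(2)[OF one] AE_I2) auto
      also have "\<dots> \<le> N * 1" using N by simp
      also have "\<dots> \<le> N * ?t" using t1 N(1) by (rule mult_left_mono)
      finally show ?thesis by simp
    qed
    have n1: "l2norm ?M (pd i \<psi>) \<le> N * ?t" for i
    proof -
      have "l2norm ?M (pd i \<psi>) \<le> sqrt K' * (?s / e)"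
        by (rule l2norm_le_lborel[OF \<psi>m(2)]) (use d1[of i] K'(1) e s in \<open>auto simp only: sq intro!: mult_nonneg_nonneg\<close>, auto)
      also have "\<dots> \<le> N * ?t" using t2 N K'(1) e s by (intro mult_mono) auto
      finally show ?thesis .
    qed
    have n2: "l2norm ?M (pd i (pd i \<psi>)) \<le> N * ?t" for i
    proof -
      have "l2norm ?M (pd i (pd i \<psi>)) \<le> sqrt K' * ?t"
        by (rule l2norm_le_lborel[OF \<psi>m(3)]) (use d2[of i] K'(1) in \<open>auto simp: sq t\<close>)
      also have "\<dots> \<le> N * ?t" using N by (intro mult_right_mono) auto
      finally show ?thesis .
    qed
    let ?e = "\<lambda>x. (qd x - qs x) - u qd x * \<psi> x" and ?d = "\<lambda>x. qd x - q x"
    have dL: "?d \<in> L2 ?M" by (rule L2_diff[OF admissible_L2[OF qd] admissible_L2[OF q]])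
    have u\<psi>L: "(\<lambda>x. u qd x * \<psi> x) \<in> L2 ?M"
      using L2_Linf_mult(1)[OF UL[OF qd] borel_measurable_lebesgue_onI[OF \<psi>m(1)] AE_I2[OF \<psi>b]] W0 c0(1) by (simp add: mult.commute)
    have eL: "?e \<in> L2 ?M" by (rule L2_diff[OF qsdL u\<psi>L])
    have en: "l2norm ?M ?e \<le> sqrt K' * ?s"
    proof (rule l2norm_leI(2)[OF L2_measurable[OF eL]])
      have "(\<integral>\<^sup>+x. ennreal ((?e x)\<^sup>2) \<partial>?M) = (\<integral>\<^sup>+x. ennreal ((w x - v x * \<psi> x)\<^sup>2) \<partial>?M)"
      proof (rule nn_integral_cong_AE)
        show "AE x in ?M. ennreal ((?e x)\<^sup>2) = ennreal ((w x - v x * \<psi> x)\<^sup>2)"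
          using weq veq by eventually_elim simp
      qed
      also have "\<dots> = (\<integral>\<^sup>+x. indicator \<Omega> x * ennreal ((w x - v x * \<psi> x)\<^sup>2) \<partial>lborel)"
        by (simp add: nn_integral_lebesgue_on[OF borel] mult.commute)
      also note err
      finally show "(\<integral>\<^sup>+x. ennreal ((?e x)\<^sup>2) \<partial>?M) \<le> ennreal ((sqrt K' * ?s)\<^sup>2)" by (simp only: sq)
    qed (use K'(1) in simp)
    have i1: "integrable ?M (\<lambda>x. ?e x * ?d x)" "integrable ?M (\<lambda>x. ?d x * (u qd x * \<psi> x))"
      by (rule L2_Cauchy_Schwarz(1)[OF eL dL], rule L2_Cauchy_Schwarz(1)[OF dL u\<psi>L])
    have "(LINT x|?M. (qd x - qs x) * ?d x) = (LINT x|?M. ?e x * ?d x + ?d x * (u qd x * \<psi> x))"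
      by (rule arg_cong[where f = "integral\<^sup>L ?M"]) (simp add: algebra_simps fun_eq_iff)
    also have "\<dots> = (LINT x|?M. ?e x * ?d x) + (LINT x|?M. ?d x * (u qd x * \<psi> x))"
      by (rule Bochner_Integration.integral_add[OF i1])
    also have "\<dots> \<le> sqrt K' * ?s * l2norm ?M ?d + l2norm ?M (\<lambda>x. u q x - u qd x) * (B * (N * ?t) * (1 + 2 * real CARD('d)))"
    proof (rule add_mono)
      have "(LINT x|?M. ?e x * ?d x) \<le> l2norm ?M ?e * l2norm ?M ?d"
        using L2_Cauchy_Schwarz(2)[OF eL dL] by linarith
      also have "\<dots> \<le> sqrt K' * ?s * l2norm ?M ?d" by (rule mult_right_mono[OF en l2norm_nonneg])
      finally show "(LINT x|?M. ?e x * ?d x) \<le> sqrt K' * ?s * l2norm ?M ?d" .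
      have qB: "AE x in ?M. \<bar>q x\<bar> \<le> B"
        using admissible_bound(1)[OF q bounds(1)] by (rule eventually_mono) (use B(4) in linarith)
      show "(LINT x|?M. ?d x * (u qd x * \<psi> x)) \<le> l2norm ?M (\<lambda>x. u q x - u qd x) * (B * (N * ?t) * (1 + 2 * real CARD('d)))"
        using duality_bound[OF u[OF q] sol aL aB a' a'B admissible_bound(2)[OF q bounds(1)] qB
            admissible_bound(2)[OF qd bounds(1)] \<psi> B(1) n0 n1 n2] by linarith
    qed
    also have "\<dots> \<le> C * (?s * l2norm ?M ?d) + C * (?t * l2norm ?M (\<lambda>x. u q x - u qd x))"
    proof (rule add_mono)
      show "sqrt K' * ?s * l2norm ?M ?d \<le> C * (?s * l2norm ?M ?d)"
        unfolding mult.assoc by (rule mult_right_mono[OF C(2)]) (intro mult_nonneg_nonneg less_imp_le[OF s] l2norm_nonneg)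
      have "l2norm ?M (\<lambda>x. u q x - u qd x) * (B * (N * ?t) * (1 + 2 * real CARD('d)))
          = (B * N * (1 + 2 * real CARD('d))) * (?t * l2norm ?M (\<lambda>x. u q x - u qd x))" by (simp add: mult_ac)
      also have "\<dots> \<le> C * (?t * l2norm ?M (\<lambda>x. u q x - u qd x))"
        by (rule mult_right_mono[OF C(3)]) (intro mult_nonneg_nonneg powr_ge_zero l2norm_nonneg)
      finally show "l2norm ?M (\<lambda>x. u q x - u qd x) * (B * (N * ?t) * (1 + 2 * real CARD('d))) \<le> C * (?t * l2norm ?M (\<lambda>x. u q x - u qd x))" .
    qed
    finally show "(LINT x|?M. (qd x - qs x) * (qd x - q x)) \<le> C * (e powr (min \<kappa> 1) * l2norm ?M (\<lambda>x. q x - qd x) +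
          e powr (min \<kappa> 1 - 2) * l2norm ?M (\<lambda>x. u q x - u qd x))"
      unfolding k_def[symmetric] l2norm_minus_commute[of ?M q qd] by (simp add: distrib_left)
  qed
qed

text \<open>Comparing the minimizer with \<open>qd\<close> gives
  \<open>X^2 + \<beta> E^2 \<le> \<delta>^2 + 2 \<beta> P\<close>, where \<open>P\<close> is the
  pairing estimated by the source inequality. Measured in units of \<open>\<delta>\<close> and
  \<open>\<delta>^(\<alpha>/2)\<close>, the unknowns satisfy a quadratic inequality with constants
  depending on \<open>C\<close> alone.\<close>

lemma rates_of_source_inequality:
  assumes qd: "qd \<in> admissible \<Omega> ql qu" and qs: "qs \<in> admissible \<Omega> ql qu"
    and UL: "\<And>q. q \<in> admissible \<Omega> ql qu \<Longrightarrow> u q \<in> L2 (lebesgue_on \<Omega>)"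
    and C: "C \<ge> 0" and b: "b > 0" and k: "0 < k" "k \<le> 1"
    and src: "\<And>e q. 0 < e \<Longrightarrow> e \<le> b \<Longrightarrow> q \<in> admissible \<Omega> ql qu \<Longrightarrow>
      (LINT x|lebesgue_on \<Omega>. (qd x - qs x) * (qd x - q x))
        \<le> C * (e powr k * l2norm (lebesgue_on \<Omega>) (\<lambda>x. q x - qd x) +
          e powr (k - 2) * l2norm (lebesgue_on \<Omega>) (\<lambda>x. u q x - u qd x))"
    and \<alpha>: "0 < \<alpha>" "\<alpha> * (2 + k) \<le> 2 * k"
  shows "rates \<Omega> u ql qu qd qs \<alpha>"
proof -
  let ?M = "lebesgue_on \<Omega>"
  \<comment> \<open>The scale will be \<open>\<delta> powr s\<close>; its \<open>k\<close>-th power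
    is \<open>\<delta> powr (\<alpha> / 2)\<close>, the rate sought for the parameter.\<close>
  define s where "s = \<alpha> / (2 * k)"
  have s: "s > 0" "s * k = \<alpha> / 2" using \<alpha> k by (auto simp: s_def)
  \<comment> \<open>Equivalent to the hypothesis \<open>\<alpha> * (2 + k) \<le> 2 * k\<close>; for
    \<open>\<delta> \<le> 1\<close> it makes \<open>\<beta>\<close> times the scale to the power
    \<open>k - 2\<close> at most \<open>\<delta>\<close>.\<close>
  have exp: "1 \<le> 2 - \<alpha> + s * (k - 2)"
  proof -
    have "s * (k - 2) = \<alpha> / 2 - \<alpha> / k" using k by (simp add: s_def field_simps)
    moreover have "\<alpha> / 2 + \<alpha> / k \<le> 1" using \<alpha> k by (simp add: field_simps)
    ultimately show ?thesis by linarith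
  qed
  \<comment> \<open>Absorbs the linear terms of the final inequality:
    \<open>4 * C * (x + y) \<le> x^2 + y^2 + 8 * C^2\<close>, inserted into
    \<open>x^2 + y^2 \<le> 1 + 2 * C * (x + y + 1)\<close>.\<close>
  define D where "D = 2 + 4 * C + 8 * C\<^sup>2"
  have D: "D \<ge> 1" using C by (simp add: D_def)
  \<comment> \<open>Guarantees \<open>\<delta> \<le> 1\<close> and that the scale
    \<open>\<delta> powr s\<close> is at most \<open>b\<close>.\<close>
  define d0 where "d0 = min 1 (b powr (1 / s))"
  have d0: "d0 > 0" using b by (simp add: d0_def)
  have main: "l2norm ?M (\<lambda>x. u q x - u qd x) \<le> (D + 1) * \<delta> \<and> l2norm ?M (\<lambda>x. q x - qd x) \<le> (D + 1) * \<delta> powr (\<alpha> / 2)"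
    if \<delta>: "0 < \<delta>" "\<delta> < d0" and z: "z \<in> L2 ?M" and noise: "l2norm ?M (\<lambda>x. u qd x - z x) \<le> \<delta>"
      and min: "is_minimizer \<Omega> u ql qu z qs (\<delta> powr (2 - \<alpha>)) q" for \<delta> z q
  proof -
    have q: "q \<in> admissible \<Omega> ql qu" and tik: "tikhonov \<Omega> u z qs (\<delta> powr (2 - \<alpha>)) q \<le> tikhonov \<Omega> u z qs (\<delta> powr (2 - \<alpha>)) qd"
      using min qd by (auto simp: is_minimizer_def)
    let ?\<beta> = "\<delta> powr (2 - \<alpha>)" and ?e = "\<delta> powr s"
    define X where "X = l2norm ?M (\<lambda>x. u q x - z x)"
    define E where "E = l2norm ?M (\<lambda>x. q x - qd x)"
    define H where "H = l2norm ?M (\<lambda>x. u q x - u qd x)"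
    define P where "P = (LINT x|?M. (qd x - qs x) * (qd x - q x))"
    have XE: "X \<ge> 0" "E \<ge> 0" by (simp_all add: X_def E_def l2norm_nonneg)
    have \<delta>1: "\<delta> \<le> 1" "\<delta> < b powr (1 / s)" using \<delta> by (auto simp: d0_def)
    have e: "0 < ?e" "?e \<le> b"
    proof -
      show "0 < ?e" using \<delta> by simp
      have "?e \<le> (b powr (1 / s)) powr s" using \<delta> \<delta>1 s by (intro powr_mono2) auto
      then show "?e \<le> b" using s b by (simp add: powr_powr)
    qed
    have \<beta>: "?\<beta> > 0" using \<delta> by simp
    have H: "H \<le> X + \<delta>"
    proof -
      have "H = l2norm ?M (\<lambda>x. (u q x - z x) + (z x - u qd x))" by (simp add: H_def)
      also have "\<dots> \<le> X + l2norm ?M (\<lambda>x. z x - u qd x)"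
        unfolding X_def by (intro l2norm_triangle L2_diff UL q qd z)
      finally show ?thesis using noise l2norm_minus_commute[of ?M z "u qd"] by simp
    qed
    \<comment> \<open>Expanding the penalty around \<open>qd\<close> produces the pairing
      \<open>P\<close>; the remaining square also occurs in the functional at \<open>qd\<close> and
      cancels.\<close>
    have sq: "(l2norm ?M (\<lambda>x. q x - qs x))\<^sup>2 = E\<^sup>2 - 2 * P + (l2norm ?M (\<lambda>x. qd x - qs x))\<^sup>2"
    proof -
      have "(l2norm ?M (\<lambda>x. q x - qs x))\<^sup>2 = (l2norm ?M (\<lambda>x. (q x - qd x) + (qd x - qs x)))\<^sup>2" by simp
      also have "\<dots> = E\<^sup>2 + 2 * (LINT x|?M. (q x - qd x) * (qd x - qs x)) + (l2norm ?M (\<lambda>x. qd x - qs x))\<^sup>2"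
        unfolding E_def by (intro l2norm_square_add L2_diff q[THEN admissible_L2] qd[THEN admissible_L2] qs[THEN admissible_L2])
      also have "(LINT x|?M. (q x - qd x) * (qd x - qs x)) = - P"
        unfolding P_def by (subst Bochner_Integration.integral_minus[symmetric]) (simp add: algebra_simps)
      finally show ?thesis by simp
    qed
    have "(l2norm ?M (\<lambda>x. u qd x - z x))\<^sup>2 \<le> \<delta>\<^sup>2" by (intro power_mono noise l2norm_nonneg)
    then have "X\<^sup>2 + ?\<beta> * (E\<^sup>2 - 2 * P) \<le> \<delta>\<^sup>2"
      using tik unfolding tikhonov_def sq X_def[symmetric] by (simp add: algebra_simps)
    then have en: "X\<^sup>2 + ?\<beta> * E\<^sup>2 \<le> \<delta>\<^sup>2 + 2 * (?\<beta> * P)" by (simp add: algebra_simps)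
    define x where "x = X / \<delta>"
    define y where "y = E / \<delta> powr (\<alpha> / 2)"
    have xy: "X = \<delta> * x" "E = \<delta> powr (\<alpha> / 2) * y" "x \<ge> 0" "y \<ge> 0"
      using \<delta> XE by (auto simp: x_def y_def)
    have "?\<beta> * P \<le> ?\<beta> * (C * (?e powr k * E + ?e powr (k - 2) * (X + \<delta>)))"
    proof (rule mult_left_mono)
      have "P \<le> C * (?e powr k * E + ?e powr (k - 2) * H)"
        unfolding P_def E_def H_def by (rule src[OF e q])
      also have "\<dots> \<le> C * (?e powr k * E + ?e powr (k - 2) * (X + \<delta>))"
        by (intro mult_left_mono add_left_mono H C) auto
      finally show "P \<le> C * (?e powr k * E + ?e powr (k - 2) * (X + \<delta>))" .
    qed simp
    also have "\<dots> = C * ((?\<beta> * ?e powr k) * E + (?\<beta> * ?e powr (k - 2)) * (X + \<delta>))" by (simp add: algebra_simps)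
    also have "\<dots> \<le> C * (\<delta>\<^sup>2 * y + \<delta> * (X + \<delta>))"
    proof (intro mult_left_mono add_mono C)
      have "(?\<beta> * ?e powr k) * E = (\<delta> powr (2 - \<alpha>) * \<delta> powr (s * k) * \<delta> powr (\<alpha> / 2)) * y"
        by (simp add: xy(2) powr_powr mult_ac)
      also have "\<dots> = \<delta> powr ((2 - \<alpha>) + s * k + \<alpha> / 2) * y" by (simp only: powr_add)
      also have "(2 - \<alpha>) + s * k + \<alpha> / 2 = 2" using s(2) by simp
      finally show "(?\<beta> * ?e powr k) * E \<le> \<delta>\<^sup>2 * y" using \<delta> by simp
      have "?\<beta> * ?e powr (k - 2) = \<delta> powr (2 - \<alpha> + s * (k - 2))" using \<delta> by (simp add: powr_powr powr_add)
      also have "\<dots> \<le> \<delta> powr 1" using exp \<delta> \<delta>1 by (intro powr_mono') auto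
      finally show "(?\<beta> * ?e powr (k - 2)) * (X + \<delta>) \<le> \<delta> * (X + \<delta>)"
        using XE \<delta> by (intro mult_right_mono) auto
    qed
    also have "\<dots> = \<delta>\<^sup>2 * (C * (y + x + 1))" by (simp add: xy(1) power2_eq_square algebra_simps)
    finally have "?\<beta> * P \<le> \<delta>\<^sup>2 * (C * (y + x + 1))" .
    moreover have "X\<^sup>2 + ?\<beta> * E\<^sup>2 = \<delta>\<^sup>2 * (x\<^sup>2 + y\<^sup>2)"
    proof -
      have "?\<beta> * E\<^sup>2 = (\<delta> powr (2 - \<alpha>) * \<delta> powr (\<alpha> / 2) * \<delta> powr (\<alpha> / 2)) * y\<^sup>2"
        by (simp add: xy(2) power2_eq_square mult_ac)
      also have "\<delta> powr (2 - \<alpha>) * \<delta> powr (\<alpha> / 2) * \<delta> powr (\<alpha> / 2) = \<delta>\<^sup>2"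
        using \<delta> by (simp add: powr_add[symmetric])
      finally show ?thesis by (simp add: xy(1) power_mult_distrib algebra_simps)
    qed
    ultimately have "\<delta>\<^sup>2 * (x\<^sup>2 + y\<^sup>2) \<le> \<delta>\<^sup>2 * (1 + 2 * (C * (y + x + 1)))"
      using en by (simp add: algebra_simps)
    then have fin: "x\<^sup>2 + y\<^sup>2 \<le> 1 + 2 * (C * (y + x + 1))" using \<delta> by simp
    have "0 \<le> (x - 2 * C)\<^sup>2 + (y - 2 * C)\<^sup>2" by simp
    then have D2: "x\<^sup>2 + y\<^sup>2 \<le> D" using fin by (simp add: D_def power2_eq_square algebra_simps)
    have "D \<le> D\<^sup>2" using D by (simp add: power2_eq_square)
    then have "x\<^sup>2 \<le> D\<^sup>2" "y\<^sup>2 \<le> D\<^sup>2" using D2 zero_le_power2[of x] zero_le_power2[of y] by linarith+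
    then have xD: "x \<le> D" "y \<le> D" using D by (auto intro: power2_le_imp_le)
    have "H \<le> (D + 1) * \<delta>"
    proof -
      have "x * \<delta> \<le> D * \<delta>" using xD(1) \<delta> by (intro mult_right_mono) auto
      then show ?thesis using H unfolding xy(1) distrib_right mult.commute[of \<delta>] by linarith
    qed
    moreover have "E \<le> (D + 1) * \<delta> powr (\<alpha> / 2)"
      unfolding xy(2) mult.commute[of _ y] using xD(2) by (intro mult_right_mono) auto
    ultimately show ?thesis by (simp add: H_def E_def)
  qed
  show ?thesis unfolding rates_def
  proof (intro exI[of _ "D + 1"])
    have "eventually (\<lambda>\<delta>. \<delta> \<in> {0<..<d0}) (at_right 0)" by (rule eventually_at_right_real[OF d0])
    then show "\<forall>\<^sub>F \<delta> in at_right 0. \<forall>z\<in>L2 ?M. l2norm ?M (\<lambda>x. u qd x - z x) \<le> \<delta> \<longrightarrow>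
       (\<forall>q. is_minimizer \<Omega> u ql qu z qs (\<delta> powr (2 - \<alpha>)) q \<longrightarrow>
          l2norm ?M (\<lambda>x. u q x - u qd x) \<le> (D + 1) * \<delta> \<and>
          l2norm ?M (\<lambda>x. q x - qd x) \<le> (D + 1) * \<delta> powr (\<alpha> / 2))"
      by (rule eventually_mono) (use main in auto)
  qed
qed

end

theorem theorem3p7:
  fixes \<Omega> :: "(real^'d::finite) set"
    and a f g qd qs :: "real^'d \<Rightarrow> real"
    and u :: "(real^'d \<Rightarrow> real) \<Rightarrow> real^'d \<Rightarrow> real"
    and ql qu a0 c0 \<kappa> :: real
  assumes dim: "CARD('d) = 2 \<or> CARD('d) = 3"
    and domain: "open \<Omega>" "bounded \<Omega>" "connected \<Omega>" "\<Omega> \<noteq> {}" "C2_boundary \<Omega>"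
    and a: "a \<in> W1inf \<Omega>" "a0 > 0" "AE x in lebesgue_on \<Omega>. a0 \<le> a x"
    and f: "f \<in> L2 (lebesgue_on \<Omega>)"
    and g: "g \<in> H32_boundary \<Omega>"
    and bounds: "0 < ql" "ql \<le> qu"
    and u: "\<And>q. q \<in> admissible \<Omega> ql qu \<Longrightarrow> is_solution \<Omega> a f g q (u q)"
    and qd: "qd \<in> admissible \<Omega> ql qu"
    and qs: "qs \<in> admissible \<Omega> ql qu"
    and c0: "c0 > 0" "AE x in lebesgue_on \<Omega>. c0 \<le> \<bar>u qd x\<bar>"
    and kappa: "\<kappa> > 0" "\<kappa> \<noteq> 1/2"
    and source: "(\<lambda>x. qd x - qs x) \<in> sobolev0 \<Omega> \<kappa>"
  shows "(\<kappa> > 1 \<longrightarrow> rates \<Omega> u ql qu qd qs (1/2)) \<and>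
    (\<kappa> \<in> {0<..<1/2} \<union> {1/2<..1} \<longrightarrow>
      (\<forall>\<eta>>0. \<exists>\<alpha>>0. \<kappa> / (1 + \<kappa>) - \<eta> < \<alpha> \<and> \<alpha> < \<kappa> / (1 + \<kappa>) \<and> rates \<Omega> u ql qu qd qs \<alpha>))"
proof -
  interpret bounded_open \<Omega> by unfold_locales (rule domain)+
  have n: "CARD('d) \<ge> 2" using dim by auto
  obtain C b where C: "C \<ge> 0" "b > 0"
    "\<And>e q. 0 < e \<Longrightarrow> e \<le> b \<Longrightarrow> q \<in> admissible \<Omega> ql qu \<Longrightarrow>
      (LINT x|lebesgue_on \<Omega>. (qd x - qs x) * (qd x - q x))
        \<le> C * (e powr (min \<kappa> 1) * l2norm (lebesgue_on \<Omega>) (\<lambda>x. q x - qd x) +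
          e powr (min \<kappa> 1 - 2) * l2norm (lebesgue_on \<Omega>) (\<lambda>x. u q x - u qd x))"
    by (rule source_inequality[OF n domain(5) a(1) bounds u qd qs c0 kappa(1) source]) (assumption, rule that)
  have UL: "u q \<in> L2 (lebesgue_on \<Omega>)" if "q \<in> admissible \<Omega> ql qu" for q
    using u[OF that] by (simp add: is_solution_def sobolev_def)
  have k: "0 < min \<kappa> 1" "min \<kappa> 1 \<le> 1" using kappa by auto
  have rate: "rates \<Omega> u ql qu qd qs \<alpha>" if "0 < \<alpha>" "\<alpha> * (2 + min \<kappa> 1) \<le> 2 * min \<kappa> 1" for \<alpha>
    by (rule rates_of_source_inequality[OF qd qs UL C(1,2) k C(3) that])
  show ?thesis
  proof (intro conjI impI allI)
    assume "\<kappa> > 1"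
    \<comment> \<open>Here \<open>min \<kappa> 1 = 1\<close>, and the condition on the exponent
      reads \<open>3 * \<alpha> \<le> 2\<close>.\<close>
    then show "rates \<Omega> u ql qu qd qs (1/2)" by (intro rate) auto
  next
    fix \<eta> :: real
    assume "\<kappa> \<in> {0<..<1/2} \<union> {1/2<..1}" and \<eta>: "\<eta> > 0"
    then have m: "min \<kappa> 1 = \<kappa>" by auto
    define \<mu> where "\<mu> = \<kappa> / (1 + \<kappa>)"
    have \<mu>: "\<mu> > 0" "\<mu> * (1 + \<kappa>) = \<kappa>" using kappa by (auto simp: \<mu>_def)
    \<comment> \<open>The first entry keeps \<open>\<alpha>\<close> positive when
      \<open>\<eta>\<close> is large; the second brings it within \<open>\<eta>\<close> of
      \<open>\<mu>\<close>, and both stay strictly below \<open>\<mu>\<close>.\<close>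
    define \<alpha> where "\<alpha> = max (\<mu> / 2) (\<mu> - \<eta> / 2)"
    have \<alpha>: "0 < \<alpha>" "\<mu> - \<eta> < \<alpha>" "\<alpha> < \<mu>" using \<mu>(1) \<eta> by (auto simp: \<alpha>_def)
    \<comment> \<open>Since \<open>2 + \<kappa> \<le> 2 * (1 + \<kappa>)\<close>, the value
      \<open>\<kappa> / (1 + \<kappa>)\<close> lies below the threshold
      \<open>2 * \<kappa> / (2 + \<kappa>)\<close>.\<close>
    have "\<alpha> * (2 + \<kappa>) \<le> \<alpha> * (2 * (1 + \<kappa>))" using \<alpha> kappa by (intro mult_left_mono) auto
    also have "\<dots> \<le> \<mu> * (2 * (1 + \<kappa>))" using \<alpha> kappa by (intro mult_right_mono) auto
    also have "\<dots> = 2 * \<kappa>" using \<mu>(2) by (simp add: algebra_simps)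
    finally have "rates \<Omega> u ql qu qd qs \<alpha>" by (intro rate \<alpha>) (simp add: m)
    then show "\<exists>\<alpha>>0. \<kappa> / (1 + \<kappa>) - \<eta> < \<alpha> \<and> \<alpha> < \<kappa> / (1 + \<kappa>) \<and> rates \<Omega> u ql qu qd qs \<alpha>"
      using \<alpha> unfolding \<mu>_def by blast
  qed
qed

end
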